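(* Let $\mathcal{O}$ be a commutative ring, let $G$ be a finite group, $N$ a normal subgroup of $G$, $\bar{G}:=G/N$, and let $n\geq 1$ be an integer. Let $\mathcal{C}$ be a $\bar{G}$-graded $\bar{G}$-acted algebra, and let $A$ and $A'$ be two $\bar{G}$-graded crossed products over $\mathcal{C}$, with identity components $B=A_1$ and $B'=A'_1$ respectively. Let $\tilde{M}$ be a $\bar{G}$-graded $(A,A')$-bimodule over $\mathcal{C}$. Then the following hold: (1) $\tilde{M}\wr S_n$ is a $\bar{G}\wr S_n$-graded $(A\wr S_n,A'\wr S_n)$-bimodule over $\mathcal{C}^{\otimes n}$; (2) $(A\wr S_n)\otimes_{B^{\otimes n}}M^{\otimes n}\simeq M^{\otimes n}\otimes_{B'^{\otimes n}}(A'\wr S_n)\simeq \tilde{M}\wr S_n$ as $\bar{G}\wr S_n$-graded $(A\wr S_n,A'\wr S_n)$-bimodules over $\mathcal{C}^{\otimes n}$, where $M=\tilde{M}_1$ is the identity component of $\tilde{M}$; (3) if $\tilde{M}$ induces a $\bar{G}$-graded Morita equivalence over $\mathcal{C}$ between $A$ and $A'$, then $\tilde{M}\wr S_n$ induces a $\bar{G}\wr S_n$-graded Morita equivalence over $\mathcal{C}^{\otimes n}$ between $A\wr S_n$ and $A'\wr S_n$.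
   Context: Conventions. All rings are associative with identity $1\neq 0$; all modules (left unless specified) are unital and finitely generated; algebras are $\mathcal{O}$-algebras and unadorned $\otimes$ means $\otimes_{\mathcal{O}}$. $S_n$ is the symmetric group on $\{1,\dots,n\}$, with identity $e$. General definitions (for a finite group $\Gamma$, to be used for $\Gamma=\bar{G}$ and $\Gamma=\bar{G}\wr S_n$). - A $\Gamma$-graded algebra $A=\bigoplus_{g\in\Gamma}A_g$ (with $A_gA_h\subseteq A_{gh}$) is a crossed product if every $A_g$ contains an invertible element of $A$. - A $\Gamma$-graded $\Gamma$-acted algebra is a $\Gamma$-graded algebra $\mathcal{D}=\bigoplus_{g\in \Gamma}\mathcal{D}_g$ with a left action of $\Gamma$ by algebra automorphisms, $(g,c)\mapsto {}^{g}c$, such that ${}^{g}c\in\mathcal{D}_{{}^{g}h}$ for all $g,h\in\Gamma$, $c\in \mathcal{D}_h$, where ${}^{g}h=ghg^{-1}$. - For a $\Gamma$-graded crossed product $A$ with identity component $B=A_1$, the centralizer $C_A(B)$ is a $\Gamma$-graded $\Gamma$-acted algebra with $C_A(B)_g=C_A(B)\cap A_g$ and ${}^{g}a=u_gau_g^{-1}$, where $u_g\in A_g$ is any invertible homogeneous element (the result does not depend on the choice). $A$ is a $\Gamma$-graded crossed product over $\mathcal{D}$ if it comes with an algebra homomorphism (structure map) $\zeta:\mathcal{D}\to C_A(B)$ satisfying $\zeta(\mathcal{D}_h)\subseteq C_A(B)_h$ and $\zeta({}^{g}c)={}^{g}\zeta(c)$ for all $g,h\in\Gamma$, $c\in\mathcal{D}$.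 - Let $A,A'$ be $\Gamma$-graded crossed products over $\mathcal{D}$ with structure maps $\zeta,\zeta'$. A $\Gamma$-graded $(A,A')$-bimodule over $\mathcal{D}$ is an $(A,A')$-bimodule $\tilde{M}$ with a decomposition $\tilde{M}=\bigoplus_{g\in\Gamma}\tilde{M}_g$ such that $A_g\tilde{M}_xA'_h\subseteq\tilde{M}_{gxh}$ for all $g,x,h\in\Gamma$, and $\tilde{m}_gc={}^{g}c\,\tilde{m}_g$ for all $c\in\mathcal{D}$, $\tilde m_g\in\tilde{M}_g$, $g\in\Gamma$, where $c\tilde{m}:=\zeta(c)\tilde{m}$ and $\tilde{m}c:=\tilde{m}\zeta'(c)$. Morphisms of such objects are the homomorphisms of $\Gamma$-graded (grade-preserving) $(A,A')$-bimodules. - The dual $\tilde{M}^*=\mathrm{Hom}_A(\tilde{M},A)$ is a $\Gamma$-graded $(A',A)$-bimodule over $\mathcal{D}$, via $(a'fa)(m)=f(ma')a$ and $(\tilde{M}^* )_g=\{f: f(\tilde{M}_x)\subseteq A_{xg}\ \forall x\in\Gamma\}$. Tensor products of graded bimodules are graded by total degree. $\tilde{M}$ induces a $\Gamma$-graded Morita equivalence over $\mathcal{D}$ between $A$ and $A'$ if $\tilde{M}\otimes_{A'}\tilde{M}^*\simeq A$ as $\Gamma$-graded $(A,A)$-bimodules over $\mathcal{D}$ and $\tilde{M}^*\otimes_A\tilde{M}\simeq A'$ as $\Gamma$-graded $(A',A')$-bimodules over $\mathcal{D}$. Wreath products. - $\bar{G}\wr S_n=\bar{G}^n\rtimes S_n$,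 with multiplication $((g_1,\dots,g_n),\sigma)((h_1,\dots,h_n),\tau)=((g_1h_{\sigma^{-1}(1)},\dots,g_nh_{\sigma^{-1}(n)}),\sigma\tau)$. - $S_n$ acts on $n$-fold tensor powers by ${}^{\sigma}(x_1\otimes\cdots\otimes x_n)=x_{\sigma^{-1}(1)}\otimes\cdots\otimes x_{\sigma^{-1}(n)}$. - $A\wr S_n=A^{\otimes n}\otimes\mathcal{O}S_n$ with multiplication $(a\otimes\sigma)(b\otimes\tau)=(a\cdot{}^{\sigma}b)\otimes\sigma\tau$ for $a,b\in A^{\otimes n}$, graded by $(A\wr S_n)_{((g_1,\dots,g_n),\sigma)}=(A_{g_1}\otimes\cdots\otimes A_{g_n})\otimes\mathcal{O}\sigma$; it is a $\bar{G}\wr S_n$-graded crossed product with identity component $B^{\otimes n}$ (identifying $a\in A^{\otimes n}$ with $a\otimes e$). Likewise for $A'$. - $\mathcal{C}^{\otimes n}$ is $\bar{G}^n$-graded by $(\mathcal{C}^{\otimes n})_{(g_1,\dots,g_n)}=\mathcal{C}_{g_1}\otimes\cdots\otimes\mathcal{C}_{g_n}$, regarded as $\bar{G}\wr S_n$-graded via $\bar{G}^n\leq\bar{G}\wr S_n$ (zero components outside $\bar{G}^n$), and $\bar{G}\wr S_n$ acts on it by ${}^{((g_1,\dots,g_n),\sigma)}(c_1\otimes\cdots\otimes c_n)={}^{g_1}c_{\sigma^{-1}(1)}\otimes\cdots\otimes{}^{g_n}c_{\sigma^{-1}(n)}$. If $\zeta:\mathcal{C}\to C_A(B)$ is the structure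 map of $A$, the structure map of $A\wr S_n$ over $\mathcal{C}^{\otimes n}$ is $c_1\otimes\cdots\otimes c_n\mapsto(\zeta(c_1)\otimes\cdots\otimes\zeta(c_n))\otimes e$; likewise for $A'$. - $\tilde{M}\wr S_n=\tilde{M}^{\otimes n}\otimes\mathcal{O}S_n$ with operations $(a\otimes\sigma)(m\otimes\tau)=(a\cdot{}^{\sigma}m)\otimes\sigma\tau$ and $(m\otimes\tau)(a'\otimes\pi)=(m\cdot{}^{\tau}a')\otimes\tau\pi$ for $a\in A^{\otimes n}$, $m\in\tilde{M}^{\otimes n}$, $a'\in A'^{\otimes n}$, $\sigma,\tau,\pi\in S_n$, and components $(\tilde{M}\wr S_n)_{((g_1,\dots,g_n),\sigma)}=(\tilde{M}_{g_1}\otimes\cdots\otimes\tilde{M}_{g_n})\otimes\mathcal{O}\sigma$. Its identity component is $M^{\otimes n}$, where $M=\tilde{M}_1$. Bimodule structures in (2). Write $\Gamma=\bar{G}\wr S_n$. The module $(A\wr S_n)\otimes_{B^{\otimes n}}M^{\otimes n}$ has the evident left $A\wr S_n$-action, the $\Gamma$-grading coming from $A\wr S_n$, and the right $A'\wr S_n$-action $(x\otimes m)\cdot x'_\gamma=xu_\gamma\otimes u_\gamma^{-1}mx'_\gamma$ for $x'_\gamma\in(A'\wr S_n)_\gamma$, $\gamma\in\Gamma$, where $u_\gamma\in(A\wr S_n)_\gamma$ is invertible and $u_\gamma^{-1}mx'_\gamma$ is computed in $\tilde{M}\wr S_n$ (it lies in $M^{\otimes n}$). Symmetrically, $M^{\otimes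 n}\otimes_{B'^{\otimes n}}(A'\wr S_n)$ has the evident right action, the $\Gamma$-grading coming from $A'\wr S_n$, and the left action $x_\gamma\cdot(m\otimes x')=x_\gamma m u'^{-1}_\gamma\otimes u'_\gamma x'$ for $x_\gamma\in(A\wr S_n)_\gamma$, with $u'_\gamma\in(A'\wr S_n)_\gamma$ invertible. *)

theory Defs
  imports "HOL-Algebra.Module" "HOL-Algebra.AbelCoset" "HOL-Algebra.Sym_Groups"
begin

(* keeps the record field name mult accessible *)
hide_const (open) Multiset.mult

section \<open>Modules given by generators and relations\<close>

definition free_mod :: "('r, 'k) ring_scheme \<Rightarrow> 's set \<Rightarrow> ('r, 's \<Rightarrow> 'r) module" where
  "free_mod R S = \<lparr>carrier = {f. range f \<subseteq> carrier R \<and> (\<forall>s. s \<notin> S \<longrightarrow> f s = \<zero>\<^bsub>R\<^esub>) \<and>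
                                 finite {s. f s \<noteq> \<zero>\<^bsub>R\<^esub>}},
     mult = undefined, one = undefined,
     zero = (\<lambda>_. \<zero>\<^bsub>R\<^esub>), add = (\<lambda>f g s. f s \<oplus>\<^bsub>R\<^esub> g s),
     smult = (\<lambda>a f s. a \<otimes>\<^bsub>R\<^esub> f s)\<rparr>"

definition free_gen :: "('r, 'k) ring_scheme \<Rightarrow> 's \<Rightarrow> 's \<Rightarrow> 'r" where
  "free_gen R s = (\<lambda>t. if t = s then \<one>\<^bsub>R\<^esub> else \<zero>\<^bsub>R\<^esub>)"

definition mspan :: "('r, 'k) ring_scheme \<Rightarrow> ('r, 'm, 'z) module_scheme \<Rightarrow> 'm set \<Rightarrow> 'm set" where
  "mspan R M X = \<Inter>{H. submodule H R M \<and> X \<subseteq> H}"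

definition quot_mod :: "('r, 'm, 'z) module_scheme \<Rightarrow> 'm set \<Rightarrow> ('r, 'm set) module" where
  "quot_mod M K = \<lparr>carrier = a_rcosets\<^bsub>M\<^esub> K,
     mult = undefined, one = undefined,
     zero = K, add = set_add M,
     smult = (\<lambda>a X. \<Union>x\<in>X. K +>\<^bsub>M\<^esub> (a \<odot>\<^bsub>M\<^esub> x))\<rparr>"

definition presented :: "('r, 'k) ring_scheme \<Rightarrow> 's set \<Rightarrow> ('s \<Rightarrow> 'r) set \<Rightarrow> ('r, ('s \<Rightarrow> 'r) set) module" where
  "presented R S rel = quot_mod (free_mod R S) (mspan R (free_mod R S) rel)"

definition pgen :: "('r, 'k) ring_scheme \<Rightarrow> 's set \<Rightarrow> ('s \<Rightarrow> 'r) set \<Rightarrow> 's \<Rightarrow> ('s \<Rightarrow> 'r) set" where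
  "pgen R S rel s = mspan R (free_mod R S) rel +>\<^bsub>free_mod R S\<^esub> free_gen R s"

text \<open>
  \<open>lin_ext R X \<phi>\<close> is the \<open>R\<close>-linear map into \<open>X\<close> that sends each generator \<open>s\<close> of a presented
  module to \<open>\<phi> s\<close>.  It is evaluated on an arbitrary representative, so it is only meaningful when
  \<open>\<phi>\<close> respects the relations; this is the case wherever it is used below.
\<close>

definition lin_ext :: "('r, 'k) ring_scheme \<Rightarrow> ('r, 'x, 'z) module_scheme \<Rightarrow> ('s \<Rightarrow> 'x)
    \<Rightarrow> ('s \<Rightarrow> 'r) set \<Rightarrow> 'x" where
  "lin_ext R X \<phi> T = (let f = (SOME f. f \<in> T) in
     \<Oplus>\<^bsub>X\<^esub>s\<in>{s. f s \<noteq> \<zero>\<^bsub>R\<^esub>}. f s \<odot>\<^bsub>X\<^esub> \<phi> s)"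


section \<open>Tensor powers over the ground ring\<close>

definition tp_fam :: "('r, 'x, 'z) module_scheme \<Rightarrow> nat \<Rightarrow> (nat \<Rightarrow> 'x) set" where
  "tp_fam X n = {1..n} \<rightarrow>\<^sub>E carrier X"

definition tp_rel :: "('r, 'k) ring_scheme \<Rightarrow> ('r, 'x, 'z) module_scheme \<Rightarrow> nat
    \<Rightarrow> ((nat \<Rightarrow> 'x) \<Rightarrow> 'r) set" where
  "tp_rel R X n = (let F = free_mod R (tp_fam X n) in
     {free_gen R (x(i := a \<oplus>\<^bsub>X\<^esub> b)) \<ominus>\<^bsub>F\<^esub> (free_gen R (x(i := a)) \<oplus>\<^bsub>F\<^esub> free_gen R (x(i := b))) | x i a b.
        x \<in> tp_fam X n \<and> i \<in> {1..n} \<and> a \<in> carrier X \<and> b \<in> carrier X} \<union>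
     {free_gen R (x(i := r \<odot>\<^bsub>X\<^esub> a)) \<ominus>\<^bsub>F\<^esub> r \<odot>\<^bsub>F\<^esub> free_gen R (x(i := a)) | x i r a.
        x \<in> tp_fam X n \<and> i \<in> {1..n} \<and> r \<in> carrier R \<and> a \<in> carrier X})"

definition tpow :: "('r, 'k) ring_scheme \<Rightarrow> ('r, 'x, 'z) module_scheme \<Rightarrow> nat
    \<Rightarrow> ('r, ((nat \<Rightarrow> 'x) \<Rightarrow> 'r) set) module" where
  "tpow R X n = presented R (tp_fam X n) (tp_rel R X n)"

text \<open>The pure tensor \<open>x 1 \<otimes> \<dots> \<otimes> x n\<close>.\<close>

definition pure :: "('r, 'k) ring_scheme \<Rightarrow> ('r, 'x, 'z) module_scheme \<Rightarrow> nat \<Rightarrow> (nat \<Rightarrow> 'x)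
    \<Rightarrow> ((nat \<Rightarrow> 'x) \<Rightarrow> 'r) set" where
  "pure R X n x = pgen R (tp_fam X n) (tp_rel R X n) (restrict x {1..n})"

text \<open>The linear map sending \<open>x 1 \<otimes> \<dots> \<otimes> x n\<close> to \<open>\<phi> x 1 \<otimes> \<dots> \<otimes> \<phi> x n\<close>.\<close>

definition tp_map :: "('r, 'k) ring_scheme \<Rightarrow> ('r, 'y, 'z) module_scheme \<Rightarrow> nat
    \<Rightarrow> ((nat \<Rightarrow> 'x) \<Rightarrow> nat \<Rightarrow> 'y) \<Rightarrow> ((nat \<Rightarrow> 'x) \<Rightarrow> 'r) set \<Rightarrow> ((nat \<Rightarrow> 'y) \<Rightarrow> 'r) set" where
  "tp_map R Y n \<phi> = lin_ext R (tpow R Y n) (\<lambda>x. pure R Y n (\<phi> x))"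

definition tp_perm :: "('r, 'k) ring_scheme \<Rightarrow> ('r, 'x, 'z) module_scheme \<Rightarrow> nat
    \<Rightarrow> (nat \<Rightarrow> nat) \<Rightarrow> ((nat \<Rightarrow> 'x) \<Rightarrow> 'r) set \<Rightarrow> ((nat \<Rightarrow> 'x) \<Rightarrow> 'r) set" where
  "tp_perm R X n \<sigma> = tp_map R X n (\<lambda>x i. x (inv' \<sigma> i))"

text \<open>The bilinear map induced factor by factor by a bilinear operation \<open>f\<close> with values in \<open>Z\<close>.\<close>

definition tp_op :: "('r, 'k) ring_scheme \<Rightarrow> ('r, 'z, 'w) module_scheme \<Rightarrow> nat
    \<Rightarrow> ('x \<Rightarrow> 'y \<Rightarrow> 'z) \<Rightarrow> ((nat \<Rightarrow> 'x) \<Rightarrow> 'r) set \<Rightarrow> ((nat \<Rightarrow> 'y) \<Rightarrow> 'r) set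
    \<Rightarrow> ((nat \<Rightarrow> 'z) \<Rightarrow> 'r) set" where
  "tp_op R Z n f T U =
     lin_ext R (tpow R Z n) (\<lambda>x. tp_map R Z n (\<lambda>y i. f (x i) (y i)) U) T"


section \<open>Graded algebras, crossed products and graded bimodules\<close>

text \<open>
  The locale \<^locale>\<open>algebra\<close> of the library only covers commutative algebras.  Since
  \<^typ>\<open>('r, 'a) module\<close> extends the ring record, it also carries a possibly noncommutative
  multiplication.
\<close>

locale assoc_algebra = module R A + ring A
  for R :: "('r, 'k) ring_scheme" (structure)
    and A :: "('r, 'a, 'z) module_scheme" (structure) +
  assumes one_neq_zero: "\<one>\<^bsub>A\<^esub> \<noteq> \<zero>\<^bsub>A\<^esub>"
    and smult_mult_left: "\<lbrakk>r \<in> carrier R; a \<in> carrier A; b \<in> carrier A\<rbrakk> \<Longrightarrow>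
      (r \<odot>\<^bsub>A\<^esub> a) \<otimes>\<^bsub>A\<^esub> b = r \<odot>\<^bsub>A\<^esub> (a \<otimes>\<^bsub>A\<^esub> b)"
    and smult_mult_right: "\<lbrakk>r \<in> carrier R; a \<in> carrier A; b \<in> carrier A\<rbrakk> \<Longrightarrow>
      a \<otimes>\<^bsub>A\<^esub> (r \<odot>\<^bsub>A\<^esub> b) = r \<odot>\<^bsub>A\<^esub> (a \<otimes>\<^bsub>A\<^esub> b)"

record ('r, 'x, 'g) graded = "('r, 'x) module" +
  gcomp :: "'g \<Rightarrow> 'x set"

record ('r, 'c, 'g) acted_algebra = "('r, 'c, 'g) graded" +
  act :: "'g \<Rightarrow> 'c \<Rightarrow> 'c"

record ('r, 'a, 'g, 'c) algebra_over = "('r, 'a, 'g) graded" +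
  smap :: "'c \<Rightarrow> 'a"

record ('r, 'm, 'g, 'a, 'b) bimodule = "('r, 'm, 'g) graded" +
  lact :: "'a \<Rightarrow> 'm \<Rightarrow> 'm"
  ract :: "'m \<Rightarrow> 'b \<Rightarrow> 'm"

definition decomposition :: "('g, 'k) monoid_scheme \<Rightarrow> ('r, 'x, 'g, 'z) graded_scheme \<Rightarrow> 'x
    \<Rightarrow> ('g \<Rightarrow> 'x) \<Rightarrow> bool" where
  "decomposition \<Gamma> X x f \<longleftrightarrow>
     f \<in> (\<Pi>\<^sub>E g\<in>carrier \<Gamma>. gcomp X g) \<and> x = (\<Oplus>\<^bsub>X\<^esub>g\<in>carrier \<Gamma>. f g)"

definition hcomp :: "('g, 'k) monoid_scheme \<Rightarrow> ('r, 'x, 'g, 'z) graded_scheme \<Rightarrow> 'x \<Rightarrow> 'g \<Rightarrow> 'x" where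
  "hcomp \<Gamma> X x = (THE f. decomposition \<Gamma> X x f)"

definition is_grading :: "('r, 'k) ring_scheme \<Rightarrow> ('g, 'l) monoid_scheme
    \<Rightarrow> ('r, 'x, 'g, 'z) graded_scheme \<Rightarrow> bool" where
  "is_grading R \<Gamma> X \<longleftrightarrow>
     (\<forall>g\<in>carrier \<Gamma>. submodule (gcomp X g) R X) \<and>
     (\<forall>x\<in>carrier X. \<exists>!f. decomposition \<Gamma> X x f)"

locale graded_algebra = assoc_algebra R A + \<Gamma>: group \<Gamma>
  for R :: "('r, 'k) ring_scheme" (structure) and \<Gamma> :: "('g, 'l) monoid_scheme"
    and A :: "('r, 'a, 'g, 'z) graded_scheme" (structure) +
  assumes finite_\<Gamma>: "finite (carrier \<Gamma>)"
    and grading: "is_grading R \<Gamma> A"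
    and gcomp_mult: "\<lbrakk>g \<in> carrier \<Gamma>; h \<in> carrier \<Gamma>; a \<in> gcomp A g; b \<in> gcomp A h\<rbrakk> \<Longrightarrow>
      a \<otimes>\<^bsub>A\<^esub> b \<in> gcomp A (g \<otimes>\<^bsub>\<Gamma>\<^esub> h)"

locale graded_acted_algebra = graded_algebra R \<Gamma> D
  for R :: "('r, 'k) ring_scheme" (structure) and \<Gamma> :: "('g, 'l) monoid_scheme"
    and D :: "('r, 'c, 'g, 'z) acted_algebra_scheme" (structure) +
  assumes act_ring_hom: "g \<in> carrier \<Gamma> \<Longrightarrow> act D g \<in> ring_hom D D"
    and act_smult: "\<lbrakk>g \<in> carrier \<Gamma>; r \<in> carrier R; c \<in> carrier D\<rbrakk> \<Longrightarrow>
      act D g (r \<odot>\<^bsub>D\<^esub> c) = r \<odot>\<^bsub>D\<^esub> act D g c"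
    and act_one: "c \<in> carrier D \<Longrightarrow> act D \<one>\<^bsub>\<Gamma>\<^esub> c = c"
    and act_mult: "\<lbrakk>g \<in> carrier \<Gamma>; h \<in> carrier \<Gamma>; c \<in> carrier D\<rbrakk> \<Longrightarrow>
      act D (g \<otimes>\<^bsub>\<Gamma>\<^esub> h) c = act D g (act D h c)"
    and act_gcomp: "\<lbrakk>g \<in> carrier \<Gamma>; h \<in> carrier \<Gamma>; c \<in> gcomp D h\<rbrakk> \<Longrightarrow>
      act D g c \<in> gcomp D (g \<otimes>\<^bsub>\<Gamma>\<^esub> h \<otimes>\<^bsub>\<Gamma>\<^esub> inv\<^bsub>\<Gamma>\<^esub> g)"

locale crossed_product = graded_algebra R \<Gamma> A
  for R :: "('r, 'k) ring_scheme" (structure) and \<Gamma> :: "('g, 'l) monoid_scheme"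
    and A :: "('r, 'a, 'g, 'z) graded_scheme" (structure) +
  assumes ex_homogeneous_unit: "g \<in> carrier \<Gamma> \<Longrightarrow> gcomp A g \<inter> Units A \<noteq> {}"

definition centralizer :: "('a, 'z) ring_scheme \<Rightarrow> 'a set \<Rightarrow> 'a set" where
  "centralizer A B = {a \<in> carrier A. \<forall>b\<in>B. a \<otimes>\<^bsub>A\<^esub> b = b \<otimes>\<^bsub>A\<^esub> a}"

locale crossed_product_over = crossed_product R \<Gamma> A + D: graded_acted_algebra R \<Gamma> D
  for R :: "('r, 'k) ring_scheme" (structure) and \<Gamma> :: "('g, 'l) monoid_scheme"
    and D :: "('r, 'c, 'g, 'z1) acted_algebra_scheme"
    and A :: "('r, 'a, 'g, 'c, 'z2) algebra_over_scheme" (structure) +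
  assumes smap_ring_hom: "smap A \<in> ring_hom D A"
    and smap_smult: "\<lbrakk>r \<in> carrier R; c \<in> carrier D\<rbrakk> \<Longrightarrow> smap A (r \<odot>\<^bsub>D\<^esub> c) = r \<odot>\<^bsub>A\<^esub> smap A c"
    and smap_centralizer: "c \<in> carrier D \<Longrightarrow> smap A c \<in> centralizer A (gcomp A \<one>\<^bsub>\<Gamma>\<^esub>)"
    and smap_gcomp: "\<lbrakk>h \<in> carrier \<Gamma>; c \<in> gcomp D h\<rbrakk> \<Longrightarrow> smap A c \<in> gcomp A h"
    and smap_act: "\<lbrakk>g \<in> carrier \<Gamma>; c \<in> carrier D; u \<in> gcomp A g \<inter> Units A\<rbrakk> \<Longrightarrow>
      smap A (act D g c) = u \<otimes>\<^bsub>A\<^esub> smap A c \<otimes>\<^bsub>A\<^esub> inv\<^bsub>A\<^esub> u"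

text \<open>
  Bimodules over \<open>R\<close>-algebras have a single \<open>R\<close>-module structure, compatible with both actions,
  and are finitely generated on either side.
\<close>

locale algebra_bimodule = A: assoc_algebra R A + A': assoc_algebra R A' + module R M
  for R :: "('r, 'k) ring_scheme" (structure)
    and A :: "('r, 'a, 'z1) module_scheme" and A' :: "('r, 'b, 'z2) module_scheme"
    and M :: "('r, 'm, 'g, 'a, 'b, 'z3) bimodule_scheme" (structure) +
  assumes lact_closed: "\<lbrakk>a \<in> carrier A; m \<in> carrier M\<rbrakk> \<Longrightarrow> lact M a m \<in> carrier M"
    and lact_add_left: "\<lbrakk>a \<in> carrier A; a' \<in> carrier A; m \<in> carrier M\<rbrakk> \<Longrightarrow>
      lact M (a \<oplus>\<^bsub>A\<^esub> a') m = lact M a m \<oplus>\<^bsub>M\<^esub> lact M a' m"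
    and lact_add_right: "\<lbrakk>a \<in> carrier A; m \<in> carrier M; m' \<in> carrier M\<rbrakk> \<Longrightarrow>
      lact M a (m \<oplus>\<^bsub>M\<^esub> m') = lact M a m \<oplus>\<^bsub>M\<^esub> lact M a m'"
    and lact_mult: "\<lbrakk>a \<in> carrier A; a' \<in> carrier A; m \<in> carrier M\<rbrakk> \<Longrightarrow>
      lact M (a \<otimes>\<^bsub>A\<^esub> a') m = lact M a (lact M a' m)"
    and lact_one: "m \<in> carrier M \<Longrightarrow> lact M \<one>\<^bsub>A\<^esub> m = m"
    and lact_smult_left: "\<lbrakk>r \<in> carrier R; a \<in> carrier A; m \<in> carrier M\<rbrakk> \<Longrightarrow>
      lact M (r \<odot>\<^bsub>A\<^esub> a) m = r \<odot>\<^bsub>M\<^esub> lact M a m"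
    and lact_smult_right: "\<lbrakk>r \<in> carrier R; a \<in> carrier A; m \<in> carrier M\<rbrakk> \<Longrightarrow>
      lact M a (r \<odot>\<^bsub>M\<^esub> m) = r \<odot>\<^bsub>M\<^esub> lact M a m"
    and ract_closed: "\<lbrakk>m \<in> carrier M; b \<in> carrier A'\<rbrakk> \<Longrightarrow> ract M m b \<in> carrier M"
    and ract_add_left: "\<lbrakk>m \<in> carrier M; m' \<in> carrier M; b \<in> carrier A'\<rbrakk> \<Longrightarrow>
      ract M (m \<oplus>\<^bsub>M\<^esub> m') b = ract M m b \<oplus>\<^bsub>M\<^esub> ract M m' b"
    and ract_add_right: "\<lbrakk>m \<in> carrier M; b \<in> carrier A'; b' \<in> carrier A'\<rbrakk> \<Longrightarrow>
      ract M m (b \<oplus>\<^bsub>A'\<^esub> b') = ract M m b \<oplus>\<^bsub>M\<^esub> ract M m b'"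
    and ract_mult: "\<lbrakk>m \<in> carrier M; b \<in> carrier A'; b' \<in> carrier A'\<rbrakk> \<Longrightarrow>
      ract M m (b \<otimes>\<^bsub>A'\<^esub> b') = ract M (ract M m b) b'"
    and ract_one: "m \<in> carrier M \<Longrightarrow> ract M m \<one>\<^bsub>A'\<^esub> = m"
    and ract_smult_left: "\<lbrakk>r \<in> carrier R; m \<in> carrier M; b \<in> carrier A'\<rbrakk> \<Longrightarrow>
      ract M (r \<odot>\<^bsub>M\<^esub> m) b = r \<odot>\<^bsub>M\<^esub> ract M m b"
    and ract_smult_right: "\<lbrakk>r \<in> carrier R; m \<in> carrier M; b \<in> carrier A'\<rbrakk> \<Longrightarrow>
      ract M m (r \<odot>\<^bsub>A'\<^esub> b) = r \<odot>\<^bsub>M\<^esub> ract M m b"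
    and lact_ract: "\<lbrakk>a \<in> carrier A; m \<in> carrier M; b \<in> carrier A'\<rbrakk> \<Longrightarrow>
      ract M (lact M a m) b = lact M a (ract M m b)"
    and left_fg: "\<exists>F. finite F \<and> F \<subseteq> carrier M \<and>
      (\<forall>m\<in>carrier M. \<exists>c\<in>F \<rightarrow> carrier A. m = (\<Oplus>\<^bsub>M\<^esub>x\<in>F. lact M (c x) x))"
    and right_fg: "\<exists>F. finite F \<and> F \<subseteq> carrier M \<and>
      (\<forall>m\<in>carrier M. \<exists>c\<in>F \<rightarrow> carrier A'. m = (\<Oplus>\<^bsub>M\<^esub>x\<in>F. ract M x (c x)))"

locale graded_bimodule_over =
  crossed_product_over R \<Gamma> D A + A': crossed_product_over R \<Gamma> D A' + algebra_bimodule R A A' M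
  for R :: "('r, 'k) ring_scheme" (structure) and \<Gamma> :: "('g, 'l) monoid_scheme"
    and D :: "('r, 'c, 'g, 'z1) acted_algebra_scheme"
    and A :: "('r, 'a, 'g, 'c, 'z2) algebra_over_scheme"
    and A' :: "('r, 'b, 'g, 'c, 'z3) algebra_over_scheme"
    and M :: "('r, 'm, 'g, 'a, 'b, 'z4) bimodule_scheme" (structure) +
  assumes bimodule_grading: "is_grading R \<Gamma> M"
    and gcomp_act: "\<lbrakk>g \<in> carrier \<Gamma>; x \<in> carrier \<Gamma>; h \<in> carrier \<Gamma>;
        a \<in> gcomp A g; m \<in> gcomp M x; b \<in> gcomp A' h\<rbrakk> \<Longrightarrow>
      ract M (lact M a m) b \<in> gcomp M (g \<otimes>\<^bsub>\<Gamma>\<^esub> x \<otimes>\<^bsub>\<Gamma>\<^esub> h)"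
    and smap_commute: "\<lbrakk>g \<in> carrier \<Gamma>; m \<in> gcomp M g; c \<in> carrier D\<rbrakk> \<Longrightarrow>
      ract M m (smap A' c) = lact M (smap A (act D g c)) m"

definition graded_bimodule_hom :: "('r, 'k) ring_scheme \<Rightarrow> ('g, 'l) monoid_scheme
    \<Rightarrow> ('r, 'a, 'z1) module_scheme \<Rightarrow> ('r, 'b, 'z2) module_scheme
    \<Rightarrow> ('r, 'm, 'g, 'a, 'b, 'z3) bimodule_scheme \<Rightarrow> ('r, 'n, 'g, 'a, 'b, 'z4) bimodule_scheme
    \<Rightarrow> ('m \<Rightarrow> 'n) set" where
  "graded_bimodule_hom R \<Gamma> A A' M N = {\<phi> \<in> carrier M \<rightarrow> carrier N.
     (\<forall>m\<in>carrier M. \<forall>m'\<in>carrier M. \<phi> (m \<oplus>\<^bsub>M\<^esub> m') = \<phi> m \<oplus>\<^bsub>N\<^esub> \<phi> m') \<and>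
     (\<forall>r\<in>carrier R. \<forall>m\<in>carrier M. \<phi> (r \<odot>\<^bsub>M\<^esub> m) = r \<odot>\<^bsub>N\<^esub> \<phi> m) \<and>
     (\<forall>a\<in>carrier A. \<forall>m\<in>carrier M. \<phi> (lact M a m) = lact N a (\<phi> m)) \<and>
     (\<forall>m\<in>carrier M. \<forall>b\<in>carrier A'. \<phi> (ract M m b) = ract N (\<phi> m) b) \<and>
     (\<forall>g\<in>carrier \<Gamma>. \<phi> ` gcomp M g \<subseteq> gcomp N g)}"

definition graded_bimodule_iso :: "('r, 'k) ring_scheme \<Rightarrow> ('g, 'l) monoid_scheme
    \<Rightarrow> ('r, 'c, 'g, 'z1) acted_algebra_scheme
    \<Rightarrow> ('r, 'a, 'g, 'c, 'z2) algebra_over_scheme \<Rightarrow> ('r, 'b, 'g, 'c, 'z3) algebra_over_scheme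
    \<Rightarrow> ('r, 'm, 'g, 'a, 'b, 'z4) bimodule_scheme \<Rightarrow> ('r, 'n, 'g, 'a, 'b, 'z5) bimodule_scheme
    \<Rightarrow> bool" where
  "graded_bimodule_iso R \<Gamma> D A A' M N \<longleftrightarrow>
     graded_bimodule_over R \<Gamma> D A A' M \<and> graded_bimodule_over R \<Gamma> D A A' N \<and>
     (\<exists>\<phi>\<in>graded_bimodule_hom R \<Gamma> A A' M N. bij_betw \<phi> (carrier M) (carrier N))"


section \<open>Tensor products and duals of bimodules\<close>

definition mk_bimodule :: "('r, 'm, 'z) module_scheme \<Rightarrow> ('g \<Rightarrow> 'm set) \<Rightarrow> ('a \<Rightarrow> 'm \<Rightarrow> 'm)
    \<Rightarrow> ('m \<Rightarrow> 'b \<Rightarrow> 'm) \<Rightarrow> ('r, 'm, 'g, 'a, 'b) bimodule" where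
  "mk_bimodule X c l r = \<lparr>carrier = carrier X, mult = mult X, one = one X, zero = zero X,
     add = add X, smult = smult X, gcomp = c, lact = l, ract = r\<rparr>"

text \<open>
  The tensor product of a right module \<open>M\<close> and a left module \<open>N\<close> over an \<open>R\<close>-algebra with carrier
  \<open>B\<close> and actions \<open>ra\<close> and \<open>la\<close>.
\<close>

definition tens_rel :: "('r, 'k) ring_scheme \<Rightarrow> 'b set \<Rightarrow> ('m \<Rightarrow> 'b \<Rightarrow> 'm) \<Rightarrow> ('b \<Rightarrow> 'n \<Rightarrow> 'n)
    \<Rightarrow> ('r, 'm, 'z1) module_scheme \<Rightarrow> ('r, 'n, 'z2) module_scheme \<Rightarrow> ('m \<times> 'n \<Rightarrow> 'r) set" where
  "tens_rel R B ra la M N = (let F = free_mod R (carrier M \<times> carrier N) in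
     {free_gen R (m \<oplus>\<^bsub>M\<^esub> m', x) \<ominus>\<^bsub>F\<^esub> (free_gen R (m, x) \<oplus>\<^bsub>F\<^esub> free_gen R (m', x)) | m m' x.
        m \<in> carrier M \<and> m' \<in> carrier M \<and> x \<in> carrier N} \<union>
     {free_gen R (m, x \<oplus>\<^bsub>N\<^esub> x') \<ominus>\<^bsub>F\<^esub> (free_gen R (m, x) \<oplus>\<^bsub>F\<^esub> free_gen R (m, x')) | m x x'.
        m \<in> carrier M \<and> x \<in> carrier N \<and> x' \<in> carrier N} \<union>
     {free_gen R (r \<odot>\<^bsub>M\<^esub> m, x) \<ominus>\<^bsub>F\<^esub> r \<odot>\<^bsub>F\<^esub> free_gen R (m, x) | r m x.
        r \<in> carrier R \<and> m \<in> carrier M \<and> x \<in> carrier N} \<union>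
     {free_gen R (m, r \<odot>\<^bsub>N\<^esub> x) \<ominus>\<^bsub>F\<^esub> r \<odot>\<^bsub>F\<^esub> free_gen R (m, x) | r m x.
        r \<in> carrier R \<and> m \<in> carrier M \<and> x \<in> carrier N} \<union>
     {free_gen R (ra m b, x) \<ominus>\<^bsub>F\<^esub> free_gen R (m, la b x) | m b x.
        m \<in> carrier M \<and> b \<in> B \<and> x \<in> carrier N})"

definition tens :: "('r, 'k) ring_scheme \<Rightarrow> 'b set \<Rightarrow> ('m \<Rightarrow> 'b \<Rightarrow> 'm) \<Rightarrow> ('b \<Rightarrow> 'n \<Rightarrow> 'n)
    \<Rightarrow> ('r, 'm, 'z1) module_scheme \<Rightarrow> ('r, 'n, 'z2) module_scheme
    \<Rightarrow> ('r, ('m \<times> 'n \<Rightarrow> 'r) set) module" where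
  "tens R B ra la M N = presented R (carrier M \<times> carrier N) (tens_rel R B ra la M N)"

definition tens_elem :: "('r, 'k) ring_scheme \<Rightarrow> 'b set \<Rightarrow> ('m \<Rightarrow> 'b \<Rightarrow> 'm) \<Rightarrow> ('b \<Rightarrow> 'n \<Rightarrow> 'n)
    \<Rightarrow> ('r, 'm, 'z1) module_scheme \<Rightarrow> ('r, 'n, 'z2) module_scheme
    \<Rightarrow> 'm \<Rightarrow> 'n \<Rightarrow> ('m \<times> 'n \<Rightarrow> 'r) set" where
  "tens_elem R B ra la M N m x = pgen R (carrier M \<times> carrier N) (tens_rel R B ra la M N) (m, x)"

text \<open>The graded bimodule \<open>M \<otimes>\<^sub>B N\<close> for a right \<open>B\<close>-module \<open>M\<close> and a left \<open>B\<close>-module \<open>N\<close>.\<close>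

definition bimodule_tensor :: "('r, 'k) ring_scheme \<Rightarrow> ('g, 'l) monoid_scheme
    \<Rightarrow> ('r, 'b, 'z) module_scheme
    \<Rightarrow> ('r, 'm, 'g, 'a, 'b) bimodule \<Rightarrow> ('r, 'n, 'g, 'b, 'c) bimodule
    \<Rightarrow> ('r, ('m \<times> 'n \<Rightarrow> 'r) set, 'g, 'a, 'c) bimodule" where
  "bimodule_tensor R \<Gamma> B M N =
    (let T = tens R (carrier B) (ract M) (lact N) M N;
         t = tens_elem R (carrier B) (ract M) (lact N) M N
     in mk_bimodule T
       (\<lambda>g. mspan R T {t m x | m x h k. h \<in> carrier \<Gamma> \<and> k \<in> carrier \<Gamma> \<and> h \<otimes>\<^bsub>\<Gamma>\<^esub> k = g \<and>
                                      m \<in> gcomp M h \<and> x \<in> gcomp N k})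
       (\<lambda>a. lin_ext R T (\<lambda>(m, x). t (lact M a m) x))
       (\<lambda>z c. lin_ext R T (\<lambda>(m, x). t m (ract N x c)) z))"

definition dual :: "('g, 'l) monoid_scheme \<Rightarrow> ('r, 'a, 'g, 'z) graded_scheme
    \<Rightarrow> ('r, 'm, 'g, 'a, 'b) bimodule \<Rightarrow> ('r, 'm \<Rightarrow> 'a, 'g, 'b, 'a) bimodule" where
  "dual \<Gamma> A M =
    (let H = {f \<in> carrier M \<rightarrow>\<^sub>E carrier A.
               (\<forall>m\<in>carrier M. \<forall>m'\<in>carrier M. f (m \<oplus>\<^bsub>M\<^esub> m') = f m \<oplus>\<^bsub>A\<^esub> f m') \<and>
               (\<forall>a\<in>carrier A. \<forall>m\<in>carrier M. f (lact M a m) = a \<otimes>\<^bsub>A\<^esub> f m)}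
     in \<lparr>carrier = H, mult = undefined, one = undefined,
         zero = (\<lambda>m\<in>carrier M. \<zero>\<^bsub>A\<^esub>),
         add = (\<lambda>f f'. \<lambda>m\<in>carrier M. f m \<oplus>\<^bsub>A\<^esub> f' m),
         smult = (\<lambda>r f. \<lambda>m\<in>carrier M. r \<odot>\<^bsub>A\<^esub> f m),
         gcomp = (\<lambda>g. {f \<in> H. \<forall>x\<in>carrier \<Gamma>. f ` gcomp M x \<subseteq> gcomp A (x \<otimes>\<^bsub>\<Gamma>\<^esub> g)}),
         lact = (\<lambda>a' f. \<lambda>m\<in>carrier M. f (ract M m a')),
         ract = (\<lambda>f a. \<lambda>m\<in>carrier M. f m \<otimes>\<^bsub>A\<^esub> a)\<rparr>)"

definition regular_bimodule :: "('r, 'a, 'g, 'z) graded_scheme \<Rightarrow> ('r, 'a, 'g, 'a, 'a) bimodule" where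
  "regular_bimodule A = mk_bimodule A (gcomp A) (mult A) (mult A)"

definition induces_graded_Morita_over :: "('r, 'k) ring_scheme \<Rightarrow> ('g, 'l) monoid_scheme
    \<Rightarrow> ('r, 'c, 'g, 'z1) acted_algebra_scheme
    \<Rightarrow> ('r, 'a, 'g, 'c, 'z2) algebra_over_scheme \<Rightarrow> ('r, 'b, 'g, 'c, 'z3) algebra_over_scheme
    \<Rightarrow> ('r, 'm, 'g, 'a, 'b) bimodule \<Rightarrow> bool" where
  "induces_graded_Morita_over R \<Gamma> D A A' M \<longleftrightarrow>
     graded_bimodule_over R \<Gamma> D A A' M \<and>
     graded_bimodule_iso R \<Gamma> D A A (bimodule_tensor R \<Gamma> A' M (dual \<Gamma> A M)) (regular_bimodule A) \<and>
     graded_bimodule_iso R \<Gamma> D A' A' (bimodule_tensor R \<Gamma> A (dual \<Gamma> A M) M) (regular_bimodule A')"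

definition hunit :: "('r, 'a, 'g, 'z) graded_scheme \<Rightarrow> 'g \<Rightarrow> 'a" where
  "hunit A g = (SOME u. u \<in> gcomp A g \<inter> Units A)"

text \<open>
  For a graded \<open>(A, A')\<close>-bimodule \<open>M\<close> with identity component \<open>M\<^sub>1\<close>, the bimodules
  \<open>A \<otimes>\<^bsub>B\<^esub> M\<^sub>1\<close> and \<open>M\<^sub>1 \<otimes>\<^bsub>B'\<^esub> A'\<close> over the identity components \<open>B\<close> of \<open>A\<close> and \<open>B'\<close> of \<open>A'\<close>.
  The action on the induced side is given on homogeneous elements by
  \<open>(x \<otimes> m) a\<^sub>g = x u\<^sub>g \<otimes> u\<^sub>g\<^sup>-\<^sup>1 m a\<^sub>g\<close> and \<open>a\<^sub>g (m \<otimes> x) = a\<^sub>g m v\<^sub>g\<^sup>-\<^sup>1 \<otimes> v\<^sub>g x\<close>, for homogeneous units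
  \<open>u\<^sub>g\<close> of \<open>A\<close> and \<open>v\<^sub>g\<close> of \<open>A'\<close>, and extended additively.
\<close>

definition left_induced :: "('r, 'k) ring_scheme \<Rightarrow> ('g, 'l) monoid_scheme
    \<Rightarrow> ('r, 'a, 'g, 'z1) graded_scheme \<Rightarrow> ('r, 'b, 'g, 'z2) graded_scheme
    \<Rightarrow> ('r, 'm, 'g, 'a, 'b) bimodule \<Rightarrow> ('r, ('a \<times> 'm \<Rightarrow> 'r) set, 'g, 'a, 'b) bimodule" where
  "left_induced R \<Gamma> A A' M =
    (let B = gcomp A \<one>\<^bsub>\<Gamma>\<^esub>; M1 = M\<lparr>carrier := gcomp M \<one>\<^bsub>\<Gamma>\<^esub>\<rparr>;
         T = tens R B (mult A) (lact M) A M1;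
         t = tens_elem R B (mult A) (lact M) A M1
     in mk_bimodule T
       (\<lambda>g. mspan R T {t x m | x m. x \<in> gcomp A g \<and> m \<in> carrier M1})
       (\<lambda>a. lin_ext R T (\<lambda>(x, m). t (a \<otimes>\<^bsub>A\<^esub> x) m))
       (\<lambda>z a'. lin_ext R T (\<lambda>(x, m). \<Oplus>\<^bsub>T\<^esub>g\<in>carrier \<Gamma>.
          t (x \<otimes>\<^bsub>A\<^esub> hunit A g) (ract M (lact M (inv\<^bsub>A\<^esub> (hunit A g)) m) (hcomp \<Gamma> A' a' g))) z))"

definition right_induced :: "('r, 'k) ring_scheme \<Rightarrow> ('g, 'l) monoid_scheme
    \<Rightarrow> ('r, 'a, 'g, 'z1) graded_scheme \<Rightarrow> ('r, 'b, 'g, 'z2) graded_scheme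
    \<Rightarrow> ('r, 'm, 'g, 'a, 'b) bimodule \<Rightarrow> ('r, ('m \<times> 'b \<Rightarrow> 'r) set, 'g, 'a, 'b) bimodule" where
  "right_induced R \<Gamma> A A' M =
    (let B = gcomp A' \<one>\<^bsub>\<Gamma>\<^esub>; M1 = M\<lparr>carrier := gcomp M \<one>\<^bsub>\<Gamma>\<^esub>\<rparr>;
         T = tens R B (ract M) (mult A') M1 A';
         t = tens_elem R B (ract M) (mult A') M1 A'
     in mk_bimodule T
       (\<lambda>g. mspan R T {t m x | m x. m \<in> carrier M1 \<and> x \<in> gcomp A' g})
       (\<lambda>a. lin_ext R T (\<lambda>(m, x). \<Oplus>\<^bsub>T\<^esub>g\<in>carrier \<Gamma>.
          t (ract M (lact M (hcomp \<Gamma> A a g) m) (inv\<^bsub>A'\<^esub> (hunit A' g))) (hunit A' g \<otimes>\<^bsub>A'\<^esub> x)))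
       (\<lambda>z a'. lin_ext R T (\<lambda>(m, x). t m (x \<otimes>\<^bsub>A'\<^esub> a')) z))"


section \<open>Wreath products\<close>

definition wreath_group :: "('g, 'l) monoid_scheme \<Rightarrow> nat \<Rightarrow> ((nat \<Rightarrow> 'g) \<times> (nat \<Rightarrow> nat)) monoid" where
  "wreath_group H n = \<lparr>carrier = ({1..n} \<rightarrow>\<^sub>E carrier H) \<times> carrier (sym_group n),
     mult = (\<lambda>(g, \<sigma>) (h, \<tau>). (\<lambda>i\<in>{1..n}. g i \<otimes>\<^bsub>H\<^esub> h (inv' \<sigma> i), \<sigma> \<circ> \<tau>)),
     one = (\<lambda>i\<in>{1..n}. \<one>\<^bsub>H\<^esub>, id)\<rparr>"

text \<open>
  \<open>X\<^bsub>g 1\<^esub> \<otimes> \<dots> \<otimes> X\<^bsub>g n\<^esub>\<close> as a submodule of the \<open>n\<close>-th tensor power of \<open>X\<close>.  The components are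
  direct summands of \<open>X\<close>, so this submodule is the tensor product of the components.
\<close>

definition tp_comp :: "('r, 'k) ring_scheme \<Rightarrow> ('r, 'x, 'g, 'z) graded_scheme \<Rightarrow> nat \<Rightarrow> (nat \<Rightarrow> 'g)
    \<Rightarrow> ((nat \<Rightarrow> 'x) \<Rightarrow> 'r) set set" where
  "tp_comp R X n g = mspan R (tpow R X n) {pure R X n x | x. x \<in> (\<Pi>\<^sub>E i\<in>{1..n}. gcomp X (g i))}"

definition tpow_acted :: "('r, 'k) ring_scheme \<Rightarrow> ('r, 'c, 'g) acted_algebra \<Rightarrow> nat
    \<Rightarrow> ('r, ((nat \<Rightarrow> 'c) \<Rightarrow> 'r) set, (nat \<Rightarrow> 'g) \<times> (nat \<Rightarrow> nat)) acted_algebra" where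
  "tpow_acted R C n = (let T = tpow R C n in
     \<lparr>carrier = carrier T,
      mult = tp_op R C n (mult C),
      one = pure R C n (\<lambda>_. \<one>\<^bsub>C\<^esub>),
      zero = zero T, add = add T, smult = smult T,
      gcomp = (\<lambda>(g, \<sigma>). if \<sigma> = id then tp_comp R C n g else {\<zero>\<^bsub>T\<^esub>}),
      act = (\<lambda>(g, \<sigma>). tp_map R C n (\<lambda>c i. act C (g i) (c (inv' \<sigma> i))))\<rparr>)"

text \<open>
  Since the group algebra of \<open>S\<^sub>n\<close> is free with basis \<open>S\<^sub>n\<close>, the elements of \<open>X\<^bsup>\<otimes>n\<^esup> \<otimes> R S\<^sub>n\<close> are the
  formal sums of the terms \<open>x\<^sub>\<sigma> \<otimes> \<sigma>\<close> with \<open>x\<^sub>\<sigma>\<close> in \<open>X\<^bsup>\<otimes>n\<^esup>\<close>; such a sum is represented by the function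
  sending \<open>\<sigma>\<close> to \<open>x\<^sub>\<sigma>\<close>.  The element \<open>t \<otimes> \<sigma>\<close> is \<open>wr_elem R X n t \<sigma>\<close>.
\<close>

definition wr_mod :: "('r, 'k) ring_scheme \<Rightarrow> ('r, 'x, 'z) module_scheme \<Rightarrow> nat
    \<Rightarrow> ('r, (nat \<Rightarrow> nat) \<Rightarrow> ((nat \<Rightarrow> 'x) \<Rightarrow> 'r) set) module" where
  "wr_mod R X n = (let T = tpow R X n; S = carrier (sym_group n) in
     \<lparr>carrier = S \<rightarrow>\<^sub>E carrier T, mult = undefined, one = undefined,
      zero = (\<lambda>\<sigma>\<in>S. \<zero>\<^bsub>T\<^esub>), add = (\<lambda>x y. \<lambda>\<sigma>\<in>S. x \<sigma> \<oplus>\<^bsub>T\<^esub> y \<sigma>),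
      smult = (\<lambda>r x. \<lambda>\<sigma>\<in>S. r \<odot>\<^bsub>T\<^esub> x \<sigma>)\<rparr>)"

definition wr_elem :: "('r, 'k) ring_scheme \<Rightarrow> ('r, 'x, 'z) module_scheme \<Rightarrow> nat
    \<Rightarrow> ((nat \<Rightarrow> 'x) \<Rightarrow> 'r) set \<Rightarrow> (nat \<Rightarrow> nat) \<Rightarrow> (nat \<Rightarrow> nat) \<Rightarrow> ((nat \<Rightarrow> 'x) \<Rightarrow> 'r) set" where
  "wr_elem R X n t \<sigma> = (\<lambda>\<tau>\<in>carrier (sym_group n). if \<tau> = \<sigma> then t else \<zero>\<^bsub>tpow R X n\<^esub>)"

text \<open>The biadditive extension of \<open>(x \<otimes> \<sigma>) (y \<otimes> \<tau>) = (x \<cdot> \<^bsup>\<sigma>\<^esup>y) \<otimes> \<sigma>\<tau>\<close>, for an operation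
  \<open>f\<close> from \<open>X\<close> and \<open>Y\<close> to \<open>Z\<close>.\<close>

definition wr_op :: "('r, 'k) ring_scheme \<Rightarrow> ('r, 'y, 'z1) module_scheme
    \<Rightarrow> ('r, 'z, 'z2) module_scheme \<Rightarrow> nat \<Rightarrow> ('x \<Rightarrow> 'y \<Rightarrow> 'z)
    \<Rightarrow> ((nat \<Rightarrow> nat) \<Rightarrow> ((nat \<Rightarrow> 'x) \<Rightarrow> 'r) set) \<Rightarrow> ((nat \<Rightarrow> nat) \<Rightarrow> ((nat \<Rightarrow> 'y) \<Rightarrow> 'r) set)
    \<Rightarrow> (nat \<Rightarrow> nat) \<Rightarrow> ((nat \<Rightarrow> 'z) \<Rightarrow> 'r) set" where
  "wr_op R Y Z n f x y = (let S = carrier (sym_group n) in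
     (\<lambda>\<rho>\<in>S. \<Oplus>\<^bsub>tpow R Z n\<^esub>\<sigma>\<in>S. tp_op R Z n f (x \<sigma>) (tp_perm R Y n \<sigma> (y (inv' \<sigma> \<circ> \<rho>)))))"

definition wr_comp :: "('r, 'k) ring_scheme \<Rightarrow> ('r, 'x, 'g, 'z) graded_scheme \<Rightarrow> nat
    \<Rightarrow> (nat \<Rightarrow> 'g) \<times> (nat \<Rightarrow> nat) \<Rightarrow> ((nat \<Rightarrow> nat) \<Rightarrow> ((nat \<Rightarrow> 'x) \<Rightarrow> 'r) set) set" where
  "wr_comp R X n = (\<lambda>(g, \<sigma>). (\<lambda>t. wr_elem R X n t \<sigma>) ` tp_comp R X n g)"

definition wr_algebra :: "('r, 'k) ring_scheme \<Rightarrow> ('r, 'a, 'g, 'c) algebra_over \<Rightarrow> nat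
    \<Rightarrow> ('r, (nat \<Rightarrow> nat) \<Rightarrow> ((nat \<Rightarrow> 'a) \<Rightarrow> 'r) set, (nat \<Rightarrow> 'g) \<times> (nat \<Rightarrow> nat),
        ((nat \<Rightarrow> 'c) \<Rightarrow> 'r) set) algebra_over" where
  "wr_algebra R A n = (let W = wr_mod R A n in
     \<lparr>carrier = carrier W,
      mult = wr_op R A A n (mult A),
      one = wr_elem R A n (pure R A n (\<lambda>_. \<one>\<^bsub>A\<^esub>)) id,
      zero = zero W, add = add W, smult = smult W,
      gcomp = wr_comp R A n,
      smap = (\<lambda>c. wr_elem R A n (tp_map R A n (\<lambda>x i. smap A (x i)) c) id)\<rparr>)"

definition wr_bimodule :: "('r, 'k) ring_scheme \<Rightarrow> ('r, 'b, 'z) module_scheme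
    \<Rightarrow> ('r, 'm, 'g, 'a, 'b) bimodule \<Rightarrow> nat
    \<Rightarrow> ('r, (nat \<Rightarrow> nat) \<Rightarrow> ((nat \<Rightarrow> 'm) \<Rightarrow> 'r) set, (nat \<Rightarrow> 'g) \<times> (nat \<Rightarrow> nat),
        (nat \<Rightarrow> nat) \<Rightarrow> ((nat \<Rightarrow> 'a) \<Rightarrow> 'r) set,
        (nat \<Rightarrow> nat) \<Rightarrow> ((nat \<Rightarrow> 'b) \<Rightarrow> 'r) set) bimodule" where
  "wr_bimodule R A' M n = mk_bimodule (wr_mod R M n) (wr_comp R M n)
     (wr_op R M M n (lact M)) (wr_op R A' M n (ract M))"

end

theory Submission
  imports Defs
begin

text \<open>
  All identities in \<open>A \<wr> S\<^sub>n\<close> and \<open>M \<wr> S\<^sub>n\<close> are linear and can be checked on elements \<open>x \<otimes> \<sigma>\<close> with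
  \<open>x\<close> a pure tensor, which gives (1).

  Part (2) holds for every graded bimodule \<open>M\<close> over crossed products: since \<open>M\<^sub>g = u\<^sub>g M\<^sub>1\<close> for a
  homogeneous unit \<open>u\<^sub>g\<close>, the map \<open>a \<otimes> m \<mapsto> a m\<close> from \<open>A \<otimes>\<^bsub>B\<^esub> M\<^sub>1\<close> to \<open>M\<close> is bijective, and the
  bimodule axioms of the induced bimodule are transported along it from those of \<open>M\<close>.

  For (3), \<open>M\<close> induces a graded Morita equivalence if and only if the following conditions, which do
  not mention the grading, hold: \<open>A'\<close> acts faithfully on \<open>M\<close>; for every \<open>A\<close>-linear map \<open>f\<close> from \<open>M\<close>
  to \<open>A\<close> and every \<open>y\<close> in \<open>M\<close>, the endomorphism \<open>m \<mapsto> f(m) y\<close> is the right multiplication by an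
  element \<open>[f, y]\<close> of \<open>A'\<close>; the unit of \<open>A\<close> is a sum of values \<open>f(x)\<close>; and the unit of \<open>A'\<close> is a sum
  of elements \<open>[f, y]\<close>.  These conditions pass to wreath products.  Linear maps \<open>f\<^sub>1, \<dots>, f\<^sub>n\<close> give
  the linear map \<open>F : m \<otimes> \<tau> \<mapsto> (\<Otimes>\<^sub>i f\<^bsub>\<tau>\<^sup>-\<^sup>1(i)\<^esub>(m\<^sub>i)) \<otimes> \<tau>\<close>, whose bracket with \<open>z \<otimes> \<tau>\<close> is
  \<open>(\<Otimes>\<^sub>i [f\<^sub>i, z\<^sub>i]) \<otimes> \<tau>\<close>.  An arbitrary linear map \<open>h\<close> on \<open>M \<wr> S\<^sub>n\<close> satisfies
  \<open>h(m [F, y]) z = F(m) (h(y) z) = m [F, h(y) z]\<close>, and the unit of \<open>A' \<wr> S\<^sub>n\<close> is a sum of such \<open>[F, y]\<close>.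
\<close>

section \<open>Linear maps and spans\<close>

text \<open>The definition of a graded Morita equivalence only asks that some isomorphisms onto
  \<open>A\<close> and \<open>A'\<close> exist. They need not be evaluation and the bracket, and no
  compatibility between the two is given. They yield pairings \<open>pr\<close> and
  \<open>br\<close> with \<open>x br(f, m) = pr(x, f) \<alpha>(m)\<close> for an
  \<open>A\<close>-linear surjection \<alpha> of \<open>M\<close> onto itself, and this twisted form
  of the usual Morita relation still gives the conditions of the overview. Conversely, under these
  conditions evaluation and the bracket are isomorphisms of the required kind. The detour avoids any
  comparison of the dual of the wreath product with a wreath product of duals: a linear map on the
  wreath product is never decomposed into factors, it only has to be compared with the maps
  \<open>F\<close> through the unit. The twist by the inverse of \<tau> in \<open>F\<close> is
  forced by left linearity, because multiplication by \<sigma> moves the factors. The grading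
  returns only at the end: by faithfulness, the bracket of homogeneous arguments has a single
  nonzero component at most.\<close>

definition lin :: "('r, 'k) ring_scheme \<Rightarrow> ('r, 'x, 'z1) module_scheme \<Rightarrow> ('r, 'y, 'z2) module_scheme
    \<Rightarrow> ('x \<Rightarrow> 'y) \<Rightarrow> bool" where
  "lin R X Y f \<longleftrightarrow> f \<in> carrier X \<rightarrow> carrier Y \<and>
     (\<forall>x\<in>carrier X. \<forall>y\<in>carrier X. f (x \<oplus>\<^bsub>X\<^esub> y) = f x \<oplus>\<^bsub>Y\<^esub> f y) \<and>
     (\<forall>r\<in>carrier R. \<forall>x\<in>carrier X. f (r \<odot>\<^bsub>X\<^esub> x) = r \<odot>\<^bsub>Y\<^esub> f x)"

lemma linI:
  assumes "\<And>x. x \<in> carrier X \<Longrightarrow> f x \<in> carrier Y"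
    and "\<And>x y. x \<in> carrier X \<Longrightarrow> y \<in> carrier X \<Longrightarrow> f (x \<oplus>\<^bsub>X\<^esub> y) = f x \<oplus>\<^bsub>Y\<^esub> f y"
    and "\<And>r x. r \<in> carrier R \<Longrightarrow> x \<in> carrier X \<Longrightarrow> f (r \<odot>\<^bsub>X\<^esub> x) = r \<odot>\<^bsub>Y\<^esub> f x"
  shows "lin R X Y f"
  using assms by (auto simp: lin_def)

lemma lin_closed: "lin R X Y f \<Longrightarrow> x \<in> carrier X \<Longrightarrow> f x \<in> carrier Y"
  and lin_add: "lin R X Y f \<Longrightarrow> x \<in> carrier X \<Longrightarrow> y \<in> carrier X \<Longrightarrow> f (x \<oplus>\<^bsub>X\<^esub> y) = f x \<oplus>\<^bsub>Y\<^esub> f y"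
  and lin_smult: "lin R X Y f \<Longrightarrow> r \<in> carrier R \<Longrightarrow> x \<in> carrier X \<Longrightarrow> f (r \<odot>\<^bsub>X\<^esub> x) = r \<odot>\<^bsub>Y\<^esub> f x"
  by (auto simp: lin_def)

text \<open>\<open>lin\<close> constrains a map on the carrier only, so the values elsewhere may be
  replaced. This is how restricted and unrestricted functions are interchanged.\<close>

lemma lin_cong:
  assumes "lin R X Y f" "module R X" "\<And>x. x \<in> carrier X \<Longrightarrow> g x = f x"
  shows "lin R X Y g"
proof -
  interpret X: module R X by fact
  show ?thesis using assms(1,3) by (auto simp: lin_def Pi_iff)
qed

lemma mod_zero_closed: "module R X \<Longrightarrow> \<zero>\<^bsub>X\<^esub> \<in> carrier X"
  by (simp add: module_def abelian_group_def abelian_monoid.zero_closed)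

lemma mod_add_closed: "module R X \<Longrightarrow> x \<in> carrier X \<Longrightarrow> y \<in> carrier X \<Longrightarrow> x \<oplus>\<^bsub>X\<^esub> y \<in> carrier X"
  by (simp add: module_def abelian_group_def abelian_monoid.a_closed)

lemma mod_smult_closed: "module R X \<Longrightarrow> r \<in> carrier R \<Longrightarrow> x \<in> carrier X \<Longrightarrow> r \<odot>\<^bsub>X\<^esub> x \<in> carrier X"
  by (simp add: module.smult_closed)

lemma lin_zero:
  assumes "lin R X Y f" "module R X" "module R Y"
  shows "f \<zero>\<^bsub>X\<^esub> = \<zero>\<^bsub>Y\<^esub>"
proof -
  interpret X: module R X by fact
  interpret Y: module R Y by fact
  have "f (\<zero>\<^bsub>R\<^esub> \<odot>\<^bsub>X\<^esub> \<zero>\<^bsub>X\<^esub>) = \<zero>\<^bsub>R\<^esub> \<odot>\<^bsub>Y\<^esub> f \<zero>\<^bsub>X\<^esub>"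
    using assms(1) by (intro lin_smult) auto
  then show ?thesis using lin_closed[OF assms(1)] by simp
qed

lemma lin_neg:
  assumes "lin R X Y f" "module R X" "module R Y" "x \<in> carrier X"
  shows "f (\<ominus>\<^bsub>X\<^esub> x) = \<ominus>\<^bsub>Y\<^esub> f x"
proof -
  interpret X: module R X by fact
  interpret Y: module R Y by fact
  have "f (\<ominus>\<^bsub>X\<^esub> x) \<oplus>\<^bsub>Y\<^esub> f x = \<zero>\<^bsub>Y\<^esub>"
    using assms lin_add[OF assms(1), of "\<ominus>\<^bsub>X\<^esub> x" x] lin_zero[OF assms(1-3)]
    by (simp add: X.M.l_neg)
  then show ?thesis using assms lin_closed[OF assms(1)]
    by (metis Y.M.minus_equality X.M.a_inv_closed)
qed

lemma lin_diff:
  assumes "lin R X Y f" "module R X" "module R Y" "x \<in> carrier X" "y \<in> carrier X"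
  shows "f (x \<ominus>\<^bsub>X\<^esub> y) = f x \<ominus>\<^bsub>Y\<^esub> f y"
proof -
  interpret X: module R X by fact
  show ?thesis using assms by (simp add: a_minus_def lin_add lin_neg)
qed

lemma mod_diff_zeroD:
  assumes "module R X" "x \<in> carrier X" "y \<in> carrier X" "x \<ominus>\<^bsub>X\<^esub> y = \<zero>\<^bsub>X\<^esub>"
  shows "x = y"
proof -
  interpret X: module R X by fact
  have "x = (x \<ominus>\<^bsub>X\<^esub> y) \<oplus>\<^bsub>X\<^esub> y" using assms(2,3) by (simp add: a_minus_def X.M.a_assoc X.M.l_neg)
  then show ?thesis using assms(3,4) by simp
qed

lemma lin_injI:
  assumes f: "lin R X Y f" and X: "module R X" and Y: "module R Y"
    and z: "\<And>x. x \<in> carrier X \<Longrightarrow> f x = \<zero>\<^bsub>Y\<^esub> \<Longrightarrow> x = \<zero>\<^bsub>X\<^esub>"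
  shows "inj_on f (carrier X)"
proof (rule inj_onI)
  interpret X: module R X by fact
  interpret Y: module R Y by fact
  fix x y assume x: "x \<in> carrier X" and y: "y \<in> carrier X" and e: "f x = f y"
  have "f (x \<ominus>\<^bsub>X\<^esub> y) = \<zero>\<^bsub>Y\<^esub>"
    using lin_diff[OF f X Y x y] e lin_closed[OF f y] by (simp add: a_minus_def Y.M.r_neg)
  then have "x \<ominus>\<^bsub>X\<^esub> y = \<zero>\<^bsub>X\<^esub>" by (rule z[rotated]) (use x y in simp)
  then show "x = y" by (rule mod_diff_zeroD[OF X x y])
qed

text \<open>A sum over an infinite set is zero by convention, so preservation of zero settles that
  case and additivity the finite one.\<close>

lemma lin_finsum:
  assumes "lin R X Y f" "module R X" "module R Y" "\<And>i. i \<in> I \<Longrightarrow> g i \<in> carrier X"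
  shows "f (finsum X g I) = (\<Oplus>\<^bsub>Y\<^esub>i\<in>I. f (g i))"
proof -
  interpret X: module R X by fact
  interpret Y: module R Y by fact
  show ?thesis using assms(4)
  proof (induction I rule: infinite_finite_induct)
    case (infinite A)
    then show ?case using lin_zero[OF assms(1-3)] by (simp add: X.M.finsum_infinite Y.M.finsum_infinite)
  next
    case empty
    then show ?case using lin_zero[OF assms(1-3)] by simp
  next
    case (insert a A)
    then show ?case using lin_closed[OF assms(1)]
      by (simp add: X.M.finsum_insert Y.M.finsum_insert Pi_def lin_add[OF assms(1)])
  qed
qed

lemma lin_comp: "lin R X Y f \<Longrightarrow> lin R Y Z g \<Longrightarrow> lin R X Z (\<lambda>x. g (f x))"
  by (auto simp: lin_def Pi_iff)

lemma lin_ident: "lin R X X (\<lambda>x. x)"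
  by (auto simp: lin_def)

lemma lin_const_zero: "module R Y \<Longrightarrow> lin R X Y (\<lambda>x. \<zero>\<^bsub>Y\<^esub>)"
proof -
  assume "module R Y"
  then interpret Y: module R Y .
  show ?thesis by (auto simp: lin_def)
qed

lemma lin_plus:
  assumes "lin R X Y f" "lin R X Y g" "module R Y"
  shows "lin R X Y (\<lambda>x. f x \<oplus>\<^bsub>Y\<^esub> g x)"
proof -
  interpret Y: module R Y by fact
  show ?thesis using assms(1,2)
    by (intro linI) (simp_all add: lin_closed lin_add lin_smult Y.smult_r_distr Y.M.a_ac)
qed

lemma lin_scale:
  assumes "lin R X Y f" "r \<in> carrier R" "module R Y"
  shows "lin R X Y (\<lambda>x. r \<odot>\<^bsub>Y\<^esub> f x)"
proof -
  interpret Y: module R Y by fact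
  \<comment> \<open>Commutativity of \<open>R\<close> enters here: scaling by \<open>r\<close> has
    to commute with scaling by \<open>s\<close>.\<close>
  have "r \<odot>\<^bsub>Y\<^esub> (s \<odot>\<^bsub>Y\<^esub> y) = s \<odot>\<^bsub>Y\<^esub> (r \<odot>\<^bsub>Y\<^esub> y)" if "s \<in> carrier R" "y \<in> carrier Y" for s y
    using that assms(2) by (metis Y.smult_assoc1 Y.R.m_comm)
  then show ?thesis using assms(1,2)
    by (intro linI) (simp_all add: lin_closed lin_add lin_smult Y.smult_r_distr)
qed

lemma lin_sum:
  assumes "\<And>i. i \<in> I \<Longrightarrow> lin R X Y (f i)" "module R Y" "module R X"
  shows "lin R X Y (\<lambda>x. \<Oplus>\<^bsub>Y\<^esub>i\<in>I. f i x)"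
proof -
  interpret Y: module R Y by fact
  show ?thesis using assms(1)
  proof (induction I rule: infinite_finite_induct)
    case (infinite A)
    then show ?case using lin_const_zero[OF assms(2)] by (simp add: Y.M.finsum_infinite)
  next
    case empty
    then show ?case using lin_const_zero[OF assms(2)] by simp
  next
    case (insert a A)
    have "lin R X Y (\<lambda>x. f a x \<oplus>\<^bsub>Y\<^esub> (\<Oplus>\<^bsub>Y\<^esub>i\<in>A. f i x))"
      using insert assms(2) by (intro lin_plus) auto
    moreover have "(\<Oplus>\<^bsub>Y\<^esub>i\<in>insert a A. f i x) = f a x \<oplus>\<^bsub>Y\<^esub> (\<Oplus>\<^bsub>Y\<^esub>i\<in>A. f i x)"
      if "x \<in> carrier X" for x
      using insert that lin_closed[of R X Y _ x] by (intro Y.M.finsum_insert) auto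
    ultimately show ?case by (rule lin_cong[OF _ assms(3)])
  qed
qed

section \<open>Submodules, spans and determination by generators\<close>

lemma submoduleI':
  assumes "module R M" "H \<subseteq> carrier M" "\<zero>\<^bsub>M\<^esub> \<in> H" "\<And>x y. x \<in> H \<Longrightarrow> y \<in> H \<Longrightarrow> x \<oplus>\<^bsub>M\<^esub> y \<in> H"
    and "\<And>r x. r \<in> carrier R \<Longrightarrow> x \<in> H \<Longrightarrow> r \<odot>\<^bsub>M\<^esub> x \<in> H"
  shows "submodule H R M"
proof -
  interpret M: module R M by fact
  \<comment> \<open>Negatives are multiples by minus one, so closure under scalars supplies
    them.\<close>
  have "\<ominus>\<^bsub>M\<^esub> x \<in> H" if "x \<in> H" for x
    using assms(5)[of "\<ominus>\<^bsub>R\<^esub> \<one>\<^bsub>R\<^esub>" x] that assms(2) by (auto simp: M.smult_l_minus)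
  then show ?thesis using assms by (intro M.submoduleI) auto
qed

lemma submodule_subset: "submodule H R M \<Longrightarrow> H \<subseteq> carrier M"
  using subgroup.subset[of H "add_monoid M"] by (simp add: submodule_def)

lemma submodule_zero: "submodule H R M \<Longrightarrow> \<zero>\<^bsub>M\<^esub> \<in> H"
  using subgroup.one_closed[of H "add_monoid M"] by (simp add: submodule_def)

lemma submodule_add: "submodule H R M \<Longrightarrow> x \<in> H \<Longrightarrow> y \<in> H \<Longrightarrow> x \<oplus>\<^bsub>M\<^esub> y \<in> H"
  using subgroup.m_closed[of H "add_monoid M"] by (simp add: submodule_def)

lemma submodule_smult: "submodule H R M \<Longrightarrow> r \<in> carrier R \<Longrightarrow> x \<in> H \<Longrightarrow> r \<odot>\<^bsub>M\<^esub> x \<in> H"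
  by (rule submodule.smult_closed)

lemma submodule_finsum:
  assumes "submodule H R M" "module R M" "\<And>i. i \<in> I \<Longrightarrow> f i \<in> H"
  shows "finsum M f I \<in> H"
proof -
  interpret M: module R M by fact
  show ?thesis using assms(3)
  proof (induction I rule: infinite_finite_induct)
    case (infinite A) then show ?case using submodule_zero[OF assms(1)] by (simp add: M.M.finsum_infinite)
  next
    case empty then show ?case using submodule_zero[OF assms(1)] by simp
  next
    case (insert a A)
    then have "finsum M f (insert a A) = f a \<oplus>\<^bsub>M\<^esub> finsum M f A"
      using submodule_subset[OF assms(1)] by (intro M.M.finsum_insert) auto
    then show ?case using insert submodule_add[OF assms(1)] by auto
  qed
qed

lemma lin_vimage_submodule:
  assumes "lin R X Y f" "module R X" "module R Y" "submodule H R Y"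
  shows "submodule {x \<in> carrier X. f x \<in> H} R X"
  using lin_add[OF assms(1)] lin_smult[OF assms(1)] lin_zero[OF assms(1-3)]
    mod_zero_closed[OF assms(2)] mod_add_closed[OF assms(2)] mod_smult_closed[OF assms(2)]
    submodule_zero[OF assms(4)] submodule_add[OF assms(4)] submodule_smult[OF assms(4)]
  by (intro submoduleI'[OF assms(2)]) auto

lemma zero_submodule: "module R M \<Longrightarrow> submodule {\<zero>\<^bsub>M\<^esub>} R M"
proof -
  assume "module R M"
  then interpret M: module R M .
  show ?thesis by (intro submoduleI' \<open>module R M\<close>) auto
qed

lemma lin_image_submodule:
  assumes "lin R X Y f" "module R X" "module R Y" "submodule H R X"
  shows "submodule (f ` H) R Y"
proof (rule submoduleI'[OF assms(3)])
  note H = submodule_subset[OF assms(4)] lin_closed[OF assms(1)]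
  show "f ` H \<subseteq> carrier Y" using H by auto
  show "\<zero>\<^bsub>Y\<^esub> \<in> f ` H" using lin_zero[OF assms(1-3)] submodule_zero[OF assms(4)] by (metis image_eqI)
  fix x y assume "x \<in> f ` H" "y \<in> f ` H"
  then obtain a b where ab: "a \<in> H" "b \<in> H" "x = f a" "y = f b" by auto
  then have "x \<oplus>\<^bsub>Y\<^esub> y = f (a \<oplus>\<^bsub>X\<^esub> b)" using H lin_add[OF assms(1), of a b] by (auto simp: subset_iff)
  then show "x \<oplus>\<^bsub>Y\<^esub> y \<in> f ` H" using ab submodule_add[OF assms(4)] by auto
next
  fix r x assume r: "r \<in> carrier R" "x \<in> f ` H"
  then obtain a where a: "a \<in> H" "x = f a" by auto
  then have "r \<odot>\<^bsub>Y\<^esub> x = f (r \<odot>\<^bsub>X\<^esub> a)"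
    using r lin_smult[OF assms(1), of r a] submodule_subset[OF assms(4)] by auto
  then show "r \<odot>\<^bsub>Y\<^esub> x \<in> f ` H" using a r submodule_smult[OF assms(4)] by auto
qed

lemma mspan_incl: "X \<subseteq> mspan R M X"
  by (auto simp: mspan_def)

lemma mspan_base: "x \<in> X \<Longrightarrow> x \<in> mspan R M X"
  by (auto simp: mspan_def)

lemma mspan_least: "submodule H R M \<Longrightarrow> X \<subseteq> H \<Longrightarrow> mspan R M X \<subseteq> H"
  by (auto simp: mspan_def)

lemma mspan_submodule:
  assumes "module R M" "X \<subseteq> carrier M"
  shows "submodule (mspan R M X) R M"
proof -
  interpret M: module R M by fact
  have c: "mspan R M X \<subseteq> carrier M" by (rule mspan_least[OF M.carrier_is_submodule assms(2)])
  show ?thesis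
    by (rule submoduleI'[OF assms(1) c])
      (auto simp: mspan_def intro: submodule_zero submodule_add submodule_smult)
qed

lemma mspan_mono: "X \<subseteq> Y \<Longrightarrow> mspan R M X \<subseteq> mspan R M Y"
  by (auto simp: mspan_def)

lemma mspan_closed: "module R M \<Longrightarrow> X \<subseteq> carrier M \<Longrightarrow> mspan R M X \<subseteq> carrier M"
  using mspan_submodule submodule_subset by blast

text \<open>The preimage of a submodule is a submodule, hence contains a span as soon as it contains
  the generators.\<close>

lemma lin_mspan:
  assumes "lin R M N f" "module R M" "module R N" "submodule H R N" "X \<subseteq> carrier M"
    and "\<And>x. x \<in> X \<Longrightarrow> f x \<in> H" "x \<in> mspan R M X"
  shows "f x \<in> H"
  using mspan_least[OF lin_vimage_submodule[OF assms(1-4)], of X] assms(5-7) by auto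

text \<open>The elements on which two linear maps agree form a submodule. Most identities below are
  reduced to generators in this way.\<close>

lemma lin_eqI:
  assumes "lin R M N f" "lin R M N g" "module R M" "module R N" "X \<subseteq> carrier M"
    and "\<And>x. x \<in> X \<Longrightarrow> f x = g x" "x \<in> mspan R M X"
  shows "f x = g x"
proof -
  interpret M: module R M by fact
  interpret N: module R N by fact
  have "submodule {x \<in> carrier M. f x = g x} R M"
    by (intro submoduleI'[OF assms(3)])
      (auto simp: lin_add[OF assms(1)] lin_add[OF assms(2)] lin_smult[OF assms(1)] lin_smult[OF assms(2)]
        lin_zero[OF assms(1,3,4)] lin_zero[OF assms(2,3,4)])
  then have "mspan R M X \<subseteq> {x \<in> carrier M. f x = g x}"
    by (rule mspan_least) (use assms(5,6) in auto)
  then show ?thesis using assms(7) by auto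
qed

section \<open>Presented modules\<close>

lemma free_mod_simps:
  "carrier (free_mod R S) = {f. range f \<subseteq> carrier R \<and> (\<forall>s. s \<notin> S \<longrightarrow> f s = \<zero>\<^bsub>R\<^esub>) \<and>
                                 finite {s. f s \<noteq> \<zero>\<^bsub>R\<^esub>}}"
  "zero (free_mod R S) = (\<lambda>_. \<zero>\<^bsub>R\<^esub>)"
  "add (free_mod R S) = (\<lambda>f g s. f s \<oplus>\<^bsub>R\<^esub> g s)"
  "smult (free_mod R S) = (\<lambda>a f s. a \<otimes>\<^bsub>R\<^esub> f s)"
  by (simp_all add: free_mod_def)

lemma free_mod_module:
  assumes "cring R"
  shows "module R (free_mod R S)"
proof -
  interpret R: cring R by fact
  have v: "f s \<in> carrier R" if "f \<in> carrier (free_mod R S)" for f s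
    using that by (auto simp: free_mod_simps)
  have cl: "(\<lambda>s. f s \<oplus>\<^bsub>R\<^esub> g s) \<in> carrier (free_mod R S)"
    if "f \<in> carrier (free_mod R S)" "g \<in> carrier (free_mod R S)" for f g
  proof -
    have "{s. f s \<oplus>\<^bsub>R\<^esub> g s \<noteq> \<zero>\<^bsub>R\<^esub>} \<subseteq> {s. f s \<noteq> \<zero>\<^bsub>R\<^esub>} \<union> {s. g s \<noteq> \<zero>\<^bsub>R\<^esub>}" by auto
    then have "finite {s. f s \<oplus>\<^bsub>R\<^esub> g s \<noteq> \<zero>\<^bsub>R\<^esub>}"
      using that by (elim finite_subset) (auto simp: free_mod_simps)
    then show ?thesis using that by (auto simp: free_mod_simps)
  qed
  have sc: "(\<lambda>s. a \<otimes>\<^bsub>R\<^esub> f s) \<in> carrier (free_mod R S)"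
    if "f \<in> carrier (free_mod R S)" "a \<in> carrier R" for f a
  proof -
    have "finite {s. a \<otimes>\<^bsub>R\<^esub> f s \<noteq> \<zero>\<^bsub>R\<^esub>}"
      using that by (intro finite_subset[of "{s. a \<otimes>\<^bsub>R\<^esub> f s \<noteq> \<zero>\<^bsub>R\<^esub>}" "{s. f s \<noteq> \<zero>\<^bsub>R\<^esub>}"]) (auto simp: free_mod_simps)
    then show ?thesis using that by (auto simp: free_mod_simps)
  qed
  have "abelian_group (free_mod R S)"
  proof (rule abelian_groupI)
    fix f assume f: "f \<in> carrier (free_mod R S)"
    have "(\<lambda>s. \<ominus>\<^bsub>R\<^esub> \<one>\<^bsub>R\<^esub> \<otimes>\<^bsub>R\<^esub> f s) \<in> carrier (free_mod R S)" using sc[OF f] by simp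
    moreover have "(\<lambda>s. \<ominus>\<^bsub>R\<^esub> \<one>\<^bsub>R\<^esub> \<otimes>\<^bsub>R\<^esub> f s) \<oplus>\<^bsub>free_mod R S\<^esub> f = \<zero>\<^bsub>free_mod R S\<^esub>"
      using v[OF f] by (auto simp: free_mod_simps R.l_minus R.l_neg)
    ultimately show "\<exists>y\<in>carrier (free_mod R S). y \<oplus>\<^bsub>free_mod R S\<^esub> f = \<zero>\<^bsub>free_mod R S\<^esub>" by blast
  qed (use v cl in \<open>auto simp: free_mod_simps(2,3) R.a_ac, simp add: free_mod_simps\<close>)
  then show ?thesis
    by (intro moduleI assms) (use v sc in \<open>auto simp: free_mod_simps(2-4) R.l_distr R.r_distr R.m_assoc\<close>)
qed

lemma free_gen_closed:
  assumes "cring R" "s \<in> S"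
  shows "free_gen R s \<in> carrier (free_mod R S)"
proof -
  interpret R: cring R by fact
  show ?thesis using assms(2) by (auto simp: free_mod_simps free_gen_def)
qed

lemma free_mod_gen:
  assumes "cring R"
  shows "carrier (free_mod R S) = mspan R (free_mod R S) (free_gen R ` S)"
proof -
  interpret R: cring R by fact
  let ?F = "free_mod R S"
  note F = free_mod_module[OF assms, of S]
  have g: "free_gen R ` S \<subseteq> carrier ?F" using free_gen_closed[OF assms] by auto
  note sub = mspan_submodule[OF F g]
  \<comment> \<open>Induction over a finite set that contains the support: each point
    \<open>a\<close> of the support splits off the multiple \<open>f a\<close> of its
    generator.\<close>
  have "f \<in> mspan R ?F (free_gen R ` S)"
    if "finite A" "f \<in> carrier ?F" "{s. f s \<noteq> \<zero>\<^bsub>R\<^esub>} \<subseteq> A" for A f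
    using that
  proof (induction A arbitrary: f)
    case empty
    then have "f = \<zero>\<^bsub>?F\<^esub>" by (auto simp: free_mod_simps)
    then show ?case using submodule_zero[OF sub] by simp
  next
    case (insert a A)
    have v: "f s \<in> carrier R" for s using insert.prems by (auto simp: free_mod_simps)
    show ?case
    proof (cases "f a = \<zero>\<^bsub>R\<^esub>")
      case True
      then show ?thesis using insert by auto
    next
      case False
      then have a: "a \<in> S" using insert.prems by (auto simp: free_mod_simps)
      have "finite {s. (f(a := \<zero>\<^bsub>R\<^esub>)) s \<noteq> \<zero>\<^bsub>R\<^esub>}"
        using insert.prems(1) by (intro finite_subset[of "{s. (f(a := \<zero>\<^bsub>R\<^esub>)) s \<noteq> \<zero>\<^bsub>R\<^esub>}" "{s. f s \<noteq> \<zero>\<^bsub>R\<^esub>}"])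
          (auto simp add: free_mod_simps)
      moreover have "f s = \<zero>\<^bsub>R\<^esub>" if "s \<notin> S" for s
        using that insert.prems(1) by (simp add: free_mod_simps)
      ultimately have c: "f(a := \<zero>\<^bsub>R\<^esub>) \<in> carrier ?F"
        using v unfolding free_mod_simps by (simp add: image_subset_iff)
      have "f(a := \<zero>\<^bsub>R\<^esub>) \<in> mspan R ?F (free_gen R ` S)"
        using insert.prems by (intro insert.IH c) auto
      moreover have "f a \<odot>\<^bsub>?F\<^esub> free_gen R a \<in> mspan R ?F (free_gen R ` S)"
        using a v by (intro submodule_smult[OF sub] mspan_base) auto
      moreover have "f = f(a := \<zero>\<^bsub>R\<^esub>) \<oplus>\<^bsub>?F\<^esub> f a \<odot>\<^bsub>?F\<^esub> free_gen R a"
        using v by (auto simp: free_mod_simps free_gen_def)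
      ultimately show ?thesis using submodule_add[OF sub] by metis
    qed
  qed
  then have "carrier ?F \<subseteq> mspan R ?F (free_gen R ` S)" by (force simp: free_mod_simps)
  then show ?thesis using mspan_closed[OF F g] by auto
qed

text \<open>The sum in \<open>lin_ext\<close>, freed from the choice of a representative. Linearity
  can then be proved on the free module, before passing to cosets.\<close>

definition flift :: "('r, 'k) ring_scheme \<Rightarrow> ('r, 'x, 'z) module_scheme \<Rightarrow> ('s \<Rightarrow> 'x) \<Rightarrow> ('s \<Rightarrow> 'r) \<Rightarrow> 'x" where
  "flift R X \<phi> f = (\<Oplus>\<^bsub>X\<^esub>s\<in>{s. f s \<noteq> \<zero>\<^bsub>R\<^esub>}. f s \<odot>\<^bsub>X\<^esub> \<phi> s)"

text \<open>Two functions have different supports, so their sums can be combined only after both are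
  extended to a common finite set.\<close>

lemma flift_superset:
  assumes "module R X" "\<phi> \<in> S \<rightarrow> carrier X" "f \<in> carrier (free_mod R S)"
    and "finite A" "{s. f s \<noteq> \<zero>\<^bsub>R\<^esub>} \<subseteq> A" "A \<subseteq> S"
  shows "flift R X \<phi> f = (\<Oplus>\<^bsub>X\<^esub>s\<in>A. f s \<odot>\<^bsub>X\<^esub> \<phi> s)"
proof -
  interpret X: module R X by fact
  have "f s \<in> carrier R" for s using assms(3) by (auto simp: free_mod_simps)
  then show ?thesis unfolding flift_def
    using assms(2,4-6) by (intro X.M.add.finprod_mono_neutral_cong_left) (auto simp: Pi_iff subset_iff)
qed

lemma flift_lin:
  assumes "module R X" "\<phi> \<in> S \<rightarrow> carrier X"
  shows "lin R (free_mod R S) X (flift R X \<phi>)"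
proof -
  interpret X: module R X by fact
  note F = free_mod_module[OF X.R.is_cring, of S]
  have v: "f s \<in> carrier R" and z: "s \<notin> S \<Longrightarrow> f s = \<zero>\<^bsub>R\<^esub>" and fin: "finite {s. f s \<noteq> \<zero>\<^bsub>R\<^esub>}"
    if "f \<in> carrier (free_mod R S)" for f s
    using that by (auto simp: free_mod_simps)
  note sup = flift_superset[where S=S and \<phi>=\<phi>, OF assms]
  have t: "f s \<odot>\<^bsub>X\<^esub> \<phi> s \<in> carrier X" if "f \<in> carrier (free_mod R S)" "s \<in> S" for f s
    using v[OF that(1)] assms(2) that by auto
  show ?thesis
  proof (rule linI)
    fix f assume f: "f \<in> carrier (free_mod R S)"
    show "flift R X \<phi> f \<in> carrier X" unfolding flift_def
      using t[OF f] z[OF f] by (intro X.M.finsum_closed) auto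
    fix r assume r: "r \<in> carrier R"
    let ?A = "{s. f s \<noteq> \<zero>\<^bsub>R\<^esub>}"
    have A: "?A \<subseteq> S" using z[OF f] by auto
    have "flift R X \<phi> (r \<odot>\<^bsub>free_mod R S\<^esub> f) = (\<Oplus>\<^bsub>X\<^esub>s\<in>?A. (r \<odot>\<^bsub>free_mod R S\<^esub> f) s \<odot>\<^bsub>X\<^esub> \<phi> s)"
      using A fin[OF f] mod_smult_closed[OF F r f] r by (intro sup) (auto simp: free_mod_simps(4))
    also have "\<dots> = (\<Oplus>\<^bsub>X\<^esub>s\<in>?A. r \<odot>\<^bsub>X\<^esub> (f s \<odot>\<^bsub>X\<^esub> \<phi> s))"
      using t[OF f] r v[OF f] assms(2) A
      by (intro X.M.finsum_cong') (auto simp: free_mod_simps(4) X.smult_assoc1 subset_iff Pi_iff)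
    also have "\<dots> = r \<odot>\<^bsub>X\<^esub> flift R X \<phi> f" unfolding flift_def
      using t[OF f] A fin[OF f] r by (intro X.finsum_smult_ldistr[symmetric]) (auto simp: Pi_iff subset_iff)
    finally show "flift R X \<phi> (r \<odot>\<^bsub>free_mod R S\<^esub> f) = r \<odot>\<^bsub>X\<^esub> flift R X \<phi> f" .
  next
    fix f g assume fg: "f \<in> carrier (free_mod R S)" "g \<in> carrier (free_mod R S)"
    let ?A = "{s. f s \<noteq> \<zero>\<^bsub>R\<^esub>} \<union> {s. g s \<noteq> \<zero>\<^bsub>R\<^esub>}"
    have A: "?A \<subseteq> S" using z[OF fg(1)] z[OF fg(2)] by auto
    have fA: "finite ?A" using fin[OF fg(1)] fin[OF fg(2)] by auto
    have "flift R X \<phi> (f \<oplus>\<^bsub>free_mod R S\<^esub> g) = (\<Oplus>\<^bsub>X\<^esub>s\<in>?A. (f \<oplus>\<^bsub>free_mod R S\<^esub> g) s \<odot>\<^bsub>X\<^esub> \<phi> s)"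
      using A fA mod_add_closed[OF F fg] by (intro sup) (auto simp: free_mod_simps(3))
    also have "\<dots> = (\<Oplus>\<^bsub>X\<^esub>s\<in>?A. f s \<odot>\<^bsub>X\<^esub> \<phi> s \<oplus>\<^bsub>X\<^esub> g s \<odot>\<^bsub>X\<^esub> \<phi> s)"
      using t[OF fg(1)] t[OF fg(2)] v[OF fg(1)] v[OF fg(2)] assms(2) A
      by (intro X.M.finsum_cong') (auto simp: free_mod_simps(3) X.smult_l_distr subset_iff Pi_iff)
    also have "\<dots> = (\<Oplus>\<^bsub>X\<^esub>s\<in>?A. f s \<odot>\<^bsub>X\<^esub> \<phi> s) \<oplus>\<^bsub>X\<^esub> (\<Oplus>\<^bsub>X\<^esub>s\<in>?A. g s \<odot>\<^bsub>X\<^esub> \<phi> s)"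
      using t[OF fg(1)] t[OF fg(2)] A by (intro X.M.finsum_addf) (auto simp: Pi_iff subset_iff)
    also have "\<dots> = flift R X \<phi> f \<oplus>\<^bsub>X\<^esub> flift R X \<phi> g"
      using A fA sup[OF fg(1), of ?A] sup[OF fg(2), of ?A] by simp
    finally show "flift R X \<phi> (f \<oplus>\<^bsub>free_mod R S\<^esub> g) = flift R X \<phi> f \<oplus>\<^bsub>X\<^esub> flift R X \<phi> g" .
  qed
qed

lemma flift_gen:
  assumes "module R X" "\<phi> \<in> S \<rightarrow> carrier X" "s \<in> S"
  shows "flift R X \<phi> (free_gen R s) = \<phi> s"
proof -
  interpret X: module R X by fact
  have "flift R X \<phi> (free_gen R s) = (\<Oplus>\<^bsub>X\<^esub>t\<in>{s}. free_gen R s t \<odot>\<^bsub>X\<^esub> \<phi> t)"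
    using assms by (intro flift_superset[where S=S] free_gen_closed X.R.is_cring) (auto simp: free_gen_def split: if_splits)
  also have "\<dots> = \<phi> s" using assms(2,3) by (simp add: free_gen_def Pi_iff)
  finally show ?thesis .
qed

lemma quot_mod_simps:
  "carrier (quot_mod M K) = a_rcosets\<^bsub>M\<^esub> K"
  "zero (quot_mod M K) = K"
  "add (quot_mod M K) = set_add M"
  "smult (quot_mod M K) = (\<lambda>a X. \<Union>x\<in>X. K +>\<^bsub>M\<^esub> (a \<odot>\<^bsub>M\<^esub> x))"
  by (simp_all add: quot_mod_def)

lemma quot_mod_module:
  assumes "module R M" "submodule K R M"
  shows "module R (quot_mod M K)"
    and "lin R M (quot_mod M K) (\<lambda>x. K +>\<^bsub>M\<^esub> x)"
    and "carrier (quot_mod M K) = (\<lambda>x. K +>\<^bsub>M\<^esub> x) ` carrier M"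
proof -
  interpret M: module R M by fact
  interpret K: abelian_subgroup K M
    using assms by (intro abelian_subgroupI3) (auto simp: additive_subgroup_def submodule_def M.M.abelian_group_axioms)
  let ?Q = "quot_mod M K"
  show car: "carrier ?Q = (\<lambda>x. K +>\<^bsub>M\<^esub> x) ` carrier M"
    by (auto simp: quot_mod_simps A_RCOSETS_def' a_r_coset_def')
  have ad: "(K +>\<^bsub>M\<^esub> x) \<oplus>\<^bsub>?Q\<^esub> (K +>\<^bsub>M\<^esub> y) = K +>\<^bsub>M\<^esub> (x \<oplus>\<^bsub>M\<^esub> y)" if "x \<in> carrier M" "y \<in> carrier M" for x y
    using that by (simp add: quot_mod_simps K.a_rcos_sum)
  have sm: "r \<odot>\<^bsub>?Q\<^esub> (K +>\<^bsub>M\<^esub> x) = K +>\<^bsub>M\<^esub> (r \<odot>\<^bsub>M\<^esub> x)" if "r \<in> carrier R" "x \<in> carrier M" for r x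
  proof -
    \<comment> \<open>Representatives of one coset differ by elements of \<open>K\<close>, and
      \<open>K\<close> is stable under scalars. Hence the union that defines scalar multiplication
      runs over a constant family.\<close>
    have "K +>\<^bsub>M\<^esub> (r \<odot>\<^bsub>M\<^esub> y) = K +>\<^bsub>M\<^esub> (r \<odot>\<^bsub>M\<^esub> x)" if y: "y \<in> K +>\<^bsub>M\<^esub> x" for y
    proof -
      obtain k where k: "k \<in> K" "y = k \<oplus>\<^bsub>M\<^esub> x" using y by (auto simp: a_r_coset_def')
      have rk: "r \<odot>\<^bsub>M\<^esub> k \<in> K" using assms(2) k \<open>r \<in> carrier R\<close> by (simp add: submodule_smult)
      have "r \<odot>\<^bsub>M\<^esub> y = r \<odot>\<^bsub>M\<^esub> k \<oplus>\<^bsub>M\<^esub> r \<odot>\<^bsub>M\<^esub> x"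
        using k \<open>r \<in> carrier R\<close> \<open>x \<in> carrier M\<close> by (simp add: M.smult_r_distr)
      then have "r \<odot>\<^bsub>M\<^esub> y \<in> K +>\<^bsub>M\<^esub> (r \<odot>\<^bsub>M\<^esub> x)" using rk by (auto simp: a_r_coset_def')
      then show ?thesis using \<open>r \<in> carrier R\<close> \<open>x \<in> carrier M\<close>
        by (intro M.M.a_repr_independence[symmetric]) (auto simp: submodule.axioms(1)[OF assms(2)])
    qed
    then have c: "\<forall>y\<in>K +>\<^bsub>M\<^esub> x. K +>\<^bsub>M\<^esub> (r \<odot>\<^bsub>M\<^esub> y) = K +>\<^bsub>M\<^esub> (r \<odot>\<^bsub>M\<^esub> x)" by blast
    have "x \<in> K +>\<^bsub>M\<^esub> x" using that K.a_rcos_self by simp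
    then show ?thesis unfolding quot_mod_simps using c by (rule UN_constant_eq)
  qed
  have ag: "abelian_group ?Q"
  proof (rule abelian_groupI)
    show "\<zero>\<^bsub>?Q\<^esub> \<in> carrier ?Q"
      by (simp add: quot_mod_simps K.a_subgroup_in_rcosets)
  next
    fix X assume "X \<in> carrier ?Q"
    then obtain x where x: "x \<in> carrier M" "X = K +>\<^bsub>M\<^esub> x" by (auto simp: car)
    have z: "\<zero>\<^bsub>?Q\<^esub> = K +>\<^bsub>M\<^esub> \<zero>\<^bsub>M\<^esub>"
      by (simp add: quot_mod_simps K.a_subset M.M.a_coset_add_zero)
    show "\<zero>\<^bsub>?Q\<^esub> \<oplus>\<^bsub>?Q\<^esub> X = X" using x z ad by simp
    have "(K +>\<^bsub>M\<^esub> (\<ominus>\<^bsub>M\<^esub> x)) \<oplus>\<^bsub>?Q\<^esub> X = \<zero>\<^bsub>?Q\<^esub>" using x z ad by (simp add: M.M.l_neg)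
    then show "\<exists>Y\<in>carrier ?Q. Y \<oplus>\<^bsub>?Q\<^esub> X = \<zero>\<^bsub>?Q\<^esub>" using x by (auto simp: car)
  qed (auto simp: car ad M.M.a_ac)
  show "module R ?Q"
    by (rule moduleI[OF M.R.is_cring ag]) (auto simp: car ad sm M.smult_l_distr M.smult_r_distr M.smult_assoc1)
  show "lin R M ?Q (\<lambda>x. K +>\<^bsub>M\<^esub> x)"
    by (rule linI) (auto simp: car ad sm)
qed

context
  fixes R :: "('r, 'k) ring_scheme" and S :: "'s set" and rel
  assumes R: "cring R" and rel: "rel \<subseteq> carrier (free_mod R S)"
begin

lemma presented_module: "module R (presented R S rel)"
  unfolding presented_def by (intro quot_mod_module(1) free_mod_module mspan_submodule R rel)

lemma presented_proj:
  "lin R (free_mod R S) (presented R S rel) (\<lambda>f. mspan R (free_mod R S) rel +>\<^bsub>free_mod R S\<^esub> f)"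
  unfolding presented_def by (intro quot_mod_module(2) free_mod_module mspan_submodule R rel)

lemma pgen_closed: "s \<in> S \<Longrightarrow> pgen R S rel s \<in> carrier (presented R S rel)"
  unfolding pgen_def by (intro lin_closed[OF presented_proj] free_gen_closed R)

lemma presented_gen: "carrier (presented R S rel) = mspan R (presented R S rel) (pgen R S rel ` S)"
proof
  have g: "pgen R S rel ` S \<subseteq> carrier (presented R S rel)" using pgen_closed by auto
  then show "mspan R (presented R S rel) (pgen R S rel ` S) \<subseteq> carrier (presented R S rel)"
    by (intro mspan_closed presented_module)
  let ?q = "\<lambda>f. mspan R (free_mod R S) rel +>\<^bsub>free_mod R S\<^esub> f"
  have c: "carrier (presented R S rel) = ?q ` carrier (free_mod R S)"
    unfolding presented_def
    by (rule quot_mod_module(3)[OF free_mod_module[OF R] mspan_submodule[OF free_mod_module[OF R] rel]])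
  have "?q f \<in> mspan R (presented R S rel) (pgen R S rel ` S)" if "f \<in> carrier (free_mod R S)" for f
  proof (rule lin_mspan[OF presented_proj free_mod_module[OF R] presented_module mspan_submodule[OF presented_module g]])
    show "f \<in> mspan R (free_mod R S) (free_gen R ` S)" using that free_mod_gen[OF R, of S] by simp
    show "free_gen R ` S \<subseteq> carrier (free_mod R S)" using free_gen_closed[OF R] by auto
    fix x assume "x \<in> free_gen R ` S"
    then show "?q x \<in> mspan R (presented R S rel) (pgen R S rel ` S)"
      by (intro mspan_base) (auto simp: pgen_def)
  qed
  then show "carrier (presented R S rel) \<subseteq> mspan R (presented R S rel) (pgen R S rel ` S)" using c by auto
qed

text \<open>Lifting the generators \<open>pgen\<close> gives the quotient map, since two linear maps
  that agree on the free generators coincide; and the quotient map kills the relations.\<close>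

lemma presented_rel: "\<rho> \<in> rel \<Longrightarrow> flift R (presented R S rel) (pgen R S rel) \<rho> = \<zero>\<^bsub>presented R S rel\<^esub>"
proof -
  assume \<rho>: "\<rho> \<in> rel"
  let ?q = "\<lambda>f. mspan R (free_mod R S) rel +>\<^bsub>free_mod R S\<^esub> f"
  note F = free_mod_module[OF R, of S]
  have g: "free_gen R ` S \<subseteq> carrier (free_mod R S)" using free_gen_closed[OF R] by auto
  have "flift R (presented R S rel) (pgen R S rel) \<rho> = ?q \<rho>"
  proof (rule lin_eqI[OF flift_lin presented_proj F presented_module g])
    show "\<rho> \<in> mspan R (free_mod R S) (free_gen R ` S)" using \<rho> rel free_mod_gen[OF R, of S] by auto
    fix x assume "x \<in> free_gen R ` S"
    then show "flift R (presented R S rel) (pgen R S rel) x = ?q x"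
      using flift_gen[where S=S and \<phi>="pgen R S rel", OF presented_module]
      by (elim imageE) (simp add: pgen_def[symmetric] pgen_closed)
  qed (use presented_module pgen_closed in auto)
  also have "\<dots> = \<zero>\<^bsub>presented R S rel\<^esub>"
  proof -
    interpret F: module R "free_mod R S" by (rule F)
    have "?q \<rho> = mspan R (free_mod R S) rel"
      using mspan_submodule[OF F rel] mspan_base[OF \<rho>]
      by (intro F.M.a_coset_join2) (use rel \<rho> in \<open>auto simp: submodule_def\<close>)
    then show ?thesis by (simp add: presented_def quot_mod_simps)
  qed
  finally show ?thesis .
qed

text \<open>The universal property of a presented module. \<open>flift\<close> vanishes on the
  relations, hence on their span, so the value does not depend on the representative that
  \<open>lin_ext\<close> picks from a coset.\<close>

lemma lin_ext:
  assumes X: "module R X" and \<phi>: "\<phi> \<in> S \<rightarrow> carrier X"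
    and z: "\<And>\<rho>. \<rho> \<in> rel \<Longrightarrow> flift R X \<phi> \<rho> = \<zero>\<^bsub>X\<^esub>"
  shows "lin R (presented R S rel) X (lin_ext R X \<phi>)"
    and "s \<in> S \<Longrightarrow> lin_ext R X \<phi> (pgen R S rel s) = \<phi> s"
proof -
  let ?F = "free_mod R S" and ?K = "mspan R (free_mod R S) rel"
  note F = free_mod_module[OF R, of S]
  interpret F: module R ?F by (rule F)
  interpret X: module R X by (rule X)
  note L = flift_lin[OF X \<phi>]
  note sub = mspan_submodule[OF F rel]
  let ?q = "\<lambda>f. ?K +>\<^bsub>?F\<^esub> f"
  have K0: "flift R X \<phi> k = \<zero>\<^bsub>X\<^esub>" if "k \<in> ?K" for k
    using lin_mspan[OF L F X zero_submodule[OF X] rel _ that] z by auto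
  have ex: "lin_ext R X \<phi> (?q f) = flift R X \<phi> f" if f: "f \<in> carrier ?F" for f
  proof -
    interpret K: abelian_subgroup ?K ?F
      using sub by (intro abelian_subgroupI3) (auto simp: additive_subgroup_def submodule_def F.M.abelian_group_axioms)
    have "f \<in> ?q f" using f by (rule K.a_rcos_self)
    then have g: "(SOME g. g \<in> ?q f) \<in> ?q f" by (rule someI[where P="\<lambda>g. g \<in> ?q f"])
    define g where "g = (SOME g. g \<in> ?q f)"
    from g have "g \<in> ?q f" unfolding g_def .
    then obtain k where k: "k \<in> ?K" "g = k \<oplus>\<^bsub>?F\<^esub> f" by (auto simp: a_r_coset_def')
    then have "flift R X \<phi> g = flift R X \<phi> f"
      using lin_add[OF L, of k f] f K0 K.a_subset lin_closed[OF L f] by auto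
    then show ?thesis by (simp add: lin_ext_def flift_def g_def Let_def)
  qed
  have c: "carrier (presented R S rel) = ?q ` carrier ?F"
    unfolding presented_def
    by (rule quot_mod_module(3)[OF free_mod_module[OF R] mspan_submodule[OF free_mod_module[OF R] rel]])
  show "lin R (presented R S rel) X (lin_ext R X \<phi>)"
  proof (rule linI)
    fix T assume "T \<in> carrier (presented R S rel)"
    then obtain f where f: "f \<in> carrier ?F" "T = ?q f" using c by auto
    then show "lin_ext R X \<phi> T \<in> carrier X" using ex lin_closed[OF L] by auto
    fix r assume r: "r \<in> carrier R"
    have "r \<odot>\<^bsub>presented R S rel\<^esub> T = ?q (r \<odot>\<^bsub>?F\<^esub> f)" using lin_smult[OF presented_proj r f(1)] f by simp
    then show "lin_ext R X \<phi> (r \<odot>\<^bsub>presented R S rel\<^esub> T) = r \<odot>\<^bsub>X\<^esub> lin_ext R X \<phi> T"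
      using f ex lin_smult[OF L r] r by auto
  next
    fix T U assume "T \<in> carrier (presented R S rel)" "U \<in> carrier (presented R S rel)"
    then obtain f g where f: "f \<in> carrier ?F" "T = ?q f" "g \<in> carrier ?F" "U = ?q g" using c by auto
    have "T \<oplus>\<^bsub>presented R S rel\<^esub> U = ?q (f \<oplus>\<^bsub>?F\<^esub> g)" using lin_add[OF presented_proj f(1,3)] f by simp
    then show "lin_ext R X \<phi> (T \<oplus>\<^bsub>presented R S rel\<^esub> U) = lin_ext R X \<phi> T \<oplus>\<^bsub>X\<^esub> lin_ext R X \<phi> U"
      using f ex lin_add[OF L] by auto
  qed
  show "lin_ext R X \<phi> (pgen R S rel s) = \<phi> s" if "s \<in> S"
    using ex[OF free_gen_closed[OF R that]] flift_gen[OF X \<phi> that] by (simp add: pgen_def)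
qed

end

lemma flift_diff_eq_zero_iff:
  assumes "module R X" "\<phi> \<in> S \<rightarrow> carrier X" "f \<in> carrier (free_mod R S)" "g \<in> carrier (free_mod R S)"
  shows "flift R X \<phi> (f \<ominus>\<^bsub>free_mod R S\<^esub> g) = \<zero>\<^bsub>X\<^esub> \<longleftrightarrow> flift R X \<phi> f = flift R X \<phi> g"
proof -
  interpret X: module R X by fact
  note F = free_mod_module[OF X.R.is_cring, of S] and L = flift_lin[OF assms(1,2)]
  show ?thesis
    using lin_diff[OF L F assms(1,3,4)] lin_closed[OF L assms(3)] lin_closed[OF L assms(4)]
    by (metis X.M.add.inv_solve_right X.M.l_zero X.M.zero_closed a_minus_def)
qed

text \<open>The relations of all tensor products in use have one of these three shapes. Read from
  left to right, the equivalences turn relations into identities of generators; read from right to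
  left, they show that a map respects the relations.\<close>

lemma flift_relation_iff:
  assumes "module R X" "\<phi> \<in> S \<rightarrow> carrier X" "a \<in> S" "b \<in> S"
  shows "c \<in> S \<Longrightarrow> flift R X \<phi> (free_gen R a \<ominus>\<^bsub>free_mod R S\<^esub> (free_gen R b \<oplus>\<^bsub>free_mod R S\<^esub> free_gen R c)) = \<zero>\<^bsub>X\<^esub>
      \<longleftrightarrow> \<phi> a = \<phi> b \<oplus>\<^bsub>X\<^esub> \<phi> c"
    and "r \<in> carrier R \<Longrightarrow> flift R X \<phi> (free_gen R a \<ominus>\<^bsub>free_mod R S\<^esub> r \<odot>\<^bsub>free_mod R S\<^esub> free_gen R b) = \<zero>\<^bsub>X\<^esub>
      \<longleftrightarrow> \<phi> a = r \<odot>\<^bsub>X\<^esub> \<phi> b"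
    and "flift R X \<phi> (free_gen R a \<ominus>\<^bsub>free_mod R S\<^esub> free_gen R b) = \<zero>\<^bsub>X\<^esub> \<longleftrightarrow> \<phi> a = \<phi> b"
proof -
  interpret X: module R X by fact
  interpret F: module R "free_mod R S" by (rule free_mod_module[OF X.R.is_cring])
  note L = flift_lin[OF assms(1,2)] and g = free_gen_closed[OF X.R.is_cring, of _ S]
  note e = flift_gen[OF assms(1,2)]
  show "flift R X \<phi> (free_gen R a \<ominus>\<^bsub>free_mod R S\<^esub> (free_gen R b \<oplus>\<^bsub>free_mod R S\<^esub> free_gen R c)) = \<zero>\<^bsub>X\<^esub>
      \<longleftrightarrow> \<phi> a = \<phi> b \<oplus>\<^bsub>X\<^esub> \<phi> c" if "c \<in> S"
    using assms(3,4) that g by (simp add: flift_diff_eq_zero_iff[OF assms(1,2)] lin_add[OF L] e)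
  show "flift R X \<phi> (free_gen R a \<ominus>\<^bsub>free_mod R S\<^esub> r \<odot>\<^bsub>free_mod R S\<^esub> free_gen R b) = \<zero>\<^bsub>X\<^esub>
      \<longleftrightarrow> \<phi> a = r \<odot>\<^bsub>X\<^esub> \<phi> b" if "r \<in> carrier R"
    using assms(3,4) that g by (simp add: flift_diff_eq_zero_iff[OF assms(1,2)] lin_smult[OF L] e)
  show "flift R X \<phi> (free_gen R a \<ominus>\<^bsub>free_mod R S\<^esub> free_gen R b) = \<zero>\<^bsub>X\<^esub> \<longleftrightarrow> \<phi> a = \<phi> b"
    using assms(3,4) g by (simp add: flift_diff_eq_zero_iff[OF assms(1,2)] e)
qed

lemma relation_closed:
  assumes "cring R" "a \<in> S" "b \<in> S"
  shows "c \<in> S \<Longrightarrow> free_gen R a \<ominus>\<^bsub>free_mod R S\<^esub> (free_gen R b \<oplus>\<^bsub>free_mod R S\<^esub> free_gen R c) \<in> carrier (free_mod R S)"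
    and "r \<in> carrier R \<Longrightarrow> free_gen R a \<ominus>\<^bsub>free_mod R S\<^esub> r \<odot>\<^bsub>free_mod R S\<^esub> free_gen R b \<in> carrier (free_mod R S)"
    and "free_gen R a \<ominus>\<^bsub>free_mod R S\<^esub> free_gen R b \<in> carrier (free_mod R S)"
proof -
  interpret F: module R "free_mod R S" by (rule free_mod_module[OF assms(1)])
  note g = free_gen_closed[OF assms(1), of _ S]
  show "c \<in> S \<Longrightarrow> free_gen R a \<ominus>\<^bsub>free_mod R S\<^esub> (free_gen R b \<oplus>\<^bsub>free_mod R S\<^esub> free_gen R c) \<in> carrier (free_mod R S)"
    and "r \<in> carrier R \<Longrightarrow> free_gen R a \<ominus>\<^bsub>free_mod R S\<^esub> r \<odot>\<^bsub>free_mod R S\<^esub> free_gen R b \<in> carrier (free_mod R S)"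
    and "free_gen R a \<ominus>\<^bsub>free_mod R S\<^esub> free_gen R b \<in> carrier (free_mod R S)"
    using g assms by simp_all
qed

declare One_nat_def [simp del]

section \<open>Multilinear maps and tensor powers\<close>

definition multilin :: "('r, 'k) ring_scheme \<Rightarrow> ('r, 'x, 'z1) module_scheme \<Rightarrow> nat
    \<Rightarrow> ('r, 'y, 'z2) module_scheme \<Rightarrow> ((nat \<Rightarrow> 'x) \<Rightarrow> 'y) \<Rightarrow> bool" where
  "multilin R X n Y \<phi> \<longleftrightarrow> \<phi> \<in> tp_fam X n \<rightarrow> carrier Y \<and>
     (\<forall>x\<in>tp_fam X n. \<forall>i\<in>{1..n}. lin R X Y (\<lambda>a. \<phi> (x(i := a))))"

lemma multilin_lin: "multilin R X n Y \<phi> \<Longrightarrow> x \<in> tp_fam X n \<Longrightarrow> i \<in> {1..n} \<Longrightarrow> lin R X Y (\<lambda>a. \<phi> (x(i := a)))"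
  by (auto simp: multilin_def)

lemma tp_fam_upd: "x \<in> tp_fam X n \<Longrightarrow> i \<in> {1..n} \<Longrightarrow> a \<in> carrier X \<Longrightarrow> x(i := a) \<in> tp_fam X n"
  by (auto simp: tp_fam_def PiE_iff extensional_def)

lemma tp_fam_mem: "x \<in> tp_fam X n \<Longrightarrow> i \<in> {1..n} \<Longrightarrow> x i \<in> carrier X"
  by (auto simp: tp_fam_def PiE_iff)

lemma tp_fam_restrict: "(\<And>i. i \<in> {1..n} \<Longrightarrow> x i \<in> carrier X) \<Longrightarrow> restrict x {1..n} \<in> tp_fam X n"
  by (auto simp: tp_fam_def)

lemma tp_fam_restrict_eq: "x \<in> tp_fam X n \<Longrightarrow> restrict x {1..n} = x"
  by (simp add: tp_fam_def PiE_restrict)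

lemma pure_restrict: "pure R X n (restrict x {1..n}) = pure R X n x"
  by (simp add: pure_def)

text \<open>\<open>pure\<close> restricts its argument to \<open>{1..n}\<close>, so arbitrary
  functions on the naturals may stand for families, and extensionality need not be carried through
  the calculations.\<close>

lemma pure_cong: "(\<And>i. i \<in> {1..n} \<Longrightarrow> x i = y i) \<Longrightarrow> pure R X n x = pure R X n y"
  unfolding pure_def by (metis restrict_ext)

lemma tp_relI:
  assumes "x \<in> tp_fam X n" "i \<in> {1..n}" "a \<in> carrier X"
  shows "b \<in> carrier X \<Longrightarrow> free_gen R (x(i := a \<oplus>\<^bsub>X\<^esub> b)) \<ominus>\<^bsub>free_mod R (tp_fam X n)\<^esub>
      (free_gen R (x(i := a)) \<oplus>\<^bsub>free_mod R (tp_fam X n)\<^esub> free_gen R (x(i := b))) \<in> tp_rel R X n"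
    and "r \<in> carrier R \<Longrightarrow> free_gen R (x(i := r \<odot>\<^bsub>X\<^esub> a)) \<ominus>\<^bsub>free_mod R (tp_fam X n)\<^esub>
      r \<odot>\<^bsub>free_mod R (tp_fam X n)\<^esub> free_gen R (x(i := a)) \<in> tp_rel R X n"
  using assms unfolding tp_rel_def Let_def by blast+

lemma tp_rel_closed:
  assumes "module R X"
  shows "tp_rel R X n \<subseteq> carrier (free_mod R (tp_fam X n))"
proof -
  interpret X: module R X by fact
  show ?thesis unfolding tp_rel_def Let_def
    by (auto intro!: relation_closed X.R.is_cring tp_fam_upd)
qed

lemma tpow_module: "module R X \<Longrightarrow> module R (tpow R X n)"
  unfolding tpow_def by (intro presented_module tp_rel_closed) (auto simp: module_def)

lemma pure_closed:
  assumes "module R X" "\<And>i. i \<in> {1..n} \<Longrightarrow> x i \<in> carrier X"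
  shows "pure R X n x \<in> carrier (tpow R X n)"
  unfolding pure_def tpow_def
  by (intro pgen_closed tp_rel_closed tp_fam_restrict assms) (use assms(1) in \<open>auto simp: module_def\<close>)

lemma pure_closed_fam: "module R X \<Longrightarrow> x \<in> tp_fam X n \<Longrightarrow> pure R X n x \<in> carrier (tpow R X n)"
  by (rule pure_closed) (auto simp: tp_fam_mem)

lemma tpow_gen:
  assumes "module R X"
  shows "carrier (tpow R X n) = mspan R (tpow R X n) (pure R X n ` tp_fam X n)"
proof -
  have "pure R X n ` tp_fam X n = pgen R (tp_fam X n) (tp_rel R X n) ` tp_fam X n"
    by (intro image_cong) (auto simp: pure_def tp_fam_restrict_eq)
  then show ?thesis unfolding tpow_def
    using presented_gen[of R "tp_rel R X n" "tp_fam X n"] tp_rel_closed[OF assms] assms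
    by (simp add: module_def)
qed

lemma pure_multilin:
  assumes "module R X"
  shows "multilin R X n (tpow R X n) (pure R X n)"
proof -
  interpret X: module R X by fact
  let ?S = "tp_fam X n" and ?T = "tpow R X n"
  have T: "module R ?T" by (rule tpow_module[OF assms])
  have g: "pgen R ?S (tp_rel R X n) \<in> ?S \<rightarrow> carrier ?T"
    using pgen_closed[OF X.R.is_cring tp_rel_closed[OF assms]] by (auto simp: tpow_def)
  note rel = presented_rel[OF X.R.is_cring tp_rel_closed[OF assms], folded tpow_def]
  have p: "pure R X n (x(i := a)) = pgen R ?S (tp_rel R X n) (x(i := a))"
    if "x \<in> ?S" "i \<in> {1..n}" "a \<in> carrier X" for x i a
    using tp_fam_restrict_eq[OF tp_fam_upd[OF that]] by (simp add: pure_def)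
  show ?thesis unfolding multilin_def
  proof (intro conjI ballI)
    show "pure R X n \<in> tp_fam X n \<rightarrow> carrier (tpow R X n)"
      by (rule funcsetI) (rule pure_closed_fam[OF assms])
    fix x i assume x: "x \<in> ?S" "i \<in> {1..n}"
    note u = tp_fam_upd[OF x]
    show "lin R X ?T (\<lambda>a. pure R X n (x(i := a)))"
    proof (rule linI)
      fix a assume a: "a \<in> carrier X"
      show "pure R X n (x(i := a)) \<in> carrier ?T" using p[OF x a] u[OF a] g by auto
      fix r assume r: "r \<in> carrier R"
      show "pure R X n (x(i := r \<odot>\<^bsub>X\<^esub> a)) = r \<odot>\<^bsub>?T\<^esub> pure R X n (x(i := a))"
        using iffD1[OF flift_relation_iff(2)[OF T g u u r] rel[OF tp_relI(2)[OF x a r]]] x a r p by simp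
    next
      fix a b assume a: "a \<in> carrier X" "b \<in> carrier X"
      show "pure R X n (x(i := a \<oplus>\<^bsub>X\<^esub> b)) = pure R X n (x(i := a)) \<oplus>\<^bsub>?T\<^esub> pure R X n (x(i := b))"
        using iffD1[OF flift_relation_iff(1)[OF T g u u u] rel[OF tp_relI(1)[OF x a]]] x a p by simp
    qed
  qed
qed

text \<open>The universal property of the tensor power: the defining relations express additivity
  and homogeneity in each place, which is what \<open>multilin\<close> provides.\<close>

lemma tpow_lift:
  assumes "module R X" "module R Y" "multilin R X n Y \<phi>"
  shows "lin R (tpow R X n) Y (lin_ext R Y \<phi>)"
    and "x \<in> tp_fam X n \<Longrightarrow> lin_ext R Y \<phi> (pure R X n x) = \<phi> x"
proof -
  interpret X: module R X by fact
  have \<phi>: "\<phi> \<in> tp_fam X n \<rightarrow> carrier Y" using assms(3) by (simp add: multilin_def)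
  have z: "flift R Y \<phi> \<rho> = \<zero>\<^bsub>Y\<^esub>" if "\<rho> \<in> tp_rel R X n" for \<rho>
    using that unfolding tp_rel_def Let_def
  proof (elim UnE CollectE exE conjE)
    fix x i a b
    assume "\<rho> = free_gen R (x(i := a \<oplus>\<^bsub>X\<^esub> b)) \<ominus>\<^bsub>free_mod R (tp_fam X n)\<^esub>
        (free_gen R (x(i := a)) \<oplus>\<^bsub>free_mod R (tp_fam X n)\<^esub> free_gen R (x(i := b)))"
      and h: "x \<in> tp_fam X n" "i \<in> {1..n}" "a \<in> carrier X" "b \<in> carrier X"
    then show ?thesis
      using flift_relation_iff(1)[OF assms(2) \<phi> tp_fam_upd tp_fam_upd tp_fam_upd, of x i "a \<oplus>\<^bsub>X\<^esub> b" x i a x i b]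
        lin_add[OF multilin_lin[OF assms(3) h(1,2)] h(3,4)] by simp
  next
    fix x i r a
    assume "\<rho> = free_gen R (x(i := r \<odot>\<^bsub>X\<^esub> a)) \<ominus>\<^bsub>free_mod R (tp_fam X n)\<^esub>
        r \<odot>\<^bsub>free_mod R (tp_fam X n)\<^esub> free_gen R (x(i := a))"
      and h: "x \<in> tp_fam X n" "i \<in> {1..n}" "r \<in> carrier R" "a \<in> carrier X"
    then show ?thesis
      using flift_relation_iff(2)[OF assms(2) \<phi> tp_fam_upd tp_fam_upd, of x i "r \<odot>\<^bsub>X\<^esub> a" x i a r]
        lin_smult[OF multilin_lin[OF assms(3) h(1,2)] h(3,4)] by simp
  qed
  show "lin R (tpow R X n) Y (lin_ext R Y \<phi>)" unfolding tpow_def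
    by (rule lin_ext[OF X.R.is_cring tp_rel_closed[OF assms(1)] assms(2) \<phi> z])
  show "lin_ext R Y \<phi> (pure R X n x) = \<phi> x" if "x \<in> tp_fam X n"
    using lin_ext(2)[OF X.R.is_cring tp_rel_closed[OF assms(1)] assms(2) \<phi> z that] that
    by (simp add: pure_def tp_fam_restrict_eq)
qed

lemma tpow_eqI:
  assumes "module R X" "module R Y" "lin R (tpow R X n) Y f" "lin R (tpow R X n) Y g"
    and "\<And>x. x \<in> tp_fam X n \<Longrightarrow> f (pure R X n x) = g (pure R X n x)" "t \<in> carrier (tpow R X n)"
  shows "f t = g t"
proof (rule lin_eqI[OF assms(3,4) tpow_module[OF assms(1)] assms(2)])
  show "pure R X n ` tp_fam X n \<subseteq> carrier (tpow R X n)"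
    by (rule image_subsetI) (rule pure_closed_fam[OF assms(1)])
  show "t \<in> mspan R (tpow R X n) (pure R X n ` tp_fam X n)" using assms(1,6) tpow_gen by blast
qed (use assms(5) in auto)

lemma tpow_induct:
  assumes "module R X" "submodule H R (tpow R X n)" "\<And>x. x \<in> tp_fam X n \<Longrightarrow> pure R X n x \<in> H"
    "t \<in> carrier (tpow R X n)"
  shows "t \<in> H"
  using mspan_least[OF assms(2), of "pure R X n ` tp_fam X n"] assms(3,4) tpow_gen[OF assms(1), of n] by auto

lemma pure_lin:
  assumes "module R X" "\<And>i. i \<in> {1..n} \<Longrightarrow> x i \<in> carrier X" "k \<in> {1..n}"
  shows "lin R X (tpow R X n) (\<lambda>a. pure R X n (x(k := a)))"
proof -
  have "pure R X n (x(k := a)) = pure R X n ((restrict x {1..n})(k := a))" for a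
    by (rule pure_cong) auto
  then show ?thesis using multilin_lin[OF pure_multilin[OF assms(1)] tp_fam_restrict[OF assms(2)] assms(3)] by simp
qed

text \<open>The factors are released one at a time. The claim for \<open>k\<close> allows the first
  \<open>k\<close> factors to lie in the spans and keeps the others among the generators; linearity
  in place \<open>Suc k\<close> leads from \<open>k\<close> to \<open>Suc k\<close>.\<close>

lemma multilin_span:
  assumes "module R X" "module R Y" "multilin R X n Y \<phi>" "submodule H R Y"
    and G: "\<And>i. i \<in> {1..n} \<Longrightarrow> G i \<subseteq> carrier X"
    and "\<And>y. y \<in> (\<Pi>\<^sub>E i\<in>{1..n}. G i) \<Longrightarrow> \<phi> y \<in> H"
    and "x \<in> tp_fam X n" "\<And>i. i \<in> {1..n} \<Longrightarrow> x i \<in> mspan R X (G i)"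
  shows "\<phi> x \<in> H"
proof -
  have "\<forall>x\<in>tp_fam X n. (\<forall>i\<in>{1..n}. x i \<in> (if i \<le> k then mspan R X (G i) else G i)) \<longrightarrow> \<phi> x \<in> H" if "k \<le> n" for k
    using that
  proof (induction k)
    \<comment> \<open>No index in \<open>{1..n}\<close> is at most zero, so every factor is still a
      generator.\<close>
    case 0
    show ?case
    proof (intro ballI impI)
      fix x assume x: "x \<in> tp_fam X n" "\<forall>i\<in>{1..n}. x i \<in> (if i \<le> 0 then mspan R X (G i) else G i)"
      have "x i \<in> G i" if "i \<in> {1..n}" for i using bspec[OF x(2) that] that by simp
      then show "\<phi> x \<in> H" using x(1) assms(6) by (simp add: tp_fam_def PiE_iff)
    qed
  next
    case (Suc k)
    have k: "Suc k \<in> {1..n}" using Suc by auto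
    show ?case
    proof (intro ballI impI)
      fix x assume x: "x \<in> tp_fam X n" "\<forall>i\<in>{1..n}. x i \<in> (if i \<le> Suc k then mspan R X (G i) else G i)"
      have "\<phi> (x(Suc k := x (Suc k))) \<in> H"
      proof (rule lin_mspan[OF multilin_lin[OF assms(3) x(1) k] assms(1,2,4) G[OF k]])
        show "x (Suc k) \<in> mspan R X (G (Suc k))" using bspec[OF x(2) k] by simp
        fix a assume a: "a \<in> G (Suc k)"
        have "x(Suc k := a) \<in> tp_fam X n" using tp_fam_upd[OF x(1) k] a G[OF k] by auto
        moreover have "\<forall>i\<in>{1..n}. (x(Suc k := a)) i \<in> (if i \<le> k then mspan R X (G i) else G i)"
        proof
          fix i assume i: "i \<in> {1..n}"
          show "(x(Suc k := a)) i \<in> (if i \<le> k then mspan R X (G i) else G i)"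
            using bspec[OF x(2) i] a by (cases "i = Suc k") (simp_all add: le_Suc_eq)
        qed
        ultimately show "\<phi> (x(Suc k := a)) \<in> H" using Suc by simp
      qed
      then show "\<phi> x \<in> H" by simp
    qed
  qed
  from this[of n] show ?thesis using assms(7,8) by simp
qed

text \<open>One construction for all the maps between tensor powers. The map \<open>f i\<close> may
  vary with the place and \<pi> rearranges the factors; this covers permutations, the action of the
  wreath group and the maps induced by structure maps.\<close>

lemma tp_map:
  assumes "module R X" "module R Y" "\<pi> permutes {1..n}" "\<And>i. i \<in> {1..n} \<Longrightarrow> lin R X Y (f i)"
  shows "lin R (tpow R X n) (tpow R Y n) (tp_map R Y n (\<lambda>x i. f i (x (\<pi> i))))"
    and "(\<And>i. i \<in> {1..n} \<Longrightarrow> x i \<in> carrier X) \<Longrightarrow>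
      tp_map R Y n (\<lambda>x i. f i (x (\<pi> i))) (pure R X n x) = pure R Y n (\<lambda>i. f i (x (\<pi> i)))"
proof -
  have cl: "f i (x (\<pi> i)) \<in> carrier Y" if "\<And>i. i \<in> {1..n} \<Longrightarrow> x i \<in> carrier X" "i \<in> {1..n}" for x i
    using that permutes_in_image[OF assms(3), of i] lin_closed[OF assms(4)] by auto
  have "multilin R X n (tpow R Y n) (\<lambda>x. pure R Y n (\<lambda>i. f i (x (\<pi> i))))"
    unfolding multilin_def
  proof (intro conjI ballI funcsetI)
    fix x assume x: "x \<in> tp_fam X n"
    note c = cl[of x, OF tp_fam_mem[OF x]]
    show "pure R Y n (\<lambda>i. f i (x (\<pi> i))) \<in> carrier (tpow R Y n)"
      by (rule pure_closed[OF assms(2) c])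
    fix j assume j: "j \<in> {1..n}"
    \<comment> \<open>Entry \<open>j\<close> of the argument is used in exactly one factor of the
      result, the one at this place.\<close>
    let ?k = "inv' \<pi> j"
    have k: "?k \<in> {1..n}" using permutes_in_image[OF permutes_inv[OF assms(3)], of j] j by simp
    have "pure R Y n (\<lambda>i. f i ((x(j := a)) (\<pi> i))) = pure R Y n ((\<lambda>i. f i (x (\<pi> i)))(?k := f ?k a))" for a
      by (rule pure_cong) (auto simp: permutes_inverses[OF assms(3)])
    then show "lin R X (tpow R Y n) (\<lambda>a. pure R Y n (\<lambda>i. f i ((x(j := a)) (\<pi> i))))"
      using lin_comp[OF assms(4)[OF k] pure_lin[OF assms(2) c k]] by simp
  qed
  note L = tpow_lift[OF assms(1) tpow_module[OF assms(2)] this]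
  show "lin R (tpow R X n) (tpow R Y n) (tp_map R Y n (\<lambda>x i. f i (x (\<pi> i))))"
    unfolding tp_map_def by (rule L(1))
  assume x: "\<And>i. i \<in> {1..n} \<Longrightarrow> x i \<in> carrier X"
  have "pure R Y n (\<lambda>i. f i (restrict x {1..n} (\<pi> i))) = pure R Y n (\<lambda>i. f i (x (\<pi> i)))"
    using permutes_in_image[OF assms(3)] by (intro pure_cong) auto
  then show "tp_map R Y n (\<lambda>x i. f i (x (\<pi> i))) (pure R X n x) = pure R Y n (\<lambda>i. f i (x (\<pi> i)))"
    using L(2)[OF tp_fam_restrict[of n x X]] x by (simp add: tp_map_def pure_restrict)
qed

lemmas tp_map_id = tp_map[where \<pi> = id, OF _ _ permutes_id, unfolded id_apply]

lemma tp_perm: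
  assumes "module R X" "\<sigma> permutes {1..n}"
  shows "lin R (tpow R X n) (tpow R X n) (tp_perm R X n \<sigma>)"
    and "(\<And>i. i \<in> {1..n} \<Longrightarrow> x i \<in> carrier X) \<Longrightarrow>
      tp_perm R X n \<sigma> (pure R X n x) = pure R X n (\<lambda>i. x (inv' \<sigma> i))"
  using tp_map[OF assms(1,1) permutes_inv[OF assms(2)], of "\<lambda>_ x. x"] lin_ident
  unfolding tp_perm_def by auto

section \<open>Operations induced factor by factor\<close>

definition bilin :: "('r, 'k) ring_scheme \<Rightarrow> ('r, 'x, 'z1) module_scheme \<Rightarrow> ('r, 'y, 'z2) module_scheme
    \<Rightarrow> ('r, 'z, 'z3) module_scheme \<Rightarrow> ('x \<Rightarrow> 'y \<Rightarrow> 'z) \<Rightarrow> bool" where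
  "bilin R X Y Z f \<longleftrightarrow> (\<forall>x\<in>carrier X. lin R Y Z (f x)) \<and> (\<forall>y\<in>carrier Y. lin R X Z (\<lambda>x. f x y))"

lemma bilin_left: "bilin R X Y Z f \<Longrightarrow> y \<in> carrier Y \<Longrightarrow> lin R X Z (\<lambda>x. f x y)"
  and bilin_right: "bilin R X Y Z f \<Longrightarrow> x \<in> carrier X \<Longrightarrow> lin R Y Z (f x)"
  and bilin_closed: "bilin R X Y Z f \<Longrightarrow> x \<in> carrier X \<Longrightarrow> y \<in> carrier Y \<Longrightarrow> f x y \<in> carrier Z"
  by (auto simp: bilin_def lin_def)

lemma bilinI:
  assumes "\<And>x. x \<in> carrier X \<Longrightarrow> lin R Y Z (f x)" "\<And>y. y \<in> carrier Y \<Longrightarrow> lin R X Z (\<lambda>x. f x y)"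
  shows "bilin R X Y Z f"
  using assms by (simp add: bilin_def)

text \<open>The definition extends linearly in the second argument first, for a fixed family
  \<open>x\<close>, and then in the first. For fixed \<open>U\<close> the inner value is multilinear
  in \<open>x\<close>: both sides of each identity are linear in \<open>U\<close>, so pure tensors
  \<open>U\<close> suffice. Linearity in \<open>U\<close> for a general first argument is afterwards
  reduced to pure first arguments.\<close>

lemma tp_op:
  assumes X: "module R X" and Y: "module R Y" and Z: "module R Z" and f: "bilin R X Y Z f"
  shows "bilin R (tpow R X n) (tpow R Y n) (tpow R Z n) (tp_op R Z n f)"
    and "(\<And>i. i \<in> {1..n} \<Longrightarrow> x i \<in> carrier X) \<Longrightarrow> (\<And>i. i \<in> {1..n} \<Longrightarrow> y i \<in> carrier Y) \<Longrightarrow>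
      tp_op R Z n f (pure R X n x) (pure R Y n y) = pure R Z n (\<lambda>i. f (x i) (y i))"
proof -
  define P where "P = (\<lambda>x. tp_map R Z n (\<lambda>y i. f (x i) (y i)))"
  note TY = tpow_module[OF Y, of n] and TZ = tpow_module[OF Z, of n]
  have L: "lin R (tpow R Y n) (tpow R Z n) (P x)" if "x \<in> tp_fam X n" for x
    unfolding P_def by (rule tp_map_id(1)[OF Y Z bilin_right[OF f tp_fam_mem[OF that]]])
  have V: "P x (pure R Y n y) = pure R Z n (\<lambda>i. f (x i) (y i))" if "y \<in> tp_fam Y n" "x \<in> tp_fam X n" for x y
    unfolding P_def by (rule tp_map_id(2)[OF Y Z bilin_right[OF f tp_fam_mem[OF that(2)]] tp_fam_mem[OF that(1)]])
  note u = tp_fam_upd[of _ X n]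
  have ml: "multilin R X n (tpow R Z n) (\<lambda>x. P x U)" if U: "U \<in> carrier (tpow R Y n)" for U
    unfolding multilin_def
  proof (intro conjI ballI funcsetI)
    fix x assume x: "x \<in> tp_fam X n"
    then show "P x U \<in> carrier (tpow R Z n)" using lin_closed[OF L U] by blast
    fix i assume i: "i \<in> {1..n}"
    note u = tp_fam_upd[OF x i]
    \<comment> \<open>For a pure second argument, replacing entry \<open>i\<close> of
      \<open>x\<close> affects factor \<open>i\<close> alone, through a map that is linear because
      \<open>f\<close> is bilinear.\<close>
    have lp: "lin R X (tpow R Z n) (\<lambda>a. P (x(i := a)) (pure R Y n y))" if y: "y \<in> tp_fam Y n" for y
    proof (rule lin_cong[OF _ X])
      show "lin R X (tpow R Z n) (\<lambda>a. pure R Z n ((\<lambda>j. f (x j) (y j))(i := f a (y i))))"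
        using bilin_closed[OF f tp_fam_mem[OF x] tp_fam_mem[OF y]]
        by (intro lin_comp[OF bilin_left[OF f tp_fam_mem[OF y i]] pure_lin[OF Z _ i]]) auto
      fix a assume "a \<in> carrier X"
      then show "P (x(i := a)) (pure R Y n y) = pure R Z n ((\<lambda>j. f (x j) (y j))(i := f a (y i)))"
        using V[OF y u] by (auto intro!: pure_cong)
    qed
    show "lin R X (tpow R Z n) (\<lambda>a. P (x(i := a)) U)"
    proof (rule linI)
      fix a assume a: "a \<in> carrier X"
      show "P (x(i := a)) U \<in> carrier (tpow R Z n)" by (rule lin_closed[OF L[OF u[OF a]] U])
      fix r assume r: "r \<in> carrier R"
      show "P (x(i := r \<odot>\<^bsub>X\<^esub> a)) U = r \<odot>\<^bsub>tpow R Z n\<^esub> P (x(i := a)) U"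
        using lin_smult[OF lp r a]
        by (intro tpow_eqI[OF Y TZ L[OF u] lin_scale[OF L[OF u] r TZ] _ U] a mod_smult_closed[OF X r])
    next
      fix a b assume a: "a \<in> carrier X" "b \<in> carrier X"
      show "P (x(i := a \<oplus>\<^bsub>X\<^esub> b)) U = P (x(i := a)) U \<oplus>\<^bsub>tpow R Z n\<^esub> P (x(i := b)) U"
        using lin_add[OF lp a]
        by (intro tpow_eqI[OF Y TZ L[OF u] lin_plus[OF L[OF u] L[OF u] TZ] _ U] a mod_add_closed[OF X])
    qed
  qed
  note E = tpow_lift[OF X TZ ml]
  have op: "tp_op R Z n f T U = lin_ext R (tpow R Z n) (\<lambda>x. P x U) T" for T U
    by (simp add: tp_op_def P_def)
  have lT: "lin R (tpow R X n) (tpow R Z n) (\<lambda>T. tp_op R Z n f T U)" if "U \<in> carrier (tpow R Y n)" for U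
    unfolding op using E(1)[OF that] by simp
  have vp: "tp_op R Z n f (pure R X n x) U = P x U" if "U \<in> carrier (tpow R Y n)" "x \<in> tp_fam X n" for x U
    unfolding op by (rule E(2)[OF that])
  have lU: "lin R (tpow R Y n) (tpow R Z n) (tp_op R Z n f T)" if T: "T \<in> carrier (tpow R X n)" for T
  proof (rule linI)
    fix U assume U: "U \<in> carrier (tpow R Y n)"
    show "tp_op R Z n f T U \<in> carrier (tpow R Z n)" by (rule lin_closed[OF lT[OF U] T])
    fix r assume r: "r \<in> carrier R"
    show "tp_op R Z n f T (r \<odot>\<^bsub>tpow R Y n\<^esub> U) = r \<odot>\<^bsub>tpow R Z n\<^esub> tp_op R Z n f T U"
      using U r lin_smult[OF L r U]
      by (intro tpow_eqI[OF X TZ lT lin_scale[OF lT r TZ] _ T]) (simp_all add: vp mod_smult_closed[OF TY r])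
  next
    fix U V assume U: "U \<in> carrier (tpow R Y n)" "V \<in> carrier (tpow R Y n)"
    show "tp_op R Z n f T (U \<oplus>\<^bsub>tpow R Y n\<^esub> V) = tp_op R Z n f T U \<oplus>\<^bsub>tpow R Z n\<^esub> tp_op R Z n f T V"
      using U lin_add[OF L U]
      by (intro tpow_eqI[OF X TZ lT lin_plus[OF lT lT TZ] _ T]) (simp_all add: vp mod_add_closed[OF TY])
  qed
  show "bilin R (tpow R X n) (tpow R Y n) (tpow R Z n) (tp_op R Z n f)"
    using lT lU by (intro bilinI)
  assume x: "\<And>i. i \<in> {1..n} \<Longrightarrow> x i \<in> carrier X" and y: "\<And>i. i \<in> {1..n} \<Longrightarrow> y i \<in> carrier Y"
  have "tp_op R Z n f (pure R X n (restrict x {1..n})) (pure R Y n (restrict y {1..n}))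
      = pure R Z n (\<lambda>i. f (restrict x {1..n} i) (restrict y {1..n} i))"
    using vp[OF _ tp_fam_restrict[of n x X]] V[OF tp_fam_restrict[of n y Y] tp_fam_restrict[of n x X]] x y
      pure_closed[OF Y, of n y] by (simp add: pure_restrict)
  also have "\<dots> = pure R Z n (\<lambda>i. f (x i) (y i))" by (rule pure_cong) simp
  finally show "tp_op R Z n f (pure R X n x) (pure R Y n y) = pure R Z n (\<lambda>i. f (x i) (y i))"
    by (simp add: pure_restrict)
qed

text \<open>The product is taken in a fixed order, as \<open>A\<close> may be noncommutative. It is
  used to see that the unit of the tensor power is not zero, as the convention on rings
  requires.\<close>

primrec iprod :: "('a, 'z) ring_scheme \<Rightarrow> (nat \<Rightarrow> 'a) \<Rightarrow> nat \<Rightarrow> 'a" where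
  "iprod A x 0 = \<one>\<^bsub>A\<^esub>"
| "iprod A x (Suc k) = iprod A x k \<otimes>\<^bsub>A\<^esub> x (Suc k)"

lemma (in assoc_algebra) mult_bilin: "bilin R A A A (\<otimes>\<^bsub>A\<^esub>)"
  by (intro bilinI linI) (simp_all add: l_distr r_distr smult_mult_left smult_mult_right)

text \<open>The multiplication map \<open>A\<^bsup>\<otimes>n\<^esup> \<rightarrow> A\<close> is linear even for noncommutative \<open>A\<close>, and sends the unit to the unit.\<close>

lemma (in assoc_algebra) tpow_one_neq_zero: "pure R A n (\<lambda>_. \<one>\<^bsub>A\<^esub>) \<noteq> \<zero>\<^bsub>tpow R A n\<^esub>"
proof -
  have A: "module R A" by (rule module_axioms)
  have cl: "iprod A x k \<in> carrier A" if "k \<le> n" "x \<in> tp_fam A n" for x k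
    using that by (induction k) (auto intro!: m_closed simp: tp_fam_mem)
  have eq: "iprod A (x(i := a)) k = iprod A x k" if "k < i" for x i a k
    using that by (induction k) auto
  \<comment> \<open>The altered entry is either the last factor, where the shorter product is a
    constant, or it lies in the shorter product, where the last factor is one.\<close>
  have ln: "lin R A A (\<lambda>a. iprod A (x(i := a)) k)" if "i \<le> k" "k \<le> n" "x \<in> tp_fam A n" "1 \<le> i" for x i k
    using that
  proof (induction k)
    case (Suc k)
    show ?case
    proof (cases "i = Suc k")
      case True
      have "lin R A A (\<lambda>a. iprod A x k \<otimes>\<^bsub>A\<^esub> a)"
        using Suc.prems by (intro bilin_right[OF mult_bilin] cl) auto
      moreover have "(\<lambda>a. iprod A (x(i := a)) (Suc k)) = (\<lambda>a. iprod A x k \<otimes>\<^bsub>A\<^esub> a)"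
        unfolding iprod.simps using True eq[of k i x] by simp
      ultimately show ?thesis by (simp only:)
    next
      case False
      have "lin R A A (\<lambda>a. iprod A (x(i := a)) k \<otimes>\<^bsub>A\<^esub> x (Suc k))"
        using False Suc.prems tp_fam_mem[of x A n "Suc k"]
        by (intro lin_comp[OF Suc.IH bilin_left[OF mult_bilin]]) auto
      moreover have "(\<lambda>a. iprod A (x(i := a)) (Suc k)) = (\<lambda>a. iprod A (x(i := a)) k \<otimes>\<^bsub>A\<^esub> x (Suc k))"
        unfolding iprod.simps using False by simp
      ultimately show ?thesis by (simp only:)
    qed
  qed simp
  have "multilin R A n A (\<lambda>x. iprod A x n)"
    using cl ln by (auto simp: multilin_def)
  note L = tpow_lift[OF A A this]
  have one: "(\<lambda>i\<in>{1..n}. \<one>\<^bsub>A\<^esub>) \<in> tp_fam A n" by (rule tp_fam_restrict) simp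
  have "iprod A (\<lambda>i\<in>{1..n}. \<one>\<^bsub>A\<^esub>) k = \<one>\<^bsub>A\<^esub>" if "k \<le> n" for k
    using that by (induction k) auto
  then have "lin_ext R A (\<lambda>x. iprod A x n) (pure R A n (\<lambda>_. \<one>\<^bsub>A\<^esub>)) = \<one>\<^bsub>A\<^esub>"
    using L(2)[OF one] by (simp add: pure_restrict)
  then show ?thesis using one_neq_zero lin_zero[OF L(1) tpow_module[OF A] A] by auto
qed

declare atLeastAtMost_iff [simp del]

text \<open>Algebras, bimodules and tensor powers are records of different types over one underlying
  module. Every notion that sees only the module structure is carried across along this
  relation.\<close>

definition same_mod :: "('r, 'x, 'z1) module_scheme \<Rightarrow> ('r, 'x, 'z2) module_scheme \<Rightarrow> bool" where
  "same_mod X Y \<longleftrightarrow> carrier X = carrier Y \<and> zero X = zero Y \<and> add X = add Y \<and> smult X = smult Y"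

lemma same_mod_lin: "same_mod X Y \<Longrightarrow> lin R X Z f \<longleftrightarrow> lin R Y Z f"
  by (simp add: same_mod_def lin_def)

lemma same_mod_lin': "same_mod X Y \<Longrightarrow> lin R Z X f \<longleftrightarrow> lin R Z Y f"
  by (simp add: same_mod_def lin_def)

lemma same_mod_module:
  assumes "same_mod X Y" "module R Y"
  shows "module R X"
proof -
  interpret Y: module R Y by fact
  have *: "carrier X = carrier Y" "zero X = zero Y" "add X = add Y" "smult X = smult Y"
    using assms(1) by (auto simp: same_mod_def)
  have "abelian_group X"
    by (rule abelian_groupI) (use * in \<open>auto simp: Y.M.a_ac intro: Y.M.l_neg Y.M.a_inv_closed\<close>)
  then show ?thesis
    by (intro moduleI Y.R.is_cring) (use * in \<open>auto simp: Y.smult_l_distr Y.smult_r_distr Y.smult_assoc1\<close>)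
qed

lemma same_mod_submodule:
  assumes "same_mod X Y" "module R Y"
  shows "submodule H R X \<longleftrightarrow> submodule H R Y"
proof -
  have X: "module R X" by (rule same_mod_module[OF assms])
  have *: "carrier X = carrier Y" "zero X = zero Y" "add X = add Y" "smult X = smult Y"
    using assms(1) by (auto simp: same_mod_def)
  show ?thesis
    using submoduleI'[OF X, of H] submoduleI'[OF assms(2), of H] *
      submodule_subset[of H R] submodule_zero[of H R] submodule_add[of H R] submodule_smult[of H R]
    by metis
qed

lemma same_mod_mspan: "same_mod X Y \<Longrightarrow> module R Y \<Longrightarrow> mspan R X S = mspan R Y S"
  by (simp add: mspan_def same_mod_submodule)

section \<open>Gradings\<close>

lemma is_grading_submodule: "is_grading R \<Gamma> X \<Longrightarrow> g \<in> carrier \<Gamma> \<Longrightarrow> submodule (gcomp X g) R X"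
  by (simp add: is_grading_def)

lemma is_grading_closed: "is_grading R \<Gamma> X \<Longrightarrow> g \<in> carrier \<Gamma> \<Longrightarrow> x \<in> gcomp X g \<Longrightarrow> x \<in> carrier X"
  by (rule subsetD[OF submodule_subset[OF is_grading_submodule]])

lemma hcomp_decomposition:
  assumes "is_grading R \<Gamma> X" "x \<in> carrier X"
  shows "decomposition \<Gamma> X x (hcomp \<Gamma> X x)"
proof -
  have "\<exists>!f. decomposition \<Gamma> X x f" using assms by (simp add: is_grading_def)
  then show ?thesis unfolding hcomp_def by (rule theI')
qed

lemma hcomp_mem:
  assumes "is_grading R \<Gamma> X" "x \<in> carrier X" "g \<in> carrier \<Gamma>"
  shows "hcomp \<Gamma> X x g \<in> gcomp X g"
proof -
  have "hcomp \<Gamma> X x \<in> (\<Pi>\<^sub>E g\<in>carrier \<Gamma>. gcomp X g)"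
    using hcomp_decomposition[OF assms(1,2)] unfolding decomposition_def by (rule conjunct1)
  then show ?thesis using assms(3) by (rule PiE_mem)
qed

lemma hcomp_closed:
  assumes "is_grading R \<Gamma> X" "x \<in> carrier X" "g \<in> carrier \<Gamma>"
  shows "hcomp \<Gamma> X x g \<in> carrier X"
  by (rule is_grading_closed[OF assms(1,3) hcomp_mem[OF assms]])

lemma hcomp_sum:
  assumes "is_grading R \<Gamma> X" "x \<in> carrier X"
  shows "(\<Oplus>\<^bsub>X\<^esub>g\<in>carrier \<Gamma>. hcomp \<Gamma> X x g) = x"
proof -
  have "x = (\<Oplus>\<^bsub>X\<^esub>g\<in>carrier \<Gamma>. hcomp \<Gamma> X x g)"
    using hcomp_decomposition[OF assms] unfolding decomposition_def by (rule conjunct2)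
  then show ?thesis by (rule sym)
qed

lemma hcomp_eqI:
  assumes "is_grading R \<Gamma> X" "module R X" "\<And>g. g \<in> carrier \<Gamma> \<Longrightarrow> f g \<in> gcomp X g"
    "x = (\<Oplus>\<^bsub>X\<^esub>g\<in>carrier \<Gamma>. f g)" "g \<in> carrier \<Gamma>"
  shows "hcomp \<Gamma> X x g = f g"
proof -
  interpret X: module R X by fact
  have c: "f g \<in> carrier X" if "g \<in> carrier \<Gamma>" for g
    by (rule is_grading_closed[OF assms(1) that assms(3)[OF that]])
  have "x \<in> carrier X" unfolding assms(4) using c by (intro X.M.finsum_closed) auto
  \<comment> \<open>Decompositions are extensional, so the restriction of \<open>f\<close> has to
    take its place.\<close>
  moreover have "decomposition \<Gamma> X x (restrict f (carrier \<Gamma>))"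
    unfolding decomposition_def assms(4) using assms(3) c
    by (auto intro!: X.M.finsum_cong')
  ultimately have "hcomp \<Gamma> X x = restrict f (carrier \<Gamma>)"
    using assms(1) hcomp_decomposition[OF assms(1)] unfolding is_grading_def by blast
  then show ?thesis using assms(5) by simp
qed

text \<open>The componentwise sum of two decompositions, or a multiple of one, is again a
  decomposition, and decompositions are unique.\<close>

lemma hcomp_lin:
  assumes "is_grading R \<Gamma> X" "module R X" "finite (carrier \<Gamma>)" "g \<in> carrier \<Gamma>"
  shows "lin R X X (\<lambda>x. hcomp \<Gamma> X x g)"
proof (rule linI)
  interpret X: module R X by fact
  note c = hcomp_closed[OF assms(1)] and m = hcomp_mem[OF assms(1)]
  note sub = is_grading_submodule[OF assms(1)]
  fix x assume x: "x \<in> carrier X"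
  show "hcomp \<Gamma> X x g \<in> carrier X" by (rule c[OF x assms(4)])
  {
    fix y assume y: "y \<in> carrier X"
    have "x \<oplus>\<^bsub>X\<^esub> y = (\<Oplus>\<^bsub>X\<^esub>g\<in>carrier \<Gamma>. hcomp \<Gamma> X x g \<oplus>\<^bsub>X\<^esub> hcomp \<Gamma> X y g)"
      using x y c hcomp_sum[OF assms(1)] X.M.finsum_addf[of "hcomp \<Gamma> X x" "carrier \<Gamma>" "hcomp \<Gamma> X y"]
      by (simp add: Pi_iff)
    from hcomp_eqI[OF assms(1,2) submodule_add[OF sub m[OF x] m[OF y]] this assms(4)]
    show "hcomp \<Gamma> X (x \<oplus>\<^bsub>X\<^esub> y) g = hcomp \<Gamma> X x g \<oplus>\<^bsub>X\<^esub> hcomp \<Gamma> X y g" by simp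
  }
  fix r assume r: "r \<in> carrier R"
  have "r \<odot>\<^bsub>X\<^esub> x = (\<Oplus>\<^bsub>X\<^esub>g\<in>carrier \<Gamma>. r \<odot>\<^bsub>X\<^esub> hcomp \<Gamma> X x g)"
    using x r c hcomp_sum[OF assms(1) x] X.finsum_smult_ldistr[OF assms(3) r, of "hcomp \<Gamma> X x"]
    by (simp add: Pi_iff)
  from hcomp_eqI[OF assms(1,2) submodule_smult[OF sub r m[OF x]] this assms(4)]
  show "hcomp \<Gamma> X (r \<odot>\<^bsub>X\<^esub> x) g = r \<odot>\<^bsub>X\<^esub> hcomp \<Gamma> X x g" by simp
qed

lemma finsum_delta:
  assumes "module R X" "finite I" "i \<in> I" "x \<in> carrier X" "\<And>j. j \<in> I \<Longrightarrow> f j = (if j = i then x else \<zero>\<^bsub>X\<^esub>)"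
  shows "finsum X f I = x"
proof -
  interpret X: module R X by fact
  have "finsum X f I = (\<Oplus>\<^bsub>X\<^esub>j\<in>I. if i = j then x else \<zero>\<^bsub>X\<^esub>)"
    using assms(4,5) by (intro X.M.finsum_cong') auto
  also have "\<dots> = x" using assms(2-4) X.M.finsum_singleton[of i I "\<lambda>_. x"] by simp
  finally show ?thesis .
qed

lemma hcomp_homogeneous:
  assumes "is_grading R \<Gamma> X" "module R X" "finite (carrier \<Gamma>)" "g \<in> carrier \<Gamma>" "h \<in> carrier \<Gamma>" "x \<in> gcomp X h"
  shows "hcomp \<Gamma> X x g = (if g = h then x else \<zero>\<^bsub>X\<^esub>)"
proof -
  let ?f = "\<lambda>g. if g = h then x else \<zero>\<^bsub>X\<^esub>"
  have "x = (\<Oplus>\<^bsub>X\<^esub>g\<in>carrier \<Gamma>. ?f g)"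
    using finsum_delta[OF assms(2,3,5) is_grading_closed[OF assms(1,5,6)], of ?f] by simp
  moreover have "?f g \<in> gcomp X g" if "g \<in> carrier \<Gamma>" for g
    using submodule_zero[OF is_grading_submodule[OF assms(1) that]] assms(6) by simp
  ultimately show ?thesis using hcomp_eqI[OF assms(1,2), of ?f x g] assms(4) by simp
qed

lemma grading_span:
  assumes "is_grading R \<Gamma> X" "module R X"
  shows "carrier X = mspan R X (\<Union>g\<in>carrier \<Gamma>. gcomp X g)"
proof
  have s: "(\<Union>g\<in>carrier \<Gamma>. gcomp X g) \<subseteq> carrier X" using is_grading_closed[OF assms(1)] by auto
  show "mspan R X (\<Union>g\<in>carrier \<Gamma>. gcomp X g) \<subseteq> carrier X" by (rule mspan_closed[OF assms(2) s])
  show "carrier X \<subseteq> mspan R X (\<Union>g\<in>carrier \<Gamma>. gcomp X g)"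
  proof
    fix x assume x: "x \<in> carrier X"
    have "(\<Oplus>\<^bsub>X\<^esub>g\<in>carrier \<Gamma>. hcomp \<Gamma> X x g) \<in> mspan R X (\<Union>g\<in>carrier \<Gamma>. gcomp X g)"
      using hcomp_mem[OF assms(1) x]
      by (intro submodule_finsum[OF mspan_submodule[OF assms(2) s] assms(2)] mspan_base) blast
    then show "x \<in> mspan R X (\<Union>g\<in>carrier \<Gamma>. gcomp X g)" using hcomp_sum[OF assms(1) x] by simp
  qed
qed

text \<open>Existence: the sums of homogeneous families form a submodule that contains every
  component, hence everything. Uniqueness: the last hypothesis, independence of the components, is
  applied to the difference of two decompositions.\<close>

lemma gradingI:
  assumes "module R X" "finite (carrier \<Gamma>)" "\<And>g. g \<in> carrier \<Gamma> \<Longrightarrow> submodule (gcomp X g) R X"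
    "carrier X \<subseteq> mspan R X (\<Union>g\<in>carrier \<Gamma>. gcomp X g)"
    "\<And>f g. (\<And>g. g \<in> carrier \<Gamma> \<Longrightarrow> f g \<in> gcomp X g) \<Longrightarrow> (\<Oplus>\<^bsub>X\<^esub>g\<in>carrier \<Gamma>. f g) = \<zero>\<^bsub>X\<^esub> \<Longrightarrow>
      g \<in> carrier \<Gamma> \<Longrightarrow> f g = \<zero>\<^bsub>X\<^esub>"
  shows "is_grading R \<Gamma> X"
proof -
  interpret X: module R X by fact
  have sub: "x \<in> carrier X" if "g \<in> carrier \<Gamma>" "x \<in> gcomp X g" for g x
    using submodule_subset[OF assms(3)] that by blast
  let ?H = "{x. \<exists>f. (\<forall>g\<in>carrier \<Gamma>. f g \<in> gcomp X g) \<and> x = (\<Oplus>\<^bsub>X\<^esub>g\<in>carrier \<Gamma>. f g)}"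
  have H: "submodule ?H R X"
  proof (rule submoduleI'[OF assms(1)])
    show "?H \<subseteq> carrier X" using sub by (auto intro!: X.M.finsum_closed)
    show "\<zero>\<^bsub>X\<^esub> \<in> ?H" using submodule_zero[OF assms(3)]
      by (auto intro!: exI[of _ "\<lambda>_. \<zero>\<^bsub>X\<^esub>"])
  next
    fix x y assume "x \<in> ?H" "y \<in> ?H"
    then obtain f f' where f: "\<forall>g\<in>carrier \<Gamma>. f g \<in> gcomp X g" "x = (\<Oplus>\<^bsub>X\<^esub>g\<in>carrier \<Gamma>. f g)"
      "\<forall>g\<in>carrier \<Gamma>. f' g \<in> gcomp X g" "y = (\<Oplus>\<^bsub>X\<^esub>g\<in>carrier \<Gamma>. f' g)" by auto
    then have "x \<oplus>\<^bsub>X\<^esub> y = (\<Oplus>\<^bsub>X\<^esub>g\<in>carrier \<Gamma>. f g \<oplus>\<^bsub>X\<^esub> f' g)"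
      using sub by (subst X.M.finsum_addf) auto
    then show "x \<oplus>\<^bsub>X\<^esub> y \<in> ?H" using f submodule_add[OF assms(3)] by (auto intro!: exI[of _ "\<lambda>g. f g \<oplus>\<^bsub>X\<^esub> f' g"])
  next
    fix r x assume r: "r \<in> carrier R" and "x \<in> ?H"
    then obtain f where f: "\<forall>g\<in>carrier \<Gamma>. f g \<in> gcomp X g" "x = (\<Oplus>\<^bsub>X\<^esub>g\<in>carrier \<Gamma>. f g)" by auto
    then have "r \<odot>\<^bsub>X\<^esub> x = (\<Oplus>\<^bsub>X\<^esub>g\<in>carrier \<Gamma>. r \<odot>\<^bsub>X\<^esub> f g)"
      using sub r assms(2) by (subst X.finsum_smult_ldistr[symmetric]) auto
    then show "r \<odot>\<^bsub>X\<^esub> x \<in> ?H" using f submodule_smult[OF assms(3) r] by (auto intro!: exI[of _ "\<lambda>g. r \<odot>\<^bsub>X\<^esub> f g"])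
  qed
  have "(\<Union>g\<in>carrier \<Gamma>. gcomp X g) \<subseteq> ?H"
  proof
    fix x assume "x \<in> (\<Union>g\<in>carrier \<Gamma>. gcomp X g)"
    then obtain h where h: "h \<in> carrier \<Gamma>" "x \<in> gcomp X h" by auto
    have "(\<Oplus>\<^bsub>X\<^esub>g\<in>carrier \<Gamma>. if g = h then x else \<zero>\<^bsub>X\<^esub>) = x"
      using h sub by (intro finsum_delta[OF assms(1,2) h(1)]) auto
    moreover have "(if g = h then x else \<zero>\<^bsub>X\<^esub>) \<in> gcomp X g" if "g \<in> carrier \<Gamma>" for g
      using h that submodule_zero[OF assms(3)] by auto
    ultimately show "x \<in> ?H" by (intro CollectI exI[of _ "\<lambda>g. if g = h then x else \<zero>\<^bsub>X\<^esub>"]) auto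
  qed
  then have ex: "carrier X \<subseteq> ?H" using mspan_least[OF H] assms(4) by blast
  have "\<exists>!f. decomposition \<Gamma> X x f" if x: "x \<in> carrier X" for x
  proof -
    from x ex obtain f where f: "\<forall>g\<in>carrier \<Gamma>. f g \<in> gcomp X g" "x = (\<Oplus>\<^bsub>X\<^esub>g\<in>carrier \<Gamma>. f g)" by auto
    have "decomposition \<Gamma> X x (restrict f (carrier \<Gamma>))"
      unfolding decomposition_def using f sub by (auto intro!: X.M.finsum_cong')
    moreover have "f = f'" if "decomposition \<Gamma> X x f" "decomposition \<Gamma> X x f'" for f f'
    proof
      fix g
      have m: "f g \<in> gcomp X g" "f' g \<in> gcomp X g" if "g \<in> carrier \<Gamma>" for g
        using that \<open>decomposition \<Gamma> X x f\<close> \<open>decomposition \<Gamma> X x f'\<close> by (auto simp: decomposition_def)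
      have c: "f g \<in> carrier X" "f' g \<in> carrier X" if "g \<in> carrier \<Gamma>" for g
        using m[OF that] sub[OF that] by auto
      show "f g = f' g"
      proof (cases "g \<in> carrier \<Gamma>")
        case True
        \<comment> \<open>The difference of the two decompositions, written with the scalar minus
          one so that the closure properties of submodules apply.\<close>
        let ?d = "\<lambda>g. f g \<oplus>\<^bsub>X\<^esub> (\<ominus>\<^bsub>R\<^esub> \<one>\<^bsub>R\<^esub>) \<odot>\<^bsub>X\<^esub> f' g"
        have "(\<Oplus>\<^bsub>X\<^esub>g\<in>carrier \<Gamma>. ?d g) = (\<Oplus>\<^bsub>X\<^esub>g\<in>carrier \<Gamma>. f g) \<oplus>\<^bsub>X\<^esub> (\<Oplus>\<^bsub>X\<^esub>g\<in>carrier \<Gamma>. (\<ominus>\<^bsub>R\<^esub> \<one>\<^bsub>R\<^esub>) \<odot>\<^bsub>X\<^esub> f' g)"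
          using c by (intro X.M.finsum_addf) auto
        also have "\<dots> = x \<oplus>\<^bsub>X\<^esub> (\<ominus>\<^bsub>R\<^esub> \<one>\<^bsub>R\<^esub>) \<odot>\<^bsub>X\<^esub> x"
          using that c assms(2) X.finsum_smult_ldistr[of "carrier \<Gamma>" "\<ominus>\<^bsub>R\<^esub> \<one>\<^bsub>R\<^esub>" f', symmetric]
          by (simp add: decomposition_def Pi_iff)
        also have "\<dots> = \<zero>\<^bsub>X\<^esub>" using x by (simp add: X.smult_l_minus X.M.r_neg)
        finally have s: "(\<Oplus>\<^bsub>X\<^esub>g\<in>carrier \<Gamma>. ?d g) = \<zero>\<^bsub>X\<^esub>" .
        have "?d g \<in> gcomp X g" if "g \<in> carrier \<Gamma>" for g
          using m[OF that] by (intro submodule_add[OF assms(3)] submodule_smult[OF assms(3)] that) auto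
        from assms(5)[of ?d, OF this s True] have "?d g = \<zero>\<^bsub>X\<^esub>" .
        then show ?thesis using c[OF True]
          by (simp add: X.smult_l_minus) (metis X.M.a_inv_closed X.M.minus_equality X.M.minus_minus)
      next
        case False
        then show ?thesis
          using PiE_arb[OF conjunct1[OF that(1)[unfolded decomposition_def]]]
            PiE_arb[OF conjunct1[OF that(2)[unfolded decomposition_def]]] by simp
      qed
    qed
    ultimately show ?thesis by blast
  qed
  then show ?thesis unfolding is_grading_def using assms(3) by blast
qed

text \<open>Projections witness the independence of the components: applied to a vanishing sum of
  homogeneous elements, \<open>p g\<close> isolates the term of degree \<open>g\<close>.\<close>

lemma gradingI_proj:
  assumes "module R X" "finite (carrier \<Gamma>)" "\<And>g. g \<in> carrier \<Gamma> \<Longrightarrow> submodule (gcomp X g) R X"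
    "carrier X \<subseteq> mspan R X (\<Union>g\<in>carrier \<Gamma>. gcomp X g)"
    "\<And>g. g \<in> carrier \<Gamma> \<Longrightarrow> lin R X X (p g)"
    "\<And>g h x. g \<in> carrier \<Gamma> \<Longrightarrow> h \<in> carrier \<Gamma> \<Longrightarrow> x \<in> gcomp X h \<Longrightarrow> p g x = (if h = g then x else \<zero>\<^bsub>X\<^esub>)"
  shows "is_grading R \<Gamma> X"
proof (rule gradingI[OF assms(1-4)])
  fix f g assume f: "\<And>g. g \<in> carrier \<Gamma> \<Longrightarrow> f g \<in> gcomp X g" "(\<Oplus>\<^bsub>X\<^esub>g\<in>carrier \<Gamma>. f g) = \<zero>\<^bsub>X\<^esub>" and g: "g \<in> carrier \<Gamma>"
  have c: "f h \<in> carrier X" if "h \<in> carrier \<Gamma>" for h using submodule_subset[OF assms(3)[OF that]] f(1)[OF that] by auto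
  have "\<zero>\<^bsub>X\<^esub> = p g (\<Oplus>\<^bsub>X\<^esub>g\<in>carrier \<Gamma>. f g)" using f(2) lin_zero[OF assms(5)[OF g] assms(1,1)] by simp
  also have "\<dots> = (\<Oplus>\<^bsub>X\<^esub>h\<in>carrier \<Gamma>. p g (f h))" by (rule lin_finsum[OF assms(5)[OF g] assms(1,1) c])
  also have "\<dots> = f g" using assms(6)[OF g _ f(1)] by (intro finsum_delta[OF assms(1,2) g c[OF g]]) auto
  finally show "f g = \<zero>\<^bsub>X\<^esub>" ..
qed

section \<open>The wreath product group\<close>

abbreviation perms :: "nat \<Rightarrow> (nat \<Rightarrow> nat) set" where
  "perms n \<equiv> carrier (sym_group n)"

lemma perm_mem: "\<sigma> \<in> perms n \<Longrightarrow> i \<in> {1..n} \<Longrightarrow> \<sigma> i \<in> {1..n}"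
  unfolding sym_group_carrier by (rule iffD2[OF permutes_in_image])

lemma perm_inv_mem: "\<sigma> \<in> perms n \<Longrightarrow> i \<in> {1..n} \<Longrightarrow> inv' \<sigma> i \<in> {1..n}"
  unfolding sym_group_carrier by (rule iffD2[OF permutes_in_image[OF permutes_inv]])

lemma perm_id: "id \<in> perms n"
  by (simp add: sym_group_carrier permutes_id)

lemma perm_comp: "\<sigma> \<in> perms n \<Longrightarrow> \<tau> \<in> perms n \<Longrightarrow> \<sigma> \<circ> \<tau> \<in> perms n"
  by (simp add: sym_group_carrier permutes_compose)

lemma perm_inv: "\<sigma> \<in> perms n \<Longrightarrow> inv' \<sigma> \<in> perms n"
  by (simp add: sym_group_carrier permutes_inv)

lemma perm_inv_o: "\<sigma> \<in> perms n \<Longrightarrow> inv' \<sigma> \<circ> \<sigma> = id"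
  and perm_o_inv: "\<sigma> \<in> perms n \<Longrightarrow> \<sigma> \<circ> inv' \<sigma> = id"
  unfolding sym_group_carrier by (rule permutes_inv_o, assumption)+

lemma perm_inv_comp: "\<sigma> \<in> perms n \<Longrightarrow> \<tau> \<in> perms n \<Longrightarrow> inv' (\<sigma> \<circ> \<tau>) = inv' \<tau> \<circ> inv' \<sigma>"
  unfolding sym_group_carrier by (rule o_inv_distrib[OF permutes_bij permutes_bij])

lemma perm_inv_inv: "\<sigma> \<in> perms n \<Longrightarrow> inv' (inv' \<sigma>) = \<sigma>"
  unfolding sym_group_carrier by (rule permutes_inv_inv)

lemma perm_finite: "finite (perms n)"
  by (simp add: sym_group_def finite_permutations)

lemma perm_inv_apply:
  assumes "\<sigma> \<in> perms n"
  shows "\<sigma> (inv' \<sigma> i) = i" "inv' \<sigma> (\<sigma> i) = i"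
  using permutes_inverses[of \<sigma> "{1..n}"] assms unfolding sym_group_carrier by blast+

lemma wreath_simps:
  "carrier (wreath_group H n) = ({1..n} \<rightarrow>\<^sub>E carrier H) \<times> perms n"
  "one (wreath_group H n) = (\<lambda>i\<in>{1..n}. \<one>\<^bsub>H\<^esub>, id)"
  "(g, \<sigma>) \<otimes>\<^bsub>wreath_group H n\<^esub> (h, \<tau>) = (\<lambda>i\<in>{1..n}. g i \<otimes>\<^bsub>H\<^esub> h (inv' \<sigma> i), \<sigma> \<circ> \<tau>)"
  by (simp_all add: wreath_group_def)

lemma wreath_group_group:
  assumes "group H"
  shows "group (wreath_group H n)"
proof -
  interpret H: group H by fact
  let ?W = "wreath_group H n"
  have e: "restrict x {1..n} = g" if "g \<in> {1..n} \<rightarrow>\<^sub>E carrier H" "\<And>i. i \<in> {1..n} \<Longrightarrow> x i = g i" for x g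
  proof (rule extensionalityI[of _ "{1..n}"])
    show "g \<in> extensional {1..n}" using that(1) by (simp add: PiE_def)
  qed (simp_all add: that(2))
  show ?thesis
  proof (rule groupI)
    fix x y assume xy: "x \<in> carrier ?W" "y \<in> carrier ?W"
    obtain g \<sigma> where [simp]: "x = (g, \<sigma>)" by (cases x) auto
    obtain h \<tau> where [simp]: "y = (h, \<tau>)" by (cases y) auto
    have *: "\<sigma> \<in> perms n" "\<tau> \<in> perms n"
      "\<And>i. i \<in> {1..n} \<Longrightarrow> g i \<in> carrier H" "\<And>i. i \<in> {1..n} \<Longrightarrow> h i \<in> carrier H"
      using xy by (simp_all add: wreath_simps PiE_iff)
    show "x \<otimes>\<^bsub>?W\<^esub> y \<in> carrier ?W"
      using * perm_inv_mem[OF *(1)] perm_comp[OF *(1,2)] by (simp add: wreath_simps restrict_PiE_iff)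
  next
    show "\<one>\<^bsub>?W\<^esub> \<in> carrier ?W" by (simp add: wreath_simps perm_id restrict_PiE_iff)
  next
    fix x y z assume xyz: "x \<in> carrier ?W" "y \<in> carrier ?W" "z \<in> carrier ?W"
    obtain g \<sigma> where [simp]: "x = (g, \<sigma>)" by (cases x) auto
    obtain h \<tau> where [simp]: "y = (h, \<tau>)" by (cases y) auto
    obtain k \<rho> where [simp]: "z = (k, \<rho>)" by (cases z) auto
    have *: "\<sigma> \<in> perms n" "\<tau> \<in> perms n" "\<rho> \<in> perms n"
      "\<And>i. i \<in> {1..n} \<Longrightarrow> g i \<in> carrier H" "\<And>i. i \<in> {1..n} \<Longrightarrow> h i \<in> carrier H" "\<And>i. i \<in> {1..n} \<Longrightarrow> k i \<in> carrier H"
      using xyz by (simp_all add: wreath_simps PiE_iff)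
    have "(\<lambda>i\<in>{1..n}. (\<lambda>i\<in>{1..n}. g i \<otimes>\<^bsub>H\<^esub> h (inv' \<sigma> i)) i \<otimes>\<^bsub>H\<^esub> k (inv' (\<sigma> \<circ> \<tau>) i)) =
      (\<lambda>i\<in>{1..n}. g i \<otimes>\<^bsub>H\<^esub> (\<lambda>i\<in>{1..n}. h i \<otimes>\<^bsub>H\<^esub> k (inv' \<tau> i)) (inv' \<sigma> i))"
      using * perm_inv_mem[OF *(1)] perm_inv_mem[OF *(2)]
      by (intro restrict_ext) (simp add: perm_inv_comp[OF *(1,2)] H.m_assoc del: atLeastAtMost_iff)
    then show "x \<otimes>\<^bsub>?W\<^esub> y \<otimes>\<^bsub>?W\<^esub> z = x \<otimes>\<^bsub>?W\<^esub> (y \<otimes>\<^bsub>?W\<^esub> z)"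
      by (simp add: wreath_simps comp_assoc)
  next
    fix x assume x: "x \<in> carrier ?W"
    obtain g \<sigma> where [simp]: "x = (g, \<sigma>)" by (cases x) auto
    have *: "\<sigma> \<in> perms n" "g \<in> {1..n} \<rightarrow>\<^sub>E carrier H" "\<And>i. i \<in> {1..n} \<Longrightarrow> g i \<in> carrier H"
      using x by (simp_all add: wreath_simps PiE_iff)
    have "(\<lambda>i\<in>{1..n}. (\<lambda>i\<in>{1..n}. \<one>\<^bsub>H\<^esub>) i \<otimes>\<^bsub>H\<^esub> g (inv' id i)) = g"
      using *(3) by (intro e[OF *(2)]) simp
    then show "\<one>\<^bsub>?W\<^esub> \<otimes>\<^bsub>?W\<^esub> x = x" by (simp add: wreath_simps)
    \<comment> \<open>In the product \<open>?y x\<close> the entry \<open>i\<close> of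
      \<open>?y\<close> meets the entry of \<open>g\<close> at
      \<open>inv' (inv' \<sigma>) i\<close>, that is at \<open>\<sigma> i\<close>, and has to cancel
      it.\<close>
    let ?y = "(\<lambda>i\<in>{1..n}. inv\<^bsub>H\<^esub> (g (\<sigma> i)), inv' \<sigma>)"
    have "(\<lambda>i\<in>{1..n}. (\<lambda>i\<in>{1..n}. inv\<^bsub>H\<^esub> (g (\<sigma> i))) i \<otimes>\<^bsub>H\<^esub> g (inv' (inv' \<sigma>) i)) = (\<lambda>i\<in>{1..n}. \<one>\<^bsub>H\<^esub>)"
      using *(3) perm_mem[OF *(1)]
      by (intro restrict_ext) (simp add: perm_inv_inv[OF *(1)] del: atLeastAtMost_iff)
    then have "?y \<otimes>\<^bsub>?W\<^esub> x = \<one>\<^bsub>?W\<^esub>"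
      by (simp add: wreath_simps perm_inv_o[OF *(1)])
    moreover have "?y \<in> carrier ?W" using *(3) perm_mem[OF *(1)] perm_inv[OF *(1)]
      by (simp add: wreath_simps restrict_PiE_iff)
    ultimately show "\<exists>y\<in>carrier ?W. y \<otimes>\<^bsub>?W\<^esub> x = \<one>\<^bsub>?W\<^esub>" by blast
  qed
qed

lemma wreath_group_finite: "finite (carrier H) \<Longrightarrow> finite (carrier (wreath_group H n))"
  by (simp add: wreath_simps finite_PiE perm_finite)

section \<open>Wreath products of modules\<close>

abbreviation wr_pure :: "('r, 'k) ring_scheme \<Rightarrow> ('r, 'x, 'z) module_scheme \<Rightarrow> nat
    \<Rightarrow> (nat \<Rightarrow> 'x) \<Rightarrow> (nat \<Rightarrow> nat) \<Rightarrow> (nat \<Rightarrow> nat) \<Rightarrow> ((nat \<Rightarrow> 'x) \<Rightarrow> 'r) set" where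
  "wr_pure R X n x \<sigma> \<equiv> wr_elem R X n (pure R X n x) \<sigma>"

lemma wr_mod_simps:
  "carrier (wr_mod R X n) = perms n \<rightarrow>\<^sub>E carrier (tpow R X n)"
  "zero (wr_mod R X n) = (\<lambda>\<sigma>\<in>perms n. \<zero>\<^bsub>tpow R X n\<^esub>)"
  "add (wr_mod R X n) = (\<lambda>x y. \<lambda>\<sigma>\<in>perms n. x \<sigma> \<oplus>\<^bsub>tpow R X n\<^esub> y \<sigma>)"
  "smult (wr_mod R X n) = (\<lambda>r x. \<lambda>\<sigma>\<in>perms n. r \<odot>\<^bsub>tpow R X n\<^esub> x \<sigma>)"
  by (simp_all add: wr_mod_def Let_def)

lemma wr_mod_eval_lin: "\<sigma> \<in> perms n \<Longrightarrow> lin R (wr_mod R X n) (tpow R X n) (\<lambda>x. x \<sigma>)"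
  by (rule linI) (auto simp: wr_mod_simps)

lemma pointwise_module:
  assumes Y: "module R Y" and cl: "carrier W \<subseteq> S \<rightarrow>\<^sub>E carrier Y"
    and s: "zero W = (\<lambda>s\<in>S. \<zero>\<^bsub>Y\<^esub>)" "add W = (\<lambda>x y. \<lambda>s\<in>S. x s \<oplus>\<^bsub>Y\<^esub> y s)"
      "smult W = (\<lambda>r x. \<lambda>s\<in>S. r \<odot>\<^bsub>Y\<^esub> x s)"
    and zc: "\<zero>\<^bsub>W\<^esub> \<in> carrier W"
    and ac: "\<And>x y. x \<in> carrier W \<Longrightarrow> y \<in> carrier W \<Longrightarrow> x \<oplus>\<^bsub>W\<^esub> y \<in> carrier W"
    and sc: "\<And>r x. r \<in> carrier R \<Longrightarrow> x \<in> carrier W \<Longrightarrow> r \<odot>\<^bsub>W\<^esub> x \<in> carrier W"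
  shows "module R W"
proof -
  interpret Y: module R Y by (rule Y)
  have c: "x i \<in> carrier Y" if "x \<in> carrier W" "i \<in> S" for x i
    using subsetD[OF cl that(1)] that(2) by (rule PiE_mem)
  have ex: "x = y" if "x \<in> carrier W" "y \<in> carrier W" "\<And>i. i \<in> S \<Longrightarrow> x i = y i" for x y
    by (rule PiE_ext[OF subsetD[OF cl that(1)] subsetD[OF cl that(2)] that(3)])
  have ag: "abelian_group W"
  proof (rule abelian_groupI)
    fix x assume x: "x \<in> carrier W"
    have n: "(\<ominus>\<^bsub>R\<^esub> \<one>\<^bsub>R\<^esub>) \<odot>\<^bsub>W\<^esub> x \<in> carrier W" using sc[OF _ x] by simp
    have "(\<ominus>\<^bsub>R\<^esub> \<one>\<^bsub>R\<^esub>) \<odot>\<^bsub>W\<^esub> x \<oplus>\<^bsub>W\<^esub> x = \<zero>\<^bsub>W\<^esub>"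
      using c[OF x] by (intro ex ac n x zc) (simp add: s Y.smult_l_minus Y.M.l_neg)
    then show "\<exists>y\<in>carrier W. y \<oplus>\<^bsub>W\<^esub> x = \<zero>\<^bsub>W\<^esub>" using n by blast
    show "\<zero>\<^bsub>W\<^esub> \<oplus>\<^bsub>W\<^esub> x = x" by (intro ex ac x zc) (simp add: s c[OF x])
    fix y assume y: "y \<in> carrier W"
    show "x \<oplus>\<^bsub>W\<^esub> y = y \<oplus>\<^bsub>W\<^esub> x"
      by (intro ex ac x y) (simp add: s c[OF x] c[OF y] Y.M.a_ac)
    fix z assume z: "z \<in> carrier W"
    show "x \<oplus>\<^bsub>W\<^esub> y \<oplus>\<^bsub>W\<^esub> z = x \<oplus>\<^bsub>W\<^esub> (y \<oplus>\<^bsub>W\<^esub> z)"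
      by (intro ex ac x y z) (simp add: s c[OF x] c[OF y] c[OF z] Y.M.a_ac)
  qed (blast intro: ac zc)+
  show ?thesis
  proof (rule moduleI[OF Y.R.is_cring ag])
    fix a b x y assume r: "a \<in> carrier R" "b \<in> carrier R" and x: "x \<in> carrier W" and y: "y \<in> carrier W"
    note c = c[OF x] c[OF y]
    show "(a \<oplus>\<^bsub>R\<^esub> b) \<odot>\<^bsub>W\<^esub> x = a \<odot>\<^bsub>W\<^esub> x \<oplus>\<^bsub>W\<^esub> b \<odot>\<^bsub>W\<^esub> x"
      using r c by (intro ex ac sc x) (simp_all add: s Y.smult_l_distr)
    show "a \<odot>\<^bsub>W\<^esub> (x \<oplus>\<^bsub>W\<^esub> y) = a \<odot>\<^bsub>W\<^esub> x \<oplus>\<^bsub>W\<^esub> a \<odot>\<^bsub>W\<^esub> y"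
      using r c by (intro ex ac sc x y) (simp_all add: s Y.smult_r_distr)
    show "(a \<otimes>\<^bsub>R\<^esub> b) \<odot>\<^bsub>W\<^esub> x = a \<odot>\<^bsub>W\<^esub> (b \<odot>\<^bsub>W\<^esub> x)"
      using r c by (intro ex ac sc x y) (simp_all add: s Y.smult_assoc1)
  next
    fix x assume x: "x \<in> carrier W"
    show "\<one>\<^bsub>R\<^esub> \<odot>\<^bsub>W\<^esub> x = x" by (intro ex sc x Y.R.one_closed) (simp add: s c[OF x])
  qed (rule sc)
qed

lemma wr_mod_module:
  assumes "module R X"
  shows "module R (wr_mod R X n)"
proof -
  interpret T: module R "tpow R X n" by (rule tpow_module[OF assms])
  show ?thesis
    by (rule pointwise_module[OF T.module_axioms _ wr_mod_simps(2-4)]) (auto simp: wr_mod_simps)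
qed

lemma wr_linI:
  assumes "\<And>\<rho>. \<rho> \<in> perms n \<Longrightarrow> lin R U (tpow R X n) (\<lambda>u. F u \<rho>)"
  shows "lin R U (wr_mod R X n) (\<lambda>u. \<lambda>\<rho>\<in>perms n. F u \<rho>)"
proof (rule linI)
  note a = assms
  fix u assume u: "u \<in> carrier U"
  show "(\<lambda>\<rho>\<in>perms n. F u \<rho>) \<in> carrier (wr_mod R X n)"
    by (simp add: wr_mod_simps restrict_PiE_iff lin_closed[OF a u])
  {
    fix v assume v: "v \<in> carrier U"
    show "(\<lambda>\<rho>\<in>perms n. F (u \<oplus>\<^bsub>U\<^esub> v) \<rho>) =
      (\<lambda>\<rho>\<in>perms n. F u \<rho>) \<oplus>\<^bsub>wr_mod R X n\<^esub> (\<lambda>\<rho>\<in>perms n. F v \<rho>)"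
      unfolding wr_mod_simps by (rule restrict_ext) (simp add: lin_add[OF a u v])
  }
  fix r assume r: "r \<in> carrier R"
  show "(\<lambda>\<rho>\<in>perms n. F (r \<odot>\<^bsub>U\<^esub> u) \<rho>) =
      r \<odot>\<^bsub>wr_mod R X n\<^esub> (\<lambda>\<rho>\<in>perms n. F u \<rho>)"
    unfolding wr_mod_simps by (rule restrict_ext) (simp add: lin_smult[OF a r u])
qed

lemma wr_elem_lin:
  assumes "module R X"
  shows "lin R (tpow R X n) (wr_mod R X n) (\<lambda>t. wr_elem R X n t \<sigma>)"
  unfolding wr_elem_def
proof (rule wr_linI)
  fix \<tau>
  show "lin R (tpow R X n) (tpow R X n) (\<lambda>t. if \<tau> = \<sigma> then t else \<zero>\<^bsub>tpow R X n\<^esub>)"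
    using lin_ident lin_const_zero[OF tpow_module[OF assms]] by (cases "\<tau> = \<sigma>") simp_all
qed

lemma wr_elem_apply: "\<tau> \<in> perms n \<Longrightarrow> wr_elem R X n t \<sigma> \<tau> = (if \<tau> = \<sigma> then t else \<zero>\<^bsub>tpow R X n\<^esub>)"
  by (simp add: wr_elem_def)

lemma wr_mod_sum:
  assumes "module R X" "x \<in> carrier (wr_mod R X n)"
  shows "x = (\<Oplus>\<^bsub>wr_mod R X n\<^esub>\<sigma>\<in>perms n. wr_elem R X n (x \<sigma>) \<sigma>)" (is "x = ?s")
proof -
  note W = wr_mod_module[OF assms(1)] and T = tpow_module[OF assms(1)]
  interpret W: module R "wr_mod R X n" by (rule W)
  have cl: "x \<sigma> \<in> carrier (tpow R X n)" if "\<sigma> \<in> perms n" for \<sigma>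
    using that assms(2) by (auto simp: wr_mod_simps)
  note c = lin_closed[OF wr_elem_lin[OF assms(1)] cl]
  have s: "?s \<in> carrier (wr_mod R X n)" using c by (intro W.M.finsum_closed) auto
  show ?thesis
  proof (rule PiE_ext[OF assms(2)[unfolded wr_mod_simps] s[unfolded wr_mod_simps]])
    fix \<tau> assume t: "\<tau> \<in> perms n"
    have "?s \<tau> = (\<Oplus>\<^bsub>tpow R X n\<^esub>\<sigma>\<in>perms n. wr_elem R X n (x \<sigma>) \<sigma> \<tau>)"
      by (rule lin_finsum[OF wr_mod_eval_lin[OF t] W T c])
    also have "\<dots> = x \<tau>"
      using t by (intro finsum_delta[OF T perm_finite t cl[OF t]]) (auto simp: wr_elem_apply)
    finally show "x \<tau> = ?s \<tau>" ..
  qed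
qed

text \<open>Decomposing along the permutations first and each coefficient along pure tensors
  afterwards shows that the elements \<open>wr_pure\<close> generate.\<close>

lemma wr_mod_induct:
  assumes "module R X" "submodule H R (wr_mod R X n)"
    "\<And>x \<sigma>. x \<in> tp_fam X n \<Longrightarrow> \<sigma> \<in> perms n \<Longrightarrow> wr_pure R X n x \<sigma> \<in> H"
    "w \<in> carrier (wr_mod R X n)"
  shows "w \<in> H"
proof -
  note W = wr_mod_module[OF assms(1)] and T = tpow_module[OF assms(1)]
  have "wr_elem R X n (w \<sigma>) \<sigma> \<in> H" if s: "\<sigma> \<in> perms n" for \<sigma>
  proof -
    have "w \<sigma> \<in> {t \<in> carrier (tpow R X n). wr_elem R X n t \<sigma> \<in> H}"
      by (rule tpow_induct[OF assms(1) lin_vimage_submodule[OF wr_elem_lin[OF assms(1)] T W assms(2)]])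
        (use s assms(3,4) pure_closed_fam[OF assms(1)] in \<open>auto simp: wr_mod_simps\<close>)
    then show ?thesis by simp
  qed
  then have "(\<Oplus>\<^bsub>wr_mod R X n\<^esub>\<sigma>\<in>perms n. wr_elem R X n (w \<sigma>) \<sigma>) \<in> H"
    by (rule submodule_finsum[OF assms(2) W])
  then show ?thesis using wr_mod_sum[OF assms(1,4)] by simp
qed

lemma wr_mod_eqI:
  assumes "module R X" "module R Y" "lin R (wr_mod R X n) Y f" "lin R (wr_mod R X n) Y g"
    and "\<And>x \<sigma>. x \<in> tp_fam X n \<Longrightarrow> \<sigma> \<in> perms n \<Longrightarrow>
      f (wr_pure R X n x \<sigma>) = g (wr_pure R X n x \<sigma>)"
    and "w \<in> carrier (wr_mod R X n)"
  shows "f w = g w"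
proof -
  let ?E = "{wr_pure R X n x \<sigma> | x \<sigma>. x \<in> tp_fam X n \<and> \<sigma> \<in> perms n}"
  note W = wr_mod_module[OF assms(1)]
  have E: "?E \<subseteq> carrier (wr_mod R X n)"
    using lin_closed[OF wr_elem_lin[OF assms(1)] pure_closed_fam[OF assms(1)]] by auto
  show ?thesis
  proof (rule lin_eqI[OF assms(3,4) W assms(2) E])
    show "w \<in> mspan R (wr_mod R X n) ?E"
      by (rule wr_mod_induct[OF assms(1) mspan_submodule[OF W E] mspan_base assms(6)]) auto
  qed (use assms(5) in auto)
qed

section \<open>Products and actions in the wreath product\<close>

lemma wr_op_bilin:
  assumes X: "module R X" and Y: "module R Y" and Z: "module R Z" and f: "bilin R X Y Z f"
  shows "bilin R (wr_mod R X n) (wr_mod R Y n) (wr_mod R Z n) (wr_op R Y Z n f)"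
proof -
  note b = tp_op(1)[OF X Y Z f, of n]
  note TZ = tpow_module[OF Z]
  have m: "inv' \<sigma> \<circ> \<rho> \<in> perms n" if "\<sigma> \<in> perms n" "\<rho> \<in> perms n" for \<sigma> \<rho>
    using that by (intro perm_comp perm_inv)
  have p: "lin R (tpow R Y n) (tpow R Y n) (tp_perm R Y n \<sigma>)" if "\<sigma> \<in> perms n" for \<sigma>
    using that tp_perm(1)[OF Y] by (simp add: sym_group_carrier)
  show ?thesis
  proof (rule bilinI)
    fix x assume x: "x \<in> carrier (wr_mod R X n)"
    show "lin R (wr_mod R Y n) (wr_mod R Z n) (wr_op R Y Z n f x)"
      unfolding wr_op_def Let_def
    proof (rule wr_linI, rule lin_sum[OF _ TZ wr_mod_module[OF Y]])
      fix \<rho> \<sigma> assume \<rho>: "\<rho> \<in> perms n" and \<sigma>: "\<sigma> \<in> perms n"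
      show "lin R (wr_mod R Y n) (tpow R Z n)
          (\<lambda>y. tp_op R Z n f (x \<sigma>) (tp_perm R Y n \<sigma> (y (inv' \<sigma> \<circ> \<rho>))))"
        by (rule lin_comp[OF lin_comp[OF wr_mod_eval_lin[OF m[OF \<sigma> \<rho>]] p[OF \<sigma>]]
          bilin_right[OF b lin_closed[OF wr_mod_eval_lin[OF \<sigma>] x]]])
    qed
  next
    fix y assume y: "y \<in> carrier (wr_mod R Y n)"
    show "lin R (wr_mod R X n) (wr_mod R Z n) (\<lambda>x. wr_op R Y Z n f x y)"
      unfolding wr_op_def Let_def
    proof (rule wr_linI, rule lin_sum[OF _ TZ wr_mod_module[OF X]])
      fix \<rho> \<sigma> assume \<rho>: "\<rho> \<in> perms n" and \<sigma>: "\<sigma> \<in> perms n"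
      show "lin R (wr_mod R X n) (tpow R Z n)
          (\<lambda>x. tp_op R Z n f (x \<sigma>) (tp_perm R Y n \<sigma> (y (inv' \<sigma> \<circ> \<rho>))))"
        by (rule lin_comp[OF wr_mod_eval_lin[OF \<sigma>]
          bilin_left[OF b lin_closed[OF p[OF \<sigma>] lin_closed[OF wr_mod_eval_lin[OF m[OF \<sigma> \<rho>]] y]]]])
    qed
  qed
qed

text \<open>In the coefficient at \<rho> only the summand at \<sigma> survives, by the first factor;
  by the second factor it survives only if \<open>inv' \<sigma> \<circ> \<rho>\<close> equals
  \<tau>.\<close>

lemma wr_op_elem:
  assumes X: "module R X" and Y: "module R Y" and Z: "module R Z" and f: "bilin R X Y Z f"
    and \<sigma>: "\<sigma> \<in> perms n" and \<tau>: "\<tau> \<in> perms n"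
    and t: "t \<in> carrier (tpow R X n)" and u: "u \<in> carrier (tpow R Y n)"
  shows "wr_op R Y Z n f (wr_elem R X n t \<sigma>) (wr_elem R Y n u \<tau>) =
    wr_elem R Z n (tp_op R Z n f t (tp_perm R Y n \<sigma> u)) (\<sigma> \<circ> \<tau>)"
proof -
  note b = tp_op(1)[OF X Y Z f, of n]
  note TX = tpow_module[OF X] and TY = tpow_module[OF Y] and TZ = tpow_module[OF Z]
  have p: "lin R (tpow R Y n) (tpow R Y n) (tp_perm R Y n \<sigma>)" if "\<sigma> \<in> perms n" for \<sigma>
    using that tp_perm(1)[OF Y] by (simp add: sym_group_carrier)
  have "(\<Oplus>\<^bsub>tpow R Z n\<^esub>\<sigma>'\<in>perms n. tp_op R Z n f (wr_elem R X n t \<sigma> \<sigma>')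
      (tp_perm R Y n \<sigma>' (wr_elem R Y n u \<tau> (inv' \<sigma>' \<circ> \<rho>)))) =
    (if \<rho> = \<sigma> \<circ> \<tau> then tp_op R Z n f t (tp_perm R Y n \<sigma> u) else \<zero>\<^bsub>tpow R Z n\<^esub>)"
    if \<rho>: "\<rho> \<in> perms n" for \<rho>
  proof (rule finsum_delta[OF TZ perm_finite \<sigma>])
    show "(if \<rho> = \<sigma> \<circ> \<tau> then tp_op R Z n f t (tp_perm R Y n \<sigma> u) else \<zero>\<^bsub>tpow R Z n\<^esub>) \<in> carrier (tpow R Z n)"
      using bilin_closed[OF b t lin_closed[OF p[OF \<sigma>] u]] mod_zero_closed[OF TZ] by simp
    fix \<sigma>' assume \<sigma>': "\<sigma>' \<in> perms n"
    have m: "inv' \<sigma>' \<circ> \<rho> \<in> perms n" using \<sigma>' \<rho> by (intro perm_comp perm_inv)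
    have e: "inv' \<sigma> \<circ> \<rho> = \<tau> \<longleftrightarrow> \<rho> = \<sigma> \<circ> \<tau>"
      using perm_inv_o[OF \<sigma>] perm_o_inv[OF \<sigma>] by (metis comp_assoc id_comp)
    have z: "tp_op R Z n f \<zero>\<^bsub>tpow R X n\<^esub> v = \<zero>\<^bsub>tpow R Z n\<^esub>" if "v \<in> carrier (tpow R Y n)" for v
      by (rule lin_zero[OF bilin_left[OF b that] TX TZ])
    have "wr_elem R Y n u \<tau> (inv' \<sigma>' \<circ> \<rho>) \<in> carrier (tpow R Y n)"
      using m u mod_zero_closed[OF TY] by (simp add: wr_elem_apply)
    note z' = z[OF lin_closed[OF p[OF \<sigma>'] this]]
    show "tp_op R Z n f (wr_elem R X n t \<sigma> \<sigma>') (tp_perm R Y n \<sigma>' (wr_elem R Y n u \<tau> (inv' \<sigma>' \<circ> \<rho>))) =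
      (if \<sigma>' = \<sigma> then if \<rho> = \<sigma> \<circ> \<tau> then tp_op R Z n f t (tp_perm R Y n \<sigma> u) else \<zero>\<^bsub>tpow R Z n\<^esub> else \<zero>\<^bsub>tpow R Z n\<^esub>)"
      using m e \<sigma>' z' lin_zero[OF p[OF \<sigma>] TY TY] lin_zero[OF bilin_right[OF b t] TY TZ]
      by (cases "\<sigma>' = \<sigma>") (simp_all add: wr_elem_apply)
  qed
  then show ?thesis unfolding wr_op_def wr_elem_def[of R Z] Let_def by (intro restrict_ext) simp
qed

text \<open>The multiplication rule of the overview on generators. Most later identities in wreath
  products are verified by means of this formula.\<close>

lemma wr_op_pure:
  assumes "module R X" "module R Y" "module R Z" "bilin R X Y Z f"
    "\<sigma> \<in> perms n" "\<tau> \<in> perms n"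
    "\<And>i. i \<in> {1..n} \<Longrightarrow> x i \<in> carrier X" "\<And>i. i \<in> {1..n} \<Longrightarrow> y i \<in> carrier Y"
  shows "wr_op R Y Z n f (wr_pure R X n x \<sigma>) (wr_pure R Y n y \<tau>) =
    wr_pure R Z n (\<lambda>i. f (x i) (y (inv' \<sigma> i))) (\<sigma> \<circ> \<tau>)"
proof -
  note im = perm_inv_mem[OF assms(5)]
  have "tp_perm R Y n \<sigma> (pure R Y n y) = pure R Y n (\<lambda>i. y (inv' \<sigma> i))"
    using assms(5) by (intro tp_perm(2)[OF assms(2)] assms(8)) (simp add: sym_group_carrier)
  moreover have "tp_op R Z n f (pure R X n x) (pure R Y n (\<lambda>i. y (inv' \<sigma> i))) = pure R Z n (\<lambda>i. f (x i) (y (inv' \<sigma> i)))"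
    by (intro tp_op(2)[OF assms(1-4)] assms(7,8) im)
  ultimately show ?thesis
    using wr_op_elem[OF assms(1-6) pure_closed[OF assms(1,7)] pure_closed[OF assms(2,8)]] by simp
qed

lemma wr_mod_eqI2:
  assumes X: "module R X" and Y: "module R Y" and Z: "module R Z"
    and F: "bilin R (wr_mod R X n) (wr_mod R Y n) Z F" and G: "bilin R (wr_mod R X n) (wr_mod R Y n) Z G"
    and e: "\<And>x y \<sigma> \<tau>. x \<in> tp_fam X n \<Longrightarrow> y \<in> tp_fam Y n \<Longrightarrow> \<sigma> \<in> perms n \<Longrightarrow> \<tau> \<in> perms n \<Longrightarrow>
      F (wr_pure R X n x \<sigma>) (wr_pure R Y n y \<tau>) =
      G (wr_pure R X n x \<sigma>) (wr_pure R Y n y \<tau>)"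
    and v: "v \<in> carrier (wr_mod R X n)" and w: "w \<in> carrier (wr_mod R Y n)"
  shows "F v w = G v w"
proof (rule wr_mod_eqI[OF X Z bilin_left[OF F w] bilin_left[OF G w] _ v])
  fix x \<sigma> assume x: "x \<in> tp_fam X n" "\<sigma> \<in> perms n"
  have c: "wr_pure R X n x \<sigma> \<in> carrier (wr_mod R X n)"
    by (rule lin_closed[OF wr_elem_lin[OF X] pure_closed_fam[OF X x(1)]])
  show "F (wr_pure R X n x \<sigma>) w = G (wr_pure R X n x \<sigma>) w"
    by (rule wr_mod_eqI[OF Y Z bilin_right[OF F c] bilin_right[OF G c] e[OF x(1) _ x(2)] w])
qed

text \<open>Stated for six modules, so that one proof yields the associativity of the algebra, the
  module laws on both sides and the commutation of the two actions. On generators both bracketings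
  take the third factor from the same place, because the inverse of
  \<open>\<sigma> \<circ> \<tau>\<close> is
  \<open>inv' \<tau> \<circ> inv' \<sigma>\<close>.\<close>

lemma wr_op_assoc:
  assumes X: "module R X" and Y: "module R Y" and Z: "module R Z" and U: "module R U" and V: "module R V" and W: "module R W"
    and f: "bilin R X Y U f" and g: "bilin R U Z W g" and h: "bilin R Y Z V h" and k: "bilin R X V W k"
    and e: "\<And>x y z. x \<in> carrier X \<Longrightarrow> y \<in> carrier Y \<Longrightarrow> z \<in> carrier Z \<Longrightarrow> g (f x y) z = k x (h y z)"
    and x: "x \<in> carrier (wr_mod R X n)" and y: "y \<in> carrier (wr_mod R Y n)" and z: "z \<in> carrier (wr_mod R Z n)"
  shows "wr_op R Z W n g (wr_op R Y U n f x y) z = wr_op R V W n k x (wr_op R Z V n h y z)"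
proof (rule wr_mod_eqI[OF Z wr_mod_module[OF W] _ _ _ z])
  note f' = wr_op_bilin[OF X Y U f, of n] and g' = wr_op_bilin[OF U Z W g, of n]
  note h' = wr_op_bilin[OF Y Z V h, of n] and k' = wr_op_bilin[OF X V W k, of n]
  show "lin R (wr_mod R Z n) (wr_mod R W n) (wr_op R Z W n g (wr_op R Y U n f x y))"
    by (rule bilin_right[OF g' bilin_closed[OF f' x y]])
  show "lin R (wr_mod R Z n) (wr_mod R W n) (\<lambda>z. wr_op R V W n k x (wr_op R Z V n h y z))"
    by (rule lin_comp[OF bilin_right[OF h' y] bilin_right[OF k' x]])
  fix z \<rho> assume z: "z \<in> tp_fam Z n" "\<rho> \<in> perms n"
  let ?z = "wr_pure R Z n z \<rho>"
  have c: "?z \<in> carrier (wr_mod R Z n)"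
    by (rule lin_closed[OF wr_elem_lin[OF Z] pure_closed_fam[OF Z z(1)]])
  show "wr_op R Z W n g (wr_op R Y U n f x y) ?z = wr_op R V W n k x (wr_op R Z V n h y ?z)"
  proof (rule wr_mod_eqI2[OF X Y wr_mod_module[OF W] _ _ _ x y])
    show "bilin R (wr_mod R X n) (wr_mod R Y n) (wr_mod R W n) (\<lambda>x y. wr_op R Z W n g (wr_op R Y U n f x y) ?z)"
      by (intro bilinI lin_comp[OF _ bilin_left[OF g' c]] bilin_right[OF f'] bilin_left[OF f'])
    show "bilin R (wr_mod R X n) (wr_mod R Y n) (wr_mod R W n) (\<lambda>x y. wr_op R V W n k x (wr_op R Z V n h y ?z))"
      by (intro bilinI lin_comp[OF bilin_left[OF h' c]] bilin_right[OF k'] bilin_left[OF k'] bilin_closed[OF h' _ c])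
    fix x y \<sigma> \<tau> assume x: "x \<in> tp_fam X n" and y: "y \<in> tp_fam Y n"
      and \<sigma>: "\<sigma> \<in> perms n" and \<tau>: "\<tau> \<in> perms n"
    note xm = tp_fam_mem[OF x] and ym = tp_fam_mem[OF y] and zm = tp_fam_mem[OF z(1)]
    note im = perm_inv_mem[OF \<sigma>] perm_inv_mem[OF \<tau>]
    have "wr_op R Z W n g (wr_op R Y U n f (wr_pure R X n x \<sigma>) (wr_pure R Y n y \<tau>)) ?z =
      wr_pure R W n (\<lambda>i. g (f (x i) (y (inv' \<sigma> i))) (z (inv' (\<sigma> \<circ> \<tau>) i))) (\<sigma> \<circ> \<tau> \<circ> \<rho>)"
      using xm ym zm im by (simp add: wr_op_pure[OF X Y U f \<sigma> \<tau>] bilin_closed[OF f]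
        wr_op_pure[OF U Z W g perm_comp[OF \<sigma> \<tau>] z(2)])
    also have "\<dots> = wr_pure R W n (\<lambda>i. k (x i) (h (y (inv' \<sigma> i)) (z (inv' \<tau> (inv' \<sigma> i))))) (\<sigma> \<circ> (\<tau> \<circ> \<rho>))"
      using xm ym zm im e by (intro arg_cong2[where f="wr_elem R W n"] pure_cong)
        (simp_all add: perm_inv_comp[OF \<sigma> \<tau>] comp_assoc)
    also have "\<dots> = wr_op R V W n k (wr_pure R X n x \<sigma>)
        (wr_op R Z V n h (wr_pure R Y n y \<tau>) ?z)"
      using xm ym zm im by (simp add: wr_op_pure[OF Y Z V h \<tau> z(2)] bilin_closed[OF h]
        wr_op_pure[OF X V W k \<sigma> perm_comp[OF \<tau> z(2)]])
    finally show "wr_op R Z W n g (wr_op R Y U n f (wr_pure R X n x \<sigma>) (wr_pure R Y n y \<tau>)) ?z =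
      wr_op R V W n k (wr_pure R X n x \<sigma>) (wr_op R Z V n h (wr_pure R Y n y \<tau>) ?z)" .
  qed
qed

section \<open>Bilinear maps on spans\<close>

lemma bilin_mspan:
  assumes "bilin R X Y Z f" "module R X" "module R Y" "module R Z" "S \<subseteq> carrier X" "T \<subseteq> carrier Y" "submodule H R Z"
    "\<And>s t. s \<in> S \<Longrightarrow> t \<in> T \<Longrightarrow> f s t \<in> H" "x \<in> mspan R X S" "y \<in> mspan R Y T"
  shows "f x y \<in> H"
proof -
  have y: "y \<in> carrier Y" using mspan_closed[OF assms(3,6)] assms(10) by blast
  have "f s y \<in> H" if s: "s \<in> S" for s
  proof -
    have "s \<in> carrier X" using s assms(5) by blast
    from lin_mspan[OF bilin_right[OF assms(1) this] assms(3,4,7,6) assms(8)[OF s] assms(10)] show ?thesis .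
  qed
  from lin_mspan[OF bilin_left[OF assms(1) y] assms(2,4,7,5) this assms(9)] show ?thesis .
qed

lemma bilin_eqI:
  assumes "bilin R X Y Z f" "bilin R X Y Z g" "module R X" "module R Y" "module R Z" "S \<subseteq> carrier X" "T \<subseteq> carrier Y"
    "\<And>s t. s \<in> S \<Longrightarrow> t \<in> T \<Longrightarrow> f s t = g s t" "x \<in> mspan R X S" "y \<in> mspan R Y T"
  shows "f x y = g x y"
proof -
  have y: "y \<in> carrier Y" using mspan_closed[OF assms(4,7)] assms(10) by blast
  have "f s y = g s y" if s: "s \<in> S" for s
  proof -
    have "s \<in> carrier X" using s assms(6) by blast
    from lin_eqI[OF bilin_right[OF assms(1) this] bilin_right[OF assms(2) this] assms(4,5,7) assms(8)[OF s] assms(10)]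
    show ?thesis .
  qed
  from lin_eqI[OF bilin_left[OF assms(1) y] bilin_left[OF assms(2) y] assms(3,5,6) this assms(9)] show ?thesis .
qed

lemma same_mod_bilin:
  assumes "same_mod X X'" "same_mod Y Y'" "same_mod Z Z'"
  shows "bilin R X Y Z f \<longleftrightarrow> bilin R X' Y' Z' f"
  using assms by (simp add: bilin_def lin_def same_mod_def)

section \<open>Gradings of tensor powers and wreath products\<close>

lemma tp_comp_gens_closed:
  assumes "module R X" "is_grading R H X" "g \<in> {1..n} \<rightarrow>\<^sub>E carrier H"
  shows "{pure R X n x | x. x \<in> (\<Pi>\<^sub>E i\<in>{1..n}. gcomp X (g i))} \<subseteq> carrier (tpow R X n)"
proof (rule subsetI, elim CollectE exE conjE)
  fix t x assume x: "t = pure R X n x" "x \<in> (\<Pi>\<^sub>E i\<in>{1..n}. gcomp X (g i))"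
  have "x i \<in> carrier X" if "i \<in> {1..n}" for i
    by (rule is_grading_closed[OF assms(2) PiE_mem[OF assms(3) that] PiE_mem[OF x(2) that]])
  then show "t \<in> carrier (tpow R X n)" unfolding x(1) by (rule pure_closed[OF assms(1)])
qed

lemma tp_comp_submodule:
  assumes "module R X" "is_grading R H X" "g \<in> {1..n} \<rightarrow>\<^sub>E carrier H"
  shows "submodule (tp_comp R X n g) R (tpow R X n)"
  unfolding tp_comp_def by (rule mspan_submodule[OF tpow_module[OF assms(1)] tp_comp_gens_closed[OF assms]])

lemma tp_comp_closed:
  assumes "module R X" "is_grading R H X" "g \<in> {1..n} \<rightarrow>\<^sub>E carrier H" "t \<in> tp_comp R X n g"
  shows "t \<in> carrier (tpow R X n)"
  using submodule_subset[OF tp_comp_submodule[OF assms(1-3)]] assms(4) by blast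

lemma pure_in_tp_comp:
  assumes "\<And>i. i \<in> {1..n} \<Longrightarrow> x i \<in> gcomp X (g i)"
  shows "pure R X n x \<in> tp_comp R X n g"
proof -
  have "restrict x {1..n} \<in> (\<Pi>\<^sub>E i\<in>{1..n}. gcomp X (g i))" using assms by (simp add: restrict_PiE_iff)
  then have "pure R X n (restrict x {1..n}) \<in> tp_comp R X n g"
    unfolding tp_comp_def by (intro mspan_base) blast
  then show ?thesis by (simp add: pure_restrict)
qed

lemma tp_comp_lin_mem:
  assumes "module R X" "is_grading R H X" "g \<in> {1..n} \<rightarrow>\<^sub>E carrier H" "lin R (tpow R X n) Y f" "module R Y"
    "submodule K R Y" "\<And>x. (\<And>i. i \<in> {1..n} \<Longrightarrow> x i \<in> gcomp X (g i)) \<Longrightarrow> f (pure R X n x) \<in> K" "t \<in> tp_comp R X n g"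
  shows "f t \<in> K"
proof (rule lin_mspan[OF assms(4) tpow_module[OF assms(1)] assms(5,6) tp_comp_gens_closed[OF assms(1-3)]])
  show "t \<in> mspan R (tpow R X n) {pure R X n x |x. x \<in> (\<Pi>\<^sub>E i\<in>{1..n}. gcomp X (g i))}"
    using assms(8) by (simp only: tp_comp_def)
  fix s assume "s \<in> {pure R X n x |x. x \<in> (\<Pi>\<^sub>E i\<in>{1..n}. gcomp X (g i))}"
  then obtain x where x: "s = pure R X n x" "x \<in> (\<Pi>\<^sub>E i\<in>{1..n}. gcomp X (g i))" by blast
  show "f s \<in> K" unfolding x(1) by (rule assms(7)[OF PiE_mem[OF x(2)]])
qed

lemma tp_comp_lin_eq:
  assumes "module R X" "is_grading R H X" "g \<in> {1..n} \<rightarrow>\<^sub>E carrier H" "lin R (tpow R X n) Y f" "lin R (tpow R X n) Y f'" "module R Y"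
    "\<And>x. (\<And>i. i \<in> {1..n} \<Longrightarrow> x i \<in> gcomp X (g i)) \<Longrightarrow> f (pure R X n x) = f' (pure R X n x)" "t \<in> tp_comp R X n g"
  shows "f t = f' t"
proof (rule lin_eqI[OF assms(4,5) tpow_module[OF assms(1)] assms(6) tp_comp_gens_closed[OF assms(1-3)]])
  show "t \<in> mspan R (tpow R X n) {pure R X n x |x. x \<in> (\<Pi>\<^sub>E i\<in>{1..n}. gcomp X (g i))}"
    using assms(8) by (simp only: tp_comp_def)
  fix s assume "s \<in> {pure R X n x |x. x \<in> (\<Pi>\<^sub>E i\<in>{1..n}. gcomp X (g i))}"
  then obtain x where x: "s = pure R X n x" "x \<in> (\<Pi>\<^sub>E i\<in>{1..n}. gcomp X (g i))" by blast
  show "f s = f' s" unfolding x(1) by (rule assms(7)[OF PiE_mem[OF x(2)]])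
qed

text \<open>Intended as the projection onto the component \<open>tp_comp R X n g\<close>, to be used
  with \<open>gradingI_proj\<close>.\<close>

definition tp_proj :: "('r, 'k) ring_scheme \<Rightarrow> ('g, 'l) monoid_scheme \<Rightarrow> ('r, 'x, 'g, 'z) graded_scheme \<Rightarrow> nat
    \<Rightarrow> (nat \<Rightarrow> 'g) \<Rightarrow> ((nat \<Rightarrow> 'x) \<Rightarrow> 'r) set \<Rightarrow> ((nat \<Rightarrow> 'x) \<Rightarrow> 'r) set" where
  "tp_proj R H X n g = tp_map R X n (\<lambda>x i. hcomp H X (x i) (g i))"

lemma pure_zero:
  assumes "module R X" "\<And>i. i \<in> {1..n} \<Longrightarrow> x i \<in> carrier X" "k \<in> {1..n}" "x k = \<zero>\<^bsub>X\<^esub>"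
  shows "pure R X n x = \<zero>\<^bsub>tpow R X n\<^esub>"
proof -
  have "pure R X n (x(k := \<zero>\<^bsub>X\<^esub>)) = \<zero>\<^bsub>tpow R X n\<^esub>"
    by (rule lin_zero[OF pure_lin[OF assms(1-3)] assms(1) tpow_module[OF assms(1)]])
  moreover have "x(k := \<zero>\<^bsub>X\<^esub>) = x" using assms(4) by (simp add: fun_upd_idem)
  ultimately show ?thesis by simp
qed

text \<open>If \<open>h\<close> and \<open>g\<close> differ, they differ at some place, and there
  the factor of degree \<open>h k\<close> is projected to zero. A pure tensor with a zero factor
  vanishes.\<close>

lemma tp_proj:
  assumes "module R X" "is_grading R H X" "finite (carrier H)" "g \<in> {1..n} \<rightarrow>\<^sub>E carrier H"
  shows "lin R (tpow R X n) (tpow R X n) (tp_proj R H X n g)"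
    and "h \<in> {1..n} \<rightarrow>\<^sub>E carrier H \<Longrightarrow> t \<in> tp_comp R X n h \<Longrightarrow>
      tp_proj R H X n g t = (if h = g then t else \<zero>\<^bsub>tpow R X n\<^esub>)"
proof -
  note L = hcomp_lin[OF assms(2,1,3) PiE_mem[OF assms(4)]] and T = tpow_module[OF assms(1)]
  show l: "lin R (tpow R X n) (tpow R X n) (tp_proj R H X n g)"
    unfolding tp_proj_def by (rule tp_map_id(1)[OF assms(1,1) L])
  assume h: "h \<in> {1..n} \<rightarrow>\<^sub>E carrier H" and t: "t \<in> tp_comp R X n h"
  have l': "lin R (tpow R X n) (tpow R X n) (\<lambda>t. if h = g then t else \<zero>\<^bsub>tpow R X n\<^esub>)"
    using lin_ident lin_const_zero[OF T] by (cases "h = g") simp_all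
  show "tp_proj R H X n g t = (if h = g then t else \<zero>\<^bsub>tpow R X n\<^esub>)"
  proof (rule tp_comp_lin_eq[OF assms(1,2) h l l' T _ t])
    fix x assume x: "\<And>i. i \<in> {1..n} \<Longrightarrow> x i \<in> gcomp X (h i)"
    have xc: "x i \<in> carrier X" if "i \<in> {1..n}" for i
      by (rule is_grading_closed[OF assms(2) PiE_mem[OF h that] x[OF that]])
    have hc: "hcomp H X (x i) (g i) = (if g i = h i then x i else \<zero>\<^bsub>X\<^esub>)" if "i \<in> {1..n}" for i
      by (rule hcomp_homogeneous[OF assms(2,1,3) PiE_mem[OF assms(4) that] PiE_mem[OF h that] x[OF that]])
    have "tp_proj R H X n g (pure R X n x) = pure R X n (\<lambda>i. hcomp H X (x i) (g i))"
      unfolding tp_proj_def by (rule tp_map_id(2)[OF assms(1,1) L xc])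
    also have "\<dots> = (if h = g then pure R X n x else \<zero>\<^bsub>tpow R X n\<^esub>)"
    proof (cases "h = g")
      case True
      then show ?thesis using hc by (simp add: True cong: pure_cong)
    next
      case False
      then obtain k where k: "k \<in> {1..n}" "h k \<noteq> g k" using PiE_ext[OF h assms(4)] by blast
      have "pure R X n (\<lambda>i. hcomp H X (x i) (g i)) = \<zero>\<^bsub>tpow R X n\<^esub>"
        by (rule pure_zero[OF assms(1) lin_closed[OF L xc] k(1)]) (use hc[OF k(1)] k(2) in simp_all)
      then show ?thesis using False by simp
    qed
    finally show "tp_proj R H X n g (pure R X n x) = (if h = g then pure R X n x else \<zero>\<^bsub>tpow R X n\<^esub>)" .
  qed
qed

text \<open>Each factor is a sum of homogeneous elements, so by \<open>multilin_span\<close> pure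
  tensors with homogeneous factors suffice, and choosing a degree for each factor places such a
  tensor in a component.\<close>

lemma tp_comp_span:
  assumes "module R X" "is_grading R H X" "submodule K R (tpow R X n)"
    "\<And>g. g \<in> {1..n} \<rightarrow>\<^sub>E carrier H \<Longrightarrow> tp_comp R X n g \<subseteq> K" "t \<in> carrier (tpow R X n)"
  shows "t \<in> K"
proof (rule tpow_induct[OF assms(1,3) _ assms(5)])
  fix x assume x: "x \<in> tp_fam X n"
  show "pure R X n x \<in> K"
  proof (rule multilin_span[OF assms(1) tpow_module[OF assms(1)] pure_multilin[OF assms(1)] assms(3) _ _ x])
    show "(\<Union>g\<in>carrier H. gcomp X g) \<subseteq> carrier X" using is_grading_closed[OF assms(2)] by blast
    show "x i \<in> mspan R X (\<Union>g\<in>carrier H. gcomp X g)" if "i \<in> {1..n}" for i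
      using tp_fam_mem[OF x that] grading_span[OF assms(2,1)] by simp
    fix y assume y: "y \<in> {1..n} \<rightarrow>\<^sub>E (\<Union>g\<in>carrier H. gcomp X g)"
    have "\<forall>i\<in>{1..n}. \<exists>g. g \<in> carrier H \<and> y i \<in> gcomp X g" using PiE_mem[OF y] by blast
    from bchoice[OF this] obtain g where g: "\<forall>i\<in>{1..n}. g i \<in> carrier H \<and> y i \<in> gcomp X (g i)" by blast
    have "pure R X n y \<in> tp_comp R X n (restrict g {1..n})" using g by (intro pure_in_tp_comp) simp
    moreover have "restrict g {1..n} \<in> {1..n} \<rightarrow>\<^sub>E carrier H" using g by (simp add: restrict_PiE_iff)
    ultimately show "pure R X n y \<in> K" using assms(4) by blast
  qed
qed

lemma tpow_grading:
  assumes "module R X" "is_grading R H X" "finite (carrier H)" "same_mod T (tpow R X n)"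
    "\<And>g \<sigma>. gcomp T (g, \<sigma>) = (if \<sigma> = id then tp_comp R X n g else {\<zero>\<^bsub>tpow R X n\<^esub>})"
  shows "is_grading R (wreath_group H n) T"
proof -
  note TM = tpow_module[OF assms(1)]
  note T = same_mod_module[OF assms(4) TM]
  have z: "zero T = zero (tpow R X n)" and c: "carrier T = carrier (tpow R X n)" using assms(4) by (auto simp: same_mod_def)
  have car: "\<gamma> \<in> carrier (wreath_group H n) \<Longrightarrow> \<exists>g \<sigma>. \<gamma> = (g, \<sigma>) \<and> g \<in> {1..n} \<rightarrow>\<^sub>E carrier H" for \<gamma>
    by (cases \<gamma>) (simp add: wreath_simps)
  have sub: "submodule (gcomp T \<gamma>) R T" if "\<gamma> \<in> carrier (wreath_group H n)" for \<gamma>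
    using car[OF that] tp_comp_submodule[OF assms(1,2)] zero_submodule[OF TM]
    by (auto simp: assms(5) same_mod_submodule[OF assms(4) TM])
  \<comment> \<open>Outside the base group the components are zero, so the projections there are
    zero maps.\<close>
  define p where "p = (\<lambda>(g, \<sigma>). if \<sigma> = (id :: nat \<Rightarrow> nat) then tp_proj R H X n g else (\<lambda>t. \<zero>\<^bsub>T\<^esub>))"
  show ?thesis
  proof (rule gradingI_proj[OF T wreath_group_finite[OF assms(3)] sub])
    show "carrier T \<subseteq> mspan R T (\<Union>g\<in>carrier (wreath_group H n). gcomp T g)"
    proof
      fix t assume t: "t \<in> carrier T"
      have s: "(\<Union>g\<in>carrier (wreath_group H n). gcomp T g) \<subseteq> carrier T" using submodule_subset[OF sub] by blast
      show "t \<in> mspan R T (\<Union>g\<in>carrier (wreath_group H n). gcomp T g)"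
      proof (rule tp_comp_span[OF assms(1,2)])
        show "submodule (mspan R T (\<Union>g\<in>carrier (wreath_group H n). gcomp T g)) R (tpow R X n)"
          using mspan_submodule[OF T s] by (simp add: same_mod_submodule[OF assms(4) TM])
        fix g assume g: "g \<in> {1..n} \<rightarrow>\<^sub>E carrier H"
        have "(g, id) \<in> carrier (wreath_group H n)" using g by (simp add: wreath_simps perm_id)
        moreover have "gcomp T (g, id) = tp_comp R X n g" by (simp add: assms(5))
        ultimately have "tp_comp R X n g \<subseteq> (\<Union>g\<in>carrier (wreath_group H n). gcomp T g)" by blast
        then show "tp_comp R X n g \<subseteq> mspan R T (\<Union>g\<in>carrier (wreath_group H n). gcomp T g)"
          by (rule subset_trans[OF _ mspan_incl])
      qed (use t c in simp)
    qed
  next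
    fix \<gamma> assume g: "\<gamma> \<in> carrier (wreath_group H n)"
    obtain g \<sigma> where \<gamma>: "\<gamma> = (g, \<sigma>)" "g \<in> {1..n} \<rightarrow>\<^sub>E carrier H" using car[OF g] by blast
    show "lin R T T (p \<gamma>)"
      using tp_proj(1)[OF assms(1-3) \<gamma>(2)] lin_const_zero[OF T, of T]
      by (simp add: p_def \<gamma>(1) same_mod_lin[OF assms(4)] same_mod_lin'[OF assms(4)])
    fix \<eta> x assume h: "\<eta> \<in> carrier (wreath_group H n)" and x: "x \<in> gcomp T \<eta>"
    obtain h \<tau> where \<eta>: "\<eta> = (h, \<tau>)" "h \<in> {1..n} \<rightarrow>\<^sub>E carrier H" using car[OF h] by blast
    show "p \<gamma> x = (if \<eta> = \<gamma> then x else \<zero>\<^bsub>T\<^esub>)"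
      using x tp_proj(2)[OF assms(1-3) \<gamma>(2) \<eta>(2)] lin_zero[OF tp_proj(1)[OF assms(1-3) \<gamma>(2)] TM TM]
      by (cases "\<tau> = id") (auto simp: p_def \<gamma>(1) \<eta>(1) assms(5) z split: if_splits)
  qed
qed

text \<open>Different permutations are separated by evaluation, since the wreath product is free
  over them; for one permutation the components are separated by the projections of the tensor
  power.\<close>

lemma wr_grading:
  assumes "module R X" "is_grading R H X" "finite (carrier H)" "same_mod W (wr_mod R X n)" "gcomp W = wr_comp R X n"
  shows "is_grading R (wreath_group H n) W"
proof -
  note WM = wr_mod_module[OF assms(1)] and TM = tpow_module[OF assms(1)]
  note W = same_mod_module[OF assms(4) WM]
  have z: "zero W = zero (wr_mod R X n)" and c: "carrier W = carrier (wr_mod R X n)" using assms(4) by (auto simp: same_mod_def)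
  have car: "\<gamma> \<in> carrier (wreath_group H n) \<Longrightarrow>
      \<exists>g \<sigma>. \<gamma> = (g, \<sigma>) \<and> g \<in> {1..n} \<rightarrow>\<^sub>E carrier H \<and> \<sigma> \<in> perms n" for \<gamma>
    by (cases \<gamma>) (simp add: wreath_simps)
  have gc: "gcomp W (g, \<sigma>) = (\<lambda>t. wr_elem R X n t \<sigma>) ` tp_comp R X n g" for g \<sigma>
    by (simp add: assms(5) wr_comp_def)
  note el = wr_elem_lin[OF assms(1)]
  have sub: "submodule (gcomp W \<gamma>) R W" if c: "\<gamma> \<in> carrier (wreath_group H n)" for \<gamma>
  proof -
    obtain g \<sigma> where \<gamma>: "\<gamma> = (g, \<sigma>)" "g \<in> {1..n} \<rightarrow>\<^sub>E carrier H" using car[OF c] by blast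
    show ?thesis unfolding \<gamma>(1) gc same_mod_submodule[OF assms(4) WM]
      by (rule lin_image_submodule[OF el TM WM tp_comp_submodule[OF assms(1,2) \<gamma>(2)]])
  qed
  define p where "p = (\<lambda>(g, \<sigma>) x. wr_elem R X n (tp_proj R H X n g (x \<sigma>)) \<sigma>)"
  show ?thesis
  proof (rule gradingI_proj[OF W wreath_group_finite[OF assms(3)] sub])
    let ?K = "mspan R W (\<Union>g\<in>carrier (wreath_group H n). gcomp W g)"
    have s: "(\<Union>g\<in>carrier (wreath_group H n). gcomp W g) \<subseteq> carrier W" using submodule_subset[OF sub] by blast
    have K: "submodule ?K R (wr_mod R X n)"
      using mspan_submodule[OF W s] by (simp add: same_mod_submodule[OF assms(4) WM])
    show "carrier W \<subseteq> ?K"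
    proof
      fix w assume w: "w \<in> carrier W"
      show "w \<in> ?K"
      proof (rule wr_mod_induct[OF assms(1) K])
        show "w \<in> carrier (wr_mod R X n)" using w c by simp
        fix x \<sigma> assume x: "x \<in> tp_fam X n" and \<sigma>: "\<sigma> \<in> perms n"
        have "pure R X n x \<in> {t \<in> carrier (tpow R X n). wr_elem R X n t \<sigma> \<in> ?K}"
        proof (rule tp_comp_span[OF assms(1,2) lin_vimage_submodule[OF el TM WM K] _ pure_closed_fam[OF assms(1) x]])
          fix g assume g: "g \<in> {1..n} \<rightarrow>\<^sub>E carrier H"
          have "(g, \<sigma>) \<in> carrier (wreath_group H n)" using g \<sigma> by (simp add: wreath_simps)
          then have "gcomp W (g, \<sigma>) \<subseteq> (\<Union>g\<in>carrier (wreath_group H n). gcomp W g)" by blast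
          then have "gcomp W (g, \<sigma>) \<subseteq> ?K" by (rule subset_trans[OF _ mspan_incl])
          then have "wr_elem R X n t \<sigma> \<in> ?K" if "t \<in> tp_comp R X n g" for t
            using that unfolding gc by blast
          then show "tp_comp R X n g \<subseteq> {t \<in> carrier (tpow R X n). wr_elem R X n t \<sigma> \<in> ?K}"
            using tp_comp_closed[OF assms(1,2) g] by blast
        qed
        then show "wr_pure R X n x \<sigma> \<in> ?K" by simp
      qed
    qed
  next
    fix \<gamma> assume g: "\<gamma> \<in> carrier (wreath_group H n)"
    obtain g \<sigma> where \<gamma>: "\<gamma> = (g, \<sigma>)" "g \<in> {1..n} \<rightarrow>\<^sub>E carrier H" "\<sigma> \<in> perms n" using car[OF g] by blast
    note P = tp_proj[OF assms(1-3) \<gamma>(2)]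
    show "lin R W W (p \<gamma>)"
      using lin_comp[OF lin_comp[OF wr_mod_eval_lin[OF \<gamma>(3)] P(1)] el]
      by (simp add: p_def \<gamma>(1) same_mod_lin[OF assms(4)] same_mod_lin'[OF assms(4)])
    fix \<eta> x assume h: "\<eta> \<in> carrier (wreath_group H n)" and x: "x \<in> gcomp W \<eta>"
    obtain h \<tau> where \<eta>: "\<eta> = (h, \<tau>)" "h \<in> {1..n} \<rightarrow>\<^sub>E carrier H" using car[OF h] by blast
    obtain t where t: "t \<in> tp_comp R X n h" "x = wr_elem R X n t \<tau>" using x unfolding \<eta>(1) gc by blast
    have "p \<gamma> x = wr_elem R X n (tp_proj R H X n g (if \<sigma> = \<tau> then t else \<zero>\<^bsub>tpow R X n\<^esub>)) \<sigma>"
      by (simp add: p_def \<gamma>(1) t(2) wr_elem_apply[OF \<gamma>(3)])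
    also have "\<dots> = (if \<eta> = \<gamma> then x else \<zero>\<^bsub>W\<^esub>)"
      using P(2)[OF \<eta>(2) t(1)] lin_zero[OF P(1) TM TM] lin_zero[OF el TM WM]
      by (auto simp: \<gamma>(1) \<eta>(1) t(2) z)
    finally show "p \<gamma> x = (if \<eta> = \<gamma> then x else \<zero>\<^bsub>W\<^esub>)" .
  qed
qed

text \<open>On generators the factor at place \<open>i\<close> is
  \<open>f (x i) (y (inv' \<sigma> i))\<close>, whose degree is the product of \<open>g i\<close>
  and \<open>h (inv' \<sigma> i)\<close>. This is entry \<open>i\<close> of the product in the
  wreath group. The operation is arbitrary, so that the multiplication and both actions are
  covered.\<close>

lemma wr_op_comp:
  assumes X: "module R X" "is_grading R H X" and Y: "module R Y" "is_grading R H Y" and Z: "module R Z" "is_grading R H Z"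
    and f: "bilin R X Y Z f" and H: "group H"
    and fc: "\<And>a b x y. a \<in> carrier H \<Longrightarrow> b \<in> carrier H \<Longrightarrow> x \<in> gcomp X a \<Longrightarrow> y \<in> gcomp Y b \<Longrightarrow> f x y \<in> gcomp Z (a \<otimes>\<^bsub>H\<^esub> b)"
    and \<gamma>: "\<gamma> \<in> carrier (wreath_group H n)" and \<eta>: "\<eta> \<in> carrier (wreath_group H n)"
    and u: "u \<in> wr_comp R X n \<gamma>" and v: "v \<in> wr_comp R Y n \<eta>"
  shows "wr_op R Y Z n f u v \<in> wr_comp R Z n (\<gamma> \<otimes>\<^bsub>wreath_group H n\<^esub> \<eta>)"
proof -
  interpret H: group H by fact
  obtain g \<sigma> where g: "\<gamma> = (g, \<sigma>)" "g \<in> {1..n} \<rightarrow>\<^sub>E carrier H" "\<sigma> \<in> perms n"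
    using \<gamma> by (cases \<gamma>) (simp add: wreath_simps)
  obtain h \<tau> where h: "\<eta> = (h, \<tau>)" "h \<in> {1..n} \<rightarrow>\<^sub>E carrier H" "\<tau> \<in> perms n"
    using \<eta> by (cases \<eta>) (simp add: wreath_simps)
  obtain t where t: "t \<in> tp_comp R X n g" "u = wr_elem R X n t \<sigma>" using u unfolding g(1) wr_comp_def by auto
  obtain s where s: "s \<in> tp_comp R Y n h" "v = wr_elem R Y n s \<tau>" using v unfolding h(1) wr_comp_def by auto
  let ?k = "\<lambda>i\<in>{1..n}. g i \<otimes>\<^bsub>H\<^esub> h (inv' \<sigma> i)"
  note im = perm_inv_mem[OF g(3)]
  have k: "?k \<in> {1..n} \<rightarrow>\<^sub>E carrier H"
    using PiE_mem[OF g(2)] PiE_mem[OF h(2) im] by (simp add: restrict_PiE_iff)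
  note K = tp_comp_submodule[OF Z k]
  have \<sigma>: "\<sigma> permutes {1..n}" using g(3) by (simp add: sym_group_carrier)
  note op = tp_op[OF X(1) Y(1) Z(1) f, of n]
  note P = tp_perm[OF Y(1) \<sigma>]
  have tc: "t \<in> carrier (tpow R X n)" by (rule tp_comp_closed[OF X g(2) t(1)])
  have sc: "s \<in> carrier (tpow R Y n)" by (rule tp_comp_closed[OF Y h(2) s(1)])
  have "tp_op R Z n f t (tp_perm R Y n \<sigma> s) \<in> tp_comp R Z n ?k"
  proof (rule tp_comp_lin_mem[OF X g(2) bilin_left[OF op(1) lin_closed[OF P(1) sc]] tpow_module[OF Z(1)] K _ t(1)])
    fix x assume x: "\<And>i. i \<in> {1..n} \<Longrightarrow> x i \<in> gcomp X (g i)"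
    have xc: "x i \<in> carrier X" if "i \<in> {1..n}" for i
      by (rule is_grading_closed[OF X(2) PiE_mem[OF g(2) that] x[OF that]])
    note px = pure_closed[OF X(1) xc]
    show "tp_op R Z n f (pure R X n x) (tp_perm R Y n \<sigma> s) \<in> tp_comp R Z n ?k"
    proof (rule tp_comp_lin_mem[OF Y h(2) lin_comp[OF P(1) bilin_right[OF op(1) px]] tpow_module[OF Z(1)] K _ s(1)])
      fix y assume y: "\<And>i. i \<in> {1..n} \<Longrightarrow> y i \<in> gcomp Y (h i)"
      have yc: "y i \<in> carrier Y" if "i \<in> {1..n}" for i
        by (rule is_grading_closed[OF Y(2) PiE_mem[OF h(2) that] y[OF that]])
      have "tp_op R Z n f (pure R X n x) (tp_perm R Y n \<sigma> (pure R Y n y)) = pure R Z n (\<lambda>i. f (x i) (y (inv' \<sigma> i)))"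
        using P(2)[OF yc] op(2)[OF xc yc[OF im]] by simp
      moreover have "pure R Z n (\<lambda>i. f (x i) (y (inv' \<sigma> i))) \<in> tp_comp R Z n ?k"
        by (rule pure_in_tp_comp)
          (simp add: fc[OF PiE_mem[OF g(2)] PiE_mem[OF h(2) im] x y[OF im]])
      ultimately show "tp_op R Z n f (pure R X n x) (tp_perm R Y n \<sigma> (pure R Y n y)) \<in> tp_comp R Z n ?k" by simp
    qed
  qed
  moreover have "wr_op R Y Z n f u v = wr_elem R Z n (tp_op R Z n f t (tp_perm R Y n \<sigma> s)) (\<sigma> \<circ> \<tau>)"
    unfolding t(2) s(2) by (rule wr_op_elem[OF X(1) Y(1) Z(1) f g(3) h(3) tc sc])
  ultimately show ?thesis unfolding g(1) h(1) wreath_simps by (simp add: wr_comp_def)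
qed

section \<open>Unit laws, and the tensor power inside the wreath product\<close>

lemma wr_op_unit_left:
  assumes U: "module R U" and X: "module R X" and f: "bilin R U X X f"
    and e: "e \<in> carrier U" "\<And>x. x \<in> carrier X \<Longrightarrow> f e x = x" and w: "w \<in> carrier (wr_mod R X n)"
  shows "wr_op R X X n f (wr_pure R U n (\<lambda>_. e) id) w = w"
proof (rule wr_mod_eqI[OF X wr_mod_module[OF X] _ lin_ident _ w])
  have c: "wr_pure R U n (\<lambda>_. e) id \<in> carrier (wr_mod R U n)"
    by (rule lin_closed[OF wr_elem_lin[OF U] pure_closed[OF U e(1)]])
  show "lin R (wr_mod R X n) (wr_mod R X n) (wr_op R X X n f (wr_pure R U n (\<lambda>_. e) id))"
    by (rule bilin_right[OF wr_op_bilin[OF U X X f] c])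
  fix x \<sigma> assume x: "x \<in> tp_fam X n" and \<sigma>: "\<sigma> \<in> perms n"
  have "pure R X n (\<lambda>i. f e (x (inv' id i))) = pure R X n x"
    using e(2)[OF tp_fam_mem[OF x]] by (intro pure_cong) simp
  then show "wr_op R X X n f (wr_pure R U n (\<lambda>_. e) id) (wr_pure R X n x \<sigma>) =
      wr_pure R X n x \<sigma>"
    using wr_op_pure[OF U X X f perm_id \<sigma> e(1) tp_fam_mem[OF x]] by simp
qed

lemma wr_op_unit_right:
  assumes U: "module R U" and X: "module R X" and f: "bilin R X U X f"
    and e: "e \<in> carrier U" "\<And>x. x \<in> carrier X \<Longrightarrow> f x e = x" and w: "w \<in> carrier (wr_mod R X n)"
  shows "wr_op R U X n f w (wr_pure R U n (\<lambda>_. e) id) = w"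
proof (rule wr_mod_eqI[OF X wr_mod_module[OF X] _ lin_ident _ w])
  have c: "wr_pure R U n (\<lambda>_. e) id \<in> carrier (wr_mod R U n)"
    by (rule lin_closed[OF wr_elem_lin[OF U] pure_closed[OF U e(1)]])
  show "lin R (wr_mod R X n) (wr_mod R X n) (\<lambda>w. wr_op R U X n f w (wr_pure R U n (\<lambda>_. e) id))"
    by (rule bilin_left[OF wr_op_bilin[OF X U X f] c])
  fix x \<sigma> assume x: "x \<in> tp_fam X n" and \<sigma>: "\<sigma> \<in> perms n"
  have "pure R X n (\<lambda>i. f (x i) e) = pure R X n x"
    using e(2)[OF tp_fam_mem[OF x]] by (intro pure_cong) simp
  then show "wr_op R U X n f (wr_pure R X n x \<sigma>) (wr_pure R U n (\<lambda>_. e) id) =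
      wr_pure R X n x \<sigma>"
    using wr_op_pure[OF X U X f \<sigma> perm_id tp_fam_mem[OF x] e(1)] by simp
qed

lemma tp_perm_id:
  assumes "module R X" "t \<in> carrier (tpow R X n)"
  shows "tp_perm R X n id t = t"
proof (rule tpow_eqI[OF assms(1) tpow_module[OF assms(1)] tp_perm(1)[OF assms(1) permutes_id] lin_ident _ assms(2)])
  fix x assume "x \<in> tp_fam X n"
  then show "tp_perm R X n id (pure R X n x) = pure R X n x"
    using tp_perm(2)[OF assms(1) permutes_id tp_fam_mem] by simp
qed

text \<open>The tensor power sits in the wreath product over the identity permutation. Its ring laws
  are read off from those of the wreath product instead of being proved anew.\<close>

lemma tp_op_wr_op:
  assumes "module R X" "module R Y" "module R Z" "bilin R X Y Z f" "t \<in> carrier (tpow R X n)" "u \<in> carrier (tpow R Y n)"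
  shows "wr_op R Y Z n f (wr_elem R X n t id) (wr_elem R Y n u id) = wr_elem R Z n (tp_op R Z n f t u) id"
  using wr_op_elem[OF assms(1-4) perm_id perm_id assms(5,6)] tp_perm_id[OF assms(2,6)] by simp

text \<open>A homogeneous component is moved past the coefficients: \<open>m \<zeta>'(c) = \<zeta>(\<^sup>g c) m\<close> factor by factor.\<close>

lemma wr_smap_commute:
  assumes A: "module R A" and A': "module R A'" and M: "module R M" "is_grading R H M" and C: "module R C"
    and l: "bilin R A M M l" and r: "bilin R M A' M r"
    and z: "lin R C A z" and z': "lin R C A' z'" and a: "\<And>g. g \<in> carrier H \<Longrightarrow> lin R C C (a g)"
    and e: "\<And>g m c. g \<in> carrier H \<Longrightarrow> m \<in> gcomp M g \<Longrightarrow> c \<in> carrier C \<Longrightarrow> r m (z' c) = l (z (a g c)) m"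
    and \<gamma>: "(g, \<sigma>) \<in> carrier (wreath_group H n)" and m: "m \<in> wr_comp R M n (g, \<sigma>)" and c: "c \<in> carrier (tpow R C n)"
  shows "wr_op R A' M n r m (wr_elem R A' n (tp_map R A' n (\<lambda>x i. z' (x i)) c) id) =
    wr_op R M M n l (wr_elem R A n (tp_map R A n (\<lambda>x i. z (x i))
      (tp_map R C n (\<lambda>c i. a (g i) (c (inv' \<sigma> i))) c)) id) m"
proof -
  have g: "g \<in> {1..n} \<rightarrow>\<^sub>E carrier H" "\<sigma> \<in> perms n" using \<gamma> by (simp_all add: wreath_simps)
  obtain t where t: "t \<in> tp_comp R M n g" "m = wr_elem R M n t \<sigma>" using m unfolding wr_comp_def by auto
  have \<sigma>: "\<sigma> permutes {1..n}" using g(2) by (simp add: sym_group_carrier)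
  note im = perm_inv_mem[OF g(2)]
  note Z = tp_map_id[OF C A z] and Z' = tp_map_id[OF C A' z']
  have ai: "lin R C C (a (g i))" if "i \<in> {1..n}" for i by (rule a[OF PiE_mem[OF g(1) that]])
  note AC = tp_map[where f="\<lambda>i. a (g i)", OF C C permutes_inv[OF \<sigma>] ai]
  note L = wr_op_bilin[OF A M(1) M(1) l] and R = wr_op_bilin[OF M(1) A' M(1) r]
  note el = wr_elem_lin[OF M(1)] and elA = wr_elem_lin[OF A] and elA' = wr_elem_lin[OF A']
  show ?thesis
  \<comment> \<open>Reduction in two stages: both sides are linear in \<open>c\<close>, so
    \<open>c\<close> may be pure; after that both are linear in the coefficient \<open>t\<close> of
    \<open>m\<close>, so \<open>t\<close> may be a pure tensor of homogeneous factors, to which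
    \<open>e\<close> applies place by place.\<close>
  proof (rule tpow_eqI[OF C wr_mod_module[OF M(1)] _ _ _ c])
    have mc: "m \<in> carrier (wr_mod R M n)"
      unfolding t(2) by (rule lin_closed[OF el tp_comp_closed[OF M g(1) t(1)]])
    show "lin R (tpow R C n) (wr_mod R M n)
        (\<lambda>c. wr_op R A' M n r m (wr_elem R A' n (tp_map R A' n (\<lambda>x i. z' (x i)) c) id))"
      by (rule lin_comp[OF lin_comp[OF Z'(1) elA'] bilin_right[OF R mc]])
    show "lin R (tpow R C n) (wr_mod R M n) (\<lambda>c. wr_op R M M n l (wr_elem R A n (tp_map R A n (\<lambda>x i. z (x i))
      (tp_map R C n (\<lambda>c i. a (g i) (c (inv' \<sigma> i))) c)) id) m)"
      by (rule lin_comp[OF lin_comp[OF lin_comp[OF AC(1) Z(1)] elA] bilin_left[OF L mc]])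
    fix c assume c: "c \<in> tp_fam C n"
    note cm = tp_fam_mem[OF c]
    have acm: "a (g i) (c (inv' \<sigma> i)) \<in> carrier C" if "i \<in> {1..n}" for i
      by (rule lin_closed[OF a[OF PiE_mem[OF g(1) that]] cm[OF im[OF that]]])
    let ?q = "wr_pure R A' n (\<lambda>i. z' (c i)) id"
    let ?p = "wr_pure R A n (\<lambda>i. z (a (g i) (c (inv' \<sigma> i)))) id"
    have q: "?q \<in> carrier (wr_mod R A' n)"
      by (rule lin_closed[OF elA' pure_closed[OF A' lin_closed[OF z' cm]]])
    have p: "?p \<in> carrier (wr_mod R A n)"
      by (rule lin_closed[OF elA pure_closed[OF A lin_closed[OF z acm]]])
    have "wr_op R A' M n r (wr_elem R M n t \<sigma>) ?q = wr_op R M M n l ?p (wr_elem R M n t \<sigma>)"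
    proof (rule tp_comp_lin_eq[OF M g(1) _ _ wr_mod_module[OF M(1)] _ t(1)])
      show "lin R (tpow R M n) (wr_mod R M n) (\<lambda>t. wr_op R A' M n r (wr_elem R M n t \<sigma>) ?q)"
        by (rule lin_comp[OF el bilin_left[OF R q]])
      show "lin R (tpow R M n) (wr_mod R M n) (\<lambda>t. wr_op R M M n l ?p (wr_elem R M n t \<sigma>))"
        by (rule lin_comp[OF el bilin_right[OF L p]])
      fix x assume x: "\<And>i. i \<in> {1..n} \<Longrightarrow> x i \<in> gcomp M (g i)"
      have xc: "x i \<in> carrier M" if "i \<in> {1..n}" for i
        by (rule is_grading_closed[OF M(2) PiE_mem[OF g(1) that] x[OF that]])
      have "wr_op R A' M n r (wr_pure R M n x \<sigma>) ?q =
          wr_pure R M n (\<lambda>i. r (x i) (z' (c (inv' \<sigma> i)))) (\<sigma> \<circ> id)"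
        by (rule wr_op_pure[OF M(1) A' M(1) r g(2) perm_id xc lin_closed[OF z' cm]])
      also have "pure R M n (\<lambda>i. r (x i) (z' (c (inv' \<sigma> i)))) = pure R M n (\<lambda>i. l (z (a (g i) (c (inv' \<sigma> i)))) (x i))"
        by (rule pure_cong) (rule e[OF PiE_mem[OF g(1)] x cm[OF im]])
      also have "wr_elem R M n \<dots> (\<sigma> \<circ> id) = wr_op R M M n l ?p (wr_pure R M n x \<sigma>)"
        using wr_op_pure[OF A M(1) M(1) l perm_id g(2) lin_closed[OF z acm] xc] by simp
      finally show "wr_op R A' M n r (wr_pure R M n x \<sigma>) ?q =
        wr_op R M M n l ?p (wr_pure R M n x \<sigma>)" .
    qed
    then show "wr_op R A' M n r m (wr_elem R A' n (tp_map R A' n (\<lambda>x i. z' (x i)) (pure R C n c)) id) =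
      wr_op R M M n l (wr_elem R A n (tp_map R A n (\<lambda>x i. z (x i))
        (tp_map R C n (\<lambda>c i. a (g i) (c (inv' \<sigma> i))) (pure R C n c))) id) m"
      by (simp add: t(2) Z'(2)[OF cm] AC(2)[OF _ cm] Z(2)[OF acm])
  qed
qed

section \<open>Graded algebras and crossed products\<close>

text \<open>For homogeneous \<open>y\<close> of degree \<open>h\<close> both sides are
  \<open>f y\<close> or zero according to whether \<open>k = h\<close>; injectivity of \<pi> is what
  makes the two tests agree. The shift will be left translation by a group element, or
  trivial.\<close>

lemma hcomp_shift:
  assumes Y: "module R Y" "is_grading R \<Gamma> Y" and Z: "module R Z" "is_grading R \<Gamma> Z" and fin: "finite (carrier \<Gamma>)"
    and f: "lin R Y Z f" and \<pi>: "\<And>k. k \<in> carrier \<Gamma> \<Longrightarrow> \<pi> k \<in> carrier \<Gamma>" "inj_on \<pi> (carrier \<Gamma>)"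
    and fk: "\<And>k y. k \<in> carrier \<Gamma> \<Longrightarrow> y \<in> gcomp Y k \<Longrightarrow> f y \<in> gcomp Z (\<pi> k)"
    and k: "k \<in> carrier \<Gamma>" and y: "y \<in> carrier Y"
  shows "hcomp \<Gamma> Z (f y) (\<pi> k) = f (hcomp \<Gamma> Y y k)"
proof (rule lin_eqI[where f="\<lambda>y. hcomp \<Gamma> Z (f y) (\<pi> k)" and g="\<lambda>y. f (hcomp \<Gamma> Y y k)"
      and x=y and X="\<Union>g\<in>carrier \<Gamma>. gcomp Y g" and M=Y and N=Z and R=R])
  show "lin R Y Z (\<lambda>y. hcomp \<Gamma> Z (f y) (\<pi> k))"
    by (rule lin_comp[OF f hcomp_lin[OF Z(2,1) fin \<pi>(1)[OF k]]])
  show "lin R Y Z (\<lambda>y. f (hcomp \<Gamma> Y y k))"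
    by (rule lin_comp[OF hcomp_lin[OF Y(2,1) fin k] f])
  show "(\<Union>g\<in>carrier \<Gamma>. gcomp Y g) \<subseteq> carrier Y" using is_grading_closed[OF Y(2)] by blast
  show "y \<in> mspan R Y (\<Union>g\<in>carrier \<Gamma>. gcomp Y g)" using y grading_span[OF Y(2,1)] by simp
  fix x assume "x \<in> (\<Union>g\<in>carrier \<Gamma>. gcomp Y g)"
  then obtain h where h: "h \<in> carrier \<Gamma>" "x \<in> gcomp Y h" by blast
  have "hcomp \<Gamma> Z (f x) (\<pi> k) = (if \<pi> k = \<pi> h then f x else \<zero>\<^bsub>Z\<^esub>)"
    by (rule hcomp_homogeneous[OF Z(2,1) fin \<pi>(1)[OF k] \<pi>(1)[OF h(1)] fk[OF h]])
  moreover have "hcomp \<Gamma> Y x k = (if k = h then x else \<zero>\<^bsub>Y\<^esub>)"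
    by (rule hcomp_homogeneous[OF Y(2,1) fin k h])
  moreover have "\<pi> k = \<pi> h \<longleftrightarrow> k = h" using inj_onD[OF \<pi>(2) _ k h(1)] by blast
  ultimately show "hcomp \<Gamma> Z (f x) (\<pi> k) = f (hcomp \<Gamma> Y x k)"
    using lin_zero[OF f Y(1) Z(1)] by simp
qed (rule Y Z)+

context graded_algebra
begin

lemma gcomp_closed: "g \<in> carrier \<Gamma> \<Longrightarrow> a \<in> gcomp A g \<Longrightarrow> a \<in> carrier A"
  by (rule is_grading_closed[OF grading])

lemma hcomp_mult_left:
  assumes "g \<in> carrier \<Gamma>" "k \<in> carrier \<Gamma>" "a \<in> gcomp A g" "b \<in> carrier A"
  shows "hcomp \<Gamma> A (a \<otimes>\<^bsub>A\<^esub> b) (g \<otimes>\<^bsub>\<Gamma>\<^esub> k) = a \<otimes>\<^bsub>A\<^esub> hcomp \<Gamma> A b k"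
proof (rule hcomp_shift[OF module_axioms grading module_axioms grading finite_\<Gamma>, where \<pi>="\<lambda>k. g \<otimes>\<^bsub>\<Gamma>\<^esub> k"])
  show "lin R A A (\<lambda>b. a \<otimes>\<^bsub>A\<^esub> b)" by (rule bilin_right[OF mult_bilin gcomp_closed[OF assms(1,3)]])
  show "inj_on (\<lambda>k. g \<otimes>\<^bsub>\<Gamma>\<^esub> k) (carrier \<Gamma>)" by (rule \<Gamma>.inj_on_cmult[OF assms(1)])
qed (use assms gcomp_mult in simp_all)

text \<open>Let \<open>e\<close> be the component of the unit in the identity degree. Comparing
  degrees in \<open>x 1 = x\<close> gives \<open>x e = x\<close> for homogeneous \<open>x\<close>,
  hence for all \<open>x\<close>, and \<open>x = 1\<close> gives \<open>e = 1\<close>.\<close>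

lemma one_gcomp: "\<one>\<^bsub>A\<^esub> \<in> gcomp A \<one>\<^bsub>\<Gamma>\<^esub>"
proof -
  let ?e = "hcomp \<Gamma> A \<one>\<^bsub>A\<^esub> \<one>\<^bsub>\<Gamma>\<^esub>"
  have e: "?e \<in> gcomp A \<one>\<^bsub>\<Gamma>\<^esub>" by (rule hcomp_mem[OF grading one_closed \<Gamma>.one_closed])
  have ec: "?e \<in> carrier A" by (rule gcomp_closed[OF \<Gamma>.one_closed e])
  have "\<one>\<^bsub>A\<^esub> \<otimes>\<^bsub>A\<^esub> ?e = \<one>\<^bsub>A\<^esub>"
  proof (rule lin_eqI[OF bilin_left[OF mult_bilin ec] lin_ident module_axioms module_axioms])
    show "(\<Union>g\<in>carrier \<Gamma>. gcomp A g) \<subseteq> carrier A" using gcomp_closed by blast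
    show "\<one>\<^bsub>A\<^esub> \<in> mspan R A (\<Union>g\<in>carrier \<Gamma>. gcomp A g)" using grading_span[OF grading module_axioms] one_closed by simp
    fix x assume "x \<in> (\<Union>g\<in>carrier \<Gamma>. gcomp A g)"
    then obtain h where h: "h \<in> carrier \<Gamma>" "x \<in> gcomp A h" by blast
    have "x \<otimes>\<^bsub>A\<^esub> ?e = hcomp \<Gamma> A (x \<otimes>\<^bsub>A\<^esub> \<one>\<^bsub>A\<^esub>) (h \<otimes>\<^bsub>\<Gamma>\<^esub> \<one>\<^bsub>\<Gamma>\<^esub>)"
      by (rule hcomp_mult_left[symmetric, OF h(1) \<Gamma>.one_closed h(2) one_closed])
    also have "\<dots> = x" using hcomp_homogeneous[OF grading module_axioms finite_\<Gamma> h(1) h] h gcomp_closed[OF h] by simp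
    finally show "x \<otimes>\<^bsub>A\<^esub> ?e = x" .
  qed
  then show ?thesis using e ec by simp
qed

text \<open>Multiplying by \<open>u\<close> sends the component of the inverse in degree
  \<open>inv g\<close> to the identity component of \<open>1\<close>, which is \<open>1\<close>.
  Cancelling \<open>u\<close>, the inverse equals this one component.\<close>

lemma inv_gcomp:
  assumes "g \<in> carrier \<Gamma>" "u \<in> gcomp A g" "u \<in> Units A"
  shows "inv\<^bsub>A\<^esub> u \<in> gcomp A (inv\<^bsub>\<Gamma>\<^esub> g)"
proof -
  let ?v = "inv\<^bsub>A\<^esub> u" and ?g = "inv\<^bsub>\<Gamma>\<^esub> g"
  have uc: "u \<in> carrier A" and vc: "?v \<in> carrier A" and gc: "?g \<in> carrier \<Gamma>" using assms by (simp_all add: Units_closed)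
  have w: "hcomp \<Gamma> A ?v ?g \<in> gcomp A ?g" by (rule hcomp_mem[OF grading vc gc])
  have wc: "hcomp \<Gamma> A ?v ?g \<in> carrier A" by (rule gcomp_closed[OF gc w])
  have "u \<otimes>\<^bsub>A\<^esub> hcomp \<Gamma> A ?v ?g = hcomp \<Gamma> A (u \<otimes>\<^bsub>A\<^esub> ?v) (g \<otimes>\<^bsub>\<Gamma>\<^esub> ?g)"
    by (rule hcomp_mult_left[symmetric, OF assms(1) gc assms(2) vc])
  also have "\<dots> = \<one>\<^bsub>A\<^esub>"
    using assms hcomp_homogeneous[OF grading module_axioms finite_\<Gamma> \<Gamma>.one_closed \<Gamma>.one_closed one_gcomp]
    by simp
  finally have "?v \<otimes>\<^bsub>A\<^esub> (u \<otimes>\<^bsub>A\<^esub> hcomp \<Gamma> A ?v ?g) = ?v" using vc by simp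
  moreover have "?v \<otimes>\<^bsub>A\<^esub> (u \<otimes>\<^bsub>A\<^esub> hcomp \<Gamma> A ?v ?g) = hcomp \<Gamma> A ?v ?g"
    using uc vc wc assms(3) by (simp add: m_assoc[symmetric])
  ultimately show ?thesis using w by simp
qed

end

lemma (in crossed_product) hunit:
  assumes "g \<in> carrier \<Gamma>"
  shows "hunit A g \<in> gcomp A g" "hunit A g \<in> Units A"
proof -
  have "\<exists>u. u \<in> gcomp A g \<inter> Units A" using ex_homogeneous_unit[OF assms] by blast
  from someI_ex[OF this] have "hunit A g \<in> gcomp A g \<inter> Units A" unfolding hunit_def .
  then show "hunit A g \<in> gcomp A g" "hunit A g \<in> Units A" by blast+
qed

text \<open>The axiom \<open>smap_act\<close> speaks of units only. For general \<open>m\<close> of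
  degree \<open>g\<close>, write \<open>m\<close> as \<open>(m v) u\<close> with a unit
  \<open>u\<close> of degree \<open>g\<close> and its inverse \<open>v\<close>: the factor
  \<open>m v\<close> lies in the identity component, so it commutes with the image of the structure
  map, and \<open>u\<close> is covered by the axiom.\<close>

lemma (in crossed_product_over) smap_commute:
  assumes "g \<in> carrier \<Gamma>" "m \<in> gcomp A g" "c \<in> carrier D"
  shows "m \<otimes>\<^bsub>A\<^esub> smap A c = smap A (act D g c) \<otimes>\<^bsub>A\<^esub> m"
proof -
  note u = hunit[OF assms(1)]
  let ?u = "hunit A g" and ?v = "inv\<^bsub>A\<^esub> (hunit A g)"
  have uc: "?u \<in> carrier A" "?v \<in> carrier A" using u by (simp_all add: Units_closed)
  have mc: "m \<in> carrier A" by (rule gcomp_closed[OF assms(1,2)])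
  have zc: "smap A c \<in> carrier A" by (rule ring_hom_closed[OF smap_ring_hom assms(3)])
  have gc: "act D g c \<in> carrier D" by (rule ring_hom_closed[OF D.act_ring_hom[OF assms(1)] assms(3)])
  have zgc: "smap A (act D g c) \<in> carrier A" by (rule ring_hom_closed[OF smap_ring_hom gc])
  have v: "?v \<in> gcomp A (inv\<^bsub>\<Gamma>\<^esub> g)" by (rule inv_gcomp[OF assms(1) u])
  have b: "m \<otimes>\<^bsub>A\<^esub> ?v \<in> gcomp A \<one>\<^bsub>\<Gamma>\<^esub>" using gcomp_mult[OF assms(1) \<Gamma>.inv_closed[OF assms(1)] assms(2) v] assms(1) by simp
  have s: "smap A (act D g c) = ?u \<otimes>\<^bsub>A\<^esub> smap A c \<otimes>\<^bsub>A\<^esub> ?v"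
    using u by (intro smap_act[OF assms(1,3)]) blast
  have "smap A (act D g c) \<otimes>\<^bsub>A\<^esub> (m \<otimes>\<^bsub>A\<^esub> ?v) = (m \<otimes>\<^bsub>A\<^esub> ?v) \<otimes>\<^bsub>A\<^esub> smap A (act D g c)"
    using smap_centralizer[OF gc] b by (simp add: centralizer_def)
  also have "\<dots> = m \<otimes>\<^bsub>A\<^esub> (?v \<otimes>\<^bsub>A\<^esub> ?u) \<otimes>\<^bsub>A\<^esub> smap A c \<otimes>\<^bsub>A\<^esub> ?v"
    unfolding s using mc uc zc by (simp add: m_assoc del: Units_l_inv)
  also have "\<dots> = m \<otimes>\<^bsub>A\<^esub> smap A c \<otimes>\<^bsub>A\<^esub> ?v" using u(2) mc by simp
  finally have "smap A (act D g c) \<otimes>\<^bsub>A\<^esub> (m \<otimes>\<^bsub>A\<^esub> ?v) \<otimes>\<^bsub>A\<^esub> ?u = m \<otimes>\<^bsub>A\<^esub> smap A c \<otimes>\<^bsub>A\<^esub> ?v \<otimes>\<^bsub>A\<^esub> ?u" by simp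
  then show ?thesis using mc uc zc zgc u(2) by (simp add: m_assoc)
qed

lemma assoc_algebraI:
  assumes W: "module R W" and b: "bilin R W W W (mult W)" and o: "\<one>\<^bsub>W\<^esub> \<in> carrier W" "\<one>\<^bsub>W\<^esub> \<noteq> \<zero>\<^bsub>W\<^esub>"
    and a: "\<And>x y z. x \<in> carrier W \<Longrightarrow> y \<in> carrier W \<Longrightarrow> z \<in> carrier W \<Longrightarrow> x \<otimes>\<^bsub>W\<^esub> y \<otimes>\<^bsub>W\<^esub> z = x \<otimes>\<^bsub>W\<^esub> (y \<otimes>\<^bsub>W\<^esub> z)"
    and u: "\<And>x. x \<in> carrier W \<Longrightarrow> \<one>\<^bsub>W\<^esub> \<otimes>\<^bsub>W\<^esub> x = x" "\<And>x. x \<in> carrier W \<Longrightarrow> x \<otimes>\<^bsub>W\<^esub> \<one>\<^bsub>W\<^esub> = x"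
  shows "assoc_algebra R W"
proof (rule assoc_algebra.intro[OF W])
  note c = bilin_closed[OF b]
  have "monoid W" by (rule monoidI[OF c o(1) a u])
  then show "ring W"
    by (rule ringI[OF module.axioms(2)[OF W]]) (simp_all add: lin_add[OF bilin_left[OF b]] lin_add[OF bilin_right[OF b]])
  show "assoc_algebra_axioms R W"
    by (rule assoc_algebra_axioms.intro[OF o(2)])
      (simp_all add: lin_smult[OF bilin_left[OF b]] lin_smult[OF bilin_right[OF b]])
qed

section \<open>The wreath product of a crossed product\<close>

lemma wr_algebra_simps:
  "carrier (wr_algebra R A n) = carrier (wr_mod R A n)"
  "zero (wr_algebra R A n) = zero (wr_mod R A n)"
  "add (wr_algebra R A n) = add (wr_mod R A n)"
  "smult (wr_algebra R A n) = smult (wr_mod R A n)"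
  "mult (wr_algebra R A n) = wr_op R A A n (mult A)"
  "one (wr_algebra R A n) = wr_pure R A n (\<lambda>_. \<one>\<^bsub>A\<^esub>) id"
  "gcomp (wr_algebra R A n) = wr_comp R A n"
  "smap (wr_algebra R A n) = (\<lambda>c. wr_elem R A n (tp_map R A n (\<lambda>x i. smap A (x i)) c) id)"
  by (simp_all add: wr_algebra_def Let_def)

lemma wr_algebra_same: "same_mod (wr_algebra R A n) (wr_mod R A n)"
  by (simp add: same_mod_def wr_algebra_simps)

lemma wr_bimodule_simps:
  "carrier (wr_bimodule R A' M n) = carrier (wr_mod R M n)"
  "zero (wr_bimodule R A' M n) = zero (wr_mod R M n)"
  "add (wr_bimodule R A' M n) = add (wr_mod R M n)"
  "smult (wr_bimodule R A' M n) = smult (wr_mod R M n)"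
  "gcomp (wr_bimodule R A' M n) = wr_comp R M n"
  "lact (wr_bimodule R A' M n) = wr_op R M M n (lact M)"
  "ract (wr_bimodule R A' M n) = wr_op R A' M n (ract M)"
  by (simp_all add: wr_bimodule_def mk_bimodule_def)

lemma wr_bimodule_same: "same_mod (wr_bimodule R A' M n) (wr_mod R M n)"
  by (simp add: same_mod_def wr_bimodule_simps)

lemma tpow_acted_simps:
  "carrier (tpow_acted R C n) = carrier (tpow R C n)"
  "zero (tpow_acted R C n) = zero (tpow R C n)"
  "add (tpow_acted R C n) = add (tpow R C n)"
  "smult (tpow_acted R C n) = smult (tpow R C n)"
  "mult (tpow_acted R C n) = tp_op R C n (mult C)"
  "one (tpow_acted R C n) = pure R C n (\<lambda>_. \<one>\<^bsub>C\<^esub>)"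
  "gcomp (tpow_acted R C n) (g, \<sigma>) = (if \<sigma> = id then tp_comp R C n g else {\<zero>\<^bsub>tpow R C n\<^esub>})"
  "act (tpow_acted R C n) (g, \<sigma>) = tp_map R C n (\<lambda>c i. act C (g i) (c (inv' \<sigma> i)))"
  by (simp_all add: tpow_acted_def Let_def)

lemma tpow_acted_same: "same_mod (tpow_acted R C n) (tpow R C n)"
  by (simp add: same_mod_def tpow_acted_simps)

lemma wr_elem_inj: "\<sigma> \<in> perms n \<Longrightarrow> wr_elem R X n t \<sigma> = wr_elem R X n u \<sigma> \<Longrightarrow> t = u"
  by (drule fun_cong[of _ _ \<sigma>]) (simp add: wr_elem_apply)

context assoc_algebra
begin

lemma wr_mult_bilin: "bilin R (wr_mod R A n) (wr_mod R A n) (wr_mod R A n) (wr_op R A A n (mult A))"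
  by (rule wr_op_bilin[OF module_axioms module_axioms module_axioms mult_bilin])

lemma wr_mult_assoc:
  "x \<in> carrier (wr_mod R A n) \<Longrightarrow> y \<in> carrier (wr_mod R A n) \<Longrightarrow> z \<in> carrier (wr_mod R A n) \<Longrightarrow>
    wr_op R A A n (mult A) (wr_op R A A n (mult A) x y) z = wr_op R A A n (mult A) x (wr_op R A A n (mult A) y z)"
  by (rule wr_op_assoc[OF module_axioms module_axioms module_axioms module_axioms module_axioms module_axioms
    mult_bilin mult_bilin mult_bilin mult_bilin m_assoc])

lemma wr_one_closed: "wr_pure R A n (\<lambda>_. \<one>\<^bsub>A\<^esub>) id \<in> carrier (wr_mod R A n)"
  by (rule lin_closed[OF wr_elem_lin[OF module_axioms] pure_closed[OF module_axioms one_closed]])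

lemma tp_mult_bilin: "bilin R (tpow R A n) (tpow R A n) (tpow R A n) (tp_op R A n (mult A))"
  by (rule tp_op(1)[OF module_axioms module_axioms module_axioms mult_bilin])

lemma tp_mult_wr:
  "t \<in> carrier (tpow R A n) \<Longrightarrow> u \<in> carrier (tpow R A n) \<Longrightarrow>
    wr_op R A A n (mult A) (wr_elem R A n t id) (wr_elem R A n u id) = wr_elem R A n (tp_op R A n (mult A) t u) id"
  by (rule tp_op_wr_op[OF module_axioms module_axioms module_axioms mult_bilin])

lemma tp_mult_assoc:
  assumes t: "t \<in> carrier (tpow R A n)" and u: "u \<in> carrier (tpow R A n)" and v: "v \<in> carrier (tpow R A n)"
  shows "tp_op R A n (mult A) (tp_op R A n (mult A) t u) v = tp_op R A n (mult A) t (tp_op R A n (mult A) u v)"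
proof (rule wr_elem_inj[OF perm_id])
  note e = lin_closed[OF wr_elem_lin[OF module_axioms]] and c = bilin_closed[OF tp_mult_bilin]
  show "wr_elem R A n (tp_op R A n (mult A) (tp_op R A n (mult A) t u) v) id =
    wr_elem R A n (tp_op R A n (mult A) t (tp_op R A n (mult A) u v)) id"
    using wr_mult_assoc[OF e[OF t] e[OF u] e[OF v], of id id id]
    by (simp add: tp_mult_wr t u v c)
qed

lemma tp_one_mult:
  assumes t: "t \<in> carrier (tpow R A n)"
  shows "tp_op R A n (mult A) (pure R A n (\<lambda>_. \<one>\<^bsub>A\<^esub>)) t = t" "tp_op R A n (mult A) t (pure R A n (\<lambda>_. \<one>\<^bsub>A\<^esub>)) = t"
proof -
  note e = lin_closed[OF wr_elem_lin[OF module_axioms] t, of id]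
  have o: "pure R A n (\<lambda>_. \<one>\<^bsub>A\<^esub>) \<in> carrier (tpow R A n)" by (rule pure_closed[OF module_axioms one_closed])
  show "tp_op R A n (mult A) (pure R A n (\<lambda>_. \<one>\<^bsub>A\<^esub>)) t = t"
    using wr_op_unit_left[OF module_axioms module_axioms mult_bilin one_closed _ e]
    unfolding tp_mult_wr[OF o t] by (intro wr_elem_inj[OF perm_id]) simp
  show "tp_op R A n (mult A) t (pure R A n (\<lambda>_. \<one>\<^bsub>A\<^esub>)) = t"
    using wr_op_unit_right[OF module_axioms module_axioms mult_bilin one_closed _ e]
    unfolding tp_mult_wr[OF t o] by (intro wr_elem_inj[OF perm_id]) simp
qed

end

lemma wr_algebra_assoc:
  fixes A :: "('r, 'a, 'g, 'c) algebra_over"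
  assumes "assoc_algebra R A"
  shows "assoc_algebra R (wr_algebra R A n)"
proof -
  interpret A: assoc_algebra R A by fact
  note m = A.module_axioms
  show ?thesis
  proof (rule assoc_algebraI)
    show "module R (wr_algebra R A n)" by (rule same_mod_module[OF wr_algebra_same wr_mod_module[OF m]])
    show "bilin R (wr_algebra R A n) (wr_algebra R A n) (wr_algebra R A n) (mult (wr_algebra R A n))"
      unfolding wr_algebra_simps same_mod_bilin[OF wr_algebra_same wr_algebra_same wr_algebra_same]
      by (rule A.wr_mult_bilin)
    have "wr_pure R A n (\<lambda>_. \<one>\<^bsub>A\<^esub>) id id \<noteq> \<zero>\<^bsub>wr_mod R A n\<^esub> id"
      using A.tpow_one_neq_zero by (simp add: wr_elem_apply[OF perm_id] wr_mod_simps perm_id)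
    then show "\<one>\<^bsub>wr_algebra R A n\<^esub> \<noteq> \<zero>\<^bsub>wr_algebra R A n\<^esub>" unfolding wr_algebra_simps by metis
    show "\<one>\<^bsub>wr_algebra R A n\<^esub> \<in> carrier (wr_algebra R A n)" unfolding wr_algebra_simps by (rule A.wr_one_closed)
    fix x assume x: "x \<in> carrier (wr_algebra R A n)"
    show "\<one>\<^bsub>wr_algebra R A n\<^esub> \<otimes>\<^bsub>wr_algebra R A n\<^esub> x = x" unfolding wr_algebra_simps
      by (rule wr_op_unit_left[OF m m A.mult_bilin A.one_closed A.l_one]) (use x in \<open>simp_all add: wr_algebra_simps\<close>)
    show "x \<otimes>\<^bsub>wr_algebra R A n\<^esub> \<one>\<^bsub>wr_algebra R A n\<^esub> = x" unfolding wr_algebra_simps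
      by (rule wr_op_unit_right[OF m m A.mult_bilin A.one_closed A.r_one]) (use x in \<open>simp_all add: wr_algebra_simps\<close>)
    fix y z assume "y \<in> carrier (wr_algebra R A n)" "z \<in> carrier (wr_algebra R A n)"
    then show "x \<otimes>\<^bsub>wr_algebra R A n\<^esub> y \<otimes>\<^bsub>wr_algebra R A n\<^esub> z =
      x \<otimes>\<^bsub>wr_algebra R A n\<^esub> (y \<otimes>\<^bsub>wr_algebra R A n\<^esub> z)"
      using x unfolding wr_algebra_simps by (intro A.wr_mult_assoc)
  qed
qed

lemma wr_algebra_graded:
  fixes A :: "('r, 'a, 'g, 'c) algebra_over"
  assumes "graded_algebra R H A"
  shows "graded_algebra R (wreath_group H n) (wr_algebra R A n)"
proof -
  interpret A: graded_algebra R H A by fact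
  note m = A.module_axioms
  show ?thesis
  proof (rule graded_algebra.intro[OF wr_algebra_assoc[OF A.assoc_algebra_axioms] wreath_group_group[OF A.\<Gamma>.group_axioms]],
      rule graded_algebra_axioms.intro)
    show "finite (carrier (wreath_group H n))" by (rule wreath_group_finite[OF A.finite_\<Gamma>])
    show "is_grading R (wreath_group H n) (wr_algebra R A n)"
      by (rule wr_grading[OF m A.grading A.finite_\<Gamma> wr_algebra_same wr_algebra_simps(7)])
    fix g h a b assume gh: "g \<in> carrier (wreath_group H n)" "h \<in> carrier (wreath_group H n)"
      and a: "a \<in> gcomp (wr_algebra R A n) g" and b: "b \<in> gcomp (wr_algebra R A n) h"
    show "a \<otimes>\<^bsub>wr_algebra R A n\<^esub> b \<in> gcomp (wr_algebra R A n) (g \<otimes>\<^bsub>wreath_group H n\<^esub> h)"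
      unfolding wr_algebra_simps
      by (rule wr_op_comp[OF m A.grading m A.grading m A.grading A.mult_bilin A.\<Gamma>.group_axioms _ gh
        a[unfolded wr_algebra_simps] b[unfolded wr_algebra_simps]]) (rule A.gcomp_mult)
  qed
qed

lemma wr_algebra_crossed:
  fixes A :: "('r, 'a, 'g, 'c) algebra_over"
  assumes "crossed_product R H A"
  shows "crossed_product R (wreath_group H n) (wr_algebra R A n)"
proof -
  interpret A: crossed_product R H A by fact
  note m = A.module_axioms
  show ?thesis
  proof (rule crossed_product.intro[OF wr_algebra_graded[OF A.graded_algebra_axioms]], rule crossed_product_axioms.intro)
    fix \<gamma> assume \<gamma>: "\<gamma> \<in> carrier (wreath_group H n)"
    obtain g \<sigma> where g: "\<gamma> = (g, \<sigma>)" "g \<in> {1..n} \<rightarrow>\<^sub>E carrier H" "\<sigma> \<in> perms n"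
      using \<gamma> by (cases \<gamma>) (simp add: wreath_simps)
    note h = A.hunit[OF PiE_mem[OF g(2)]]
    note pm = perm_mem[OF g(3)]
    have uc: "hunit A (g i) \<in> carrier A" and vc: "inv\<^bsub>A\<^esub> hunit A (g i) \<in> carrier A" if "i \<in> {1..n}" for i
      using h[OF that] by (simp_all add: A.Units_closed)
    let ?u = "wr_pure R A n (\<lambda>i. hunit A (g i)) \<sigma>"
    \<comment> \<open>In the product \<open>?u ?v\<close> the factor of \<open>?v\<close> at
      \<open>inv' \<sigma> i\<close> meets the factor of \<open>?u\<close> at \<open>i\<close>; this
      dictates the index \<open>\<sigma> i\<close>.\<close>
    let ?v = "wr_pure R A n (\<lambda>i. inv\<^bsub>A\<^esub> hunit A (g (\<sigma> i))) (inv' \<sigma>)"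
    note el = lin_closed[OF wr_elem_lin[OF m] pure_closed[OF m]]
    have u: "?u \<in> carrier (wr_mod R A n)" by (rule el[OF uc])
    have v: "?v \<in> carrier (wr_mod R A n)" by (rule el[OF vc[OF pm]])
    have "wr_op R A A n (mult A) ?u ?v =
        wr_pure R A n (\<lambda>i. hunit A (g i) \<otimes>\<^bsub>A\<^esub> inv\<^bsub>A\<^esub> hunit A (g (\<sigma> (inv' \<sigma> i)))) (\<sigma> \<circ> inv' \<sigma>)"
      by (rule wr_op_pure[OF m m m A.mult_bilin g(3) perm_inv[OF g(3)] uc vc[OF pm]])
    also have "pure R A n (\<lambda>i. hunit A (g i) \<otimes>\<^bsub>A\<^esub> inv\<^bsub>A\<^esub> hunit A (g (\<sigma> (inv' \<sigma> i)))) = pure R A n (\<lambda>_. \<one>\<^bsub>A\<^esub>)"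
      using h by (intro pure_cong) (simp add: perm_inv_apply[OF g(3)])
    finally have uv: "wr_op R A A n (mult A) ?u ?v = \<one>\<^bsub>wr_algebra R A n\<^esub>"
      by (simp only: perm_o_inv[OF g(3)] wr_algebra_simps)
    have "wr_op R A A n (mult A) ?v ?u =
        wr_pure R A n (\<lambda>i. inv\<^bsub>A\<^esub> hunit A (g (\<sigma> i)) \<otimes>\<^bsub>A\<^esub> hunit A (g (inv' (inv' \<sigma>) i))) (inv' \<sigma> \<circ> \<sigma>)"
      by (rule wr_op_pure[OF m m m A.mult_bilin perm_inv[OF g(3)] g(3) vc[OF pm] uc])
    also have "pure R A n (\<lambda>i. inv\<^bsub>A\<^esub> hunit A (g (\<sigma> i)) \<otimes>\<^bsub>A\<^esub> hunit A (g (inv' (inv' \<sigma>) i))) = pure R A n (\<lambda>_. \<one>\<^bsub>A\<^esub>)"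
      using h[OF pm] by (intro pure_cong) (simp add: perm_inv_inv[OF g(3)])
    finally have vu: "wr_op R A A n (mult A) ?v ?u = \<one>\<^bsub>wr_algebra R A n\<^esub>"
      by (simp only: perm_inv_o[OF g(3)] wr_algebra_simps)
    have "?u \<in> Units (wr_algebra R A n)"
      unfolding Units_def wr_algebra_simps(1,5) using u v uv vu by blast
    moreover have "pure R A n (\<lambda>i. hunit A (g i)) \<in> tp_comp R A n g" by (rule pure_in_tp_comp) (rule h(1))
    then have "?u \<in> gcomp (wr_algebra R A n) \<gamma>" by (simp add: wr_algebra_simps wr_comp_def g(1))
    ultimately show "gcomp (wr_algebra R A n) \<gamma> \<inter> Units (wr_algebra R A n) \<noteq> {}" by blast
  qed
qed

text \<open>Serves the action of the wreath group, where the factors are permuted as well, and the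
  structure map, where \<pi> is the identity.\<close>

lemma tp_map_mult:
  assumes X: "module R X" and Y: "module R Y" and b: "bilin R X X X m" and b': "bilin R Y Y Y m'"
    and \<pi>: "\<pi> permutes {1..n}" and f: "\<And>i. i \<in> {1..n} \<Longrightarrow> lin R X Y (f i)"
    and e: "\<And>i x y. i \<in> {1..n} \<Longrightarrow> x \<in> carrier X \<Longrightarrow> y \<in> carrier X \<Longrightarrow> f i (m x y) = m' (f i x) (f i y)"
    and t: "t \<in> carrier (tpow R X n)" and u: "u \<in> carrier (tpow R X n)"
  shows "tp_map R Y n (\<lambda>x i. f i (x (\<pi> i))) (tp_op R X n m t u) =
    tp_op R Y n m' (tp_map R Y n (\<lambda>x i. f i (x (\<pi> i))) t) (tp_map R Y n (\<lambda>x i. f i (x (\<pi> i))) u)"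
proof -
  let ?F = "tp_map R Y n (\<lambda>x i. f i (x (\<pi> i)))"
  note F = tp_map[OF X Y \<pi> f] and B = tp_op[OF X X X b, of n] and B' = tp_op[OF Y Y Y b', of n]
  note TX = tpow_module[OF X, of n] and TY = tpow_module[OF Y, of n]
  have \<pi>i: "\<pi> i \<in> {1..n}" if "i \<in> {1..n}" for i using permutes_in_image[OF \<pi>] that by simp
  have lF: "lin R (tpow R X n) (tpow R Y n) ?F" by (rule F(1))
  have S: "pure R X n ` tp_fam X n \<subseteq> carrier (tpow R X n)"
    by (rule image_subsetI) (rule pure_closed_fam[OF X])
  show ?thesis
  proof (rule bilin_eqI[where f="\<lambda>t u. ?F (tp_op R X n m t u)" and g="\<lambda>t u. tp_op R Y n m' (?F t) (?F u)", OF _ _ TX TX TY S S])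
    show "bilin R (tpow R X n) (tpow R X n) (tpow R Y n) (\<lambda>t u. ?F (tp_op R X n m t u))"
      by (rule bilinI) (rule lin_comp[OF bilin_right[OF B(1)] lF] lin_comp[OF bilin_left[OF B(1)] lF], assumption)+
    show "bilin R (tpow R X n) (tpow R X n) (tpow R Y n) (\<lambda>t u. tp_op R Y n m' (?F t) (?F u))"
      by (rule bilinI) (rule lin_comp[OF lF bilin_right[OF B'(1) lin_closed[OF lF]]]
        lin_comp[OF lF bilin_left[OF B'(1) lin_closed[OF lF]]], assumption)+
    show "t \<in> mspan R (tpow R X n) (pure R X n ` tp_fam X n)" "u \<in> mspan R (tpow R X n) (pure R X n ` tp_fam X n)"
      using t u tpow_gen[OF X, of n] by simp_all
    fix s s' assume "s \<in> pure R X n ` tp_fam X n" "s' \<in> pure R X n ` tp_fam X n"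
    then obtain x y where x: "x \<in> tp_fam X n" "s = pure R X n x" and y: "y \<in> tp_fam X n" "s' = pure R X n y" by blast
    note xm = tp_fam_mem[OF x(1)] and ym = tp_fam_mem[OF y(1)]
    have fx: "f i (x (\<pi> i)) \<in> carrier Y" and fy: "f i (y (\<pi> i)) \<in> carrier Y" if "i \<in> {1..n}" for i
      using lin_closed[OF f[OF that] xm[OF \<pi>i[OF that]]] lin_closed[OF f[OF that] ym[OF \<pi>i[OF that]]] by simp_all
    have "?F (tp_op R X n m s s') = ?F (pure R X n (\<lambda>i. m (x i) (y i)))"
      unfolding x(2) y(2) by (rule arg_cong[OF B(2)[OF xm ym]])
    also have "\<dots> = pure R Y n (\<lambda>i. f i (m (x (\<pi> i)) (y (\<pi> i))))"
      by (rule F(2)) (simp_all add: bilin_closed[OF b xm ym])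
    also have "\<dots> = pure R Y n (\<lambda>i. m' (f i (x (\<pi> i))) (f i (y (\<pi> i))))"
      by (rule pure_cong) (rule e[OF _ xm[OF \<pi>i] ym[OF \<pi>i]])
    also have "\<dots> = tp_op R Y n m' (?F s) (?F s')"
      unfolding x(2) y(2) using F(2)[OF _ xm] F(2)[OF _ ym] B'(2)[OF fx fy] by simp
    finally show "?F (tp_op R X n m s s') = tp_op R Y n m' (?F s) (?F s')" .
  qed
qed

lemma tpow_acted_graded_acted:
  fixes C :: "('r, 'c, 'g) acted_algebra"
  assumes "graded_acted_algebra R H C"
  shows "graded_acted_algebra R (wreath_group H n) (tpow_acted R C n)"
proof -
  interpret C: graded_acted_algebra R H C by fact
  let ?D = "tpow_acted R C n" and ?W = "wreath_group H n"
  note m = C.module_axioms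
  note T = tpow_module[OF m, of n]
  note TM = same_mod_module[OF tpow_acted_same[of R C n] T]
  interpret W: group ?W by (rule wreath_group_group[OF C.\<Gamma>.group_axioms])
  note s = tpow_acted_simps
  have o: "pure R C n (\<lambda>_. \<one>\<^bsub>C\<^esub>) \<in> carrier (tpow R C n)" by (rule pure_closed[OF m C.one_closed])
  have al: "lin R C C (act C g)" if "g \<in> carrier H" for g
    using C.act_ring_hom[OF that] C.act_smult[OF that] by (intro linI) (simp_all add: ring_hom_closed ring_hom_add)
  have gr: "is_grading R ?W ?D"
    by (rule tpow_grading[OF m C.grading C.finite_\<Gamma> tpow_acted_same]) (simp add: s)
  have z: "\<zero>\<^bsub>tpow R C n\<^esub> \<in> gcomp ?D \<gamma>" if "\<gamma> \<in> carrier ?W" for \<gamma>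
    using submodule_zero[OF is_grading_submodule[OF gr that]] by (simp add: s)
  have alg: "assoc_algebra R ?D"
  proof (rule assoc_algebraI[OF TM])
    show "bilin R ?D ?D ?D (mult ?D)"
      unfolding s same_mod_bilin[OF tpow_acted_same tpow_acted_same tpow_acted_same] by (rule C.tp_mult_bilin)
    show "\<one>\<^bsub>?D\<^esub> \<in> carrier ?D" unfolding s by (rule o)
    show "\<one>\<^bsub>?D\<^esub> \<noteq> \<zero>\<^bsub>?D\<^esub>" unfolding s by (rule C.tpow_one_neq_zero)
    fix x assume x: "x \<in> carrier ?D"
    show "\<one>\<^bsub>?D\<^esub> \<otimes>\<^bsub>?D\<^esub> x = x" "x \<otimes>\<^bsub>?D\<^esub> \<one>\<^bsub>?D\<^esub> = x"
      using C.tp_one_mult x unfolding s by simp_all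
    fix y z assume "y \<in> carrier ?D" "z \<in> carrier ?D"
    then show "x \<otimes>\<^bsub>?D\<^esub> y \<otimes>\<^bsub>?D\<^esub> z = x \<otimes>\<^bsub>?D\<^esub> (y \<otimes>\<^bsub>?D\<^esub> z)"
      using x unfolding s by (intro C.tp_mult_assoc)
  qed
  have gm: "a \<otimes>\<^bsub>?D\<^esub> b \<in> gcomp ?D (\<gamma> \<otimes>\<^bsub>?W\<^esub> \<eta>)"
    if \<gamma>: "\<gamma> \<in> carrier ?W" and \<eta>: "\<eta> \<in> carrier ?W" and a: "a \<in> gcomp ?D \<gamma>" and b: "b \<in> gcomp ?D \<eta>" for \<gamma> \<eta> a b
  proof -
    obtain g \<sigma> where [simp]: "\<gamma> = (g, \<sigma>)" by (cases \<gamma>)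
    obtain h \<tau> where [simp]: "\<eta> = (h, \<tau>)" by (cases \<eta>)
    have ac: "a \<in> carrier (tpow R C n)" and bc: "b \<in> carrier (tpow R C n)"
      using is_grading_closed[OF gr \<gamma> a] is_grading_closed[OF gr \<eta> b] by (simp_all add: s)
    have \<gamma>\<eta>: "\<gamma> \<otimes>\<^bsub>?W\<^esub> \<eta> \<in> carrier ?W" using \<gamma> \<eta> by (rule W.m_closed)
    \<comment> \<open>A component outside the base group is zero, so the product vanishes unless
      both degrees lie in the base group. There the claim is inherited from the wreath product over
      the identity permutation.\<close>
    consider "a = \<zero>\<^bsub>tpow R C n\<^esub>" | "b = \<zero>\<^bsub>tpow R C n\<^esub>" | "\<sigma> = id" "\<tau> = id"
      using a b by (auto simp: s split: if_splits)
    then show ?thesis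
    proof cases
      case 1
      then have "a \<otimes>\<^bsub>?D\<^esub> b = \<zero>\<^bsub>tpow R C n\<^esub>" using lin_zero[OF bilin_left[OF C.tp_mult_bilin bc] T T] by (simp add: s)
      then show ?thesis using z[OF \<gamma>\<eta>] by simp
    next
      case 2
      then have "a \<otimes>\<^bsub>?D\<^esub> b = \<zero>\<^bsub>tpow R C n\<^esub>" using lin_zero[OF bilin_right[OF C.tp_mult_bilin ac] T T] by (simp add: s)
      then show ?thesis using z[OF \<gamma>\<eta>] by simp
    next
      case 3
      have a': "wr_elem R C n a id \<in> wr_comp R C n \<gamma>" and b': "wr_elem R C n b id \<in> wr_comp R C n \<eta>"
        using a b 3 by (simp_all add: s wr_comp_def)
      have "wr_op R C C n (mult C) (wr_elem R C n a id) (wr_elem R C n b id) \<in> wr_comp R C n (\<gamma> \<otimes>\<^bsub>?W\<^esub> \<eta>)"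
        by (rule wr_op_comp[OF m C.grading m C.grading m C.grading C.mult_bilin C.\<Gamma>.group_axioms _ \<gamma> \<eta> a' b'])
          (rule C.gcomp_mult)
      then have "wr_elem R C n (tp_op R C n (mult C) a b) id \<in> wr_comp R C n (\<gamma> \<otimes>\<^bsub>?W\<^esub> \<eta>)"
        by (simp add: C.tp_mult_wr[OF ac bc])
      then obtain t where t: "t \<in> tp_comp R C n (fst (\<gamma> \<otimes>\<^bsub>?W\<^esub> \<eta>))" "wr_elem R C n (tp_op R C n (mult C) a b) id = wr_elem R C n t id"
        using 3 by (auto simp: wr_comp_def wreath_simps)
      show ?thesis using t(1) wr_elem_inj[OF perm_id t(2)] 3 by (simp add: s wreath_simps)
    qed
  qed
  have ga: "graded_algebra R ?W ?D"
    by (rule graded_algebra.intro[OF alg W.group_axioms], rule graded_algebra_axioms.intro[OF wreath_group_finite[OF C.finite_\<Gamma>] gr gm])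
  have AC: "lin R (tpow R C n) (tpow R C n) (act ?D (g, \<sigma>))"
    and AP: "\<And>x. (\<And>i. i \<in> {1..n} \<Longrightarrow> x i \<in> carrier C) \<Longrightarrow>
      act ?D (g, \<sigma>) (pure R C n x) = pure R C n (\<lambda>i. act C (g i) (x (inv' \<sigma> i)))"
    if "(g, \<sigma>) \<in> carrier ?W" for g \<sigma>
  proof -
    have g: "g \<in> {1..n} \<rightarrow>\<^sub>E carrier H" and \<sigma>: "\<sigma> permutes {1..n}" using that by (simp_all add: wreath_simps sym_group_carrier)
    note M = tp_map[where f="\<lambda>i. act C (g i)", OF m m permutes_inv[OF \<sigma>] al[OF PiE_mem[OF g]]]
    show "lin R (tpow R C n) (tpow R C n) (act ?D (g, \<sigma>))" unfolding s by (rule M(1))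
    fix x assume x: "\<And>i. i \<in> {1..n} \<Longrightarrow> x i \<in> carrier C"
    show "act ?D (g, \<sigma>) (pure R C n x) = pure R C n (\<lambda>i. act C (g i) (x (inv' \<sigma> i)))" unfolding s by (rule M(2)) (simp_all add: x)
  qed
  have ac: "act C g x \<in> carrier C" if "g \<in> carrier H" "x \<in> carrier C" for g x by (rule lin_closed[OF al[OF that(1)] that(2)])
  show ?thesis
  proof (rule graded_acted_algebra.intro[OF ga], rule graded_acted_algebra_axioms.intro)
    fix \<gamma> assume \<gamma>: "\<gamma> \<in> carrier ?W"
    obtain g \<sigma> where g: "\<gamma> = (g, \<sigma>)" by (cases \<gamma>)
    have gc: "g \<in> {1..n} \<rightarrow>\<^sub>E carrier H" and \<sigma>: "\<sigma> permutes {1..n}" and \<sigma>': "\<sigma> \<in> perms n"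
      using \<gamma> by (simp_all add: g wreath_simps sym_group_carrier)
    note L = AC[OF \<gamma>[unfolded g]]
    note P = AP[OF \<gamma>[unfolded g]]
    show "act ?D \<gamma> \<in> ring_hom ?D ?D"
    proof (rule ring_hom_memI)
      fix x y assume x: "x \<in> carrier ?D" and y: "y \<in> carrier ?D"
      show "act ?D \<gamma> x \<in> carrier ?D" using lin_closed[OF L] x by (simp add: g s(1))
      show "act ?D \<gamma> (x \<oplus>\<^bsub>?D\<^esub> y) = act ?D \<gamma> x \<oplus>\<^bsub>?D\<^esub> act ?D \<gamma> y" using lin_add[OF L] x y by (simp add: g s(1,3))
      show "act ?D \<gamma> (x \<otimes>\<^bsub>?D\<^esub> y) = act ?D \<gamma> x \<otimes>\<^bsub>?D\<^esub> act ?D \<gamma> y"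
        unfolding g s
      proof (rule tp_map_mult[where f="\<lambda>i. act C (g i)", OF m m C.mult_bilin C.mult_bilin permutes_inv[OF \<sigma>] al[OF PiE_mem[OF gc]]])
        fix i x y assume "i \<in> {1..n}" "x \<in> carrier C" "y \<in> carrier C"
        then show "act C (g i) (x \<otimes>\<^bsub>C\<^esub> y) = act C (g i) x \<otimes>\<^bsub>C\<^esub> act C (g i) y"
          by (intro ring_hom_mult[OF C.act_ring_hom[OF PiE_mem[OF gc]]])
      qed (use x y in \<open>simp_all add: s\<close>)
    next
      have "pure R C n (\<lambda>i. act C (g i) \<one>\<^bsub>C\<^esub>) = pure R C n (\<lambda>_. \<one>\<^bsub>C\<^esub>)"
        by (rule pure_cong) (rule ring_hom_one[OF C.act_ring_hom[OF PiE_mem[OF gc]]])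
      then show "act ?D \<gamma> \<one>\<^bsub>?D\<^esub> = \<one>\<^bsub>?D\<^esub>" using P[of "\<lambda>_. \<one>\<^bsub>C\<^esub>"] by (simp add: g s(6))
    qed
    fix r c assume "r \<in> carrier R" "c \<in> carrier ?D"
    then show "act ?D \<gamma> (r \<odot>\<^bsub>?D\<^esub> c) = r \<odot>\<^bsub>?D\<^esub> act ?D \<gamma> c" using lin_smult[OF L] by (simp add: g s(1,4))
  next
    fix c assume c: "c \<in> carrier ?D"
    have o: "((\<lambda>i\<in>{1..n}. \<one>\<^bsub>H\<^esub>), id) \<in> carrier ?W" using W.one_closed by (simp add: wreath_simps(2))
    show "act ?D \<one>\<^bsub>?W\<^esub> c = c" unfolding wreath_simps(2)
    proof (rule tpow_eqI[OF m T AC[OF o] lin_ident])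
      fix x assume x: "x \<in> tp_fam C n"
      have "pure R C n (\<lambda>i. act C ((\<lambda>i\<in>{1..n}. \<one>\<^bsub>H\<^esub>) i) (x (inv' id i))) = pure R C n x"
        by (rule pure_cong) (simp add: C.act_one tp_fam_mem[OF x])
      then show "act ?D ((\<lambda>i\<in>{1..n}. \<one>\<^bsub>H\<^esub>), id) (pure R C n x) = pure R C n x"
        using AP[OF o tp_fam_mem[OF x]] by simp
    qed (use c in \<open>simp add: s\<close>)
  next
    fix \<gamma> \<eta> c assume \<gamma>: "\<gamma> \<in> carrier ?W" and \<eta>: "\<eta> \<in> carrier ?W" and c: "c \<in> carrier ?D"
    obtain g \<sigma> where g: "\<gamma> = (g, \<sigma>)" by (cases \<gamma>)
    obtain h \<tau> where h: "\<eta> = (h, \<tau>)" by (cases \<eta>)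
    have gc: "g \<in> {1..n} \<rightarrow>\<^sub>E carrier H" "h \<in> {1..n} \<rightarrow>\<^sub>E carrier H" and \<sigma>: "\<sigma> \<in> perms n" and \<tau>: "\<tau> \<in> perms n"
      using \<gamma> \<eta> by (simp_all add: g h wreath_simps)
    have gh: "(\<lambda>i\<in>{1..n}. g i \<otimes>\<^bsub>H\<^esub> h (inv' \<sigma> i), \<sigma> \<circ> \<tau>) \<in> carrier ?W"
      using W.m_closed[OF \<gamma> \<eta>] by (simp add: g h wreath_simps(3))
    note im = perm_inv_mem[OF \<sigma>] and jm = perm_inv_mem[OF \<tau>]
    show "act ?D (\<gamma> \<otimes>\<^bsub>?W\<^esub> \<eta>) c = act ?D \<gamma> (act ?D \<eta> c)" unfolding g h wreath_simps(3)
    proof (rule tpow_eqI[OF m T AC[OF gh] lin_comp[OF AC[OF \<eta>[unfolded h]] AC[OF \<gamma>[unfolded g]]]])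
      fix x assume x: "x \<in> tp_fam C n"
      note xm = tp_fam_mem[OF x]
      have hx: "act C (h i) (x (inv' \<tau> i)) \<in> carrier C" if "i \<in> {1..n}" for i
        by (rule ac[OF PiE_mem[OF gc(2) that] xm[OF jm[OF that]]])
      have "act ?D (g, \<sigma>) (act ?D (h, \<tau>) (pure R C n x)) =
          pure R C n (\<lambda>i. act C (g i) (act C (h (inv' \<sigma> i)) (x (inv' \<tau> (inv' \<sigma> i)))))"
        using AP[OF \<eta>[unfolded h] xm] AP[OF \<gamma>[unfolded g] hx] by simp
      also have "\<dots> = pure R C n (\<lambda>i. act C ((\<lambda>i\<in>{1..n}. g i \<otimes>\<^bsub>H\<^esub> h (inv' \<sigma> i)) i) (x (inv' (\<sigma> \<circ> \<tau>) i)))"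
        by (rule pure_cong)
          (simp add: perm_inv_comp[OF \<sigma> \<tau>] C.act_mult[OF PiE_mem[OF gc(1)] PiE_mem[OF gc(2) im] xm[OF jm[OF im]]])
      also have "\<dots> = act ?D (\<lambda>i\<in>{1..n}. g i \<otimes>\<^bsub>H\<^esub> h (inv' \<sigma> i), \<sigma> \<circ> \<tau>) (pure R C n x)"
        by (rule AP[OF gh xm, symmetric])
      finally show "act ?D (\<lambda>i\<in>{1..n}. g i \<otimes>\<^bsub>H\<^esub> h (inv' \<sigma> i), \<sigma> \<circ> \<tau>) (pure R C n x) =
        act ?D (g, \<sigma>) (act ?D (h, \<tau>) (pure R C n x))" ..
    qed (use c in \<open>simp add: s\<close>)
  next
    fix \<gamma> \<eta> c assume \<gamma>: "\<gamma> \<in> carrier ?W" and \<eta>: "\<eta> \<in> carrier ?W" and c: "c \<in> gcomp ?D \<eta>"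
    obtain g \<sigma> where g: "\<gamma> = (g, \<sigma>)" by (cases \<gamma>)
    obtain h \<tau> where h: "\<eta> = (h, \<tau>)" by (cases \<eta>)
    have gc: "g \<in> {1..n} \<rightarrow>\<^sub>E carrier H" "h \<in> {1..n} \<rightarrow>\<^sub>E carrier H" and \<sigma>: "\<sigma> \<in> perms n"
      using \<gamma> \<eta> by (simp_all add: g h wreath_simps)
    note im = perm_inv_mem[OF \<sigma>]
    note L = AC[OF \<gamma>[unfolded g]]
    have conj: "\<gamma> \<otimes>\<^bsub>?W\<^esub> \<eta> \<otimes>\<^bsub>?W\<^esub> inv\<^bsub>?W\<^esub> \<gamma> \<in> carrier ?W" using \<gamma> \<eta> by simp
    show "act ?D \<gamma> c \<in> gcomp ?D (\<gamma> \<otimes>\<^bsub>?W\<^esub> \<eta> \<otimes>\<^bsub>?W\<^esub> inv\<^bsub>?W\<^esub> \<gamma>)"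
    proof (cases "\<tau> = id")
      case False
      then have "c = \<zero>\<^bsub>tpow R C n\<^esub>" using c by (simp add: h s)
      then have "act ?D \<gamma> c = \<zero>\<^bsub>tpow R C n\<^esub>" using lin_zero[OF L T T] by (simp add: g)
      then show ?thesis using z[OF conj] by simp
    next
      case True
      \<comment> \<open>The base entries of the conjugate of \<open>(h, id)\<close> by
        \<open>(g, \<sigma>)\<close>. The identity
        \<open>\<gamma> \<eta> = (?k, id) \<gamma>\<close> is checked instead, which avoids an
        explicit formula for the inverse of \<gamma>.\<close>
      let ?k = "\<lambda>i\<in>{1..n}. g i \<otimes>\<^bsub>H\<^esub> h (inv' \<sigma> i) \<otimes>\<^bsub>H\<^esub> inv\<^bsub>H\<^esub> (g i)"
      have k: "?k \<in> {1..n} \<rightarrow>\<^sub>E carrier H"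
        using PiE_mem[OF gc(1)] PiE_mem[OF gc(2) im] by (simp add: restrict_PiE_iff)
      have kc: "(?k, id) \<in> carrier ?W" using k by (simp add: wreath_simps perm_id)
      have "(\<lambda>i\<in>{1..n}. ?k i \<otimes>\<^bsub>H\<^esub> g (inv' id i)) = (\<lambda>i\<in>{1..n}. g i \<otimes>\<^bsub>H\<^esub> h (inv' \<sigma> i))"
        using PiE_mem[OF gc(1)] PiE_mem[OF gc(2) im] by (intro restrict_ext) (simp add: C.\<Gamma>.m_assoc)
      then have e: "\<gamma> \<otimes>\<^bsub>?W\<^esub> \<eta> = (?k, id) \<otimes>\<^bsub>?W\<^esub> \<gamma>" by (simp add: g h True wreath_simps(3))
      have ke: "\<gamma> \<otimes>\<^bsub>?W\<^esub> \<eta> \<otimes>\<^bsub>?W\<^esub> inv\<^bsub>?W\<^esub> \<gamma> = (?k, id)"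
        unfolding e using W.inv_solve_right'[OF kc W.m_closed[OF kc \<gamma>] \<gamma>] W.m_assoc[OF kc \<gamma> W.inv_closed[OF \<gamma>]]
          W.r_inv[OF \<gamma>] W.r_one[OF kc] by simp
      have c': "c \<in> tp_comp R C n h" using c True by (simp add: h s)
      have "act ?D (g, \<sigma>) c \<in> tp_comp R C n ?k"
      proof (rule tp_comp_lin_mem[OF m C.grading gc(2) L T tp_comp_submodule[OF m C.grading k] _ c'])
        fix x assume x: "\<And>i. i \<in> {1..n} \<Longrightarrow> x i \<in> gcomp C (h i)"
        have xc: "x i \<in> carrier C" if "i \<in> {1..n}" for i by (rule C.gcomp_closed[OF PiE_mem[OF gc(2) that] x[OF that]])
        have e: "act ?D (g, \<sigma>) (pure R C n x) = pure R C n (\<lambda>i. act C (g i) (x (inv' \<sigma> i)))"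
          by (rule AP[OF \<gamma>[unfolded g]]) (rule xc)
        show "act ?D (g, \<sigma>) (pure R C n x) \<in> tp_comp R C n ?k" unfolding e
          by (rule pure_in_tp_comp) (simp add: C.act_gcomp[OF PiE_mem[OF gc(1)] PiE_mem[OF gc(2) im] x[OF im]])
      qed
      then show ?thesis unfolding ke by (simp add: s g)
    qed
  qed
qed


lemma wr_algebra_over:
  fixes A :: "('r, 'a, 'g, 'c) algebra_over" and C :: "('r, 'c, 'g) acted_algebra"
  assumes "crossed_product_over R H C A"
  shows "crossed_product_over R (wreath_group H n) (tpow_acted R C n) (wr_algebra R A n)"
proof -
  interpret A: crossed_product_over R H C A by fact
  let ?D = "tpow_acted R C n" and ?W = "wreath_group H n" and ?A = "wr_algebra R A n"
  have gD: "graded_acted_algebra R ?W ?D" by (rule tpow_acted_graded_acted[OF A.D.graded_acted_algebra_axioms])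
  have cA: "crossed_product R ?W ?A" by (rule wr_algebra_crossed[OF A.crossed_product_axioms])
  interpret Aw: crossed_product R ?W ?A by (rule cA)
  interpret D: graded_acted_algebra R ?W ?D by (rule gD)
  note mA = A.module_axioms and mC = A.D.module_axioms
  have zl: "lin R C A (smap A)"
    using A.smap_ring_hom A.smap_smult by (intro linI) (simp_all add: ring_hom_closed ring_hom_add)
  have al: "lin R C C (act C g)" if "g \<in> carrier H" for g
    using A.D.act_ring_hom[OF that] A.D.act_smult[OF that] by (intro linI) (simp_all add: ring_hom_closed ring_hom_add)
  note Z = tp_map_id[OF mC mA zl]
  have zc: "tp_map R A n (\<lambda>x i. smap A (x i)) c \<in> carrier (tpow R A n)" if "c \<in> carrier (tpow R C n)" for c
    by (rule lin_closed[OF Z(1) that])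
  note el = wr_elem_lin[OF mA]
  have sl: "lin R ?D ?A (smap ?A)"
    unfolding same_mod_lin[OF tpow_acted_same] same_mod_lin'[OF wr_algebra_same] wr_algebra_simps
    by (rule lin_comp[OF Z(1) el])
  \<comment> \<open>Two axioms follow from this relation. In the identity degree, where the action
    is trivial, it says that the structure map has values in the centralizer; for a unit
    \<open>m\<close>, multiplying by its inverse on the right gives the compatibility with the
    action.\<close>
  have comm: "m \<otimes>\<^bsub>?A\<^esub> smap ?A c = smap ?A (act ?D \<gamma> c) \<otimes>\<^bsub>?A\<^esub> m"
    if \<gamma>: "\<gamma> \<in> carrier ?W" and m: "m \<in> gcomp ?A \<gamma>" and c: "c \<in> carrier ?D" for \<gamma> m c
  proof -
    obtain g \<sigma> where g: "\<gamma> = (g, \<sigma>)" by (cases \<gamma>)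
    show ?thesis unfolding g wr_algebra_simps tpow_acted_simps
    proof (rule wr_smap_commute[where a="act C", OF mA mA mA A.grading mC A.mult_bilin A.mult_bilin zl zl al])
      show "(g, \<sigma>) \<in> carrier ?W" "m \<in> wr_comp R A n (g, \<sigma>)" "c \<in> carrier (tpow R C n)"
        using \<gamma> m c by (simp_all add: g wr_algebra_simps tpow_acted_simps)
    qed (assumption, rule A.smap_commute)
  qed
  have zone: "smap ?A \<one>\<^bsub>?D\<^esub> = \<one>\<^bsub>?A\<^esub>"
  proof -
    have "pure R A n (\<lambda>_. smap A \<one>\<^bsub>C\<^esub>) = pure R A n (\<lambda>_. \<one>\<^bsub>A\<^esub>)"
      by (rule pure_cong) (rule ring_hom_one[OF A.smap_ring_hom])
    then show ?thesis using Z(2)[of n "\<lambda>_. \<one>\<^bsub>C\<^esub>"] by (simp add: wr_algebra_simps tpow_acted_simps)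
  qed
  show ?thesis
  proof (rule crossed_product_over.intro[OF cA gD], rule crossed_product_over_axioms.intro)
    show "smap ?A \<in> ring_hom ?D ?A"
    proof (rule ring_hom_memI)
      fix x y assume x: "x \<in> carrier ?D" and y: "y \<in> carrier ?D"
      show "smap ?A x \<in> carrier ?A" by (rule lin_closed[OF sl x])
      show "smap ?A (x \<oplus>\<^bsub>?D\<^esub> y) = smap ?A x \<oplus>\<^bsub>?A\<^esub> smap ?A y" by (rule lin_add[OF sl x y])
      have x': "x \<in> carrier (tpow R C n)" and y': "y \<in> carrier (tpow R C n)" using x y by (simp_all add: tpow_acted_simps)
      have "tp_map R A n (\<lambda>x i. smap A (x i)) (tp_op R C n (mult C) x y) =
        tp_op R A n (mult A) (tp_map R A n (\<lambda>x i. smap A (x i)) x) (tp_map R A n (\<lambda>x i. smap A (x i)) y)"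
        by (rule tp_map_mult[where \<pi>=id and f="\<lambda>_. smap A",
            OF mC mA A.D.mult_bilin A.mult_bilin permutes_id zl _ x' y', unfolded id_apply])
          (rule ring_hom_mult[OF A.smap_ring_hom])
      then show "smap ?A (x \<otimes>\<^bsub>?D\<^esub> y) = smap ?A x \<otimes>\<^bsub>?A\<^esub> smap ?A y"
        unfolding wr_algebra_simps tpow_acted_simps A.tp_mult_wr[OF zc[OF x'] zc[OF y']] by (simp only:)
    qed (rule zone)
  next
    fix r c assume r: "r \<in> carrier R" and c: "c \<in> carrier ?D"
    show "smap ?A (r \<odot>\<^bsub>?D\<^esub> c) = r \<odot>\<^bsub>?A\<^esub> smap ?A c" by (rule lin_smult[OF sl r c])
  next
    fix c assume c: "c \<in> carrier ?D"
    show "smap ?A c \<in> centralizer ?A (gcomp ?A \<one>\<^bsub>?W\<^esub>)"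
      using comm[OF Aw.\<Gamma>.one_closed _ c] lin_closed[OF sl c] by (simp add: centralizer_def D.act_one[OF c])
  next
    fix \<gamma> c assume \<gamma>: "\<gamma> \<in> carrier ?W" and c: "c \<in> gcomp ?D \<gamma>"
    obtain g \<sigma> where g: "\<gamma> = (g, \<sigma>)" by (cases \<gamma>)
    have gc: "g \<in> {1..n} \<rightarrow>\<^sub>E carrier H" using \<gamma> by (simp add: g wreath_simps)
    show "smap ?A c \<in> gcomp ?A \<gamma>"
    proof (cases "\<sigma> = id")
      case True
      then have c': "c \<in> tp_comp R C n g" using c by (simp add: g tpow_acted_simps)
      have "tp_map R A n (\<lambda>x i. smap A (x i)) c \<in> tp_comp R A n g"
      proof (rule tp_comp_lin_mem[OF mC A.D.grading gc Z(1) tpow_module[OF mA] tp_comp_submodule[OF mA A.grading gc] _ c'])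
        fix x assume x: "\<And>i. i \<in> {1..n} \<Longrightarrow> x i \<in> gcomp C (g i)"
        have xc: "x i \<in> carrier C" if "i \<in> {1..n}" for i by (rule A.D.gcomp_closed[OF PiE_mem[OF gc that] x[OF that]])
        have e: "tp_map R A n (\<lambda>x i. smap A (x i)) (pure R C n x) = pure R A n (\<lambda>i. smap A (x i))"
          by (rule Z(2)) (rule xc)
        show "tp_map R A n (\<lambda>x i. smap A (x i)) (pure R C n x) \<in> tp_comp R A n g"
          unfolding e by (rule pure_in_tp_comp) (rule A.smap_gcomp[OF PiE_mem[OF gc] x])
      qed
      then show ?thesis unfolding g True wr_algebra_simps wr_comp_def by simp
    next
      case False
      then have "c = \<zero>\<^bsub>?D\<^esub>" using c by (simp add: g tpow_acted_simps)
      then have "smap ?A c = \<zero>\<^bsub>?A\<^esub>" using lin_zero[OF sl D.module_axioms Aw.module_axioms] by simp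
      then show ?thesis using submodule_zero[OF is_grading_submodule[OF Aw.grading \<gamma>]] by simp
    qed
  next
    fix \<gamma> c u assume \<gamma>: "\<gamma> \<in> carrier ?W" and c: "c \<in> carrier ?D" and u: "u \<in> gcomp ?A \<gamma> \<inter> Units ?A"
    have U: "u \<in> Units ?A" and ug: "u \<in> gcomp ?A \<gamma>" using u by blast+
    have ac: "act ?D \<gamma> c \<in> carrier ?D" by (rule ring_hom_closed[OF D.act_ring_hom[OF \<gamma>] c])
    have zac: "smap ?A (act ?D \<gamma> c) \<in> carrier ?A" by (rule lin_closed[OF sl ac])
    have "u \<otimes>\<^bsub>?A\<^esub> smap ?A c \<otimes>\<^bsub>?A\<^esub> inv\<^bsub>?A\<^esub> u = smap ?A (act ?D \<gamma> c) \<otimes>\<^bsub>?A\<^esub> u \<otimes>\<^bsub>?A\<^esub> inv\<^bsub>?A\<^esub> u"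
      by (simp only: comm[OF \<gamma> ug c])
    also have "\<dots> = smap ?A (act ?D \<gamma> c) \<otimes>\<^bsub>?A\<^esub> (u \<otimes>\<^bsub>?A\<^esub> inv\<^bsub>?A\<^esub> u)"
      by (rule Aw.m_assoc[OF zac Aw.Units_closed[OF U] Aw.Units_inv_closed[OF U]])
    also have "\<dots> = smap ?A (act ?D \<gamma> c)" by (simp only: Aw.Units_r_inv[OF U] Aw.r_one[OF zac])
    finally show "smap ?A (act ?D \<gamma> c) = u \<otimes>\<^bsub>?A\<^esub> smap ?A c \<otimes>\<^bsub>?A\<^esub> inv\<^bsub>?A\<^esub> u" ..
  qed
qed

section \<open>The wreath product of a graded bimodule\<close>

text \<open>Combinations with one coefficient for each generator form a submodule, so the finite
  generation of the locale can be treated as a statement about spans. The operation \<open>l\<close>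
  is arbitrary, so that the right action is covered after exchanging its arguments.\<close>

lemma fg_span:
  assumes M: "module R M" and A: "module R A" and l: "bilin R A M M l" and F: "finite F" "F \<subseteq> carrier M"
  shows "(\<forall>m\<in>carrier M. \<exists>c\<in>F \<rightarrow> carrier A. m = (\<Oplus>\<^bsub>M\<^esub>x\<in>F. l (c x) x)) \<longleftrightarrow>
    carrier M \<subseteq> mspan R M {l a x | a x. a \<in> carrier A \<and> x \<in> F}"
proof -
  interpret M: module R M by fact
  interpret A: module R A by fact
  let ?S = "{l a x | a x. a \<in> carrier A \<and> x \<in> F}"
  have cl: "l a x \<in> carrier M" if "a \<in> carrier A" "x \<in> F" for a x
    using bilin_closed[OF l that(1)] F(2) that(2) by blast
  have S: "?S \<subseteq> carrier M" using cl by blast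
  let ?H = "{m. \<exists>c\<in>F \<rightarrow> carrier A. m = (\<Oplus>\<^bsub>M\<^esub>x\<in>F. l (c x) x)}"
  have ll: "lin R A M (\<lambda>a. l a x)" if "x \<in> F" for x using bilin_left[OF l] F(2) that by blast
  have H: "submodule ?H R M"
  proof (rule submoduleI'[OF M])
    show "?H \<subseteq> carrier M"
    proof (rule subsetI, elim CollectE bexE)
      fix m c assume c: "c \<in> F \<rightarrow> carrier A" and m: "m = (\<Oplus>\<^bsub>M\<^esub>x\<in>F. l (c x) x)"
      show "m \<in> carrier M" unfolding m using c cl by (intro M.M.finsum_closed funcsetI) (simp add: Pi_iff)
    qed
    have "(\<Oplus>\<^bsub>M\<^esub>x\<in>F. l \<zero>\<^bsub>A\<^esub> x) = (\<Oplus>\<^bsub>M\<^esub>x\<in>F. \<zero>\<^bsub>M\<^esub>)"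
      by (rule M.M.finsum_cong') (simp_all add: lin_zero[OF ll A M])
    then show "\<zero>\<^bsub>M\<^esub> \<in> ?H" by (intro CollectI bexI[of _ "\<lambda>_. \<zero>\<^bsub>A\<^esub>"]) simp_all
  next
    fix m m' assume "m \<in> ?H" "m' \<in> ?H"
    then obtain c c' where c: "c \<in> F \<rightarrow> carrier A" "m = (\<Oplus>\<^bsub>M\<^esub>x\<in>F. l (c x) x)"
      and c': "c' \<in> F \<rightarrow> carrier A" "m' = (\<Oplus>\<^bsub>M\<^esub>x\<in>F. l (c' x) x)" by blast
    have "m \<oplus>\<^bsub>M\<^esub> m' = (\<Oplus>\<^bsub>M\<^esub>x\<in>F. l (c x) x \<oplus>\<^bsub>M\<^esub> l (c' x) x)"
      unfolding c(2) c'(2) using c(1) c'(1) cl by (intro M.M.finsum_addf[symmetric] funcsetI) (simp_all add: Pi_iff)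
    also have "\<dots> = (\<Oplus>\<^bsub>M\<^esub>x\<in>F. l (c x \<oplus>\<^bsub>A\<^esub> c' x) x)"
      using c(1) c'(1) cl by (intro M.M.finsum_cong') (simp_all add: Pi_iff lin_add[OF ll])
    finally show "m \<oplus>\<^bsub>M\<^esub> m' \<in> ?H" using c(1) c'(1)
      by (intro CollectI bexI[of _ "\<lambda>x. c x \<oplus>\<^bsub>A\<^esub> c' x"]) (simp_all add: Pi_iff)
  next
    fix r m assume r: "r \<in> carrier R" and "m \<in> ?H"
    then obtain c where c: "c \<in> F \<rightarrow> carrier A" "m = (\<Oplus>\<^bsub>M\<^esub>x\<in>F. l (c x) x)" by blast
    have "r \<odot>\<^bsub>M\<^esub> m = (\<Oplus>\<^bsub>M\<^esub>x\<in>F. r \<odot>\<^bsub>M\<^esub> l (c x) x)"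
      unfolding c(2) using c(1) cl by (intro M.finsum_smult_ldistr F(1) r funcsetI) (simp add: Pi_iff)
    also have "\<dots> = (\<Oplus>\<^bsub>M\<^esub>x\<in>F. l (r \<odot>\<^bsub>A\<^esub> c x) x)"
      using c(1) cl r by (intro M.M.finsum_cong') (simp_all add: Pi_iff lin_smult[OF ll])
    finally show "r \<odot>\<^bsub>M\<^esub> m \<in> ?H" using c(1) r
      by (intro CollectI bexI[of _ "\<lambda>x. r \<odot>\<^bsub>A\<^esub> c x"]) (simp_all add: Pi_iff)
  qed
  have SH: "?S \<subseteq> ?H"
  proof (rule subsetI, elim CollectE exE conjE)
    fix m a x assume m: "m = l a x" and a: "a \<in> carrier A" and x: "x \<in> F"
    have "(\<Oplus>\<^bsub>M\<^esub>y\<in>F. l (if y = x then a else \<zero>\<^bsub>A\<^esub>) y) = l a x"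
      by (rule finsum_delta[OF M F(1) x cl[OF a x]]) (simp add: lin_zero[OF ll A M])
    then show "m \<in> ?H" unfolding m using a
      by (intro CollectI bexI[of _ "\<lambda>y. if y = x then a else \<zero>\<^bsub>A\<^esub>"]) (simp_all add: Pi_iff)
  qed
  show ?thesis
  proof
    assume h: "\<forall>m\<in>carrier M. \<exists>c\<in>F \<rightarrow> carrier A. m = (\<Oplus>\<^bsub>M\<^esub>x\<in>F. l (c x) x)"
    show "carrier M \<subseteq> mspan R M ?S"
    proof
      fix m assume "m \<in> carrier M"
      then obtain c where c: "c \<in> F \<rightarrow> carrier A" "m = (\<Oplus>\<^bsub>M\<^esub>x\<in>F. l (c x) x)" using h by blast
      show "m \<in> mspan R M ?S" unfolding c(2)
        by (rule submodule_finsum[OF mspan_submodule[OF M S] M mspan_base]) (use c(1) in blast)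
    qed
  next
    assume "carrier M \<subseteq> mspan R M ?S"
    then have "carrier M \<subseteq> ?H" using mspan_least[OF H SH] by (rule subset_trans)
    then show "\<forall>m\<in>carrier M. \<exists>c\<in>F \<rightarrow> carrier A. m = (\<Oplus>\<^bsub>M\<^esub>x\<in>F. l (c x) x)" by blast
  qed
qed

context algebra_bimodule
begin

lemma lact_bilin: "bilin R A M M (lact M)"
  by (intro bilinI linI) (simp_all add: lact_closed lact_add_left lact_add_right lact_smult_left lact_smult_right)

lemma ract_bilin: "bilin R M A' M (ract M)"
  by (intro bilinI linI) (simp_all add: ract_closed ract_add_left ract_add_right ract_smult_left ract_smult_right)

lemma ract_bilin': "bilin R A' M M (\<lambda>b m. ract M m b)"
  by (intro bilinI linI) (simp_all add: ract_closed ract_add_left ract_add_right ract_smult_left ract_smult_right)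

end

lemma algebra_bimoduleI:
  assumes A: "assoc_algebra R A" and A': "assoc_algebra R A'" and M: "module R M"
    and l: "bilin R A M M (lact M)" and r: "bilin R M A' M (ract M)"
    and "\<And>a a' m. a \<in> carrier A \<Longrightarrow> a' \<in> carrier A \<Longrightarrow> m \<in> carrier M \<Longrightarrow> lact M (a \<otimes>\<^bsub>A\<^esub> a') m = lact M a (lact M a' m)"
    and "\<And>m. m \<in> carrier M \<Longrightarrow> lact M \<one>\<^bsub>A\<^esub> m = m"
    and "\<And>m b b'. m \<in> carrier M \<Longrightarrow> b \<in> carrier A' \<Longrightarrow> b' \<in> carrier A' \<Longrightarrow> ract M m (b \<otimes>\<^bsub>A'\<^esub> b') = ract M (ract M m b) b'"
    and "\<And>m. m \<in> carrier M \<Longrightarrow> ract M m \<one>\<^bsub>A'\<^esub> = m"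
    and "\<And>a m b. a \<in> carrier A \<Longrightarrow> m \<in> carrier M \<Longrightarrow> b \<in> carrier A' \<Longrightarrow> ract M (lact M a m) b = lact M a (ract M m b)"
    and lfg: "\<exists>F. finite F \<and> F \<subseteq> carrier M \<and> carrier M \<subseteq> mspan R M {lact M a x | a x. a \<in> carrier A \<and> x \<in> F}"
    and rfg: "\<exists>F. finite F \<and> F \<subseteq> carrier M \<and> carrier M \<subseteq> mspan R M {ract M x b | b x. b \<in> carrier A' \<and> x \<in> F}"
  shows "algebra_bimodule R A A' M"
proof (rule algebra_bimodule.intro[OF A A' M])
  have r': "bilin R A' M M (\<lambda>b m. ract M m b)" using r by (simp add: bilin_def conj_commute)
  note mA = assoc_algebra.axioms(1)[OF A] and mA' = assoc_algebra.axioms(1)[OF A']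
  show "algebra_bimodule_axioms R A A' M"
  proof (rule algebra_bimodule_axioms.intro)
    obtain F where F: "finite F" "F \<subseteq> carrier M" "carrier M \<subseteq> mspan R M {lact M a x | a x. a \<in> carrier A \<and> x \<in> F}"
      using lfg by blast
    show "\<exists>F. finite F \<and> F \<subseteq> carrier M \<and> (\<forall>m\<in>carrier M. \<exists>c\<in>F \<rightarrow> carrier A. m = (\<Oplus>\<^bsub>M\<^esub>x\<in>F. lact M (c x) x))"
      using iffD2[OF fg_span[OF M mA l F(1,2)] F(3)] F(1,2) by blast
    obtain F where F: "finite F" "F \<subseteq> carrier M" "carrier M \<subseteq> mspan R M {ract M x b | b x. b \<in> carrier A' \<and> x \<in> F}"
      using rfg by blast
    show "\<exists>F. finite F \<and> F \<subseteq> carrier M \<and> (\<forall>m\<in>carrier M. \<exists>c\<in>F \<rightarrow> carrier A'. m = (\<Oplus>\<^bsub>M\<^esub>x\<in>F. ract M x (c x)))"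
      using iffD2[OF fg_span[OF M mA' r' F(1,2)] F(3)] F(1,2) by blast
  qed (simp_all add: assms(6-10) bilin_closed[OF l] bilin_closed[OF r]
      lin_add[OF bilin_left[OF l]] lin_add[OF bilin_right[OF l]] lin_smult[OF bilin_left[OF l]] lin_smult[OF bilin_right[OF l]]
      lin_add[OF bilin_left[OF r]] lin_add[OF bilin_right[OF r]] lin_smult[OF bilin_left[OF r]] lin_smult[OF bilin_right[OF r]])
qed

lemma (in algebra_bimodule) fg_mspan:
  shows "\<exists>F. finite F \<and> F \<subseteq> carrier M \<and> carrier M \<subseteq> mspan R M {lact M a x | a x. a \<in> carrier A \<and> x \<in> F}"
    and "\<exists>F. finite F \<and> F \<subseteq> carrier M \<and> carrier M \<subseteq> mspan R M {ract M x b | b x. b \<in> carrier A' \<and> x \<in> F}"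
proof -
  obtain F where F: "finite F" "F \<subseteq> carrier M" "\<forall>m\<in>carrier M. \<exists>c\<in>F \<rightarrow> carrier A. m = (\<Oplus>\<^bsub>M\<^esub>x\<in>F. lact M (c x) x)"
    using left_fg by blast
  show "\<exists>F. finite F \<and> F \<subseteq> carrier M \<and> carrier M \<subseteq> mspan R M {lact M a x | a x. a \<in> carrier A \<and> x \<in> F}"
    using iffD1[OF fg_span[OF module_axioms A.module_axioms lact_bilin F(1,2)] F(3)] F(1,2) by blast
  obtain F where F: "finite F" "F \<subseteq> carrier M" "\<forall>m\<in>carrier M. \<exists>c\<in>F \<rightarrow> carrier A'. m = (\<Oplus>\<^bsub>M\<^esub>x\<in>F. ract M x (c x))"
    using right_fg by blast
  show "\<exists>F. finite F \<and> F \<subseteq> carrier M \<and> carrier M \<subseteq> mspan R M {ract M x b | b x. b \<in> carrier A' \<and> x \<in> F}"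
    using iffD1[OF fg_span[OF module_axioms A'.module_axioms ract_bilin' F(1,2)] F(3)] F(1,2) by blast
qed

text \<open>Here the factors are further restricted to a spanning subset of \<open>M\<close>, which
  \<open>multilin_span\<close> permits.\<close>

lemma wr_span:
  assumes M: "module R M" and K: "submodule K R (wr_mod R M n)" and S: "carrier M \<subseteq> mspan R M S" "S \<subseteq> carrier M"
    and h: "\<And>x \<sigma>. (\<And>i. i \<in> {1..n} \<Longrightarrow> x i \<in> S) \<Longrightarrow> \<sigma> \<in> perms n \<Longrightarrow> wr_pure R M n x \<sigma> \<in> K"
    and w: "w \<in> carrier (wr_mod R M n)"
  shows "w \<in> K"
proof (rule wr_mod_induct[OF M K _ w])
  fix x \<sigma> assume x: "x \<in> tp_fam M n" and \<sigma>: "\<sigma> \<in> perms n"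
  note el = wr_elem_lin[OF M]
  have "pure R M n x \<in> {t \<in> carrier (tpow R M n). wr_elem R M n t \<sigma> \<in> K}"
  proof (rule multilin_span[OF M tpow_module[OF M] pure_multilin[OF M]
      lin_vimage_submodule[OF el tpow_module[OF M] wr_mod_module[OF M] K] S(2) _ x])
    show "x i \<in> mspan R M S" if "i \<in> {1..n}" for i using tp_fam_mem[OF x that] S(1) by blast
    fix y assume y: "y \<in> {1..n} \<rightarrow>\<^sub>E S"
    have "pure R M n y \<in> carrier (tpow R M n)"
      by (rule pure_closed[OF M]) (rule subsetD[OF S(2) PiE_mem[OF y]])
    then show "pure R M n y \<in> {t \<in> carrier (tpow R M n). wr_elem R M n t \<sigma> \<in> K}"
      using h[OF PiE_mem[OF y] \<sigma>] by simp
  qed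
  then show "wr_pure R M n x \<sigma> \<in> K" by simp
qed

lemma wr_bimodule_bimodule:
  fixes A :: "('r, 'a, 'g, 'c) algebra_over" and A' :: "('r, 'b, 'g, 'c) algebra_over"
    and M :: "('r, 'm, 'g, 'a, 'b) bimodule"
  assumes "algebra_bimodule R A A' M"
  shows "algebra_bimodule R (wr_algebra R A n) (wr_algebra R A' n) (wr_bimodule R A' M n)"
proof -
  interpret M: algebra_bimodule R A A' M by fact
  let ?A = "wr_algebra R A n" and ?A' = "wr_algebra R A' n" and ?M = "wr_bimodule R A' M n"
  note m = M.module_axioms and mA = M.A.module_axioms and mA' = M.A'.module_axioms
  note W = wr_mod_module[OF m]
  note ss = wr_algebra_simps wr_bimodule_simps
  note L = wr_op_bilin[OF mA m m M.lact_bilin, of n] and Rb = wr_op_bilin[OF m mA' m M.ract_bilin, of n]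
  note el = lin_closed[OF wr_elem_lin]
  show ?thesis
  proof (rule algebra_bimoduleI[OF wr_algebra_assoc[OF M.A.assoc_algebra_axioms] wr_algebra_assoc[OF M.A'.assoc_algebra_axioms]
        same_mod_module[OF wr_bimodule_same W]])
    show "bilin R ?A ?M ?M (lact ?M)"
      unfolding ss same_mod_bilin[OF wr_algebra_same wr_bimodule_same wr_bimodule_same] by (rule L)
    show "bilin R ?M ?A' ?M (ract ?M)"
      unfolding ss same_mod_bilin[OF wr_bimodule_same wr_algebra_same wr_bimodule_same] by (rule Rb)
  next
    fix x assume "x \<in> carrier ?M"
    then have x: "x \<in> carrier (wr_mod R M n)" by (simp add: ss)
    show "lact ?M \<one>\<^bsub>?A\<^esub> x = x" unfolding ss
      by (rule wr_op_unit_left[OF mA m M.lact_bilin M.A.one_closed M.lact_one x])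
    show "ract ?M x \<one>\<^bsub>?A'\<^esub> = x" unfolding ss
      by (rule wr_op_unit_right[OF mA' m M.ract_bilin M.A'.one_closed M.ract_one x])
    fix a assume "a \<in> carrier ?A"
    then have a: "a \<in> carrier (wr_mod R A n)" by (simp add: ss)
    show "lact ?M (a' \<otimes>\<^bsub>?A\<^esub> a) x = lact ?M a' (lact ?M a x)" if "a' \<in> carrier ?A" for a'
      unfolding ss
      by (rule wr_op_assoc[OF mA mA m mA m m M.A.mult_bilin M.lact_bilin M.lact_bilin M.lact_bilin M.lact_mult _ a x])
        (use that in \<open>simp_all add: ss\<close>)
    fix b assume "b \<in> carrier ?A'"
    then have b: "b \<in> carrier (wr_mod R A' n)" by (simp add: ss)
    show "ract ?M (lact ?M a x) b = lact ?M a (ract ?M x b)"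
      unfolding ss
      by (rule wr_op_assoc[OF mA m mA' m m m M.lact_bilin M.ract_bilin M.ract_bilin M.lact_bilin M.lact_ract a x b])
  next
    fix x b b' assume "x \<in> carrier ?M" "b \<in> carrier ?A'" "b' \<in> carrier ?A'"
    then have x: "x \<in> carrier (wr_mod R M n)" and b: "b \<in> carrier (wr_mod R A' n)" "b' \<in> carrier (wr_mod R A' n)"
      by (simp_all add: ss)
    show "ract ?M x (b \<otimes>\<^bsub>?A'\<^esub> b') = ract ?M (ract ?M x b) b'"
      unfolding ss
      by (rule wr_op_assoc[OF m mA' mA' m mA' m M.ract_bilin M.ract_bilin M.A'.mult_bilin M.ract_bilin _ x b, symmetric])
        (rule M.ract_mult[symmetric])
  next
    obtain F where F: "finite F" "F \<subseteq> carrier M" "carrier M \<subseteq> mspan R M {lact M a x | a x. a \<in> carrier A \<and> x \<in> F}"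
      using M.fg_mspan(1) by blast
    \<comment> \<open>Generators over the identity permutation suffice: the other permutations are
      reached by multiplying with elements of the wreath algebra.\<close>
    let ?F = "(\<lambda>x. wr_pure R M n x id) ` ({1..n} \<rightarrow>\<^sub>E F)"
    have Fm: "x i \<in> carrier M" if "x \<in> {1..n} \<rightarrow>\<^sub>E F" "i \<in> {1..n}" for x i by (rule subsetD[OF F(2) PiE_mem[OF that]])
    have Fc: "?F \<subseteq> carrier (wr_mod R M n)"
      by (rule image_subsetI) (rule el[OF m pure_closed[OF m Fm]])
    let ?S = "{wr_op R M M n (lact M) a x |a x. a \<in> carrier (wr_mod R A n) \<and> x \<in> ?F}"
    have S: "?S \<subseteq> carrier (wr_mod R M n)" using bilin_closed[OF L] Fc by blast
    have "carrier (wr_mod R M n) \<subseteq> mspan R (wr_mod R M n) ?S"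
    proof
      fix w assume w: "w \<in> carrier (wr_mod R M n)"
      show "w \<in> mspan R (wr_mod R M n) ?S"
      proof (rule wr_span[OF m mspan_submodule[OF W S] F(3) _ _ w])
        show "{lact M a x | a x. a \<in> carrier A \<and> x \<in> F} \<subseteq> carrier M" using M.lact_closed F(2) by blast
        fix x \<sigma> assume x: "\<And>i. i \<in> {1..n} \<Longrightarrow> x i \<in> {lact M a x | a x. a \<in> carrier A \<and> x \<in> F}"
          and \<sigma>: "\<sigma> \<in> perms n"
        have "\<forall>i\<in>{1..n}. \<exists>p. x i = lact M (fst p) (snd p) \<and> fst p \<in> carrier A \<and> snd p \<in> F" using x by fastforce
        from bchoice[OF this] obtain p where p: "\<forall>i\<in>{1..n}. x i = lact M (fst (p i)) (snd (p i)) \<and> fst (p i) \<in> carrier A \<and> snd (p i) \<in> F"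
          by blast
        \<comment> \<open>Acting on the left with an element at \<sigma> puts the factor
          \<open>inv' \<sigma> i\<close> of the generator at place \<open>i\<close>. Indexing by
          \<open>\<sigma> i\<close> compensates for this.\<close>
        let ?y = "\<lambda>i\<in>{1..n}. snd (p (\<sigma> i))"
        note pm = perm_mem[OF \<sigma>] and im = perm_inv_mem[OF \<sigma>]
        have y: "?y \<in> {1..n} \<rightarrow>\<^sub>E F" using p pm by (simp add: restrict_PiE_iff)
        have pa: "fst (p i) \<in> carrier A" if "i \<in> {1..n}" for i using p that by blast
        have "wr_op R M M n (lact M) (wr_pure R A n (\<lambda>i. fst (p i)) \<sigma>) (wr_pure R M n ?y id) =
            wr_pure R M n (\<lambda>i. lact M (fst (p i)) (?y (inv' \<sigma> i))) (\<sigma> \<circ> id)"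
          by (rule wr_op_pure[OF mA m m M.lact_bilin \<sigma> perm_id pa Fm[OF y]])
        also have "pure R M n (\<lambda>i. lact M (fst (p i)) (?y (inv' \<sigma> i))) = pure R M n x"
          using p im by (intro pure_cong) (simp add: perm_inv_apply[OF \<sigma>])
        finally have e: "wr_pure R M n x \<sigma> = wr_op R M M n (lact M) (wr_pure R A n (\<lambda>i. fst (p i)) \<sigma>) (wr_pure R M n ?y id)"
          by (simp only: comp_id)
        have "wr_pure R A n (\<lambda>i. fst (p i)) \<sigma> \<in> carrier (wr_mod R A n)"
          by (rule el[OF mA pure_closed[OF mA pa]])
        then have "wr_pure R M n x \<sigma> \<in> ?S" using e y by blast
        then show "wr_pure R M n x \<sigma> \<in> mspan R (wr_mod R M n) ?S" by (rule mspan_base)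
      qed
    qed
    moreover have "finite ?F" by (intro finite_imageI finite_PiE) (simp_all add: F(1))
    ultimately show "\<exists>F. finite F \<and> F \<subseteq> carrier ?M \<and> carrier ?M \<subseteq> mspan R ?M {lact ?M a x | a x. a \<in> carrier ?A \<and> x \<in> F}"
      unfolding same_mod_mspan[OF wr_bimodule_same W] ss using Fc by blast
  next
    obtain F where F: "finite F" "F \<subseteq> carrier M" "carrier M \<subseteq> mspan R M {ract M x b | b x. b \<in> carrier A' \<and> x \<in> F}"
      using M.fg_mspan(2) by blast
    let ?F = "(\<lambda>x. wr_pure R M n x id) ` ({1..n} \<rightarrow>\<^sub>E F)"
    have Fm: "x i \<in> carrier M" if "x \<in> {1..n} \<rightarrow>\<^sub>E F" "i \<in> {1..n}" for x i by (rule subsetD[OF F(2) PiE_mem[OF that]])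
    have Fc: "?F \<subseteq> carrier (wr_mod R M n)"
      by (rule image_subsetI) (rule el[OF m pure_closed[OF m Fm]])
    let ?S = "{wr_op R A' M n (ract M) x b |b x. b \<in> carrier (wr_mod R A' n) \<and> x \<in> ?F}"
    have S: "?S \<subseteq> carrier (wr_mod R M n)" using bilin_closed[OF Rb] Fc by blast
    have "carrier (wr_mod R M n) \<subseteq> mspan R (wr_mod R M n) ?S"
    proof
      fix w assume w: "w \<in> carrier (wr_mod R M n)"
      show "w \<in> mspan R (wr_mod R M n) ?S"
      proof (rule wr_span[OF m mspan_submodule[OF W S] F(3) _ _ w])
        show "{ract M x b | b x. b \<in> carrier A' \<and> x \<in> F} \<subseteq> carrier M" using M.ract_closed F(2) by blast
        fix x \<sigma> assume x: "\<And>i. i \<in> {1..n} \<Longrightarrow> x i \<in> {ract M x b | b x. b \<in> carrier A' \<and> x \<in> F}"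
          and \<sigma>: "\<sigma> \<in> perms n"
        have "\<forall>i\<in>{1..n}. \<exists>p. x i = ract M (snd p) (fst p) \<and> fst p \<in> carrier A' \<and> snd p \<in> F" using x by fastforce
        from bchoice[OF this] obtain p where p: "\<forall>i\<in>{1..n}. x i = ract M (snd (p i)) (fst (p i)) \<and> fst (p i) \<in> carrier A' \<and> snd (p i) \<in> F"
          by blast
        \<comment> \<open>On this side the generator comes first and sits at \<open>id\<close>, so
          all factors stay in place.\<close>
        let ?y = "\<lambda>i\<in>{1..n}. snd (p i)"
        have y: "?y \<in> {1..n} \<rightarrow>\<^sub>E F" using p by (simp add: restrict_PiE_iff)
        have pa: "fst (p i) \<in> carrier A'" if "i \<in> {1..n}" for i using p that by blast
        have "wr_op R A' M n (ract M) (wr_pure R M n ?y id) (wr_pure R A' n (\<lambda>i. fst (p i)) \<sigma>) =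
            wr_pure R M n (\<lambda>i. ract M (?y i) (fst (p (inv' id i)))) (id \<circ> \<sigma>)"
          by (rule wr_op_pure[OF m mA' m M.ract_bilin perm_id \<sigma> Fm[OF y] pa])
        also have "pure R M n (\<lambda>i. ract M (?y i) (fst (p (inv' id i)))) = pure R M n x"
          using p by (intro pure_cong) simp
        finally have e: "wr_pure R M n x \<sigma> = wr_op R A' M n (ract M) (wr_pure R M n ?y id) (wr_pure R A' n (\<lambda>i. fst (p i)) \<sigma>)"
          by (simp only: id_comp)
        have "wr_pure R A' n (\<lambda>i. fst (p i)) \<sigma> \<in> carrier (wr_mod R A' n)"
          by (rule el[OF mA' pure_closed[OF mA' pa]])
        then have "wr_pure R M n x \<sigma> \<in> ?S" using e y by blast
        then show "wr_pure R M n x \<sigma> \<in> mspan R (wr_mod R M n) ?S" by (rule mspan_base)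
      qed
    qed
    moreover have "finite ?F" by (intro finite_imageI finite_PiE) (simp_all add: F(1))
    ultimately show "\<exists>F. finite F \<and> F \<subseteq> carrier ?M \<and> carrier ?M \<subseteq> mspan R ?M {ract ?M x b | b x. b \<in> carrier ?A' \<and> x \<in> F}"
      unfolding same_mod_mspan[OF wr_bimodule_same W] ss using Fc by blast
  qed
qed

context graded_bimodule_over
begin

lemma M_gcomp_closed: "g \<in> carrier \<Gamma> \<Longrightarrow> m \<in> gcomp M g \<Longrightarrow> m \<in> carrier M"
  by (rule is_grading_closed[OF bimodule_grading])

text \<open>The grading axiom of bimodules is two-sided. Acting with the unit on the other side
  isolates one action, because the unit has the identity degree.\<close>

lemma lact_gcomp:
  assumes "g \<in> carrier \<Gamma>" "x \<in> carrier \<Gamma>" "a \<in> gcomp A g" "m \<in> gcomp M x"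
  shows "lact M a m \<in> gcomp M (g \<otimes>\<^bsub>\<Gamma>\<^esub> x)"
proof -
  have "ract M (lact M a m) \<one>\<^bsub>A'\<^esub> \<in> gcomp M (g \<otimes>\<^bsub>\<Gamma>\<^esub> x \<otimes>\<^bsub>\<Gamma>\<^esub> \<one>\<^bsub>\<Gamma>\<^esub>)"
    by (rule gcomp_act[OF assms(1,2) \<Gamma>.one_closed assms(3,4) A'.one_gcomp])
  then show ?thesis
    using assms by (simp add: ract_one lact_closed[OF gcomp_closed[OF assms(1,3)] M_gcomp_closed[OF assms(2,4)]])
qed

lemma ract_gcomp:
  assumes "x \<in> carrier \<Gamma>" "h \<in> carrier \<Gamma>" "m \<in> gcomp M x" "b \<in> gcomp A' h"
  shows "ract M m b \<in> gcomp M (x \<otimes>\<^bsub>\<Gamma>\<^esub> h)"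
proof -
  have "ract M (lact M \<one>\<^bsub>A\<^esub> m) b \<in> gcomp M (\<one>\<^bsub>\<Gamma>\<^esub> \<otimes>\<^bsub>\<Gamma>\<^esub> x \<otimes>\<^bsub>\<Gamma>\<^esub> h)"
    by (rule gcomp_act[OF \<Gamma>.one_closed assms(1,2) one_gcomp assms(3,4)])
  then show ?thesis using assms by (simp add: lact_one M_gcomp_closed[OF assms(1,3)])
qed

end

lemma wr_bimodule_over:
  fixes A :: "('r, 'a, 'g, 'c) algebra_over" and A' :: "('r, 'b, 'g, 'c) algebra_over"
    and M :: "('r, 'm, 'g, 'a, 'b) bimodule" and C :: "('r, 'c, 'g) acted_algebra"
  assumes "graded_bimodule_over R H C A A' M"
  shows "graded_bimodule_over R (wreath_group H n) (tpow_acted R C n) (wr_algebra R A n) (wr_algebra R A' n)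
    (wr_bimodule R A' M n)"
proof -
  interpret M: graded_bimodule_over R H C A A' M by fact
  let ?D = "tpow_acted R C n" and ?W = "wreath_group H n"
  let ?A = "wr_algebra R A n" and ?A' = "wr_algebra R A' n" and ?M = "wr_bimodule R A' M n"
  note m = M.module_axioms and mA = assoc_algebra.axioms(1)[OF algebra_bimodule.axioms(1)[OF M.algebra_bimodule_axioms]] and mA' = M.A'.module_axioms
  have gr: "is_grading R ?W ?M"
    by (rule wr_grading[OF m M.bimodule_grading M.finite_\<Gamma> wr_bimodule_same wr_bimodule_simps(5)])
  have zl: "lin R C A (smap A)"
    using M.smap_ring_hom M.smap_smult by (intro linI) (simp_all add: ring_hom_closed ring_hom_add)
  have zl': "lin R C A' (smap A')"
    using M.A'.smap_ring_hom M.A'.smap_smult by (intro linI) (simp_all add: ring_hom_closed ring_hom_add)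
  have al: "lin R C C (act C g)" if "g \<in> carrier H" for g
    using M.D.act_ring_hom[OF that] M.D.act_smult[OF that] by (intro linI) (simp_all add: ring_hom_closed ring_hom_add)
  show ?thesis
  proof (rule graded_bimodule_over.intro[OF wr_algebra_over[OF M.crossed_product_over_axioms]
      wr_algebra_over[OF M.A'.crossed_product_over_axioms] wr_bimodule_bimodule[OF M.algebra_bimodule_axioms]],
      rule graded_bimodule_over_axioms.intro[OF gr])
    interpret W: group ?W by (rule wreath_group_group[OF M.\<Gamma>.group_axioms])
    fix g x h a y b assume g: "g \<in> carrier ?W" and x: "x \<in> carrier ?W" and h: "h \<in> carrier ?W"
      and "a \<in> gcomp ?A g" and "y \<in> gcomp ?M x" and "b \<in> gcomp ?A' h"
    then have a: "a \<in> wr_comp R A n g" and y: "y \<in> wr_comp R M n x" and b: "b \<in> wr_comp R A' n h"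
      by (simp_all add: wr_algebra_simps wr_bimodule_simps)
    have ay: "wr_op R M M n (lact M) a y \<in> wr_comp R M n (g \<otimes>\<^bsub>?W\<^esub> x)"
      by (rule wr_op_comp[OF mA M.grading m M.bimodule_grading m M.bimodule_grading M.lact_bilin M.\<Gamma>.group_axioms _ g x a y])
        (rule M.lact_gcomp)
    show "ract ?M (lact ?M a y) b \<in> gcomp ?M (g \<otimes>\<^bsub>?W\<^esub> x \<otimes>\<^bsub>?W\<^esub> h)" unfolding wr_bimodule_simps
      by (rule wr_op_comp[OF m M.bimodule_grading mA' M.A'.grading m M.bimodule_grading M.ract_bilin M.\<Gamma>.group_axioms _
          W.m_closed[OF g x] h ay b])
        (rule M.ract_gcomp)
  next
    fix \<gamma> y c assume \<gamma>: "\<gamma> \<in> carrier ?W" and y: "y \<in> gcomp ?M \<gamma>" and c: "c \<in> carrier ?D"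
    obtain g \<sigma> where g: "\<gamma> = (g, \<sigma>)" by (cases \<gamma>)
    show "ract ?M y (smap ?A' c) = lact ?M (smap ?A (act ?D \<gamma> c)) y"
      unfolding g wr_algebra_simps wr_bimodule_simps tpow_acted_simps
    proof (rule wr_smap_commute[where a="act C", OF mA mA' m M.bimodule_grading M.D.module_axioms M.lact_bilin M.ract_bilin zl zl' al])
      show "(g, \<sigma>) \<in> carrier ?W" "y \<in> wr_comp R M n (g, \<sigma>)" "c \<in> carrier (tpow R C n)"
        using \<gamma> y c by (simp_all add: g wr_bimodule_simps tpow_acted_simps)
    qed (assumption, rule M.smap_commute)
  qed
qed

section \<open>Tensor products over an algebra\<close>

text \<open>\<open>B\<close> enters through the balancing relations only. For the induced bimodules
  it is an identity component, for the tensor products with the dual it is the carrier of a whole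
  algebra.\<close>

locale tens_data =
  fixes R :: "('r, 'k) ring_scheme" and B :: "'b set" and ra :: "'m \<Rightarrow> 'b \<Rightarrow> 'm" and la :: "'b \<Rightarrow> 'n \<Rightarrow> 'n"
    and M :: "('r, 'm, 'z1) module_scheme" and N :: "('r, 'n, 'z2) module_scheme"
  assumes M: "module R M" and N: "module R N"
    and ra: "\<And>m b. m \<in> carrier M \<Longrightarrow> b \<in> B \<Longrightarrow> ra m b \<in> carrier M"
    and la: "\<And>b x. b \<in> B \<Longrightarrow> x \<in> carrier N \<Longrightarrow> la b x \<in> carrier N"
begin

abbreviation "T \<equiv> tens R B ra la M N"
abbreviation "t \<equiv> tens_elem R B ra la M N"
abbreviation "S \<equiv> carrier M \<times> carrier N"

lemma R: "cring R"
  using M by (rule module.axioms(1))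

lemma rel_closed: "tens_rel R B ra la M N \<subseteq> carrier (free_mod R S)"
proof -
  note a = mod_add_closed[OF M] mod_add_closed[OF N] mod_smult_closed[OF M] mod_smult_closed[OF N] ra la
  show ?thesis unfolding tens_rel_def Let_def
    by (intro Un_least subsetI; elim CollectE exE conjE; hypsubst; intro relation_closed[OF R] SigmaI)
      (simp_all add: a)
qed

lemma T_module: "module R T"
  unfolding tens_def by (rule presented_module[OF R rel_closed])

lemma t_closed: "m \<in> carrier M \<Longrightarrow> x \<in> carrier N \<Longrightarrow> t m x \<in> carrier T"
  unfolding tens_def tens_elem_def by (rule pgen_closed[OF R rel_closed]) simp

lemma T_gen: "carrier T = mspan R T {t m x | m x. m \<in> carrier M \<and> x \<in> carrier N}"
proof -
  have "{t m x | m x. m \<in> carrier M \<and> x \<in> carrier N} = pgen R S (tens_rel R B ra la M N) ` S"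
    unfolding tens_elem_def by blast
  then show ?thesis using presented_gen[OF R rel_closed] unfolding tens_def by simp
qed

lemma pg: "pgen R S (tens_rel R B ra la M N) \<in> S \<rightarrow> carrier T"
  unfolding tens_def by (rule funcsetI) (rule pgen_closed[OF R rel_closed])

lemma t_bilin: "bilin R M N T t"
proof -
  note rl = presented_rel[OF R rel_closed, folded tens_def]
  note F1 = iffD1[OF flift_relation_iff(1)[OF T_module pg] rl] and F2 = iffD1[OF flift_relation_iff(2)[OF T_module pg] rl]
  note cl = mod_add_closed[OF M] mod_add_closed[OF N] mod_smult_closed[OF M] mod_smult_closed[OF N]
  show ?thesis
  proof (rule bilinI; rule linI)
    fix m x assume m: "m \<in> carrier M" and x: "x \<in> carrier N"
    show "t m x \<in> carrier T" "t m x \<in> carrier T" using t_closed[OF m x] by simp_all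
    fix r assume r: "r \<in> carrier R"
    show "t m (r \<odot>\<^bsub>N\<^esub> x) = r \<odot>\<^bsub>T\<^esub> t m x" unfolding tens_elem_def
      by (rule F2[OF _ _ r]) (use m x r cl in simp, use m x in simp, unfold tens_rel_def Let_def, use m x r in blast)
    show "t (r \<odot>\<^bsub>M\<^esub> m) x = r \<odot>\<^bsub>T\<^esub> t m x" unfolding tens_elem_def
      by (rule F2[OF _ _ r]) (use m x r cl in simp, use m x in simp, unfold tens_rel_def Let_def, use m x r in blast)
  next
    fix m x y assume m: "m \<in> carrier M" and x: "x \<in> carrier N" and y: "y \<in> carrier N"
    show "t m (x \<oplus>\<^bsub>N\<^esub> y) = t m x \<oplus>\<^bsub>T\<^esub> t m y" unfolding tens_elem_def
      by (rule F1) (use m x y cl in simp, use m x in simp, use m y in simp, unfold tens_rel_def Let_def, use m x y in blast)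
  next
    fix x m m' assume m: "m \<in> carrier M" "m' \<in> carrier M" and x: "x \<in> carrier N"
    show "t (m \<oplus>\<^bsub>M\<^esub> m') x = t m x \<oplus>\<^bsub>T\<^esub> t m' x" unfolding tens_elem_def
      by (rule F1) (use m x cl in simp, use m x in simp, use m x in simp, unfold tens_rel_def Let_def, use m x in blast)
  qed
qed

lemma t_balanced:
  assumes "m \<in> carrier M" "b \<in> B" "x \<in> carrier N"
  shows "t (ra m b) x = t m (la b x)"
  unfolding tens_elem_def
proof (rule iffD1[OF flift_relation_iff(3)[OF T_module pg] presented_rel[OF R rel_closed, folded tens_def]])
  show "(ra m b, x) \<in> S" "(m, la b x) \<in> S" using assms ra la by simp_all
  show "free_gen R (ra m b, x) \<ominus>\<^bsub>free_mod R S\<^esub> free_gen R (m, la b x) \<in> tens_rel R B ra la M N"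
    unfolding tens_rel_def Let_def using assms by blast
qed

text \<open>Four of the five families of relations express bilinearity, the fifth that
  \<open>f\<close> is balanced over \<open>B\<close>.\<close>

lemma lift:
  assumes Y: "module R Y" and f: "bilin R M N Y f"
    and b: "\<And>m b x. m \<in> carrier M \<Longrightarrow> b \<in> B \<Longrightarrow> x \<in> carrier N \<Longrightarrow> f (ra m b) x = f m (la b x)"
  shows "lin R T Y (lin_ext R Y (\<lambda>(m, x). f m x))"
    and "m \<in> carrier M \<Longrightarrow> x \<in> carrier N \<Longrightarrow> lin_ext R Y (\<lambda>(m, x). f m x) (t m x) = f m x"
proof -
  let ?\<phi> = "\<lambda>(m, x). f m x"
  have \<phi>: "?\<phi> \<in> S \<rightarrow> carrier Y"
  proof (rule funcsetI)
    fix s assume "s \<in> S"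
    then show "?\<phi> s \<in> carrier Y" using bilin_closed[OF f, of "fst s" "snd s"] by (cases s) simp
  qed
  note cM = mod_add_closed[OF M] mod_smult_closed[OF M] and cN = mod_add_closed[OF N] mod_smult_closed[OF N]
  note I = flift_relation_iff[OF Y \<phi>]
  have z: "flift R Y ?\<phi> \<rho> = \<zero>\<^bsub>Y\<^esub>" if "\<rho> \<in> tens_rel R B ra la M N" for \<rho>
    using that unfolding tens_rel_def Let_def
  proof (elim UnE CollectE exE conjE)
    fix m m' x assume \<rho>: "\<rho> = free_gen R (m \<oplus>\<^bsub>M\<^esub> m', x) \<ominus>\<^bsub>free_mod R S\<^esub> (free_gen R (m, x) \<oplus>\<^bsub>free_mod R S\<^esub> free_gen R (m', x))"
      and h: "m \<in> carrier M" "m' \<in> carrier M" "x \<in> carrier N"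
    show ?thesis unfolding \<rho>
      by (rule iffD2[OF I(1)]) (simp_all add: h cM lin_add[OF bilin_left[OF f h(3)] h(1,2)])
  next
    fix m x x' assume \<rho>: "\<rho> = free_gen R (m, x \<oplus>\<^bsub>N\<^esub> x') \<ominus>\<^bsub>free_mod R S\<^esub> (free_gen R (m, x) \<oplus>\<^bsub>free_mod R S\<^esub> free_gen R (m, x'))"
      and h: "m \<in> carrier M" "x \<in> carrier N" "x' \<in> carrier N"
    show ?thesis unfolding \<rho>
      by (rule iffD2[OF I(1)]) (simp_all add: h cN lin_add[OF bilin_right[OF f h(1)] h(2,3)])
  next
    fix r m x assume \<rho>: "\<rho> = free_gen R (r \<odot>\<^bsub>M\<^esub> m, x) \<ominus>\<^bsub>free_mod R S\<^esub> r \<odot>\<^bsub>free_mod R S\<^esub> free_gen R (m, x)"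
      and h: "r \<in> carrier R" "m \<in> carrier M" "x \<in> carrier N"
    show ?thesis unfolding \<rho>
      by (rule iffD2[OF I(2)]) (simp_all add: h cM lin_smult[OF bilin_left[OF f h(3)] h(1,2)])
  next
    fix r m x assume \<rho>: "\<rho> = free_gen R (m, r \<odot>\<^bsub>N\<^esub> x) \<ominus>\<^bsub>free_mod R S\<^esub> r \<odot>\<^bsub>free_mod R S\<^esub> free_gen R (m, x)"
      and h: "r \<in> carrier R" "m \<in> carrier M" "x \<in> carrier N"
    show ?thesis unfolding \<rho>
      by (rule iffD2[OF I(2)]) (simp_all add: h cN lin_smult[OF bilin_right[OF f h(2)] h(1,3)])
  next
    fix m c x assume \<rho>: "\<rho> = free_gen R (ra m c, x) \<ominus>\<^bsub>free_mod R S\<^esub> free_gen R (m, la c x)"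
      and h: "m \<in> carrier M" "c \<in> B" "x \<in> carrier N"
    show ?thesis unfolding \<rho>
      by (rule iffD2[OF I(3)]) (simp_all add: h ra la b[OF h])
  qed
  show "lin R T Y (lin_ext R Y ?\<phi>)" unfolding tens_def by (rule lin_ext(1)[OF R rel_closed Y \<phi> z])
  show "lin_ext R Y ?\<phi> (t m x) = f m x" if "m \<in> carrier M" "x \<in> carrier N"
    unfolding tens_elem_def using lin_ext(2)[OF R rel_closed Y \<phi> z, of "(m, x)"] that by simp
qed

lemma induct:
  assumes "submodule K R T" "\<And>m x. m \<in> carrier M \<Longrightarrow> x \<in> carrier N \<Longrightarrow> t m x \<in> K" "\<tau> \<in> carrier T"
  shows "\<tau> \<in> K"
proof -
  have "{t m x | m x. m \<in> carrier M \<and> x \<in> carrier N} \<subseteq> K" using assms(2) by blast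
  from mspan_least[OF assms(1) this] show ?thesis using assms(3) unfolding T_gen[symmetric] by (rule subsetD)
qed

lemma gens_closed: "{t m x | m x. m \<in> carrier M \<and> x \<in> carrier N} \<subseteq> carrier T"
  using t_closed by blast

lemma eqI:
  assumes "module R Y" "lin R T Y f" "lin R T Y g"
    "\<And>m x. m \<in> carrier M \<Longrightarrow> x \<in> carrier N \<Longrightarrow> f (t m x) = g (t m x)" "\<tau> \<in> carrier T"
  shows "f \<tau> = g \<tau>"
proof (rule lin_eqI[OF assms(2,3) T_module assms(1) gens_closed])
  show "\<tau> \<in> mspan R T {t m x | m x. m \<in> carrier M \<and> x \<in> carrier N}" using assms(5) T_gen by simp
qed (use assms(4) in blast)

text \<open>The map induced by \<open>f\<close> is well defined because this can be tested after applying the injective \<open>\<Phi>\<close>.\<close>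

lemma lift_inj:
  assumes Y: "module R Y" and \<Phi>: "lin R T Y \<Phi>" "inj_on \<Phi> (carrier T)"
    and c: "\<And>m x. m \<in> carrier M \<Longrightarrow> x \<in> carrier N \<Longrightarrow> f m x \<in> carrier T"
    and \<rho>: "lin R Y Y \<rho>" and e: "\<And>m x. m \<in> carrier M \<Longrightarrow> x \<in> carrier N \<Longrightarrow> \<Phi> (f m x) = \<rho> (\<Phi> (t m x))"
  shows "lin R T T (lin_ext R T (\<lambda>(m, x). f m x))"
    and "\<tau> \<in> carrier T \<Longrightarrow> \<Phi> (lin_ext R T (\<lambda>(m, x). f m x) \<tau>) = \<rho> (\<Phi> \<tau>)"
proof -
  interpret M: module R M by (rule M)
  interpret N: module R N by (rule N)
  interpret T: module R T by (rule T_module)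
  note i = inj_onD[OF \<Phi>(2)]
  have g: "lin R T Y (\<lambda>\<tau>. \<rho> (\<Phi> \<tau>))" by (rule lin_comp[OF \<Phi>(1) \<rho>])
  note tl = bilin_left[OF t_bilin] and tr = bilin_right[OF t_bilin]
  have "bilin R M N T f"
  proof (rule bilinI; rule linI)
    fix m x assume m: "m \<in> carrier M" and x: "x \<in> carrier N"
    show "f m x \<in> carrier T" "f m x \<in> carrier T" by (rule c[OF m x])+
    fix r assume r: "r \<in> carrier R"
    show "f m (r \<odot>\<^bsub>N\<^esub> x) = r \<odot>\<^bsub>T\<^esub> f m x"
      using m x r by (intro i c T.smult_closed N.smult_closed)
        (simp_all add: e c lin_smult[OF \<Phi>(1)] lin_smult[OF tr] lin_smult[OF \<rho>] lin_closed[OF \<Phi>(1)] t_closed)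
    show "f (r \<odot>\<^bsub>M\<^esub> m) x = r \<odot>\<^bsub>T\<^esub> f m x"
      using m x r by (intro i c T.smult_closed M.smult_closed)
        (simp_all add: e c lin_smult[OF \<Phi>(1)] lin_smult[OF tl] lin_smult[OF \<rho>] lin_closed[OF \<Phi>(1)] t_closed)
  next
    fix m x y assume m: "m \<in> carrier M" and x: "x \<in> carrier N" and y: "y \<in> carrier N"
    show "f m (x \<oplus>\<^bsub>N\<^esub> y) = f m x \<oplus>\<^bsub>T\<^esub> f m y"
      using m x y by (intro i c T.M.a_closed N.M.a_closed)
        (simp_all add: e c lin_add[OF \<Phi>(1)] lin_add[OF tr] lin_add[OF \<rho>] lin_closed[OF \<Phi>(1)] t_closed)
  next
    fix x m m' assume m: "m \<in> carrier M" "m' \<in> carrier M" and x: "x \<in> carrier N"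
    show "f (m \<oplus>\<^bsub>M\<^esub> m') x = f m x \<oplus>\<^bsub>T\<^esub> f m' x"
      using m x by (intro i c T.M.a_closed M.M.a_closed)
        (simp_all add: e c lin_add[OF \<Phi>(1)] lin_add[OF tl] lin_add[OF \<rho>] lin_closed[OF \<Phi>(1)] t_closed)
  qed
  moreover have "f (ra m b) x = f m (la b x)" if "m \<in> carrier M" "b \<in> B" "x \<in> carrier N" for m b x
    using that ra la by (intro i c) (simp_all add: e t_balanced)
  ultimately have L: "lin R T T (lin_ext R T (\<lambda>(m, x). f m x))"
    and V: "\<And>m x. m \<in> carrier M \<Longrightarrow> x \<in> carrier N \<Longrightarrow> lin_ext R T (\<lambda>(m, x). f m x) (t m x) = f m x"
    using lift[OF T_module] by blast+
  show "lin R T T (lin_ext R T (\<lambda>(m, x). f m x))" by (rule L)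
  show "\<Phi> (lin_ext R T (\<lambda>(m, x). f m x) \<tau>) = \<rho> (\<Phi> \<tau>)" if "\<tau> \<in> carrier T"
    by (rule eqI[OF Y lin_comp[OF L \<Phi>(1)] g _ that]) (simp add: V e)
qed

text \<open>Each single \<open>c\<close> acts because \<open>l c\<close> commutes with the right
  action of \<open>B\<close>, which makes the new map balanced. Linearity in \<open>c\<close> is
  then compared on the generators.\<close>

lemma act_left:
  assumes C: "module R C" and l: "bilin R C M M l"
    and lr: "\<And>c m b. c \<in> carrier C \<Longrightarrow> m \<in> carrier M \<Longrightarrow> b \<in> B \<Longrightarrow> l c (ra m b) = ra (l c m) b"
  shows "bilin R C T T (\<lambda>c. lin_ext R T (\<lambda>(m, x). t (l c m) x))"
    and "c \<in> carrier C \<Longrightarrow> m \<in> carrier M \<Longrightarrow> x \<in> carrier N \<Longrightarrow> lin_ext R T (\<lambda>(m, x). t (l c m) x) (t m x) = t (l c m) x"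
proof -
  let ?L = "\<lambda>c. lin_ext R T (\<lambda>(m, x). t (l c m) x)"
  note tl = bilin_left[OF t_bilin] and tr = bilin_right[OF t_bilin] and lc = bilin_closed[OF l]
  have L: "lin R T T (?L c)" and Le: "m \<in> carrier M \<Longrightarrow> x \<in> carrier N \<Longrightarrow> ?L c (t m x) = t (l c m) x"
    if c: "c \<in> carrier C" for c m x
  proof -
    have f: "bilin R M N T (\<lambda>m x. t (l c m) x)"
      by (rule bilinI) (rule tr[OF lc[OF c]], assumption, rule lin_comp[OF bilin_right[OF l c] tl])
    have b: "t (l c (ra m b)) x = t (l c m) (la b x)" if "m \<in> carrier M" "b \<in> B" "x \<in> carrier N" for m b x
      using t_balanced[OF lc[OF c that(1)] that(2,3)] lr[OF c that(1,2)] by simp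
    show "lin R T T (?L c)" by (rule lift(1)[OF T_module f b])
    show "?L c (t m x) = t (l c m) x" if "m \<in> carrier M" "x \<in> carrier N"
      by (rule lift(2)[OF T_module f b that])
  qed
  show "?L c (t m x) = t (l c m) x" if "c \<in> carrier C" "m \<in> carrier M" "x \<in> carrier N"
    by (rule Le[OF that])
  show "bilin R C T T ?L"
  proof (rule bilinI[OF L], assumption, rule linI)
    fix \<tau> c assume \<tau>: "\<tau> \<in> carrier T" and c: "c \<in> carrier C"
    show "?L c \<tau> \<in> carrier T" by (rule lin_closed[OF L[OF c] \<tau>])
    show "?L (c \<oplus>\<^bsub>C\<^esub> d) \<tau> = ?L c \<tau> \<oplus>\<^bsub>T\<^esub> ?L d \<tau>" if d: "d \<in> carrier C" for d
    proof (rule eqI[OF T_module L[OF mod_add_closed[OF C c d]] lin_plus[OF L[OF c] L[OF d] T_module] _ \<tau>])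
      fix m x assume m: "m \<in> carrier M" and x: "x \<in> carrier N"
      show "?L (c \<oplus>\<^bsub>C\<^esub> d) (t m x) = ?L c (t m x) \<oplus>\<^bsub>T\<^esub> ?L d (t m x)"
        using lin_add[OF bilin_left[OF l m] c d] lin_add[OF tl[OF x] lc[OF c m] lc[OF d m]]
        by (simp add: Le m x c d mod_add_closed[OF C])
    qed
    show "?L (r \<odot>\<^bsub>C\<^esub> c) \<tau> = r \<odot>\<^bsub>T\<^esub> ?L c \<tau>" if r: "r \<in> carrier R" for r
    proof (rule eqI[OF T_module L[OF mod_smult_closed[OF C r c]] lin_scale[OF L[OF c] r T_module] _ \<tau>])
      fix m x assume m: "m \<in> carrier M" and x: "x \<in> carrier N"
      show "?L (r \<odot>\<^bsub>C\<^esub> c) (t m x) = r \<odot>\<^bsub>T\<^esub> ?L c (t m x)"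
        using lin_smult[OF bilin_left[OF l m] r c] lin_smult[OF tl[OF x] r lc[OF c m]]
        by (simp add: Le m x c r mod_smult_closed[OF C])
    qed
  qed
qed

lemma act_right:
  assumes C: "module R C" and r: "bilin R N C N r"
    and lr: "\<And>b x c. b \<in> B \<Longrightarrow> x \<in> carrier N \<Longrightarrow> c \<in> carrier C \<Longrightarrow> r (la b x) c = la b (r x c)"
  shows "bilin R T C T (\<lambda>\<tau> c. lin_ext R T (\<lambda>(m, x). t m (r x c)) \<tau>)"
    and "c \<in> carrier C \<Longrightarrow> m \<in> carrier M \<Longrightarrow> x \<in> carrier N \<Longrightarrow> lin_ext R T (\<lambda>(m, x). t m (r x c)) (t m x) = t m (r x c)"
proof -
  let ?L = "\<lambda>c. lin_ext R T (\<lambda>(m, x). t m (r x c))"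
  note tl = bilin_left[OF t_bilin] and tr = bilin_right[OF t_bilin] and rc = bilin_closed[OF r]
  have L: "lin R T T (?L c)" and Le: "m \<in> carrier M \<Longrightarrow> x \<in> carrier N \<Longrightarrow> ?L c (t m x) = t m (r x c)"
    if c: "c \<in> carrier C" for c m x
  proof -
    have f: "bilin R M N T (\<lambda>m x. t m (r x c))"
      by (rule bilinI) (rule lin_comp[OF bilin_left[OF r c] tr], assumption, rule tl[OF rc[OF _ c]])
    have b: "t (ra m b) (r x c) = t m (r (la b x) c)" if "m \<in> carrier M" "b \<in> B" "x \<in> carrier N" for m b x
      using t_balanced[OF that(1,2) rc[OF that(3) c]] lr[OF that(2,3) c] by simp
    show "lin R T T (?L c)" by (rule lift(1)[OF T_module f b])
    show "?L c (t m x) = t m (r x c)" if "m \<in> carrier M" "x \<in> carrier N"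
      by (rule lift(2)[OF T_module f b that])
  qed
  show "?L c (t m x) = t m (r x c)" if "c \<in> carrier C" "m \<in> carrier M" "x \<in> carrier N"
    by (rule Le[OF that])
  show "bilin R T C T (\<lambda>\<tau> c. ?L c \<tau>)"
  proof (rule bilinI[OF _ L], rule linI)
    fix \<tau> c assume \<tau>: "\<tau> \<in> carrier T" and c: "c \<in> carrier C"
    show "?L c \<tau> \<in> carrier T" by (rule lin_closed[OF L[OF c] \<tau>])
    show "?L (c \<oplus>\<^bsub>C\<^esub> d) \<tau> = ?L c \<tau> \<oplus>\<^bsub>T\<^esub> ?L d \<tau>" if d: "d \<in> carrier C" for d
    proof (rule eqI[OF T_module L[OF mod_add_closed[OF C c d]] lin_plus[OF L[OF c] L[OF d] T_module] _ \<tau>])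
      fix m x assume m: "m \<in> carrier M" and x: "x \<in> carrier N"
      show "?L (c \<oplus>\<^bsub>C\<^esub> d) (t m x) = ?L c (t m x) \<oplus>\<^bsub>T\<^esub> ?L d (t m x)"
        using lin_add[OF bilin_right[OF r x] c d] lin_add[OF tr[OF m] rc[OF x c] rc[OF x d]]
        by (simp add: Le m x c d mod_add_closed[OF C])
    qed
    show "?L (s \<odot>\<^bsub>C\<^esub> c) \<tau> = s \<odot>\<^bsub>T\<^esub> ?L c \<tau>" if s: "s \<in> carrier R" for s
    proof (rule eqI[OF T_module L[OF mod_smult_closed[OF C s c]] lin_scale[OF L[OF c] s T_module] _ \<tau>])
      fix m x assume m: "m \<in> carrier M" and x: "x \<in> carrier N"
      show "?L (s \<odot>\<^bsub>C\<^esub> c) (t m x) = s \<odot>\<^bsub>T\<^esub> ?L c (t m x)"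
        using lin_smult[OF bilin_right[OF r x] s c] lin_smult[OF tr[OF m] s rc[OF x c]]
        by (simp add: Le m x c s mod_smult_closed[OF C])
    qed
  qed
qed

text \<open>Prepares the grading of \<open>bimodule_tensor\<close>: the components are submodules,
  they span, and maps on a component can be tested on its generators. Their independence is obtained
  later, from an isomorphism with a regular bimodule.\<close>

lemma graded_span:
  assumes cl: "\<forall>h\<in>I. \<forall>k\<in>I. mul h k \<in> I"
    and GM: "(\<Union>h\<in>I. G h) \<subseteq> carrier M" and GN: "(\<Union>h\<in>I. H h) \<subseteq> carrier N"
    and sM: "carrier M \<subseteq> mspan R M (\<Union>h\<in>I. G h)" and sN: "carrier N \<subseteq> mspan R N (\<Union>h\<in>I. H h)"
  defines "W \<equiv> \<lambda>g. {t m x | m x h k. h \<in> I \<and> k \<in> I \<and> mul h k = g \<and> m \<in> G h \<and> x \<in> H k}"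
  shows "submodule (mspan R T (W g)) R T"
    and "carrier T \<subseteq> mspan R T (\<Union>g\<in>I. mspan R T (W g))"
    and "lin R T Y \<Phi> \<Longrightarrow> module R Y \<Longrightarrow> submodule K R Y \<Longrightarrow>
      (\<And>m x h k. h \<in> I \<Longrightarrow> k \<in> I \<Longrightarrow> mul h k = g \<Longrightarrow> m \<in> G h \<Longrightarrow> x \<in> H k \<Longrightarrow> \<Phi> (t m x) \<in> K) \<Longrightarrow>
      \<tau> \<in> mspan R T (W g) \<Longrightarrow> \<Phi> \<tau> \<in> K"
proof -
  have W: "W g \<subseteq> carrier T" for g
  proof (unfold W_def, rule subsetI, elim CollectE exE conjE)
    fix \<tau> m x h k assume "\<tau> = t m x" "h \<in> I" "k \<in> I" "m \<in> G h" "x \<in> H k"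
    then show "\<tau> \<in> carrier T" using t_closed[OF subsetD[OF GM UN_I] subsetD[OF GN UN_I]] by simp
  qed
  show S: "submodule (mspan R T (W g)) R T" for g by (rule mspan_submodule[OF T_module W])
  show "\<Phi> \<tau> \<in> K" if \<Phi>: "lin R T Y \<Phi>" "module R Y" "submodule K R Y"
    and h: "\<And>m x h k. h \<in> I \<Longrightarrow> k \<in> I \<Longrightarrow> mul h k = g \<Longrightarrow> m \<in> G h \<Longrightarrow> x \<in> H k \<Longrightarrow> \<Phi> (t m x) \<in> K"
    and \<tau>: "\<tau> \<in> mspan R T (W g)"
  proof (rule lin_mspan[OF \<Phi>(1) T_module \<Phi>(2,3) W _ \<tau>], unfold W_def, elim CollectE exE conjE)
    fix s m x h' k assume "s = t m x" "h' \<in> I" "k \<in> I" "mul h' k = g" "m \<in> G h'" "x \<in> H k"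
    then show "\<Phi> s \<in> K" using h by simp
  qed
  let ?K = "mspan R T (\<Union>g\<in>I. mspan R T (W g))"
  have U: "(\<Union>g\<in>I. mspan R T (W g)) \<subseteq> carrier T" by (rule UN_least) (rule submodule_subset[OF S])
  show "carrier T \<subseteq> ?K"
  proof (rule subsetI, rule induct[OF mspan_submodule[OF T_module U]])
    fix m x assume m: "m \<in> carrier M" and x: "x \<in> carrier N"
    show "t m x \<in> ?K"
    proof (rule bilin_mspan[OF t_bilin M N T_module GM GN mspan_submodule[OF T_module U] _ subsetD[OF sM m] subsetD[OF sN x]])
      fix y z assume "y \<in> (\<Union>h\<in>I. G h)" "z \<in> (\<Union>h\<in>I. H h)"
      then obtain h k where hk: "h \<in> I" "y \<in> G h" "k \<in> I" "z \<in> H k" by (elim UN_E)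
      have "t y z \<in> W (mul h k)" unfolding W_def using hk by blast
      then show "t y z \<in> ?K" using cl hk(1,3) by (intro mspan_base UN_I) simp_all
    qed
  qed
qed

end

section \<open>Transport of structure\<close>

lemma mk_bimodule_simps:
  "carrier (mk_bimodule X c l r) = carrier X" "zero (mk_bimodule X c l r) = zero X"
  "add (mk_bimodule X c l r) = add X" "smult (mk_bimodule X c l r) = smult X"
  "gcomp (mk_bimodule X c l r) = c" "lact (mk_bimodule X c l r) = l" "ract (mk_bimodule X c l r) = r"
  by (simp_all add: mk_bimodule_def)

lemma mk_bimodule_same: "same_mod (mk_bimodule X c l r) X"
  by (simp add: same_mod_def mk_bimodule_simps)

text \<open>A grade preserving linear map commutes with taking components. If \<open>f x\<close> is
  homogeneous of degree \<open>g\<close>, then \<open>x\<close> and its component of degree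
  \<open>g\<close> have the same image, so they agree by injectivity.\<close>

lemma gcomp_reflect:
  assumes X: "module R X" "is_grading R \<Gamma> X" and Y: "module R Y" "is_grading R \<Gamma> Y" and fin: "finite (carrier \<Gamma>)"
    and f: "lin R X Y f" "inj_on f (carrier X)" and fg: "\<And>g x. g \<in> carrier \<Gamma> \<Longrightarrow> x \<in> gcomp X g \<Longrightarrow> f x \<in> gcomp Y g"
    and g: "g \<in> carrier \<Gamma>" and x: "x \<in> carrier X" and fx: "f x \<in> gcomp Y g"
  shows "x \<in> gcomp X g"
proof -
  have "f (hcomp \<Gamma> X x g) = hcomp \<Gamma> Y (f x) g"
    by (rule hcomp_shift[where \<pi>="\<lambda>k. k", OF X Y fin f(1) _ _ fg g x, symmetric]) simp_all
  also have "\<dots> = f x" using hcomp_homogeneous[OF Y(2,1) fin g g fx] by simp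
  finally have "hcomp \<Gamma> X x g = x"
    by (rule inj_onD[OF f(2)]) (rule hcomp_closed[OF X(2) x g], rule x)
  then show ?thesis using hcomp_mem[OF X(2) x g] by simp
qed

lemma graded_bimodule_homD:
  assumes "\<phi> \<in> graded_bimodule_hom R \<Gamma> A A' M N"
  shows "lin R M N \<phi>"
    and "a \<in> carrier A \<Longrightarrow> m \<in> carrier M \<Longrightarrow> \<phi> (lact M a m) = lact N a (\<phi> m)"
    and "m \<in> carrier M \<Longrightarrow> b \<in> carrier A' \<Longrightarrow> \<phi> (ract M m b) = ract N (\<phi> m) b"
    and "g \<in> carrier \<Gamma> \<Longrightarrow> m \<in> gcomp M g \<Longrightarrow> \<phi> m \<in> gcomp N g"
proof -
  show "lin R M N \<phi>" using assms by (simp add: graded_bimodule_hom_def lin_def)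
  show "a \<in> carrier A \<Longrightarrow> m \<in> carrier M \<Longrightarrow> \<phi> (lact M a m) = lact N a (\<phi> m)"
    using assms by (simp add: graded_bimodule_hom_def)
  show "m \<in> carrier M \<Longrightarrow> b \<in> carrier A' \<Longrightarrow> \<phi> (ract M m b) = ract N (\<phi> m) b"
    using assms by (simp add: graded_bimodule_hom_def)
  show "g \<in> carrier \<Gamma> \<Longrightarrow> m \<in> gcomp M g \<Longrightarrow> \<phi> m \<in> gcomp N g"
    using assms by (simp add: graded_bimodule_hom_def image_subset_iff)
qed

lemma graded_bimodule_homI:
  assumes "lin R M N \<phi>"
    and "\<And>a m. a \<in> carrier A \<Longrightarrow> m \<in> carrier M \<Longrightarrow> \<phi> (lact M a m) = lact N a (\<phi> m)"
    and "\<And>m b. m \<in> carrier M \<Longrightarrow> b \<in> carrier A' \<Longrightarrow> \<phi> (ract M m b) = ract N (\<phi> m) b"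
    and "\<And>g m. g \<in> carrier \<Gamma> \<Longrightarrow> m \<in> gcomp M g \<Longrightarrow> \<phi> m \<in> gcomp N g"
  shows "\<phi> \<in> graded_bimodule_hom R \<Gamma> A A' M N"
  using assms by (simp add: graded_bimodule_hom_def lin_def image_subset_iff)

text \<open>\<open>graded_bimodule_iso\<close> also demands that both sides be graded bimodules over
  \<open>D\<close>. Both parts come from \<phi>: every axiom is an identity that holds after
  applying \<phi> and can be reflected, since \<phi> is injective.\<close>

lemma graded_bimodule_transport:
  assumes N: "graded_bimodule_over R \<Gamma> D A A' N" and M: "module R M" and \<phi>: "lin R M N \<phi>"
    and bij: "bij_betw \<phi> (carrier M) (carrier N)"
    and l: "\<And>a m. a \<in> carrier A \<Longrightarrow> m \<in> carrier M \<Longrightarrow> lact M a m \<in> carrier M"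
      "\<And>a m. a \<in> carrier A \<Longrightarrow> m \<in> carrier M \<Longrightarrow> \<phi> (lact M a m) = lact N a (\<phi> m)"
    and r: "\<And>m b. m \<in> carrier M \<Longrightarrow> b \<in> carrier A' \<Longrightarrow> ract M m b \<in> carrier M"
      "\<And>m b. m \<in> carrier M \<Longrightarrow> b \<in> carrier A' \<Longrightarrow> \<phi> (ract M m b) = ract N (\<phi> m) b"
    and g: "\<And>g. g \<in> carrier \<Gamma> \<Longrightarrow> submodule (gcomp M g) R M"
      "carrier M \<subseteq> mspan R M (\<Union>g\<in>carrier \<Gamma>. gcomp M g)"
      "\<And>g m. g \<in> carrier \<Gamma> \<Longrightarrow> m \<in> gcomp M g \<Longrightarrow> \<phi> m \<in> gcomp N g"
  shows "graded_bimodule_iso R \<Gamma> D A A' M N"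
proof -
  interpret N: graded_bimodule_over R \<Gamma> D A A' N by (rule N)
  interpret M: module R M by (rule M)
  have Nm: "module R N" by (rule N.module_axioms)
  have aA: "assoc_algebra R A" and aA': "assoc_algebra R A'"
    using N.algebra_bimodule_axioms by (rule algebra_bimodule.axioms)+
  have mA: "module R A" and mA': "module R A'" using assoc_algebra.axioms(1)[OF aA] assoc_algebra.axioms(1)[OF aA'] by simp_all
  have inj: "inj_on \<phi> (carrier M)" and im: "\<phi> ` carrier M = carrier N" using bij by (simp_all add: bij_betw_def)
  note i = inj_onD[OF inj] and c = lin_closed[OF \<phi>]
  note bl = N.lact_bilin and br = N.ract_bilin
  have gc: "m \<in> carrier M" if "g \<in> carrier \<Gamma>" "m \<in> gcomp M g" for g m using submodule_subset[OF g(1)[OF that(1)]] that(2) by blast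
  have gr: "is_grading R \<Gamma> M"
  \<comment> \<open>Independence of the components of \<open>M\<close>: under \<phi>, a vanishing
    sum of homogeneous elements becomes a decomposition of zero in \<open>N\<close>, which is
    unique.\<close>
  proof (rule gradingI[OF M N.finite_\<Gamma> g(1,2)])
    fix f h assume f: "\<And>g. g \<in> carrier \<Gamma> \<Longrightarrow> f g \<in> gcomp M g" "(\<Oplus>\<^bsub>M\<^esub>g\<in>carrier \<Gamma>. f g) = \<zero>\<^bsub>M\<^esub>" and h: "h \<in> carrier \<Gamma>"
    have "\<phi> (\<Oplus>\<^bsub>M\<^esub>g\<in>carrier \<Gamma>. f g) = (\<Oplus>\<^bsub>N\<^esub>g\<in>carrier \<Gamma>. \<phi> (f g))"
      by (rule lin_finsum[OF \<phi> M Nm gc[OF _ f(1)]])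
    then have e: "\<zero>\<^bsub>N\<^esub> = (\<Oplus>\<^bsub>N\<^esub>g\<in>carrier \<Gamma>. \<phi> (f g))" using f(2) lin_zero[OF \<phi> M Nm] by simp
    have p: "\<phi> (f g) \<in> gcomp N g" if "g \<in> carrier \<Gamma>" for g by (rule g(3)[OF that f(1)[OF that]])
    have "\<phi> (f h) = hcomp \<Gamma> N \<zero>\<^bsub>N\<^esub> h"
      using hcomp_eqI[of R \<Gamma> N "\<lambda>g. \<phi> (f g)" "\<zero>\<^bsub>N\<^esub>" h] N.bimodule_grading Nm p e h by simp
    also have "\<dots> = \<zero>\<^bsub>N\<^esub>" by (rule lin_zero[OF hcomp_lin[OF N.bimodule_grading Nm N.finite_\<Gamma> h] Nm Nm])
    also have "\<dots> = \<phi> \<zero>\<^bsub>M\<^esub>" using lin_zero[OF \<phi> M Nm] by simp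
    finally show "f h = \<zero>\<^bsub>M\<^esub>" by (rule i) (rule gc[OF h f(1)[OF h]], rule M.M.zero_closed)
  qed
  have refl: "m \<in> gcomp M g" if "g \<in> carrier \<Gamma>" "m \<in> carrier M" "\<phi> m \<in> gcomp N g" for g m
    by (rule gcomp_reflect[OF M gr Nm N.bimodule_grading N.finite_\<Gamma> \<phi> inj _ that]) (rule g(3))
  have bim: "algebra_bimodule R A A' M"
  proof (rule algebra_bimoduleI[OF aA aA' M])
    show "bilin R A M M (lact M)"
    proof (rule bilinI; rule linI)
      fix a m assume a: "a \<in> carrier A" and m: "m \<in> carrier M"
      show "lact M a m \<in> carrier M" "lact M a m \<in> carrier M" by (rule l(1)[OF a m])+
      fix s assume s: "s \<in> carrier R"
      show "lact M a (s \<odot>\<^bsub>M\<^esub> m) = s \<odot>\<^bsub>M\<^esub> lact M a m"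
        using a m s by (intro i l(1) M.smult_closed) (simp_all add: l lin_smult[OF \<phi>] lin_smult[OF bilin_right[OF bl]] c)
      show "lact M (s \<odot>\<^bsub>A\<^esub> a) m = s \<odot>\<^bsub>M\<^esub> lact M a m"
        using a m s mod_smult_closed[OF mA] by (intro i l(1) M.smult_closed) (simp_all add: l lin_smult[OF \<phi>] lin_smult[OF bilin_left[OF bl]] c)
    next
      fix a m m' assume a: "a \<in> carrier A" and m: "m \<in> carrier M" "m' \<in> carrier M"
      show "lact M a (m \<oplus>\<^bsub>M\<^esub> m') = lact M a m \<oplus>\<^bsub>M\<^esub> lact M a m'"
        using a m by (intro i l(1) M.M.a_closed) (simp_all add: l lin_add[OF \<phi>] lin_add[OF bilin_right[OF bl]] c)
    next
      fix m a a' assume a: "a \<in> carrier A" "a' \<in> carrier A" and m: "m \<in> carrier M"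
      show "lact M (a \<oplus>\<^bsub>A\<^esub> a') m = lact M a m \<oplus>\<^bsub>M\<^esub> lact M a' m"
        using a m mod_add_closed[OF mA] by (intro i l(1) M.M.a_closed) (simp_all add: l lin_add[OF \<phi>] lin_add[OF bilin_left[OF bl]] c)
    qed
    show "bilin R M A' M (ract M)"
    proof (rule bilinI; rule linI)
      fix a m assume a: "a \<in> carrier A'" and m: "m \<in> carrier M"
      show "ract M m a \<in> carrier M" "ract M m a \<in> carrier M" by (rule r(1)[OF m a])+
      fix s assume s: "s \<in> carrier R"
      show "ract M (s \<odot>\<^bsub>M\<^esub> m) a = s \<odot>\<^bsub>M\<^esub> ract M m a"
        using a m s by (intro i r(1) M.smult_closed) (simp_all add: r lin_smult[OF \<phi>] lin_smult[OF bilin_left[OF br]] c)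
      show "ract M m (s \<odot>\<^bsub>A'\<^esub> a) = s \<odot>\<^bsub>M\<^esub> ract M m a"
        using a m s mod_smult_closed[OF mA'] by (intro i r(1) M.smult_closed) (simp_all add: r lin_smult[OF \<phi>] lin_smult[OF bilin_right[OF br]] c)
    next
      fix a m m' assume a: "a \<in> carrier A'" and m: "m \<in> carrier M" "m' \<in> carrier M"
      show "ract M (m \<oplus>\<^bsub>M\<^esub> m') a = ract M m a \<oplus>\<^bsub>M\<^esub> ract M m' a"
        using a m by (intro i r(1) M.M.a_closed) (simp_all add: r lin_add[OF \<phi>] lin_add[OF bilin_left[OF br]] c)
    next
      fix m a a' assume a: "a \<in> carrier A'" "a' \<in> carrier A'" and m: "m \<in> carrier M"
      show "ract M m (a \<oplus>\<^bsub>A'\<^esub> a') = ract M m a \<oplus>\<^bsub>M\<^esub> ract M m a'"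
        using a m mod_add_closed[OF mA'] by (intro i r(1) M.M.a_closed) (simp_all add: r lin_add[OF \<phi>] lin_add[OF bilin_right[OF br]] c)
    qed
  next
    fix m assume m: "m \<in> carrier M"
    show "lact M \<one>\<^bsub>A\<^esub> m = m" using m by (intro i l(1) N.one_closed) (simp_all add: l N.lact_one c)
    show "ract M m \<one>\<^bsub>A'\<^esub> = m" using m by (intro i r(1) N.A'.one_closed) (simp_all add: r N.ract_one c)
    fix a assume a: "a \<in> carrier A"
    show "lact M (a' \<otimes>\<^bsub>A\<^esub> a) m = lact M a' (lact M a m)" if a': "a' \<in> carrier A" for a'
      using m a a' by (intro i l(1) N.m_closed) (simp_all add: l N.lact_mult c)
    fix b assume b: "b \<in> carrier A'"
    show "ract M (lact M a m) b = lact M a (ract M m b)"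
      using m a b by (intro i l(1) r(1)) (simp_all add: l r N.lact_ract c)
  next
    fix m b b' assume m: "m \<in> carrier M" and b: "b \<in> carrier A'" "b' \<in> carrier A'"
    show "ract M m (b \<otimes>\<^bsub>A'\<^esub> b') = ract M (ract M m b) b'"
      using m b by (intro i r(1) N.A'.m_closed) (simp_all add: r N.ract_mult c)
  next
    obtain F where F: "finite F" "F \<subseteq> carrier N" "carrier N \<subseteq> mspan R N {lact N a x | a x. a \<in> carrier A \<and> x \<in> F}"
      using N.fg_mspan(1) by blast
    \<comment> \<open>As \<phi> is onto, a finite generating set of \<open>N\<close> is the image of
      a finite set in \<open>M\<close>, which generates \<open>M\<close> because \<phi> is
      injective.\<close>
    obtain E where E: "E \<subseteq> carrier M" "finite E" "F = \<phi> ` E"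
      using F(1,2) im by (metis finite_subset_image)
    let ?S = "{lact M a x | a x. a \<in> carrier A \<and> x \<in> E}"
    have S: "?S \<subseteq> carrier M" using l(1) E(1) by blast
    note K = mspan_submodule[OF M S]
    have "{lact N a x | a x. a \<in> carrier A \<and> x \<in> F} \<subseteq> \<phi> ` mspan R M ?S"
    proof (rule subsetI, elim CollectE exE conjE)
      fix y a x assume y: "y = lact N a x" and a: "a \<in> carrier A" and "x \<in> F"
      then obtain e where e: "e \<in> E" "x = \<phi> e" using E(3) by blast
      have "y = \<phi> (lact M a e)" using l(2)[OF a] e E(1) y by auto
      moreover have "lact M a e \<in> mspan R M ?S" using a e by (intro mspan_base) blast
      ultimately show "y \<in> \<phi> ` mspan R M ?S" by blast
    qed
    then have "mspan R N {lact N a x | a x. a \<in> carrier A \<and> x \<in> F} \<subseteq> \<phi> ` mspan R M ?S"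
      by (rule mspan_least[OF lin_image_submodule[OF \<phi> M Nm K]])
    then have "\<phi> ` carrier M \<subseteq> \<phi> ` mspan R M ?S" using F(3) im by blast
    then have "carrier M \<subseteq> mspan R M ?S"
      using inj_on_image_mem_iff[OF inj _ submodule_subset[OF K]] by blast
    then show "\<exists>F. finite F \<and> F \<subseteq> carrier M \<and> carrier M \<subseteq> mspan R M {lact M a x | a x. a \<in> carrier A \<and> x \<in> F}"
      using E by blast
  next
    obtain F where F: "finite F" "F \<subseteq> carrier N" "carrier N \<subseteq> mspan R N {ract N x b | b x. b \<in> carrier A' \<and> x \<in> F}"
      using N.fg_mspan(2) by blast
    obtain E where E: "E \<subseteq> carrier M" "finite E" "F = \<phi> ` E"
      using F(1,2) im by (metis finite_subset_image)
    let ?S = "{ract M x b | b x. b \<in> carrier A' \<and> x \<in> E}"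
    have S: "?S \<subseteq> carrier M" using r(1) E(1) by blast
    note K = mspan_submodule[OF M S]
    have "{ract N x b | b x. b \<in> carrier A' \<and> x \<in> F} \<subseteq> \<phi> ` mspan R M ?S"
    proof (rule subsetI, elim CollectE exE conjE)
      fix y b x assume y: "y = ract N x b" and b: "b \<in> carrier A'" and "x \<in> F"
      then obtain e where e: "e \<in> E" "x = \<phi> e" using E(3) by blast
      have "y = \<phi> (ract M e b)" using r(2)[OF _ b] e E(1) y by auto
      moreover have "ract M e b \<in> mspan R M ?S" using b e by (intro mspan_base) blast
      ultimately show "y \<in> \<phi> ` mspan R M ?S" by blast
    qed
    then have "mspan R N {ract N x b | b x. b \<in> carrier A' \<and> x \<in> F} \<subseteq> \<phi> ` mspan R M ?S"
      by (rule mspan_least[OF lin_image_submodule[OF \<phi> M Nm K]])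
    then have "\<phi> ` carrier M \<subseteq> \<phi> ` mspan R M ?S" using F(3) im by blast
    then have "carrier M \<subseteq> mspan R M ?S"
      using inj_on_image_mem_iff[OF inj _ submodule_subset[OF K]] by blast
    then show "\<exists>F. finite F \<and> F \<subseteq> carrier M \<and> carrier M \<subseteq> mspan R M {ract M x b | b x. b \<in> carrier A' \<and> x \<in> F}"
      using E by blast
  qed
  have "graded_bimodule_over R \<Gamma> D A A' M"
  proof (rule graded_bimodule_over.intro[OF N.crossed_product_over_axioms N.A'.crossed_product_over_axioms bim],
      rule graded_bimodule_over_axioms.intro[OF gr])
    fix g x h a m b assume gxh: "g \<in> carrier \<Gamma>" "x \<in> carrier \<Gamma>" "h \<in> carrier \<Gamma>"
      and a: "a \<in> gcomp A g" and m: "m \<in> gcomp M x" and b: "b \<in> gcomp A' h"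
    have ac: "a \<in> carrier A" by (rule N.gcomp_closed[OF gxh(1) a])
    have bc: "b \<in> carrier A'" by (rule N.A'.gcomp_closed[OF gxh(3) b])
    have mc: "m \<in> carrier M" by (rule gc[OF gxh(2) m])
    have "\<phi> (ract M (lact M a m) b) = ract N (lact N a (\<phi> m)) b" by (simp add: r l ac bc mc)
    then have p: "\<phi> (ract M (lact M a m) b) \<in> gcomp N (g \<otimes>\<^bsub>\<Gamma>\<^esub> x \<otimes>\<^bsub>\<Gamma>\<^esub> h)"
      using N.gcomp_act[OF gxh a g(3)[OF gxh(2) m] b] by simp
    have "g \<otimes>\<^bsub>\<Gamma>\<^esub> x \<otimes>\<^bsub>\<Gamma>\<^esub> h \<in> carrier \<Gamma>" using gxh by simp
    then show "ract M (lact M a m) b \<in> gcomp M (g \<otimes>\<^bsub>\<Gamma>\<^esub> x \<otimes>\<^bsub>\<Gamma>\<^esub> h)"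
      by (rule refl[OF _ r(1)[OF l(1)[OF ac mc] bc] p])
  next
    fix g m d assume gm: "g \<in> carrier \<Gamma>" and m: "m \<in> gcomp M g" and d: "d \<in> carrier D"
    have mc: "m \<in> carrier M" by (rule gc[OF gm m])
    have zc: "smap A' d \<in> carrier A'" by (rule ring_hom_closed[OF N.A'.smap_ring_hom d])
    have yc: "smap A (act D g d) \<in> carrier A"
      by (rule ring_hom_closed[OF N.smap_ring_hom ring_hom_closed[OF N.D.act_ring_hom[OF gm] d]])
    have "\<phi> (ract M m (smap A' d)) = \<phi> (lact M (smap A (act D g d)) m)"
      using N.smap_commute[OF gm g(3)[OF gm m] d] by (simp add: r(2)[OF mc zc] l(2)[OF yc mc])
    then show "ract M m (smap A' d) = lact M (smap A (act D g d)) m" by (rule i) (rule r(1)[OF mc zc], rule l(1)[OF yc mc])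
  qed
  moreover have "\<phi> \<in> graded_bimodule_hom R \<Gamma> A A' M N"
    by (rule graded_bimodule_homI[OF \<phi> l(2) r(2) g(3)])
  ultimately show ?thesis unfolding graded_bimodule_iso_def using N bij by blast
qed

text \<open>The first isomorphism is followed by the inverse of the second. That the composite
  preserves degrees is the point where \<open>gcomp_reflect\<close> is needed.\<close>

lemma graded_bimodule_iso_joint:
  assumes "graded_bimodule_iso R \<Gamma> D A A' M K" "graded_bimodule_iso R \<Gamma> D A A' N K"
  shows "graded_bimodule_iso R \<Gamma> D A A' M N"
proof -
  obtain \<phi> where \<phi>: "\<phi> \<in> graded_bimodule_hom R \<Gamma> A A' M K" "bij_betw \<phi> (carrier M) (carrier K)"
    using assms(1) unfolding graded_bimodule_iso_def by blast
  obtain \<psi> where \<psi>: "\<psi> \<in> graded_bimodule_hom R \<Gamma> A A' N K" "bij_betw \<psi> (carrier N) (carrier K)"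
    using assms(2) unfolding graded_bimodule_iso_def by blast
  interpret M: graded_bimodule_over R \<Gamma> D A A' M using assms(1) unfolding graded_bimodule_iso_def by blast
  interpret N: graded_bimodule_over R \<Gamma> D A A' N using assms(2) unfolding graded_bimodule_iso_def by blast
  interpret K: graded_bimodule_over R \<Gamma> D A A' K using assms(2) unfolding graded_bimodule_iso_def by blast
  note \<phi>l = graded_bimodule_homD(1)[OF \<phi>(1)] and \<psi>l = graded_bimodule_homD(1)[OF \<psi>(1)]
  note hl = graded_bimodule_homD(2)[OF \<phi>(1)] graded_bimodule_homD(2)[OF \<psi>(1)]
  note hr = graded_bimodule_homD(3)[OF \<phi>(1)] graded_bimodule_homD(3)[OF \<psi>(1)]
  note hg = graded_bimodule_homD(4)[OF \<phi>(1)] graded_bimodule_homD(4)[OF \<psi>(1)]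
  have inj: "inj_on \<psi> (carrier N)" and im: "\<psi> ` carrier N = carrier K" using \<psi>(2) by (simp_all add: bij_betw_def)
  note i = inj_onD[OF inj]
  define \<chi> where "\<chi> = (\<lambda>m. inv_into (carrier N) \<psi> (\<phi> m))"
  have fc: "\<phi> m \<in> \<psi> ` carrier N" if "m \<in> carrier M" for m using lin_closed[OF \<phi>l that] im by simp
  have \<chi>c: "\<chi> m \<in> carrier N" and \<chi>e: "\<psi> (\<chi> m) = \<phi> m" if "m \<in> carrier M" for m
    unfolding \<chi>_def using inv_into_into[OF fc[OF that]] f_inv_into_f[OF fc[OF that]] by simp_all
  have "\<chi> \<in> graded_bimodule_hom R \<Gamma> A A' M N"
  proof (rule graded_bimodule_homI)
    show "lin R M N \<chi>"
    proof (rule linI)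
      fix m assume m: "m \<in> carrier M"
      show "\<chi> m \<in> carrier N" by (rule \<chi>c[OF m])
      show "\<chi> (m \<oplus>\<^bsub>M\<^esub> m') = \<chi> m \<oplus>\<^bsub>N\<^esub> \<chi> m'" if m': "m' \<in> carrier M" for m'
        using m m' by (intro i \<chi>c mod_add_closed[OF N.module_axioms] mod_add_closed[OF M.module_axioms])
          (simp_all add: \<chi>e \<chi>c lin_add[OF \<phi>l] lin_add[OF \<psi>l] mod_add_closed[OF M.module_axioms])
      show "\<chi> (r \<odot>\<^bsub>M\<^esub> m) = r \<odot>\<^bsub>N\<^esub> \<chi> m" if r: "r \<in> carrier R" for r
        using m r by (intro i \<chi>c mod_smult_closed[OF N.module_axioms] mod_smult_closed[OF M.module_axioms])
          (simp_all add: \<chi>e \<chi>c lin_smult[OF \<phi>l] lin_smult[OF \<psi>l] mod_smult_closed[OF M.module_axioms])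
    qed
  next
    fix m a assume m: "m \<in> carrier M" and a: "a \<in> carrier A"
    show "\<chi> (lact M a m) = lact N a (\<chi> m)"
      using m a by (intro i \<chi>c N.lact_closed M.lact_closed) (simp_all add: \<chi>e \<chi>c M.lact_closed hl)
  next
    fix m b assume m: "m \<in> carrier M" and b: "b \<in> carrier A'"
    show "\<chi> (ract M m b) = ract N (\<chi> m) b"
      using m b by (intro i \<chi>c N.ract_closed M.ract_closed) (simp_all add: \<chi>e \<chi>c M.ract_closed hr)
  next
    fix g m assume g: "g \<in> carrier \<Gamma>" and m: "m \<in> gcomp M g"
    have mc: "m \<in> carrier M" by (rule M.M_gcomp_closed[OF g m])
    show "\<chi> m \<in> gcomp N g"
      by (rule gcomp_reflect[OF N.module_axioms N.bimodule_grading K.module_axioms K.bimodule_grading M.finite_\<Gamma> \<psi>l inj _ g \<chi>c[OF mc]])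
        (simp_all add: \<chi>e[OF mc] hg(1)[OF g m] hg(2))
  qed
  moreover have "bij_betw \<chi> (carrier M) (carrier N)"
    using bij_betw_trans[OF \<phi>(2) bij_betw_inv_into[OF \<psi>(2)]] unfolding \<chi>_def comp_def .
  ultimately show ?thesis
    unfolding graded_bimodule_iso_def using M.graded_bimodule_over_axioms N.graded_bimodule_over_axioms by blast
qed

text \<open>The target in the definition of a Morita equivalence. Its condition over
  \<open>D\<close> is the rule \<open>smap_commute\<close> of the algebra, and the unit alone
  generates it on either side.\<close>

lemma regular_bimodule_over:
  fixes A :: "('r, 'a, 'g, 'c, 'z) algebra_over_scheme"
  assumes "crossed_product_over R \<Gamma> D A"
  shows "graded_bimodule_over R \<Gamma> D A A (regular_bimodule A)"
proof -
  interpret A: crossed_product_over R \<Gamma> D A by fact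
  note s = regular_bimodule_def mk_bimodule_simps
  have sm: "same_mod (regular_bimodule A) A" unfolding regular_bimodule_def by (rule mk_bimodule_same)
  note m = same_mod_module[OF sm A.module_axioms]
  have b: "algebra_bimodule R A A (regular_bimodule A)"
  proof (rule algebra_bimoduleI[OF A.assoc_algebra_axioms A.assoc_algebra_axioms m])
    have sA: "same_mod A A" by (simp add: same_mod_def)
    show "bilin R A (regular_bimodule A) (regular_bimodule A) (lact (regular_bimodule A))"
      unfolding same_mod_bilin[OF sA sm sm] using A.mult_bilin by (simp add: s)
    show "bilin R (regular_bimodule A) A (regular_bimodule A) (ract (regular_bimodule A))"
      unfolding same_mod_bilin[OF sm sA sm] using A.mult_bilin by (simp add: s)
    have "x \<in> mspan R A {a \<otimes>\<^bsub>A\<^esub> x |a x. a \<in> carrier A \<and> x \<in> {\<one>\<^bsub>A\<^esub>}}" if "x \<in> carrier A" for x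
      by (rule mspan_base, rule CollectI, rule exI[of _ x], rule exI[of _ "\<one>\<^bsub>A\<^esub>"]) (use that in simp)
    then show "\<exists>F. finite F \<and> F \<subseteq> carrier (regular_bimodule A) \<and> carrier (regular_bimodule A) \<subseteq>
        mspan R (regular_bimodule A) {lact (regular_bimodule A) a x |a x. a \<in> carrier A \<and> x \<in> F}"
      unfolding same_mod_mspan[OF sm A.module_axioms] by (intro exI[of _ "{\<one>\<^bsub>A\<^esub>}"]) (simp add: s subset_iff)
    have "x \<in> mspan R A {x \<otimes>\<^bsub>A\<^esub> b |b x. b \<in> carrier A \<and> x \<in> {\<one>\<^bsub>A\<^esub>}}" if "x \<in> carrier A" for x
      by (rule mspan_base, rule CollectI, rule exI[of _ x], rule exI[of _ "\<one>\<^bsub>A\<^esub>"]) (use that in simp)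
    then show "\<exists>F. finite F \<and> F \<subseteq> carrier (regular_bimodule A) \<and> carrier (regular_bimodule A) \<subseteq>
        mspan R (regular_bimodule A) {ract (regular_bimodule A) x b |b x. b \<in> carrier A \<and> x \<in> F}"
      unfolding same_mod_mspan[OF sm A.module_axioms] by (intro exI[of _ "{\<one>\<^bsub>A\<^esub>}"]) (simp add: s subset_iff)
  qed (simp_all add: s A.m_assoc)
  have gr: "is_grading R \<Gamma> (regular_bimodule A)"
  proof (rule gradingI_proj[where p="\<lambda>g x. hcomp \<Gamma> A x g", OF m A.finite_\<Gamma>])
    fix g assume g: "g \<in> carrier \<Gamma>"
    show "submodule (gcomp (regular_bimodule A) g) R (regular_bimodule A)"
      unfolding same_mod_submodule[OF sm A.module_axioms] using is_grading_submodule[OF A.grading g] by (simp add: s)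
    show "lin R (regular_bimodule A) (regular_bimodule A) (\<lambda>x. hcomp \<Gamma> A x g)"
      unfolding same_mod_lin[OF sm] same_mod_lin'[OF sm] by (rule hcomp_lin[OF A.grading A.module_axioms A.finite_\<Gamma> g])
    fix h x assume "h \<in> carrier \<Gamma>" "x \<in> gcomp (regular_bimodule A) h"
    then show "hcomp \<Gamma> A x g = (if h = g then x else \<zero>\<^bsub>regular_bimodule A\<^esub>)"
      using hcomp_homogeneous[OF A.grading A.module_axioms A.finite_\<Gamma> g] by (simp add: s)
  next
    show "carrier (regular_bimodule A) \<subseteq> mspan R (regular_bimodule A) (\<Union>g\<in>carrier \<Gamma>. gcomp (regular_bimodule A) g)"
      unfolding same_mod_mspan[OF sm A.module_axioms] using grading_span[OF A.grading A.module_axioms] by (simp add: s)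
  qed
  show ?thesis
    by (rule graded_bimodule_over.intro[OF A.crossed_product_over_axioms A.crossed_product_over_axioms b],
        rule graded_bimodule_over_axioms.intro[OF gr])
      (simp_all add: s A.gcomp_mult A.smap_commute)
qed

section \<open>Induced bimodules\<close>

lemma lin_restrict: "lin R M X f \<Longrightarrow> H \<subseteq> carrier M \<Longrightarrow> lin R (M\<lparr>carrier := H\<rparr>) X f"
  by (simp add: lin_def subset_iff Pi_iff)

lemma left_induced_iso:
  fixes A :: "('r, 'a, 'g, 'c, 'z1) algebra_over_scheme" and A' :: "('r, 'b, 'g, 'c, 'z2) algebra_over_scheme"
    and M :: "('r, 'm, 'g, 'a, 'b) bimodule"
  assumes over: "graded_bimodule_over R \<Gamma> D A A' M"
  shows "graded_bimodule_iso R \<Gamma> D A A' (left_induced R \<Gamma> A A' M) M"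
proof -
  interpret M: graded_bimodule_over R \<Gamma> D A A' M by (rule over)
  have aA: "assoc_algebra R A" using M.algebra_bimodule_axioms by (rule algebra_bimodule.axioms(1))
  have mA: "module R A" by (rule assoc_algebra.axioms(1)[OF aA])
  note mM = M.module_axioms and o = M.\<Gamma>.one_closed and fin = M.finite_\<Gamma> and grM = M.bimodule_grading and grA = M.grading
  let ?B = "gcomp A \<one>\<^bsub>\<Gamma>\<^esub>" and ?H = "gcomp M \<one>\<^bsub>\<Gamma>\<^esub>"
  let ?M1 = "M\<lparr>carrier := ?H\<rparr>"
  have sub: "submodule ?H R M" by (rule is_grading_submodule[OF grM o])
  have mM1: "module R ?M1" by (rule submodule.submodule_is_module[OF sub mM])
  have Hc: "?H \<subseteq> carrier M" by (rule submodule_subset[OF sub])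
  have Bc: "b \<in> carrier A" if "b \<in> ?B" for b by (rule M.gcomp_closed[OF o that])
  have cM1: "carrier ?M1 = ?H" by simp
  interpret Td: tens_data R ?B "mult A" "lact M" A ?M1
  proof (rule tens_data.intro[OF mA mM1])
    show "lact M b x \<in> carrier ?M1" if "b \<in> ?B" "x \<in> carrier ?M1" for b x
      using M.lact_gcomp[OF o o that(1)] that(2) by simp
    show "m \<otimes>\<^bsub>A\<^esub> b \<in> carrier A" if "m \<in> carrier A" "b \<in> ?B" for m b
      by (rule M.m_closed[OF that(1) Bc[OF that(2)]])
  qed
  let ?T = "tens R ?B (mult A) (lact M) A ?M1" and ?t = "tens_elem R ?B (mult A) (lact M) A ?M1"
  note mT = Td.T_module and tc = Td.t_closed[unfolded cM1]
  have tl: "lin R A ?T (\<lambda>a. ?t a m)" if "m \<in> ?H" for m using bilin_left[OF Td.t_bilin] that by simp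
  have tr: "lin R ?M1 ?T (\<lambda>m. ?t a m)" if "a \<in> carrier A" for a using bilin_right[OF Td.t_bilin that] by simp
  have lb: "bilin R A ?M1 M (lact M)"
  proof (rule bilinI)
    show "lin R ?M1 M (lact M a)" if "a \<in> carrier A" for a by (rule lin_restrict[OF bilin_right[OF M.lact_bilin that] Hc])
    show "lin R A M (\<lambda>a. lact M a m)" if "m \<in> carrier ?M1" for m
      using bilin_left[OF M.lact_bilin] that Hc by auto
  qed
  define \<Phi> where "\<Phi> = lin_ext R M (\<lambda>(a, m). lact M a m)"
  have lm: "lact M (a \<otimes>\<^bsub>A\<^esub> b) m = lact M a (lact M b m)" if "a \<in> carrier A" "b \<in> carrier A" "m \<in> ?H" for a b m
    using that Hc by (intro M.lact_mult) auto
  have \<Phi>: "lin R ?T M \<Phi>" unfolding \<Phi>_def by (rule Td.lift(1)[OF mM lb]) (simp add: lm Bc)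
  have \<Phi>t: "\<Phi> (?t a m) = lact M a m" if "a \<in> carrier A" "m \<in> ?H" for a m
    unfolding \<Phi>_def by (rule Td.lift(2)[OF mM lb]) (simp_all add: lm Bc that)
  define u where "u = hunit A"
  define v where "v = (\<lambda>g. inv\<^bsub>A\<^esub> (hunit A g))"
  have uU: "u g \<in> Units A" and ug: "u g \<in> gcomp A g" if "g \<in> carrier \<Gamma>" for g using M.hunit[OF that] by (simp_all add: u_def)
  have uc: "u g \<in> carrier A" if "g \<in> carrier \<Gamma>" for g by (rule M.gcomp_closed[OF that ug[OF that]])
  have vg: "v g \<in> gcomp A (inv\<^bsub>\<Gamma>\<^esub> g)" if "g \<in> carrier \<Gamma>" for g
    using M.inv_gcomp[OF that ug[OF that] uU[OF that]] by (simp add: u_def v_def)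
  have vc: "v g \<in> carrier A" if "g \<in> carrier \<Gamma>" for g by (rule M.gcomp_closed[OF M.\<Gamma>.inv_closed[OF that] vg[OF that]])
  have uv: "u g \<otimes>\<^bsub>A\<^esub> v g = \<one>\<^bsub>A\<^esub>" if "g \<in> carrier \<Gamma>" for g using M.Units_r_inv[OF uU[OF that]] by (simp add: u_def v_def)
  have luv: "lact M (u g) (lact M (v g) m) = m" if "g \<in> carrier \<Gamma>" "m \<in> carrier M" for g m
    using M.lact_mult[OF uc[OF that(1)] vc[OF that(1)] that(2)] uv[OF that(1)] M.lact_one[OF that(2)] by simp
  have v1: "lact M (v g) m \<in> ?H" if "g \<in> carrier \<Gamma>" "m \<in> gcomp M g" for g m
    using M.lact_gcomp[OF M.\<Gamma>.inv_closed[OF that(1)] that(1) vg[OF that(1)] that(2)] that(1) by simp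
  \<comment> \<open>The inverse of \<Phi>: the component of \<open>m\<close> in degree
    \<open>g\<close> is \<open>u g\<close> times an element of the identity component, and the two
    factors are separated by the tensor sign.\<close>
  define \<Psi> where "\<Psi> = (\<lambda>m. \<Oplus>\<^bsub>?T\<^esub>g\<in>carrier \<Gamma>. ?t (u g) (lact M (v g) (hcomp \<Gamma> M m g)))"
  have \<Psi>1: "lin R M ?M1 (\<lambda>m. lact M (v g) (hcomp \<Gamma> M m g))" if g: "g \<in> carrier \<Gamma>" for g
  proof -
    have l: "lin R M M (\<lambda>m. lact M (v g) (hcomp \<Gamma> M m g))"
      by (rule lin_comp[OF hcomp_lin[OF grM mM fin g] bilin_right[OF M.lact_bilin vc[OF g]]])
    show ?thesis
      by (rule linI) (simp_all add: v1[OF g hcomp_mem[OF grM _ g]] lin_add[OF l] lin_smult[OF l])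
  qed
  have \<Psi>: "lin R M ?T \<Psi>" unfolding \<Psi>_def
    by (rule lin_sum[OF _ mT mM]) (rule lin_comp[OF \<Psi>1 tr[OF uc]])
  have \<Psi>\<Phi>: "\<Psi> (\<Phi> \<tau>) = \<tau>" if "\<tau> \<in> carrier ?T" for \<tau>
  proof (rule Td.eqI[OF mT lin_comp[OF \<Phi> \<Psi>] lin_ident _ that])
    fix a m assume a: "a \<in> carrier A" and "m \<in> carrier ?M1"
    then have m: "m \<in> ?H" and mc: "m \<in> carrier M" using Hc by auto
    have "\<Psi> (lact M a m) = ?t a m"
    proof (rule lin_eqI[where f="\<lambda>a. \<Psi> (lact M a m)" and g="\<lambda>a. ?t a m" and x=a, OF _ tl[OF m] mA mT])
      show "lin R A ?T (\<lambda>a. \<Psi> (lact M a m))" by (rule lin_comp[OF bilin_left[OF M.lact_bilin mc] \<Psi>])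
      show "(\<Union>g\<in>carrier \<Gamma>. gcomp A g) \<subseteq> carrier A" using M.gcomp_closed by blast
      show "a \<in> mspan R A (\<Union>g\<in>carrier \<Gamma>. gcomp A g)" using a grading_span[OF grA mA] by simp
      fix a assume "a \<in> (\<Union>g\<in>carrier \<Gamma>. gcomp A g)"
      then obtain h where h: "h \<in> carrier \<Gamma>" "a \<in> gcomp A h" by blast
      have ac: "a \<in> carrier A" by (rule M.gcomp_closed[OF h])
      have am: "lact M a m \<in> gcomp M h" using M.lact_gcomp[OF h(1) o h(2) m] h(1) by simp
      \<comment> \<open>This product lies in the identity component \<open>B\<close>, so it may
        cross the tensor sign; \<open>u h\<close> then absorbs it and gives back
        \<open>a\<close>.\<close>
      have va: "v h \<otimes>\<^bsub>A\<^esub> a \<in> ?B" using M.gcomp_mult[OF M.\<Gamma>.inv_closed[OF h(1)] h(1) vg[OF h(1)] h(2)] h(1) by simp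
      have "\<Psi> (lact M a m) = ?t (u h) (lact M (v h) (lact M a m))"
        unfolding \<Psi>_def
      proof (rule finsum_delta[OF mT fin h(1)])
        show "?t (u h) (lact M (v h) (lact M a m)) \<in> carrier ?T" by (rule tc[OF uc[OF h(1)] v1[OF h(1) am]])
        fix g assume g: "g \<in> carrier \<Gamma>"
        have "hcomp \<Gamma> M (lact M a m) g = (if g = h then lact M a m else \<zero>\<^bsub>M\<^esub>)"
          by (rule hcomp_homogeneous[OF grM mM fin g h(1) am])
        moreover have "lact M (v g) \<zero>\<^bsub>M\<^esub> = \<zero>\<^bsub>M\<^esub>" by (rule lin_zero[OF bilin_right[OF M.lact_bilin vc[OF g]] mM mM])
        moreover have "?t (u g) \<zero>\<^bsub>M\<^esub> = \<zero>\<^bsub>?T\<^esub>" using lin_zero[OF tr[OF uc[OF g]] mM1 mT] by simp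
        ultimately show "?t (u g) (lact M (v g) (hcomp \<Gamma> M (lact M a m) g)) =
          (if g = h then ?t (u h) (lact M (v h) (lact M a m)) else \<zero>\<^bsub>?T\<^esub>)" by simp
      qed
      also have "\<dots> = ?t (u h) (lact M (v h \<otimes>\<^bsub>A\<^esub> a) m)" by (simp only: lm[OF vc[OF h(1)] ac m])
      also have "\<dots> = ?t (u h \<otimes>\<^bsub>A\<^esub> (v h \<otimes>\<^bsub>A\<^esub> a)) m"
        using Td.t_balanced[OF uc[OF h(1)] va] m by simp
      also have "u h \<otimes>\<^bsub>A\<^esub> (v h \<otimes>\<^bsub>A\<^esub> a) = a"
        using uv[OF h(1)] M.m_assoc[OF uc[OF h(1)] vc[OF h(1)] ac] ac by simp
      finally show "\<Psi> (lact M a m) = ?t a m" .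
    qed
    then show "\<Psi> (\<Phi> (?t a m)) = ?t a m" by (simp only: \<Phi>t[OF a m])
  qed
  have \<Phi>\<Psi>: "\<Phi> (\<Psi> m) = m" if m: "m \<in> carrier M" for m
  proof -
    have h: "hcomp \<Gamma> M m g \<in> gcomp M g" "hcomp \<Gamma> M m g \<in> carrier M" if "g \<in> carrier \<Gamma>" for g
      using hcomp_mem[OF grM m that] hcomp_closed[OF grM m that] by simp_all
    have "\<Phi> (\<Psi> m) = (\<Oplus>\<^bsub>M\<^esub>g\<in>carrier \<Gamma>. \<Phi> (?t (u g) (lact M (v g) (hcomp \<Gamma> M m g))))"
      unfolding \<Psi>_def by (rule lin_finsum[OF \<Phi> mT mM tc[OF uc v1[OF _ h(1)]]])
    also have "\<dots> = (\<Oplus>\<^bsub>M\<^esub>g\<in>carrier \<Gamma>. hcomp \<Gamma> M m g)"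
      by (rule M.M.finsum_cong') (simp_all add: h \<Phi>t[OF uc v1[OF _ h(1)]] luv)
    finally show ?thesis using hcomp_sum[OF grM m] by simp
  qed
  have inj: "inj_on \<Phi> (carrier ?T)" by (rule inj_on_inverseI[where g=\<Psi>]) (rule \<Psi>\<Phi>)
  have bij: "bij_betw \<Phi> (carrier ?T) (carrier M)"
    by (rule bij_betw_byWitness[where f'=\<Psi>]) (use \<Psi>\<Phi> \<Phi>\<Psi> lin_closed[OF \<Phi>] lin_closed[OF \<Psi>] in blast)+
  have L: "lin R ?T ?T (lin_ext R ?T (\<lambda>(x, m). ?t (a \<otimes>\<^bsub>A\<^esub> x) m))"
    and Le: "\<And>\<tau>. \<tau> \<in> carrier ?T \<Longrightarrow> \<Phi> (lin_ext R ?T (\<lambda>(x, m). ?t (a \<otimes>\<^bsub>A\<^esub> x) m) \<tau>) = lact M a (\<Phi> \<tau>)"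
    if a: "a \<in> carrier A" for a
  proof -
    have c: "?t (a \<otimes>\<^bsub>A\<^esub> x) m \<in> carrier ?T" if "x \<in> carrier A" "m \<in> carrier ?M1" for x m
      using that a by (intro tc M.m_closed) simp_all
    have e: "\<Phi> (?t (a \<otimes>\<^bsub>A\<^esub> x) m) = lact M a (\<Phi> (?t x m))" if "x \<in> carrier A" "m \<in> carrier ?M1" for x m
      using that a by (simp add: \<Phi>t lm)
    note * = Td.lift_inj[OF mM \<Phi> inj c bilin_right[OF M.lact_bilin a] e]
    show "lin R ?T ?T (lin_ext R ?T (\<lambda>(x, m). ?t (a \<otimes>\<^bsub>A\<^esub> x) m))" by (rule *(1))
    show "\<Phi> (lin_ext R ?T (\<lambda>(x, m). ?t (a \<otimes>\<^bsub>A\<^esub> x) m) \<tau>) = lact M a (\<Phi> \<tau>)" if "\<tau> \<in> carrier ?T" for \<tau>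
      by (rule *(2)) (assumption | rule that)+
  qed
  \<comment> \<open>The right action of \<open>left_induced\<close> on a pure tensor. Under \<Phi>
    the unit \<open>u g\<close> cancels against its inverse and the action of \<open>b\<close> on
    \<open>M\<close> remains, so by \<open>lift_inj\<close> the formula is well defined for the
    chosen units.\<close>
  define f where "f = (\<lambda>b x m. \<Oplus>\<^bsub>?T\<^esub>g\<in>carrier \<Gamma>. ?t (x \<otimes>\<^bsub>A\<^esub> u g) (ract M (lact M (v g) m) (hcomp \<Gamma> A' b g)))"
  have Rr: "lin R ?T ?T (lin_ext R ?T (\<lambda>(x, m). f b x m))"
    and Re: "\<And>\<tau>. \<tau> \<in> carrier ?T \<Longrightarrow> \<Phi> (lin_ext R ?T (\<lambda>(x, m). f b x m) \<tau>) = ract M (\<Phi> \<tau>) b"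
    if b: "b \<in> carrier A'" for b
  proof -
    have bg: "hcomp \<Gamma> A' b g \<in> gcomp A' g" "hcomp \<Gamma> A' b g \<in> carrier A'" if "g \<in> carrier \<Gamma>" for g
      using hcomp_mem[OF M.A'.grading b that] hcomp_closed[OF M.A'.grading b that] by simp_all
    have w: "ract M (lact M (v g) m) (hcomp \<Gamma> A' b g) \<in> ?H" if "m \<in> ?H" "g \<in> carrier \<Gamma>" for m g
      using M.gcomp_act[OF M.\<Gamma>.inv_closed[OF that(2)] o that(2) vg[OF that(2)] that(1) bg(1)[OF that(2)]] that(2) by simp
    have xu: "x \<otimes>\<^bsub>A\<^esub> u g \<in> carrier A" if "x \<in> carrier A" "g \<in> carrier \<Gamma>" for x g by (rule M.m_closed[OF that(1) uc[OF that(2)]])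
    have c: "f b x m \<in> carrier ?T" if "x \<in> carrier A" "m \<in> carrier ?M1" for x m
      unfolding f_def using that
      by (intro submodule_finsum[OF module.carrier_is_submodule[OF mT] mT] tc xu w) simp_all
    have e: "\<Phi> (f b x m) = ract M (\<Phi> (?t x m)) b" if x: "x \<in> carrier A" and "m \<in> carrier ?M1" for x m
    proof -
      have m: "m \<in> ?H" and mc: "m \<in> carrier M" using that(2) Hc by auto
      have "\<Phi> (f b x m) = (\<Oplus>\<^bsub>M\<^esub>g\<in>carrier \<Gamma>. \<Phi> (?t (x \<otimes>\<^bsub>A\<^esub> u g) (ract M (lact M (v g) m) (hcomp \<Gamma> A' b g))))"
        unfolding f_def by (rule lin_finsum[OF \<Phi> mT mM tc[OF xu[OF x] w[OF m]]])
      also have "\<dots> = (\<Oplus>\<^bsub>M\<^esub>g\<in>carrier \<Gamma>. ract M (lact M x m) (hcomp \<Gamma> A' b g))"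
      proof (rule M.M.finsum_cong')
        show "(\<lambda>g. ract M (lact M x m) (hcomp \<Gamma> A' b g)) \<in> carrier \<Gamma> \<rightarrow> carrier M"
          by (rule funcsetI) (rule M.ract_closed[OF M.lact_closed[OF x mc] bg(2)])
        fix g assume g: "g \<in> carrier \<Gamma>"
        have vm: "lact M (v g) m \<in> carrier M" by (rule M.lact_closed[OF vc[OF g] mc])
        have "\<Phi> (?t (x \<otimes>\<^bsub>A\<^esub> u g) (ract M (lact M (v g) m) (hcomp \<Gamma> A' b g))) =
            lact M (x \<otimes>\<^bsub>A\<^esub> u g) (ract M (lact M (v g) m) (hcomp \<Gamma> A' b g))" by (rule \<Phi>t[OF xu[OF x g] w[OF m g]])
        also have "\<dots> = ract M (lact M x (lact M (u g) (lact M (v g) m))) (hcomp \<Gamma> A' b g)"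
          using M.lact_ract[OF xu[OF x g] vm bg(2)[OF g]] M.lact_mult[OF x uc[OF g] vm] by simp
        finally show "\<Phi> (?t (x \<otimes>\<^bsub>A\<^esub> u g) (ract M (lact M (v g) m) (hcomp \<Gamma> A' b g))) =
            ract M (lact M x m) (hcomp \<Gamma> A' b g)" by (simp only: luv[OF g mc])
      qed simp
      also have "\<dots> = ract M (lact M x m) (\<Oplus>\<^bsub>A'\<^esub>g\<in>carrier \<Gamma>. hcomp \<Gamma> A' b g)"
        by (rule lin_finsum[OF bilin_right[OF M.ract_bilin M.lact_closed[OF x mc]] M.A'.module_axioms mM bg(2), symmetric])
      finally show ?thesis by (simp only: hcomp_sum[OF M.A'.grading b] \<Phi>t[OF x m])
    qed
    note * = Td.lift_inj[OF mM \<Phi> inj c bilin_left[OF M.ract_bilin b] e]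
    show "lin R ?T ?T (lin_ext R ?T (\<lambda>(x, m). f b x m))" by (rule *(1))
    show "\<Phi> (lin_ext R ?T (\<lambda>(x, m). f b x m) \<tau>) = ract M (\<Phi> \<tau>) b" if "\<tau> \<in> carrier ?T" for \<tau>
      by (rule *(2)) (assumption | rule that)+
  qed
  define gc where "gc = (\<lambda>g. mspan R ?T {?t x m | x m. x \<in> gcomp A g \<and> m \<in> carrier ?M1})"
  have gs: "{?t x m | x m. x \<in> gcomp A g \<and> m \<in> carrier ?M1} \<subseteq> carrier ?T" if "g \<in> carrier \<Gamma>" for g
    using tc M.gcomp_closed[OF that] by auto
  have gsub: "submodule (gc g) R ?T" if "g \<in> carrier \<Gamma>" for g
    unfolding gc_def by (rule mspan_submodule[OF mT gs[OF that]])
  have le: "left_induced R \<Gamma> A A' M = mk_bimodule ?T gc (\<lambda>a. lin_ext R ?T (\<lambda>(x, m). ?t (a \<otimes>\<^bsub>A\<^esub> x) m))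
      (\<lambda>z b. lin_ext R ?T (\<lambda>(x, m). f b x m) z)"
    by (simp add: left_induced_def Let_def gc_def f_def u_def v_def)
  note same = mk_bimodule_same[of ?T gc "\<lambda>a. lin_ext R ?T (\<lambda>(x, m). ?t (a \<otimes>\<^bsub>A\<^esub> x) m)" "\<lambda>z b. lin_ext R ?T (\<lambda>(x, m). f b x m) z"]
  show ?thesis unfolding le
  proof (rule graded_bimodule_transport[OF over same_mod_module[OF same mT], where \<phi>=\<Phi>], unfold mk_bimodule_simps
      same_mod_lin[OF same] same_mod_mspan[OF same mT] same_mod_submodule[OF same mT])
    show "lin R ?T M \<Phi>" by (rule \<Phi>)
    show "bij_betw \<Phi> (carrier ?T) (carrier M)" by (rule bij)
    show "lin_ext R ?T (\<lambda>(x, m). ?t (a \<otimes>\<^bsub>A\<^esub> x) m) \<tau> \<in> carrier ?T" if "a \<in> carrier A" "\<tau> \<in> carrier ?T" for a \<tau>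
      by (rule lin_closed[OF L[OF that(1)] that(2)])
    show "\<Phi> (lin_ext R ?T (\<lambda>(x, m). ?t (a \<otimes>\<^bsub>A\<^esub> x) m) \<tau>) = lact M a (\<Phi> \<tau>)" if "a \<in> carrier A" "\<tau> \<in> carrier ?T" for a \<tau>
      by (rule Le[OF that])
    show "lin_ext R ?T (\<lambda>(x, m). f b x m) \<tau> \<in> carrier ?T" if "\<tau> \<in> carrier ?T" "b \<in> carrier A'" for b \<tau>
      by (rule lin_closed[OF Rr[OF that(2)] that(1)])
    show "\<Phi> (lin_ext R ?T (\<lambda>(x, m). f b x m) \<tau>) = ract M (\<Phi> \<tau>) b" if "\<tau> \<in> carrier ?T" "b \<in> carrier A'" for b \<tau>
      by (rule Re[OF that(2,1)])
    show "submodule (gc g) R ?T" if "g \<in> carrier \<Gamma>" for g by (rule gsub[OF that])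
    show "\<Phi> \<tau> \<in> gcomp M g" if g: "g \<in> carrier \<Gamma>" and \<tau>: "\<tau> \<in> gc g" for g \<tau>
    proof (rule lin_mspan[OF \<Phi> mT mM is_grading_submodule[OF grM g] gs[OF g] _ \<tau>[unfolded gc_def]])
      fix s assume "s \<in> {?t x m | x m. x \<in> gcomp A g \<and> m \<in> carrier ?M1}"
      then obtain x m where x: "s = ?t x m" "x \<in> gcomp A g" "m \<in> ?H" by auto
      show "\<Phi> s \<in> gcomp M g"
        using M.lact_gcomp[OF g o x(2,3)] g \<Phi>t[OF M.gcomp_closed[OF g x(2)] x(3)] by (simp add: x(1))
    qed
    let ?K = "mspan R ?T (\<Union>g\<in>carrier \<Gamma>. gc g)"
    have us: "(\<Union>g\<in>carrier \<Gamma>. gc g) \<subseteq> carrier ?T" using submodule_subset[OF gsub] by blast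
    note K = mspan_submodule[OF mT us]
    show "carrier ?T \<subseteq> ?K"
    proof (rule subsetI, rule Td.induct[OF K])
      fix a m assume a: "a \<in> carrier A" and "m \<in> carrier ?M1"
      then have m: "m \<in> ?H" by simp
      show "?t a m \<in> ?K"
      proof (rule lin_mspan[OF tl[OF m] mA mT K])
        show "(\<Union>g\<in>carrier \<Gamma>. gcomp A g) \<subseteq> carrier A" using M.gcomp_closed by blast
        show "a \<in> mspan R A (\<Union>g\<in>carrier \<Gamma>. gcomp A g)" using a grading_span[OF grA mA] by simp
        fix x assume "x \<in> (\<Union>g\<in>carrier \<Gamma>. gcomp A g)"
        then obtain h where h: "h \<in> carrier \<Gamma>" "x \<in> gcomp A h" by blast
        have "?t x m \<in> gc h" unfolding gc_def using h(2) m by (intro mspan_base) auto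
        then show "?t x m \<in> ?K" using h(1) by (intro mspan_base) blast
      qed
    qed
  qed
qed

text \<open>The mirror image of \<open>left_induced_iso\<close>: the right action gives the
  isomorphism, and the units are those of \<open>A'\<close>, whose inverses act on the
  right.\<close>

lemma right_induced_iso:
  fixes A :: "('r, 'a, 'g, 'c, 'z1) algebra_over_scheme" and A' :: "('r, 'b, 'g, 'c, 'z2) algebra_over_scheme"
    and M :: "('r, 'm, 'g, 'a, 'b) bimodule"
  assumes over: "graded_bimodule_over R \<Gamma> D A A' M"
  shows "graded_bimodule_iso R \<Gamma> D A A' (right_induced R \<Gamma> A A' M) M"
proof -
  interpret M: graded_bimodule_over R \<Gamma> D A A' M by (rule over)
  have aA: "assoc_algebra R A" using M.algebra_bimodule_axioms by (rule algebra_bimodule.axioms(1))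
  have mA: "module R A" by (rule assoc_algebra.axioms(1)[OF aA])
  note mA' = M.A'.module_axioms
  note mM = M.module_axioms and o = M.\<Gamma>.one_closed and fin = M.finite_\<Gamma> and grM = M.bimodule_grading and grA' = M.A'.grading
  let ?B = "gcomp A' \<one>\<^bsub>\<Gamma>\<^esub>" and ?H = "gcomp M \<one>\<^bsub>\<Gamma>\<^esub>"
  let ?M1 = "M\<lparr>carrier := ?H\<rparr>"
  have sub: "submodule ?H R M" by (rule is_grading_submodule[OF grM o])
  have mM1: "module R ?M1" by (rule submodule.submodule_is_module[OF sub mM])
  have Hc: "?H \<subseteq> carrier M" by (rule submodule_subset[OF sub])
  have Bc: "b \<in> carrier A'" if "b \<in> ?B" for b by (rule M.A'.gcomp_closed[OF o that])
  have cM1: "carrier ?M1 = ?H" by simp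
  interpret Td: tens_data R ?B "ract M" "mult A'" ?M1 A'
  proof (rule tens_data.intro[OF mM1 mA'])
    show "ract M x b \<in> carrier ?M1" if "x \<in> carrier ?M1" "b \<in> ?B" for b x
      using M.ract_gcomp[OF o o _ that(2)] that(1) by simp
    show "b \<otimes>\<^bsub>A'\<^esub> x \<in> carrier A'" if "b \<in> ?B" "x \<in> carrier A'" for x b
      by (rule M.A'.m_closed[OF Bc[OF that(1)] that(2)])
  qed
  let ?T = "tens R ?B (ract M) (mult A') ?M1 A'" and ?t = "tens_elem R ?B (ract M) (mult A') ?M1 A'"
  note mT = Td.T_module and tc = Td.t_closed[unfolded cM1]
  have tr: "lin R A' ?T (\<lambda>x. ?t m x)" if "m \<in> ?H" for m using bilin_right[OF Td.t_bilin] that by simp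
  have tl: "lin R ?M1 ?T (\<lambda>m. ?t m x)" if "x \<in> carrier A'" for x using bilin_left[OF Td.t_bilin that] by simp
  have rb: "bilin R ?M1 A' M (ract M)"
  proof (rule bilinI)
    show "lin R ?M1 M (\<lambda>m. ract M m x)" if "x \<in> carrier A'" for x by (rule lin_restrict[OF bilin_left[OF M.ract_bilin that] Hc])
    show "lin R A' M (ract M m)" if "m \<in> carrier ?M1" for m
      using bilin_right[OF M.ract_bilin] that Hc by auto
  qed
  define \<Phi> where "\<Phi> = lin_ext R M (\<lambda>(m, x). ract M m x)"
  have rm: "ract M m (a \<otimes>\<^bsub>A'\<^esub> b) = ract M (ract M m a) b" if "a \<in> carrier A'" "b \<in> carrier A'" "m \<in> ?H" for a b m
    using that Hc by (intro M.ract_mult) auto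
  have \<Phi>: "lin R ?T M \<Phi>" unfolding \<Phi>_def by (rule Td.lift(1)[OF mM rb]) (simp add: rm Bc)
  have \<Phi>t: "\<Phi> (?t m x) = ract M m x" if "x \<in> carrier A'" "m \<in> ?H" for x m
    unfolding \<Phi>_def by (rule Td.lift(2)[OF mM rb]) (simp_all add: rm Bc that)
  define u where "u = hunit A'"
  define v where "v = (\<lambda>g. inv\<^bsub>A'\<^esub> (hunit A' g))"
  have uU: "u g \<in> Units A'" and ug: "u g \<in> gcomp A' g" if "g \<in> carrier \<Gamma>" for g using M.A'.hunit[OF that] by (simp_all add: u_def)
  have uc: "u g \<in> carrier A'" if "g \<in> carrier \<Gamma>" for g by (rule M.A'.gcomp_closed[OF that ug[OF that]])
  have vg: "v g \<in> gcomp A' (inv\<^bsub>\<Gamma>\<^esub> g)" if "g \<in> carrier \<Gamma>" for g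
    using M.A'.inv_gcomp[OF that ug[OF that] uU[OF that]] by (simp add: u_def v_def)
  have vc: "v g \<in> carrier A'" if "g \<in> carrier \<Gamma>" for g by (rule M.A'.gcomp_closed[OF M.\<Gamma>.inv_closed[OF that] vg[OF that]])
  have vu: "v g \<otimes>\<^bsub>A'\<^esub> u g = \<one>\<^bsub>A'\<^esub>" if "g \<in> carrier \<Gamma>" for g using M.A'.Units_l_inv[OF uU[OF that]] by (simp add: u_def v_def)
  have rvu: "ract M (ract M m (v g)) (u g) = m" if "g \<in> carrier \<Gamma>" "m \<in> carrier M" for g m
    using M.ract_mult[OF that(2) vc[OF that(1)] uc[OF that(1)]] vu[OF that(1)] M.ract_one[OF that(2)] by simp
  have v1: "ract M m (v g) \<in> ?H" if "g \<in> carrier \<Gamma>" "m \<in> gcomp M g" for g m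
    using M.ract_gcomp[OF that(1) M.\<Gamma>.inv_closed[OF that(1)] that(2) vg[OF that(1)]] that(1) by simp
  define \<Psi> where "\<Psi> = (\<lambda>m. \<Oplus>\<^bsub>?T\<^esub>g\<in>carrier \<Gamma>. ?t (ract M (hcomp \<Gamma> M m g) (v g)) (u g))"
  have \<Psi>1: "lin R M ?M1 (\<lambda>m. ract M (hcomp \<Gamma> M m g) (v g))" if g: "g \<in> carrier \<Gamma>" for g
  proof -
    have l: "lin R M M (\<lambda>m. ract M (hcomp \<Gamma> M m g) (v g))"
      by (rule lin_comp[OF hcomp_lin[OF grM mM fin g] bilin_left[OF M.ract_bilin vc[OF g]]])
    show ?thesis
      by (rule linI) (simp_all add: v1[OF g hcomp_mem[OF grM _ g]] lin_add[OF l] lin_smult[OF l])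
  qed
  have \<Psi>: "lin R M ?T \<Psi>" unfolding \<Psi>_def
    by (rule lin_sum[OF _ mT mM]) (rule lin_comp[OF \<Psi>1 tl[OF uc]])
  have \<Psi>\<Phi>: "\<Psi> (\<Phi> \<tau>) = \<tau>" if "\<tau> \<in> carrier ?T" for \<tau>
  proof (rule Td.eqI[OF mT lin_comp[OF \<Phi> \<Psi>] lin_ident _ that])
    fix m a assume a: "a \<in> carrier A'" and "m \<in> carrier ?M1"
    then have m: "m \<in> ?H" and mc: "m \<in> carrier M" using Hc by auto
    have "\<Psi> (ract M m a) = ?t m a"
    proof (rule lin_eqI[where f="\<lambda>a. \<Psi> (ract M m a)" and g="\<lambda>a. ?t m a" and x=a, OF _ tr[OF m] mA' mT])
      show "lin R A' ?T (\<lambda>a. \<Psi> (ract M m a))" by (rule lin_comp[OF bilin_right[OF M.ract_bilin mc] \<Psi>])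
      show "(\<Union>g\<in>carrier \<Gamma>. gcomp A' g) \<subseteq> carrier A'" using M.A'.gcomp_closed by blast
      show "a \<in> mspan R A' (\<Union>g\<in>carrier \<Gamma>. gcomp A' g)" using a grading_span[OF grA' mA'] by simp
      fix a assume "a \<in> (\<Union>g\<in>carrier \<Gamma>. gcomp A' g)"
      then obtain h where h: "h \<in> carrier \<Gamma>" "a \<in> gcomp A' h" by blast
      have ac: "a \<in> carrier A'" by (rule M.A'.gcomp_closed[OF h])
      have am: "ract M m a \<in> gcomp M h" using M.ract_gcomp[OF o h(1) m h(2)] h(1) by simp
      have av: "a \<otimes>\<^bsub>A'\<^esub> v h \<in> ?B" using M.A'.gcomp_mult[OF h(1) M.\<Gamma>.inv_closed[OF h(1)] h(2) vg[OF h(1)]] h(1) by simp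
      have "\<Psi> (ract M m a) = ?t (ract M (ract M m a) (v h)) (u h)"
        unfolding \<Psi>_def
      proof (rule finsum_delta[OF mT fin h(1)])
        show "?t (ract M (ract M m a) (v h)) (u h) \<in> carrier ?T" by (rule tc[OF v1[OF h(1) am] uc[OF h(1)]])
        fix g assume g: "g \<in> carrier \<Gamma>"
        have "hcomp \<Gamma> M (ract M m a) g = (if g = h then ract M m a else \<zero>\<^bsub>M\<^esub>)"
          by (rule hcomp_homogeneous[OF grM mM fin g h(1) am])
        moreover have "ract M \<zero>\<^bsub>M\<^esub> (v g) = \<zero>\<^bsub>M\<^esub>" by (rule lin_zero[OF bilin_left[OF M.ract_bilin vc[OF g]] mM mM])
        moreover have "?t \<zero>\<^bsub>M\<^esub> (u g) = \<zero>\<^bsub>?T\<^esub>" using lin_zero[OF tl[OF uc[OF g]] mM1 mT] by simp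
        ultimately show "?t (ract M (hcomp \<Gamma> M (ract M m a) g) (v g)) (u g) =
          (if g = h then ?t (ract M (ract M m a) (v h)) (u h) else \<zero>\<^bsub>?T\<^esub>)" by simp
      qed
      also have "\<dots> = ?t (ract M m (a \<otimes>\<^bsub>A'\<^esub> v h)) (u h)" by (simp only: rm[OF ac vc[OF h(1)] m])
      also have "\<dots> = ?t m (a \<otimes>\<^bsub>A'\<^esub> v h \<otimes>\<^bsub>A'\<^esub> u h)"
        using Td.t_balanced[OF _ av uc[OF h(1)]] m by simp
      also have "a \<otimes>\<^bsub>A'\<^esub> v h \<otimes>\<^bsub>A'\<^esub> u h = a"
        using vu[OF h(1)] M.A'.m_assoc[OF ac vc[OF h(1)] uc[OF h(1)]] ac by simp
      finally show "\<Psi> (ract M m a) = ?t m a" .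
    qed
    then show "\<Psi> (\<Phi> (?t m a)) = ?t m a" by (simp only: \<Phi>t[OF a m])
  qed
  have \<Phi>\<Psi>: "\<Phi> (\<Psi> m) = m" if m: "m \<in> carrier M" for m
  proof -
    have h: "hcomp \<Gamma> M m g \<in> gcomp M g" "hcomp \<Gamma> M m g \<in> carrier M" if "g \<in> carrier \<Gamma>" for g
      using hcomp_mem[OF grM m that] hcomp_closed[OF grM m that] by simp_all
    have "\<Phi> (\<Psi> m) = (\<Oplus>\<^bsub>M\<^esub>g\<in>carrier \<Gamma>. \<Phi> (?t (ract M (hcomp \<Gamma> M m g) (v g)) (u g)))"
      unfolding \<Psi>_def by (rule lin_finsum[OF \<Phi> mT mM tc[OF v1[OF _ h(1)] uc]])
    also have "\<dots> = (\<Oplus>\<^bsub>M\<^esub>g\<in>carrier \<Gamma>. hcomp \<Gamma> M m g)"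
      by (rule M.M.finsum_cong') (simp_all add: h \<Phi>t[OF uc v1[OF _ h(1)]] rvu)
    finally show ?thesis using hcomp_sum[OF grM m] by simp
  qed
  have inj: "inj_on \<Phi> (carrier ?T)" by (rule inj_on_inverseI[where g=\<Psi>]) (rule \<Psi>\<Phi>)
  have bij: "bij_betw \<Phi> (carrier ?T) (carrier M)"
    by (rule bij_betw_byWitness[where f'=\<Psi>]) (use \<Psi>\<Phi> \<Phi>\<Psi> lin_closed[OF \<Phi>] lin_closed[OF \<Psi>] in blast)+
  have Rr: "lin R ?T ?T (lin_ext R ?T (\<lambda>(m, x). ?t m (x \<otimes>\<^bsub>A'\<^esub> b)))"
    and Re: "\<And>\<tau>. \<tau> \<in> carrier ?T \<Longrightarrow> \<Phi> (lin_ext R ?T (\<lambda>(m, x). ?t m (x \<otimes>\<^bsub>A'\<^esub> b)) \<tau>) = ract M (\<Phi> \<tau>) b"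
    if b: "b \<in> carrier A'" for b
  proof -
    have c: "?t m (x \<otimes>\<^bsub>A'\<^esub> b) \<in> carrier ?T" if "m \<in> carrier ?M1" "x \<in> carrier A'" for x m
      using that b by (intro tc M.A'.m_closed) simp_all
    have e: "\<Phi> (?t m (x \<otimes>\<^bsub>A'\<^esub> b)) = ract M (\<Phi> (?t m x)) b" if "m \<in> carrier ?M1" "x \<in> carrier A'" for x m
      using that b by (simp add: \<Phi>t rm)
    note * = Td.lift_inj[OF mM \<Phi> inj c bilin_left[OF M.ract_bilin b] e]
    show "lin R ?T ?T (lin_ext R ?T (\<lambda>(m, x). ?t m (x \<otimes>\<^bsub>A'\<^esub> b)))" by (rule *(1))
    show "\<Phi> (lin_ext R ?T (\<lambda>(m, x). ?t m (x \<otimes>\<^bsub>A'\<^esub> b)) \<tau>) = ract M (\<Phi> \<tau>) b" if "\<tau> \<in> carrier ?T" for \<tau>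
      by (rule *(2)) (assumption | rule that)+
  qed
  define f where "f = (\<lambda>a m x. \<Oplus>\<^bsub>?T\<^esub>g\<in>carrier \<Gamma>. ?t (ract M (lact M (hcomp \<Gamma> A a g) m) (v g)) (u g \<otimes>\<^bsub>A'\<^esub> x))"
  have L: "lin R ?T ?T (lin_ext R ?T (\<lambda>(m, x). f a m x))"
    and Le: "\<And>\<tau>. \<tau> \<in> carrier ?T \<Longrightarrow> \<Phi> (lin_ext R ?T (\<lambda>(m, x). f a m x) \<tau>) = lact M a (\<Phi> \<tau>)"
    if a: "a \<in> carrier A" for a
  proof -
    have ag: "hcomp \<Gamma> A a g \<in> gcomp A g" "hcomp \<Gamma> A a g \<in> carrier A" if "g \<in> carrier \<Gamma>" for g
      using hcomp_mem[OF M.grading a that] hcomp_closed[OF M.grading a that] by simp_all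
    have w: "ract M (lact M (hcomp \<Gamma> A a g) m) (v g) \<in> ?H" if "m \<in> ?H" "g \<in> carrier \<Gamma>" for m g
      using M.gcomp_act[OF that(2) o M.\<Gamma>.inv_closed[OF that(2)] ag(1)[OF that(2)] that(1) vg[OF that(2)]] that(2) by simp
    have ux: "u g \<otimes>\<^bsub>A'\<^esub> x \<in> carrier A'" if "x \<in> carrier A'" "g \<in> carrier \<Gamma>" for x g by (rule M.A'.m_closed[OF uc[OF that(2)] that(1)])
    have c: "f a m x \<in> carrier ?T" if "m \<in> carrier ?M1" "x \<in> carrier A'" for x m
      unfolding f_def using that
      by (intro submodule_finsum[OF module.carrier_is_submodule[OF mT] mT] tc ux w) simp_all
    have e: "\<Phi> (f a m x) = lact M a (\<Phi> (?t m x))" if "m \<in> carrier ?M1" and x: "x \<in> carrier A'" for x m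
    proof -
      have m: "m \<in> ?H" and mc: "m \<in> carrier M" using that(1) Hc by auto
      have "\<Phi> (f a m x) = (\<Oplus>\<^bsub>M\<^esub>g\<in>carrier \<Gamma>. \<Phi> (?t (ract M (lact M (hcomp \<Gamma> A a g) m) (v g)) (u g \<otimes>\<^bsub>A'\<^esub> x)))"
        unfolding f_def by (rule lin_finsum[OF \<Phi> mT mM tc[OF w[OF m] ux[OF x]]])
      also have "\<dots> = (\<Oplus>\<^bsub>M\<^esub>g\<in>carrier \<Gamma>. lact M (hcomp \<Gamma> A a g) (ract M m x))"
      proof (rule M.M.finsum_cong')
        show "(\<lambda>g. lact M (hcomp \<Gamma> A a g) (ract M m x)) \<in> carrier \<Gamma> \<rightarrow> carrier M"
          by (rule funcsetI) (rule M.lact_closed[OF ag(2) M.ract_closed[OF mc x]])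
        fix g assume g: "g \<in> carrier \<Gamma>"
        have am: "lact M (hcomp \<Gamma> A a g) m \<in> carrier M" by (rule M.lact_closed[OF ag(2)[OF g] mc])
        have amv: "ract M (lact M (hcomp \<Gamma> A a g) m) (v g) \<in> carrier M" by (rule M.ract_closed[OF am vc[OF g]])
        have "\<Phi> (?t (ract M (lact M (hcomp \<Gamma> A a g) m) (v g)) (u g \<otimes>\<^bsub>A'\<^esub> x)) =
            ract M (ract M (lact M (hcomp \<Gamma> A a g) m) (v g)) (u g \<otimes>\<^bsub>A'\<^esub> x)" by (rule \<Phi>t[OF ux[OF x g] w[OF m g]])
        also have "\<dots> = ract M (lact M (hcomp \<Gamma> A a g) m) x"
          by (simp only: M.ract_mult[OF amv uc[OF g] x] rvu[OF g am])
        also have "\<dots> = lact M (hcomp \<Gamma> A a g) (ract M m x)" by (rule M.lact_ract[OF ag(2)[OF g] mc x])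
        finally show "\<Phi> (?t (ract M (lact M (hcomp \<Gamma> A a g) m) (v g)) (u g \<otimes>\<^bsub>A'\<^esub> x)) =
            lact M (hcomp \<Gamma> A a g) (ract M m x)" .
      qed simp
      also have "\<dots> = lact M (\<Oplus>\<^bsub>A\<^esub>g\<in>carrier \<Gamma>. hcomp \<Gamma> A a g) (ract M m x)"
        by (rule lin_finsum[OF bilin_left[OF M.lact_bilin M.ract_closed[OF mc x]] mA mM ag(2), symmetric])
      finally show ?thesis by (simp only: hcomp_sum[OF M.grading a] \<Phi>t[OF x m])
    qed
    note * = Td.lift_inj[OF mM \<Phi> inj c bilin_right[OF M.lact_bilin a] e]
    show "lin R ?T ?T (lin_ext R ?T (\<lambda>(m, x). f a m x))" by (rule *(1))
    show "\<Phi> (lin_ext R ?T (\<lambda>(m, x). f a m x) \<tau>) = lact M a (\<Phi> \<tau>)" if "\<tau> \<in> carrier ?T" for \<tau>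
      by (rule *(2)) (assumption | rule that)+
  qed
  define gc where "gc = (\<lambda>g. mspan R ?T {?t m x | m x. m \<in> carrier ?M1 \<and> x \<in> gcomp A' g})"
  have gs: "{?t m x | m x. m \<in> carrier ?M1 \<and> x \<in> gcomp A' g} \<subseteq> carrier ?T" if "g \<in> carrier \<Gamma>" for g
    using tc M.A'.gcomp_closed[OF that] by auto
  have gsub: "submodule (gc g) R ?T" if "g \<in> carrier \<Gamma>" for g
    unfolding gc_def by (rule mspan_submodule[OF mT gs[OF that]])
  have le: "right_induced R \<Gamma> A A' M = mk_bimodule ?T gc (\<lambda>a. lin_ext R ?T (\<lambda>(m, x). f a m x))
      (\<lambda>z b. lin_ext R ?T (\<lambda>(m, x). ?t m (x \<otimes>\<^bsub>A'\<^esub> b)) z)"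
    by (simp add: right_induced_def Let_def gc_def f_def u_def v_def)
  note same = mk_bimodule_same[of ?T gc "\<lambda>a. lin_ext R ?T (\<lambda>(m, x). f a m x)" "\<lambda>z b. lin_ext R ?T (\<lambda>(m, x). ?t m (x \<otimes>\<^bsub>A'\<^esub> b)) z"]
  show ?thesis unfolding le
  proof (rule graded_bimodule_transport[OF over same_mod_module[OF same mT], where \<phi>=\<Phi>], unfold mk_bimodule_simps
      same_mod_lin[OF same] same_mod_mspan[OF same mT] same_mod_submodule[OF same mT])
    show "lin R ?T M \<Phi>" by (rule \<Phi>)
    show "bij_betw \<Phi> (carrier ?T) (carrier M)" by (rule bij)
    show "lin_ext R ?T (\<lambda>(m, x). ?t m (x \<otimes>\<^bsub>A'\<^esub> b)) \<tau> \<in> carrier ?T" if "\<tau> \<in> carrier ?T" "b \<in> carrier A'" for b \<tau>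
      by (rule lin_closed[OF Rr[OF that(2)] that(1)])
    show "\<Phi> (lin_ext R ?T (\<lambda>(m, x). ?t m (x \<otimes>\<^bsub>A'\<^esub> b)) \<tau>) = ract M (\<Phi> \<tau>) b" if "\<tau> \<in> carrier ?T" "b \<in> carrier A'" for b \<tau>
      by (rule Re[OF that(2,1)])
    show "lin_ext R ?T (\<lambda>(m, x). f a m x) \<tau> \<in> carrier ?T" if "a \<in> carrier A" "\<tau> \<in> carrier ?T" for a \<tau>
      by (rule lin_closed[OF L[OF that(1)] that(2)])
    show "\<Phi> (lin_ext R ?T (\<lambda>(m, x). f a m x) \<tau>) = lact M a (\<Phi> \<tau>)" if "a \<in> carrier A" "\<tau> \<in> carrier ?T" for a \<tau>
      by (rule Le[OF that])
    show "submodule (gc g) R ?T" if "g \<in> carrier \<Gamma>" for g by (rule gsub[OF that])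
    show "\<Phi> \<tau> \<in> gcomp M g" if g: "g \<in> carrier \<Gamma>" and \<tau>: "\<tau> \<in> gc g" for g \<tau>
    proof (rule lin_mspan[OF \<Phi> mT mM is_grading_submodule[OF grM g] gs[OF g] _ \<tau>[unfolded gc_def]])
      fix s assume "s \<in> {?t m x | m x. m \<in> carrier ?M1 \<and> x \<in> gcomp A' g}"
      then obtain x m where x: "s = ?t m x" "x \<in> gcomp A' g" "m \<in> ?H" by auto
      show "\<Phi> s \<in> gcomp M g"
        using M.ract_gcomp[OF o g x(3,2)] g \<Phi>t[OF M.A'.gcomp_closed[OF g x(2)] x(3)] by (simp add: x(1))
    qed
    let ?K = "mspan R ?T (\<Union>g\<in>carrier \<Gamma>. gc g)"
    have us: "(\<Union>g\<in>carrier \<Gamma>. gc g) \<subseteq> carrier ?T" using submodule_subset[OF gsub] by blast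
    note K = mspan_submodule[OF mT us]
    show "carrier ?T \<subseteq> ?K"
    proof (rule subsetI, rule Td.induct[OF K])
      fix a m assume a: "a \<in> carrier A'" and "m \<in> carrier ?M1"
      then have m: "m \<in> ?H" by simp
      show "?t m a \<in> ?K"
      proof (rule lin_mspan[OF tr[OF m] mA' mT K])
        show "(\<Union>g\<in>carrier \<Gamma>. gcomp A' g) \<subseteq> carrier A'" using M.A'.gcomp_closed by blast
        show "a \<in> mspan R A' (\<Union>g\<in>carrier \<Gamma>. gcomp A' g)" using a grading_span[OF grA' mA'] by simp
        fix x assume "x \<in> (\<Union>g\<in>carrier \<Gamma>. gcomp A' g)"
        then obtain h where h: "h \<in> carrier \<Gamma>" "x \<in> gcomp A' h" by blast
        have "?t m x \<in> gc h" unfolding gc_def using h(2) m by (intro mspan_base) auto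
        then show "?t m x \<in> ?K" using h(1) by (intro mspan_base) blast
      qed
    qed
  qed
qed

section \<open>Progenerators\<close>

text \<open>The left linear maps from \<open>M\<close> to \<open>A\<close>, with arbitrary values
  outside the carrier. The dual consists of the extensional ones, and
  \<open>equivariant_restrict\<close> leads there.\<close>

definition equivariant :: "('r, 'k) ring_scheme \<Rightarrow> ('r, 'a, 'z1) module_scheme
    \<Rightarrow> ('r, 'm, 'g, 'a, 'b, 'z2) bimodule_scheme \<Rightarrow> ('m \<Rightarrow> 'a) \<Rightarrow> bool" where
  "equivariant R A M f \<longleftrightarrow> lin R M A f \<and> (\<forall>a\<in>carrier A. \<forall>m\<in>carrier M. f (lact M a m) = a \<otimes>\<^bsub>A\<^esub> f m)"

lemma equivariant_lin: "equivariant R A M f \<Longrightarrow> lin R M A f"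
  and equivariant_lact: "equivariant R A M f \<Longrightarrow> a \<in> carrier A \<Longrightarrow> m \<in> carrier M \<Longrightarrow> f (lact M a m) = a \<otimes>\<^bsub>A\<^esub> f m"
  by (simp_all add: equivariant_def)

lemma equivariant_closed: "equivariant R A M f \<Longrightarrow> m \<in> carrier M \<Longrightarrow> f m \<in> carrier A"
  by (rule lin_closed[OF equivariant_lin])

lemma equivariant_mspan:
  assumes "equivariant R A M f" "m \<in> carrier M"
  shows "f m \<in> mspan R A {f x | f x. equivariant R A M f \<and> x \<in> carrier M}"
  by (rule mspan_base, rule CollectI, rule exI[of _ f], rule exI[of _ m]) (use assms in simp)

text \<open>
  These conditions say that \<open>M\<close> is a progenerator over \<open>A\<close> with \<open>A' = End\<^sub>A(M)\<^sup>o\<^sup>p\<close>: the last two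
  express that \<open>M\<close> is a generator and that it is finitely generated and projective.
\<close>

locale progenerator = algebra_bimodule +
  assumes faithful: "b \<in> carrier A' \<Longrightarrow> (\<And>m. m \<in> carrier M \<Longrightarrow> ract M m b = \<zero>\<^bsub>M\<^esub>) \<Longrightarrow> b = \<zero>\<^bsub>A'\<^esub>"
    and rank_one: "equivariant R A M f \<Longrightarrow> y \<in> carrier M \<Longrightarrow>
      \<exists>b\<in>carrier A'. \<forall>m\<in>carrier M. ract M m b = lact M (f m) y"
    and generator: "\<one>\<^bsub>A\<^esub> \<in> mspan R A {f x | f x. equivariant R A M f \<and> x \<in> carrier M}"
    and projective: "\<one>\<^bsub>A'\<^esub> \<in> mspan R A' {b \<in> carrier A'. \<exists>g y. equivariant R A M g \<and> y \<in> carrier M \<and>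
      (\<forall>m\<in>carrier M. ract M m b = lact M (g m) y)}"
begin

lemma faithful_eq:
  assumes b: "b \<in> carrier A'" and c: "c \<in> carrier A'" and e: "\<And>m. m \<in> carrier M \<Longrightarrow> ract M m b = ract M m c"
  shows "b = c"
proof -
  have "b \<ominus>\<^bsub>A'\<^esub> c = \<zero>\<^bsub>A'\<^esub>"
  proof (rule faithful)
    show "b \<ominus>\<^bsub>A'\<^esub> c \<in> carrier A'" using b c by simp
    fix m assume m: "m \<in> carrier M"
    have "ract M m (b \<ominus>\<^bsub>A'\<^esub> c) = ract M m b \<ominus>\<^bsub>M\<^esub> ract M m c"
      by (rule lin_diff[OF bilin_right[OF ract_bilin m] A'.module_axioms module_axioms b c])
    then show "ract M m (b \<ominus>\<^bsub>A'\<^esub> c) = \<zero>\<^bsub>M\<^esub>"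
      using e[OF m] M.r_neg[OF ract_closed[OF m c]] by (simp add: a_minus_def)
  qed
  then show ?thesis by (rule mod_diff_zeroD[OF A'.module_axioms b c])
qed

text \<open>The element \<open>[f, y]\<close> of the overview. By faithfulness there is only one
  candidate, so identities between brackets may be tested by their action on
  \<open>M\<close>.\<close>

definition bracket where
  "bracket f y = (SOME b. b \<in> carrier A' \<and> (\<forall>m\<in>carrier M. ract M m b = lact M (f m) y))"

lemma bracket:
  assumes "equivariant R A M f" "y \<in> carrier M"
  shows "bracket f y \<in> carrier A'" "m \<in> carrier M \<Longrightarrow> ract M m (bracket f y) = lact M (f m) y"
proof -
  have "\<exists>b. b \<in> carrier A' \<and> (\<forall>m\<in>carrier M. ract M m b = lact M (f m) y)"
    using rank_one[OF assms] by blast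
  from someI_ex[OF this] show "bracket f y \<in> carrier A'" "m \<in> carrier M \<Longrightarrow> ract M m (bracket f y) = lact M (f m) y"
    unfolding bracket_def by blast+
qed

lemma bracket_eqI:
  assumes "equivariant R A M f" "y \<in> carrier M" "b \<in> carrier A'" "\<And>m. m \<in> carrier M \<Longrightarrow> ract M m b = lact M (f m) y"
  shows "bracket f y = b"
  by (rule faithful_eq[OF bracket(1)[OF assms(1,2)] assms(3)]) (simp add: bracket(2)[OF assms(1,2)] assms(4))

lemma bracket_lin:
  assumes f: "equivariant R A M f"
  shows "lin R M A' (bracket f)"
proof (rule linI)
  note fl = bilin_right[OF lact_bilin equivariant_closed[OF f]] and rl = bilin_right[OF ract_bilin]
  fix y assume y: "y \<in> carrier M"
  show "bracket f y \<in> carrier A'" by (rule bracket(1)[OF f y])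
  show "bracket f (y \<oplus>\<^bsub>M\<^esub> z) = bracket f y \<oplus>\<^bsub>A'\<^esub> bracket f z" if z: "z \<in> carrier M" for z
    by (rule bracket_eqI[OF f]) (simp_all add: y z bracket[OF f] lin_add[OF rl] lin_add[OF fl])
  show "bracket f (r \<odot>\<^bsub>M\<^esub> y) = r \<odot>\<^bsub>A'\<^esub> bracket f y" if r: "r \<in> carrier R" for r
    by (rule bracket_eqI[OF f]) (simp_all add: y r bracket[OF f] lin_smult[OF rl] lin_smult[OF fl])
qed

lemma bracket_ract:
  assumes f: "equivariant R A M f" and y: "y \<in> carrier M" and b: "b \<in> carrier A'"
  shows "bracket f (ract M y b) = bracket f y \<otimes>\<^bsub>A'\<^esub> b"
proof (rule bracket_eqI[OF f ract_closed[OF y b] A'.m_closed[OF bracket(1)[OF f y] b]])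
  fix m assume m: "m \<in> carrier M"
  show "ract M m (bracket f y \<otimes>\<^bsub>A'\<^esub> b) = lact M (f m) (ract M y b)"
    by (simp add: ract_mult[OF m bracket(1)[OF f y] b] bracket(2)[OF f y m] lact_ract[OF equivariant_closed[OF f m] y b])
qed

text \<open>An element of \<open>A'\<close> that acts as a rank one endomorphism is a bracket,
  because the right action is faithful.\<close>

lemma projective':
  "\<one>\<^bsub>A'\<^esub> \<in> mspan R A' {bracket g y | g y. equivariant R A M g \<and> y \<in> carrier M}"
proof -
  have "{b \<in> carrier A'. \<exists>g y. equivariant R A M g \<and> y \<in> carrier M \<and> (\<forall>m\<in>carrier M. ract M m b = lact M (g m) y)}
    \<subseteq> {bracket g y | g y. equivariant R A M g \<and> y \<in> carrier M}"
  proof (rule subsetI, elim CollectE conjE exE)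
    fix b g y assume b: "b \<in> carrier A'" and g: "equivariant R A M g" and y: "y \<in> carrier M"
      and e: "\<forall>m\<in>carrier M. ract M m b = lact M (g m) y"
    have "bracket g y = b" by (rule bracket_eqI[OF g y b]) (simp add: e)
    then show "b \<in> {bracket g y | g y. equivariant R A M g \<and> y \<in> carrier M}" using g y by blast
  qed
  from mspan_mono[OF this] show ?thesis using projective by blast
qed

end

text \<open>A device for proving \<open>rank_one\<close>: at \<open>s = 1\<close> membership is the
  existence of the bracket of \<open>f\<close> and \<open>y\<close>. Since this is a submodule, it
  suffices to treat the elements of which the unit is a linear combination, and these can be chosen
  conveniently.\<close>

lemma rank_one_submodule:
  assumes "algebra_bimodule R A A' M" and f: "equivariant R A M f" and y: "y \<in> carrier M"
  shows "submodule {s \<in> carrier A'. \<exists>b\<in>carrier A'. \<forall>m\<in>carrier M. ract M m b = lact M (f (ract M m s)) y} R A'"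
    (is "submodule ?K R A'")
proof -
  interpret M: algebra_bimodule R A A' M by fact
  note mM = M.module_axioms and mA' = M.A'.module_axioms
  have l: "lin R A' M (\<lambda>s. lact M (f (ract M m s)) y)" if m: "m \<in> carrier M" for m
    by (rule lin_comp[OF lin_comp[OF bilin_right[OF M.ract_bilin m] equivariant_lin[OF f]] bilin_left[OF M.lact_bilin y]])
  note r = bilin_right[OF M.ract_bilin]
  show ?thesis
  proof (rule submoduleI'[OF mA'])
    show "?K \<subseteq> carrier A'" by blast
    have "\<forall>m\<in>carrier M. ract M m \<zero>\<^bsub>A'\<^esub> = lact M (f (ract M m \<zero>\<^bsub>A'\<^esub>)) y"
      using lin_zero[OF l mA' mM] lin_zero[OF r mA' mM] by simp
    then show "\<zero>\<^bsub>A'\<^esub> \<in> ?K" using mod_zero_closed[OF mA'] by blast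
  next
    fix s t assume "s \<in> ?K" "t \<in> ?K"
    then obtain b c where h: "s \<in> carrier A'" "t \<in> carrier A'" "b \<in> carrier A'" "c \<in> carrier A'"
      "\<And>m. m \<in> carrier M \<Longrightarrow> ract M m b = lact M (f (ract M m s)) y"
      "\<And>m. m \<in> carrier M \<Longrightarrow> ract M m c = lact M (f (ract M m t)) y" by blast
    have "\<forall>m\<in>carrier M. ract M m (b \<oplus>\<^bsub>A'\<^esub> c) = lact M (f (ract M m (s \<oplus>\<^bsub>A'\<^esub> t))) y"
    proof
      fix m assume m: "m \<in> carrier M"
      show "ract M m (b \<oplus>\<^bsub>A'\<^esub> c) = lact M (f (ract M m (s \<oplus>\<^bsub>A'\<^esub> t))) y"
        using lin_add[OF l[OF m] h(1,2)] lin_add[OF r[OF m] h(3,4)] h(5,6)[OF m] by simp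
    qed
    then show "s \<oplus>\<^bsub>A'\<^esub> t \<in> ?K" using mod_add_closed[OF mA' h(1,2)] mod_add_closed[OF mA' h(3,4)] by blast
  next
    fix a s assume a: "a \<in> carrier R" and "s \<in> ?K"
    then obtain b where h: "s \<in> carrier A'" "b \<in> carrier A'"
      "\<And>m. m \<in> carrier M \<Longrightarrow> ract M m b = lact M (f (ract M m s)) y" by blast
    have "\<forall>m\<in>carrier M. ract M m (a \<odot>\<^bsub>A'\<^esub> b) = lact M (f (ract M m (a \<odot>\<^bsub>A'\<^esub> s))) y"
    proof
      fix m assume m: "m \<in> carrier M"
      show "ract M m (a \<odot>\<^bsub>A'\<^esub> b) = lact M (f (ract M m (a \<odot>\<^bsub>A'\<^esub> s))) y"
        using lin_smult[OF l[OF m] a h(1)] lin_smult[OF r[OF m] a h(2)] h(3)[OF m] by simp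
    qed
    then show "a \<odot>\<^bsub>A'\<^esub> s \<in> ?K" using mod_smult_closed[OF mA' a h(1)] mod_smult_closed[OF mA' a h(2)] by blast
  qed
qed

section \<open>Wreath products of progenerators\<close>

text \<open>The factor maps may depend on the permutation of the coefficient. Linear maps into the
  wreath algebra need this freedom, while their brackets use the same maps at every
  permutation.\<close>

definition wr_map :: "('r, 'k) ring_scheme \<Rightarrow> ('r, 'y, 'z) module_scheme \<Rightarrow> nat \<Rightarrow> ((nat \<Rightarrow> nat) \<Rightarrow> nat \<Rightarrow> 'x \<Rightarrow> 'y)
    \<Rightarrow> ((nat \<Rightarrow> nat) \<Rightarrow> ((nat \<Rightarrow> 'x) \<Rightarrow> 'r) set) \<Rightarrow> (nat \<Rightarrow> nat) \<Rightarrow> ((nat \<Rightarrow> 'y) \<Rightarrow> 'r) set" where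
  "wr_map R Y n f w = (\<lambda>\<tau>\<in>perms n. tp_map R Y n (\<lambda>x i. f \<tau> i (x i)) (w \<tau>))"

lemma wr_map:
  assumes X: "module R X" and Y: "module R Y"
    and f: "\<And>\<tau> i. \<tau> \<in> perms n \<Longrightarrow> i \<in> {1..n} \<Longrightarrow> lin R X Y (f \<tau> i)"
  shows "lin R (wr_mod R X n) (wr_mod R Y n) (wr_map R Y n f)"
    and "\<tau> \<in> perms n \<Longrightarrow> (\<And>i. i \<in> {1..n} \<Longrightarrow> x i \<in> carrier X) \<Longrightarrow>
      wr_map R Y n f (wr_pure R X n x \<tau>) = wr_pure R Y n (\<lambda>i. f \<tau> i (x i)) \<tau>"
proof -
  have m: "lin R (tpow R X n) (tpow R Y n) (tp_map R Y n (\<lambda>x i. f \<tau> i (x i)))"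
    "(\<And>i. i \<in> {1..n} \<Longrightarrow> x i \<in> carrier X) \<Longrightarrow>
      tp_map R Y n (\<lambda>x i. f \<tau> i (x i)) (pure R X n x) = pure R Y n (\<lambda>i. f \<tau> i (x i))"
    if "\<tau> \<in> perms n" for \<tau> x
    using tp_map_id[OF X Y, of n "f \<tau>"] f[OF that] by blast+
  show "lin R (wr_mod R X n) (wr_mod R Y n) (wr_map R Y n f)"
    unfolding wr_map_def by (rule wr_linI) (rule lin_comp[OF wr_mod_eval_lin m(1)])
  show "wr_map R Y n f (wr_pure R X n x \<tau>) = wr_pure R Y n (\<lambda>i. f \<tau> i (x i)) \<tau>"
    if t: "\<tau> \<in> perms n" and x: "\<And>i. i \<in> {1..n} \<Longrightarrow> x i \<in> carrier X"
    unfolding wr_map_def wr_elem_def[of R Y]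
  proof (rule restrict_ext)
    fix \<rho> assume r: "\<rho> \<in> perms n"
    show "tp_map R Y n (\<lambda>x i. f \<rho> i (x i)) (wr_pure R X n x \<tau> \<rho>) =
        (if \<rho> = \<tau> then pure R Y n (\<lambda>i. f \<tau> i (x i)) else \<zero>\<^bsub>tpow R Y n\<^esub>)"
      using m(2)[where x=x, OF r x] lin_zero[OF m(1)[OF r] tpow_module[OF X] tpow_module[OF Y]]
      by (cases "\<rho> = \<tau>") (simp_all add: wr_elem_def t r)
  qed
qed

abbreviation wr_hom :: "('r, 'k) ring_scheme \<Rightarrow> ('r, 'y, 'z) module_scheme \<Rightarrow> nat \<Rightarrow> (nat \<Rightarrow> 'x \<Rightarrow> 'y)
    \<Rightarrow> ((nat \<Rightarrow> nat) \<Rightarrow> ((nat \<Rightarrow> 'x) \<Rightarrow> 'r) set) \<Rightarrow> (nat \<Rightarrow> nat) \<Rightarrow> ((nat \<Rightarrow> 'y) \<Rightarrow> 'r) set" where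
  "wr_hom R Y n g \<equiv> wr_map R Y n (\<lambda>\<tau> i. g (inv' \<tau> i))"

text \<open>\<open>wr_hom\<close> is the map \<open>F\<close> of the overview. Multiplication by an
  element at \<sigma> moves the factor \<open>inv' \<sigma> i\<close> of \<open>y\<close> to place
  \<open>i\<close>. The map used there has index \<open>inv' (\<sigma> \<circ> \<tau>) i = inv'
  \<tau> (inv' \<sigma> i)\<close>, so each factor meets the same map before and after the
  move.\<close>

lemma wr_map_equivariant:
  fixes A :: "('r, 'a, 'g, 'c) algebra_over" and A' :: "('r, 'b, 'z) module_scheme"
    and M :: "('r, 'm, 'g, 'a, 'b) bimodule"
  assumes "algebra_bimodule R A A' M" and g: "\<And>i. i \<in> {1..n} \<Longrightarrow> equivariant R A M (g i)"
  shows "equivariant R (wr_algebra R A n) (wr_bimodule R A' M n) (wr_hom R A n g)"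
proof -
  interpret M: algebra_bimodule R A A' M by fact
  note mM = M.module_axioms and mA = M.A.module_axioms
  note F = wr_map[OF mM mA equivariant_lin[OF g[OF perm_inv_mem]]]
  have Fl: "lin R (wr_bimodule R A' M n) (wr_algebra R A n) (wr_hom R A n g)"
    unfolding same_mod_lin[OF wr_bimodule_same] same_mod_lin'[OF wr_algebra_same] by (rule F(1))
  note b = wr_op_bilin[OF mA mM mM M.lact_bilin, of n] and b' = M.A.wr_mult_bilin[of n]
  have "wr_hom R A n g (wr_op R M M n (lact M) v w) = wr_op R A A n (mult A) v (wr_hom R A n g w)"
    if v: "v \<in> carrier (wr_mod R A n)" and w: "w \<in> carrier (wr_mod R M n)" for v w
  proof (rule wr_mod_eqI2[OF mA mM wr_mod_module[OF mA] _ _ _ v w])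
    show "bilin R (wr_mod R A n) (wr_mod R M n) (wr_mod R A n) (\<lambda>v w. wr_hom R A n g (wr_op R M M n (lact M) v w))"
    proof (rule bilinI)
      show "lin R (wr_mod R M n) (wr_mod R A n) (\<lambda>w. wr_hom R A n g (wr_op R M M n (lact M) v w))" if "v \<in> carrier (wr_mod R A n)" for v
        by (rule lin_comp[OF bilin_right[OF b that] F(1)])
      show "lin R (wr_mod R A n) (wr_mod R A n) (\<lambda>v. wr_hom R A n g (wr_op R M M n (lact M) v w))" if "w \<in> carrier (wr_mod R M n)" for w
        by (rule lin_comp[OF bilin_left[OF b that] F(1)])
    qed
    show "bilin R (wr_mod R A n) (wr_mod R M n) (wr_mod R A n) (\<lambda>v w. wr_op R A A n (mult A) v (wr_hom R A n g w))"
    proof (rule bilinI)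
      show "lin R (wr_mod R M n) (wr_mod R A n) (\<lambda>w. wr_op R A A n (mult A) v (wr_hom R A n g w))" if "v \<in> carrier (wr_mod R A n)" for v
        by (rule lin_comp[OF F(1) bilin_right[OF b' that]])
      show "lin R (wr_mod R A n) (wr_mod R A n) (\<lambda>v. wr_op R A A n (mult A) v (wr_hom R A n g w))" if "w \<in> carrier (wr_mod R M n)" for w
        by (rule bilin_left[OF b' lin_closed[OF F(1) that]])
    qed
    fix x y \<sigma> \<tau> assume x: "x \<in> tp_fam A n" and y: "y \<in> tp_fam M n"
      and s: "\<sigma> \<in> perms n" and t: "\<tau> \<in> perms n"
    have x': "x i \<in> carrier A" and y': "y (inv' \<sigma> i) \<in> carrier M" and y'': "y i \<in> carrier M" if "i \<in> {1..n}" for i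
      using tp_fam_mem[OF x that] tp_fam_mem[OF y perm_inv_mem[OF s that]] tp_fam_mem[OF y that] by simp_all
    have g1: "g (inv' \<tau> i) (y i) \<in> carrier A" if "i \<in> {1..n}" for i
      by (rule equivariant_closed[OF g[OF perm_inv_mem[OF t that]] y''[OF that]])
    have "wr_hom R A n g (wr_op R M M n (lact M) (wr_pure R A n x \<sigma>) (wr_pure R M n y \<tau>)) =
      wr_hom R A n g (wr_pure R M n (\<lambda>i. lact M (x i) (y (inv' \<sigma> i))) (\<sigma> \<circ> \<tau>))"
      by (subst wr_op_pure[OF mA mM mM M.lact_bilin s t x' y'']) simp_all
    also have "\<dots> = wr_pure R A n (\<lambda>i. g (inv' (\<sigma> \<circ> \<tau>) i) (lact M (x i) (y (inv' \<sigma> i)))) (\<sigma> \<circ> \<tau>)"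
      by (rule F(2)[OF _ _ perm_comp[OF s t] M.lact_closed[OF x' y']]) assumption+
    also have "pure R A n (\<lambda>i. g (inv' (\<sigma> \<circ> \<tau>) i) (lact M (x i) (y (inv' \<sigma> i)))) =
        pure R A n (\<lambda>i. x i \<otimes>\<^bsub>A\<^esub> g (inv' \<tau> (inv' \<sigma> i)) (y (inv' \<sigma> i)))"
      by (rule pure_cong)
        (simp add: perm_inv_comp[OF s t] equivariant_lact[OF g[OF perm_inv_mem[OF t perm_inv_mem[OF s]]] x' y'])
    also have "wr_elem R A n \<dots> (\<sigma> \<circ> \<tau>) =
        wr_op R A A n (mult A) (wr_pure R A n x \<sigma>) (wr_pure R A n (\<lambda>i. g (inv' \<tau> i) (y i)) \<tau>)"
      by (rule wr_op_pure[OF mA mA mA M.A.mult_bilin s t x' g1, symmetric])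
    also have "wr_pure R A n (\<lambda>i. g (inv' \<tau> i) (y i)) \<tau> = wr_hom R A n g (wr_pure R M n y \<tau>)"
      by (rule F(2)[OF _ _ t y'', symmetric]) assumption+
    finally show "wr_hom R A n g (wr_op R M M n (lact M) (wr_pure R A n x \<sigma>) (wr_pure R M n y \<tau>)) =
      wr_op R A A n (mult A) (wr_pure R A n x \<sigma>) (wr_hom R A n g (wr_pure R M n y \<tau>))" .
  qed
  then show ?thesis
    unfolding equivariant_def using Fl by (simp add: wr_algebra_simps wr_bimodule_simps)
qed


text \<open>\<open>L\<close> is the prospective bracket with \<open>wr_hom\<close>, built before the
  wreath product is known to be a progenerator. The second claim says that \<open>L z\<close> acts
  as the rank one endomorphism, the third that \<open>L\<close> is linear for the right action. In
  the second, a left factor at \<sigma> meets the bracket of index \<open>inv' \<sigma> i\<close> at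
  place \<open>i\<close>, which is the index that \<open>wr_hom\<close> uses at \<sigma>.\<close>

lemma wr_bracket:
  fixes A :: "('r, 'a, 'g, 'c) algebra_over" and A' :: "('r, 'b, 'g, 'c) algebra_over"
    and M :: "('r, 'm, 'g, 'a, 'b) bimodule"
  assumes "progenerator R A A' M" and g: "\<And>i. i \<in> {1..n} \<Longrightarrow> equivariant R A M (g i)"
    and w: "w \<in> carrier (wr_mod R M n)"
  defines "L \<equiv> wr_map R A' n (\<lambda>\<tau> i. progenerator.bracket A' M (g i))"
  shows "lin R (wr_mod R M n) (wr_mod R A' n) L"
    and "z \<in> carrier (wr_mod R M n) \<Longrightarrow> wr_op R A' M n (ract M) w (L z) = wr_op R M M n (lact M) (wr_hom R A n g w) z"
    and "b \<in> carrier (wr_mod R A' n) \<Longrightarrow> L (wr_op R A' M n (ract M) w b) = wr_op R A' A' n (mult A') (L w) b"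
proof -
  interpret M: progenerator R A A' M by fact
  note mM = M.module_axioms and mA = M.A.module_axioms and mA' = M.A'.module_axioms
  note F = wr_map[OF mM mA equivariant_lin[OF g[OF perm_inv_mem]]]
  have Ll: "lin R (wr_mod R M n) (wr_mod R A' n) L"
    and Le: "\<And>\<tau> x. \<tau> \<in> perms n \<Longrightarrow> (\<And>i. i \<in> {1..n} \<Longrightarrow> x i \<in> carrier M) \<Longrightarrow>
      L (wr_pure R M n x \<tau>) = wr_pure R A' n (\<lambda>i. M.bracket (g i) (x i)) \<tau>"
    unfolding L_def using wr_map[OF mM mA', of n "\<lambda>\<tau> i. M.bracket (g i)"] M.bracket_lin[OF g] by blast+
  show "lin R (wr_mod R M n) (wr_mod R A' n) L" by (rule Ll)
  note bl = wr_op_bilin[OF mA mM mM M.lact_bilin, of n] and br = wr_op_bilin[OF mM mA' mM M.ract_bilin, of n]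
    and b' = M.A'.wr_mult_bilin[of n]
  note eL = bilinI[OF lin_comp[OF Ll bilin_right[OF br]] bilin_left[OF br lin_closed[OF Ll]]]
  note eF = bilinI[OF bilin_right[OF bl lin_closed[OF F(1)]] lin_comp[OF F(1) bilin_left[OF bl]]]
  show "wr_op R A' M n (ract M) w (L z) = wr_op R M M n (lact M) (wr_hom R A n g w) z" if z: "z \<in> carrier (wr_mod R M n)"
  proof (rule wr_mod_eqI2[OF mM mM wr_mod_module[OF mM] _ _ _ w z])
    show "bilin R (wr_mod R M n) (wr_mod R M n) (wr_mod R M n) (\<lambda>w z. wr_op R A' M n (ract M) w (L z))"
      by (rule eL) assumption+
    show "bilin R (wr_mod R M n) (wr_mod R M n) (wr_mod R M n) (\<lambda>w z. wr_op R M M n (lact M) (wr_hom R A n g w) z)"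
      by (rule eF) assumption+
    fix x y \<sigma> \<tau> assume x: "x \<in> tp_fam M n" and y: "y \<in> tp_fam M n"
      and s: "\<sigma> \<in> perms n" and t: "\<tau> \<in> perms n"
    have x': "x i \<in> carrier M" and y': "y (inv' \<sigma> i) \<in> carrier M" and y'': "y i \<in> carrier M" if "i \<in> {1..n}" for i
      using tp_fam_mem[OF x that] tp_fam_mem[OF y perm_inv_mem[OF s that]] tp_fam_mem[OF y that] by simp_all
    have g1: "g (inv' \<sigma> i) (x i) \<in> carrier A" if "i \<in> {1..n}" for i
      by (rule equivariant_closed[OF g[OF perm_inv_mem[OF s that]] x'[OF that]])
    have b1: "M.bracket (g i) (y i) \<in> carrier A'" if "i \<in> {1..n}" for i
      by (rule M.bracket(1)[OF g[OF that] y''[OF that]])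
    have "wr_op R A' M n (ract M) (wr_pure R M n x \<sigma>) (L (wr_pure R M n y \<tau>)) =
        wr_op R A' M n (ract M) (wr_pure R M n x \<sigma>) (wr_pure R A' n (\<lambda>i. M.bracket (g i) (y i)) \<tau>)"
      by (subst Le[OF t y'']) simp_all
    also have "\<dots> = wr_pure R M n (\<lambda>i. ract M (x i) (M.bracket (g (inv' \<sigma> i)) (y (inv' \<sigma> i)))) (\<sigma> \<circ> \<tau>)"
      by (rule wr_op_pure[OF mM mA' mM M.ract_bilin s t x' b1])
    also have "pure R M n (\<lambda>i. ract M (x i) (M.bracket (g (inv' \<sigma> i)) (y (inv' \<sigma> i)))) =
        pure R M n (\<lambda>i. lact M (g (inv' \<sigma> i) (x i)) (y (inv' \<sigma> i)))"
      by (rule pure_cong) (rule M.bracket(2)[OF g[OF perm_inv_mem[OF s]] y' x'])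
    also have "wr_elem R M n \<dots> (\<sigma> \<circ> \<tau>) =
        wr_op R M M n (lact M) (wr_pure R A n (\<lambda>i. g (inv' \<sigma> i) (x i)) \<sigma>) (wr_pure R M n y \<tau>)"
      by (rule wr_op_pure[OF mA mM mM M.lact_bilin s t g1 y'', symmetric])
    also have "wr_pure R A n (\<lambda>i. g (inv' \<sigma> i) (x i)) \<sigma> = wr_hom R A n g (wr_pure R M n x \<sigma>)"
      by (rule F(2)[OF _ _ s x', symmetric]) assumption+
    finally show "wr_op R A' M n (ract M) (wr_pure R M n x \<sigma>) (L (wr_pure R M n y \<tau>)) =
      wr_op R M M n (lact M) (wr_hom R A n g (wr_pure R M n x \<sigma>)) (wr_pure R M n y \<tau>)" .
  qed
  note eL = bilinI[OF lin_comp[OF bilin_right[OF br] Ll] lin_comp[OF bilin_left[OF br] Ll]]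
  note eR = bilinI[OF bilin_right[OF b' lin_closed[OF Ll]] lin_comp[OF Ll bilin_left[OF b']]]
  show "L (wr_op R A' M n (ract M) w b) = wr_op R A' A' n (mult A') (L w) b" if b: "b \<in> carrier (wr_mod R A' n)"
  proof (rule wr_mod_eqI2[OF mM mA' wr_mod_module[OF mA'] _ _ _ w b])
    show "bilin R (wr_mod R M n) (wr_mod R A' n) (wr_mod R A' n) (\<lambda>w b. L (wr_op R A' M n (ract M) w b))"
      by (rule eL) assumption+
    show "bilin R (wr_mod R M n) (wr_mod R A' n) (wr_mod R A' n) (\<lambda>w b. wr_op R A' A' n (mult A') (L w) b)"
      by (rule eR) assumption+
    fix x y \<sigma> \<tau> assume x: "x \<in> tp_fam M n" and y: "y \<in> tp_fam A' n"
      and s: "\<sigma> \<in> perms n" and t: "\<tau> \<in> perms n"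
    have x': "x i \<in> carrier M" and y': "y (inv' \<sigma> i) \<in> carrier A'" and y'': "y i \<in> carrier A'" if "i \<in> {1..n}" for i
      using tp_fam_mem[OF x that] tp_fam_mem[OF y perm_inv_mem[OF s that]] tp_fam_mem[OF y that] by simp_all
    have b1: "M.bracket (g i) (x i) \<in> carrier A'" if "i \<in> {1..n}" for i
      by (rule M.bracket(1)[OF g[OF that] x'[OF that]])
    have "L (wr_op R A' M n (ract M) (wr_pure R M n x \<sigma>) (wr_pure R A' n y \<tau>)) =
        L (wr_pure R M n (\<lambda>i. ract M (x i) (y (inv' \<sigma> i))) (\<sigma> \<circ> \<tau>))"
      by (subst wr_op_pure[OF mM mA' mM M.ract_bilin s t x' y'']) simp_all
    also have "\<dots> = wr_pure R A' n (\<lambda>i. M.bracket (g i) (ract M (x i) (y (inv' \<sigma> i)))) (\<sigma> \<circ> \<tau>)"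
      by (rule Le[OF perm_comp[OF s t] M.ract_closed[OF x' y']]) assumption+
    also have "pure R A' n (\<lambda>i. M.bracket (g i) (ract M (x i) (y (inv' \<sigma> i)))) =
        pure R A' n (\<lambda>i. M.bracket (g i) (x i) \<otimes>\<^bsub>A'\<^esub> y (inv' \<sigma> i))"
      by (rule pure_cong) (rule M.bracket_ract[OF g x' y'])
    also have "wr_elem R A' n \<dots> (\<sigma> \<circ> \<tau>) =
        wr_op R A' A' n (mult A') (wr_pure R A' n (\<lambda>i. M.bracket (g i) (x i)) \<sigma>) (wr_pure R A' n y \<tau>)"
      by (rule wr_op_pure[OF mA' mA' mA' M.A'.mult_bilin s t b1 y'', symmetric])
    also have "wr_pure R A' n (\<lambda>i. M.bracket (g i) (x i)) \<sigma> = L (wr_pure R M n x \<sigma>)"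
      by (rule Le[OF s x', symmetric])
    finally show "L (wr_op R A' M n (ract M) (wr_pure R M n x \<sigma>) (wr_pure R A' n y \<tau>)) =
      wr_op R A' A' n (mult A') (L (wr_pure R M n x \<sigma>)) (wr_pure R A' n y \<tau>)" .
  qed
qed


text \<open>The unit of the wreath algebra is the pure tensor of units over the identity
  permutation. Expanding every factor along \<open>S\<close>, by multilinearity, reduces the claim
  to pure tensors with factors in \<open>S\<close>.\<close>

lemma wr_one_mspan:
  assumes A: "assoc_algebra R A" and K: "submodule K R (wr_mod R A n)"
    and S: "S \<subseteq> carrier A" "\<one>\<^bsub>A\<^esub> \<in> mspan R A S"
    and h: "\<And>x. (\<And>i. i \<in> {1..n} \<Longrightarrow> x i \<in> S) \<Longrightarrow> wr_pure R A n x id \<in> K"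
  shows "wr_pure R A n (\<lambda>_. \<one>\<^bsub>A\<^esub>) id \<in> K"
proof -
  interpret A: assoc_algebra R A by (rule A)
  note mA = A.module_axioms
  have ml: "multilin R A n (wr_mod R A n) (\<lambda>x. wr_pure R A n x id)"
    unfolding multilin_def
  proof (intro conjI ballI)
    show "(\<lambda>x. wr_pure R A n x id) \<in> tp_fam A n \<rightarrow> carrier (wr_mod R A n)"
      by (rule funcsetI) (rule lin_closed[OF wr_elem_lin[OF mA] pure_closed_fam[OF mA]])
    show "lin R A (wr_mod R A n) (\<lambda>a. wr_pure R A n (x(i := a)) id)"
      if "x \<in> tp_fam A n" "i \<in> {1..n}" for x i
      by (rule lin_comp[OF multilin_lin[OF pure_multilin[OF mA] that] wr_elem_lin[OF mA]])
  qed
  have "wr_pure R A n (\<lambda>i\<in>{1..n}. \<one>\<^bsub>A\<^esub>) id \<in> K"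
  proof (rule multilin_span[OF mA wr_mod_module[OF mA] ml K, where G="\<lambda>_. S"])
    show "wr_pure R A n y id \<in> K" if "y \<in> {1..n} \<rightarrow>\<^sub>E S" for y
      by (rule h) (rule PiE_mem[OF that])
    show "(\<lambda>i\<in>{1..n}. \<one>\<^bsub>A\<^esub>) \<in> tp_fam A n" by (rule tp_fam_restrict) simp
  qed (use S in simp_all)
  then show ?thesis by (simp only: pure_restrict)
qed

lemma wr_progenerator:
  fixes A :: "('r, 'a, 'g, 'c) algebra_over" and A' :: "('r, 'b, 'g, 'c) algebra_over"
    and M :: "('r, 'm, 'g, 'a, 'b) bimodule"
  assumes p: "progenerator R A A' M"
  shows "progenerator R (wr_algebra R A n) (wr_algebra R A' n) (wr_bimodule R A' M n)"
proof -
  interpret M: progenerator R A A' M by (rule p)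
  note mM = M.module_axioms and mA = M.A.module_axioms and mA' = M.A'.module_axioms
  have aA: "assoc_algebra R A" and aA': "assoc_algebra R A'"
    by (rule M.A.assoc_algebra_axioms, rule M.A'.assoc_algebra_axioms)
  let ?Aw = "wr_algebra R A n" and ?Bw = "wr_algebra R A' n" and ?Mw = "wr_bimodule R A' M n"
  have bim: "algebra_bimodule R ?Aw ?Bw ?Mw" by (rule wr_bimodule_bimodule[OF M.algebra_bimodule_axioms])
  interpret W: algebra_bimodule R ?Aw ?Bw ?Mw by (rule bim)
  note sim = wr_algebra_simps wr_bimodule_simps
  note smA = same_mod_submodule[OF wr_algebra_same wr_mod_module[OF mA]]
    and smA' = same_mod_submodule[OF wr_algebra_same wr_mod_module[OF mA']]
  define S where "S = {f x | f x. equivariant R A M f \<and> x \<in> carrier M}"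
  define S' where "S' = {M.bracket g y | g y. equivariant R A M g \<and> y \<in> carrier M}"
  have S: "S \<subseteq> carrier A" unfolding S_def using equivariant_closed[of R A M] by blast
  have S': "S' \<subseteq> carrier A'" unfolding S'_def using M.bracket(1) by blast
  define E where "E = {g :: nat \<Rightarrow> 'm \<Rightarrow> 'a. \<forall>i\<in>{1..n}. equivariant R A M (g i)}"
  have E: "equivariant R A M (g i)" if "g \<in> E" "i \<in> {1..n}" for g i using that unfolding E_def by blast
  define F where "F = (\<lambda>g :: nat \<Rightarrow> 'm \<Rightarrow> 'a. wr_hom R A n g)"
  define L where "L = (\<lambda>g. wr_map R A' n (\<lambda>\<tau> i. M.bracket (g i)))"
  have F: "equivariant R ?Aw ?Mw (F g)" if "g \<in> E" for g
    unfolding F_def by (rule wr_map_equivariant[OF M.algebra_bimodule_axioms E[OF that]])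
  have Fp: "F g (wr_pure R M n x id) = wr_pure R A n (\<lambda>i. g i (x i)) id"
    if g: "g \<in> E" and x: "\<And>i. i \<in> {1..n} \<Longrightarrow> x i \<in> carrier M" for g x
    using wr_map(2)[OF mM mA equivariant_lin[OF E[OF g perm_inv_mem]] perm_id x] unfolding F_def by simp
  have Lp: "L g (wr_pure R M n x id) = wr_pure R A' n (\<lambda>i. M.bracket (g i) (x i)) id"
    if g: "g \<in> E" and x: "\<And>i. i \<in> {1..n} \<Longrightarrow> x i \<in> carrier M" for g x
    using wr_map(2)[OF mM mA', of n "\<lambda>\<tau> i. M.bracket (g i)", OF M.bracket_lin[OF E[OF g]] perm_id x] unfolding L_def by simp
  have Ll: "lin R ?Mw ?Bw (L g)"
    and Lr: "\<And>w z. w \<in> carrier ?Mw \<Longrightarrow> z \<in> carrier ?Mw \<Longrightarrow> ract ?Mw w (L g z) = lact ?Mw (F g w) z"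
    and Lm: "\<And>w b. w \<in> carrier ?Mw \<Longrightarrow> b \<in> carrier ?Bw \<Longrightarrow> L g (ract ?Mw w b) = L g w \<otimes>\<^bsub>?Bw\<^esub> b"
    if g: "g \<in> E" for g
  proof -
    note b = wr_bracket[OF p, of n g, OF E[OF g]]
    have z: "\<zero>\<^bsub>wr_mod R M n\<^esub> \<in> carrier (wr_mod R M n)" by (rule mod_zero_closed[OF wr_mod_module[OF mM]])
    show "lin R ?Mw ?Bw (L g)"
      unfolding same_mod_lin[OF wr_bimodule_same] same_mod_lin'[OF wr_algebra_same] L_def using b(1)[OF _ z] by simp
    show "ract ?Mw w (L g z) = lact ?Mw (F g w) z" if "w \<in> carrier ?Mw" "z \<in> carrier ?Mw" for w z
      using b(2) that unfolding L_def F_def sim by simp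
    show "L g (ract ?Mw w b) = L g w \<otimes>\<^bsub>?Bw\<^esub> b" if "w \<in> carrier ?Mw" "b \<in> carrier ?Bw" for w b
      using b(3) that unfolding L_def F_def sim by simp
  qed
  have S'E: "\<exists>g y. g \<in> E \<and> (\<forall>i\<in>{1..n}. y i \<in> carrier M) \<and>
      pure R A' n x = pure R A' n (\<lambda>i. M.bracket (g i) (y i))" if "\<And>i. i \<in> {1..n} \<Longrightarrow> x i \<in> S'" for x
  proof -
    have "\<forall>i\<in>{1..n}. \<exists>gy. equivariant R A M (fst gy) \<and> snd gy \<in> carrier M \<and> x i = M.bracket (fst gy) (snd gy)"
      using that unfolding S'_def by fastforce
    from bchoice[OF this] obtain gy where gy: "\<forall>i\<in>{1..n}. equivariant R A M (fst (gy i)) \<and> snd (gy i) \<in> carrier M \<and>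
      x i = M.bracket (fst (gy i)) (snd (gy i))" by blast
    have 1: "pure R A' n x = pure R A' n (\<lambda>i. M.bracket (fst (gy i)) (snd (gy i)))" by (rule pure_cong) (use gy in blast)
    have 2: "(\<lambda>i. fst (gy i)) \<in> E" unfolding E_def using gy by blast
    have 3: "\<forall>i\<in>{1..n}. snd (gy i) \<in> carrier M" using gy by blast
    show ?thesis
      by (rule exI[of _ "\<lambda>i. fst (gy i)"], rule exI[of _ "\<lambda>i. snd (gy i)"]) (rule conjI[OF 2 conjI[OF 3 1]])
  qed
  \<comment> \<open>The form in which the hypotheses on \<open>M\<close> are used for the wreath
    product: the unit is a linear combination of values of the maps \<open>L g\<close>, so a
    submodule that contains all these values contains it.\<close>
  have one': "\<one>\<^bsub>?Bw\<^esub> \<in> K" if K: "submodule K R ?Bw"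
    and h: "\<And>g Y. g \<in> E \<Longrightarrow> Y \<in> carrier ?Mw \<Longrightarrow> L g Y \<in> K" for K
    unfolding wr_algebra_simps(6)
  proof (rule wr_one_mspan[OF aA' K[unfolded smA'] S'])
    show "\<one>\<^bsub>A'\<^esub> \<in> mspan R A' S'" unfolding S'_def by (rule M.projective')
    fix x assume "\<And>i. i \<in> {1..n} \<Longrightarrow> x i \<in> S'"
    from S'E[where x=x, OF this] obtain g y where g: "g \<in> E"
      and y: "\<And>i. i \<in> {1..n} \<Longrightarrow> y i \<in> carrier M" and e: "pure R A' n x = pure R A' n (\<lambda>i. M.bracket (g i) (y i))" by blast
    have "wr_pure R M n y id \<in> carrier ?Mw"
      unfolding sim by (rule lin_closed[OF wr_elem_lin[OF mM] pure_closed[OF mM y]])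
    from h[OF g this] show "wr_pure R A' n x id \<in> K" unfolding e by (simp add: Lp[where x=y, OF g y])
  qed
  show ?thesis
  proof (rule progenerator.intro[OF bim], rule progenerator_axioms.intro)
    fix b assume b: "b \<in> carrier ?Bw" and z: "\<And>m. m \<in> carrier ?Mw \<Longrightarrow> ract ?Mw m b = \<zero>\<^bsub>?Mw\<^esub>"
    \<comment> \<open>If \<open>b\<close> annihilates the bimodule, then \<open>L g Y\<close> times
      \<open>b\<close> is \<open>L g\<close> of the product of \<open>Y\<close> and
      \<open>b\<close>, hence zero. Elements with this property form a submodule, so the unit is one
      of them and \<open>b\<close> is zero.\<close>
    have "\<one>\<^bsub>?Bw\<^esub> \<in> {s \<in> carrier ?Bw. s \<otimes>\<^bsub>?Bw\<^esub> b \<in> {\<zero>\<^bsub>?Bw\<^esub>}}"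
    proof (rule one')
      show "submodule {s \<in> carrier ?Bw. s \<otimes>\<^bsub>?Bw\<^esub> b \<in> {\<zero>\<^bsub>?Bw\<^esub>}} R ?Bw"
        by (rule lin_vimage_submodule[OF bilin_left[OF W.A'.mult_bilin b] W.A'.module_axioms W.A'.module_axioms
            zero_submodule[OF W.A'.module_axioms]])
      fix g Y assume g: "g \<in> E" and Y: "Y \<in> carrier ?Mw"
      have "L g Y \<otimes>\<^bsub>?Bw\<^esub> b = L g \<zero>\<^bsub>?Mw\<^esub>" using Lm[OF g Y b] z[OF Y] by simp
      also have "\<dots> = \<zero>\<^bsub>?Bw\<^esub>" by (rule lin_zero[OF Ll[OF g] W.module_axioms W.A'.module_axioms])
      finally show "L g Y \<in> {s \<in> carrier ?Bw. s \<otimes>\<^bsub>?Bw\<^esub> b \<in> {\<zero>\<^bsub>?Bw\<^esub>}}"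
        using lin_closed[OF Ll[OF g] Y] by simp
    qed
    then show "b = \<zero>\<^bsub>?Bw\<^esub>" using b by simp
  next
    fix h y assume h: "equivariant R ?Aw ?Mw h" and y: "y \<in> carrier ?Mw"
    \<comment> \<open>Here \<open>h\<close> is an arbitrary linear map on the wreath product and
      need not arise from maps on \<open>M\<close>. Membership of the unit in \<open>K\<close> is
      the claim for \<open>h\<close>, and only the elements \<open>L g Y\<close> have to be
      examined.\<close>
    define K where "K = {s \<in> carrier ?Bw. \<exists>b\<in>carrier ?Bw. \<forall>w\<in>carrier ?Mw. ract ?Mw w b = lact ?Mw (h (ract ?Mw w s)) y}"
    have "\<one>\<^bsub>?Bw\<^esub> \<in> K"
    proof (rule one')
      show "submodule K R ?Bw" unfolding K_def by (rule rank_one_submodule[OF bim h y])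
      fix g Y assume g: "g \<in> E" and Y: "Y \<in> carrier ?Mw"
      \<comment> \<open>The value of \<open>L g\<close> at this element is the witness for
        \<open>L g Y\<close>: linearity of \<open>h\<close> lets the scalar \<open>F g w\<close>
        pass in and out of \<open>h\<close>.\<close>
      have z: "lact ?Mw (h Y) y \<in> carrier ?Mw" by (rule W.lact_closed[OF equivariant_closed[OF h Y] y])
      have "ract ?Mw w (L g (lact ?Mw (h Y) y)) = lact ?Mw (h (ract ?Mw w (L g Y))) y" if w: "w \<in> carrier ?Mw" for w
      proof -
        have Fw: "F g w \<in> carrier ?Aw" by (rule equivariant_closed[OF F[OF g] w])
        have "ract ?Mw w (L g (lact ?Mw (h Y) y)) = lact ?Mw (F g w) (lact ?Mw (h Y) y)" by (rule Lr[OF g w z])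
        also have "\<dots> = lact ?Mw (h (lact ?Mw (F g w) Y)) y"
          using equivariant_lact[OF h Fw Y] W.lact_mult[OF Fw equivariant_closed[OF h Y] y] by simp
        finally show ?thesis using Lr[OF g w Y] by simp
      qed
      then show "L g Y \<in> K" unfolding K_def using lin_closed[OF Ll[OF g] Y] lin_closed[OF Ll[OF g] z] by blast
    qed
    then show "\<exists>b\<in>carrier ?Bw. \<forall>m\<in>carrier ?Mw. ract ?Mw m b = lact ?Mw (h m) y"
      unfolding K_def using W.ract_one by auto
  next
    let ?X = "{f x | f x. equivariant R ?Aw ?Mw f \<and> x \<in> carrier ?Mw}"
    have X: "?X \<subseteq> carrier ?Aw" using equivariant_closed[of R ?Aw ?Mw] by blast
    show "\<one>\<^bsub>?Aw\<^esub> \<in> mspan R ?Aw ?X"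
      unfolding wr_algebra_simps(6)
    proof (rule wr_one_mspan[OF aA mspan_submodule[OF W.A.module_axioms X, unfolded smA] S])
      show "\<one>\<^bsub>A\<^esub> \<in> mspan R A S" unfolding S_def by (rule M.generator)
      fix x assume x: "\<And>i. i \<in> {1..n} \<Longrightarrow> x i \<in> S"
      have "\<forall>i\<in>{1..n}. \<exists>gy. equivariant R A M (fst gy) \<and> snd gy \<in> carrier M \<and> x i = fst gy (snd gy)"
        using x unfolding S_def by fastforce
      from bchoice[OF this] obtain gy where gy: "\<And>i. i \<in> {1..n} \<Longrightarrow> equivariant R A M (fst (gy i))"
        "\<And>i. i \<in> {1..n} \<Longrightarrow> snd (gy i) \<in> carrier M" "\<And>i. i \<in> {1..n} \<Longrightarrow> x i = fst (gy i) (snd (gy i))" by blast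
      have gE: "(\<lambda>i. fst (gy i)) \<in> E" unfolding E_def using gy(1) by blast
      have "pure R A n x = pure R A n (\<lambda>i. fst (gy i) (snd (gy i)))" by (rule pure_cong) (rule gy(3))
      then have e: "wr_pure R A n x id = F (\<lambda>i. fst (gy i)) (wr_pure R M n (\<lambda>i. snd (gy i)) id)"
        using Fp[of "\<lambda>i. fst (gy i)" "\<lambda>i. snd (gy i)", OF gE gy(2)] by simp
      have "wr_pure R M n (\<lambda>i. snd (gy i)) id \<in> carrier ?Mw"
        unfolding sim by (rule lin_closed[OF wr_elem_lin[OF mM] pure_closed[OF mM gy(2)]])
      from equivariant_mspan[OF F[OF gE] this] show "wr_pure R A n x id \<in> mspan R ?Aw ?X" unfolding e .
    qed
  next
    let ?X = "{b \<in> carrier ?Bw. \<exists>g y. equivariant R ?Aw ?Mw g \<and> y \<in> carrier ?Mw \<and>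
      (\<forall>m\<in>carrier ?Mw. ract ?Mw m b = lact ?Mw (g m) y)}"
    have X: "?X \<subseteq> carrier ?Bw" by (rule subsetI, drule CollectD, erule conjunct1)
    show "\<one>\<^bsub>?Bw\<^esub> \<in> mspan R ?Bw ?X"
    proof (rule one'[where K="mspan R ?Bw ?X"])
      show "submodule (mspan R ?Bw ?X) R ?Bw" by (rule mspan_submodule[OF W.A'.module_axioms X])
      fix g Y assume g: "g \<in> E" and Y: "Y \<in> carrier ?Mw"
      have "\<forall>m\<in>carrier ?Mw. ract ?Mw m (L g Y) = lact ?Mw (F g m) Y" using Lr[OF g _ Y] by (rule ballI)
      then have "equivariant R ?Aw ?Mw (F g) \<and> Y \<in> carrier ?Mw \<and>
        (\<forall>m\<in>carrier ?Mw. ract ?Mw m (L g Y) = lact ?Mw (F g m) Y)" by (intro conjI F[OF g] Y)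
      then have "\<exists>f z. equivariant R ?Aw ?Mw f \<and> z \<in> carrier ?Mw \<and>
        (\<forall>m\<in>carrier ?Mw. ract ?Mw m (L g Y) = lact ?Mw (f m) z)" by (rule exI[of _ "F g", OF exI[of _ Y]])
      with lin_closed[OF Ll[OF g] Y] have "L g Y \<in> ?X" by (intro CollectI conjI)
      then show "L g Y \<in> mspan R ?Bw ?X" by (rule mspan_base)
    qed
  qed
qed

section \<open>Duals\<close>

lemma dual_simps:
  "zero (dual \<Gamma> A M) = (\<lambda>m\<in>carrier M. \<zero>\<^bsub>A\<^esub>)"
  "add (dual \<Gamma> A M) = (\<lambda>f f'. \<lambda>m\<in>carrier M. f m \<oplus>\<^bsub>A\<^esub> f' m)"
  "smult (dual \<Gamma> A M) = (\<lambda>r f. \<lambda>m\<in>carrier M. r \<odot>\<^bsub>A\<^esub> f m)"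
  "gcomp (dual \<Gamma> A M) g = {f \<in> carrier (dual \<Gamma> A M). \<forall>x\<in>carrier \<Gamma>. f ` gcomp M x \<subseteq> gcomp A (x \<otimes>\<^bsub>\<Gamma>\<^esub> g)}"
  "lact (dual \<Gamma> A M) = (\<lambda>b f. \<lambda>m\<in>carrier M. f (ract M m b))"
  "ract (dual \<Gamma> A M) = (\<lambda>f a. \<lambda>m\<in>carrier M. f m \<otimes>\<^bsub>A\<^esub> a)"
  by (simp_all add: dual_def Let_def)

text \<open>The definition of the dual asks for additivity and for linearity over \<open>A\<close>.
  Linearity over \<open>R\<close> follows, as scalars act through multiples of the unit of
  \<open>A\<close>.\<close>

lemma dual_carrier:
  fixes M :: "('r, 'm, 'g, 'a, 'b) bimodule"
  assumes "algebra_bimodule R A A' M"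
  shows "carrier (dual \<Gamma> A M) = {f \<in> extensional (carrier M). equivariant R A M f}"
proof -
  interpret M: algebra_bimodule R A A' M by fact
  have "f (r \<odot>\<^bsub>M\<^esub> m) = r \<odot>\<^bsub>A\<^esub> f m"
    if c: "f \<in> carrier M \<rightarrow> carrier A" and e: "\<forall>a\<in>carrier A. \<forall>m\<in>carrier M. f (lact M a m) = a \<otimes>\<^bsub>A\<^esub> f m"
      and r: "r \<in> carrier R" and m: "m \<in> carrier M" for f r m
  proof -
    have fm: "f m \<in> carrier A" using c m by blast
    have "f (r \<odot>\<^bsub>M\<^esub> m) = f (lact M (r \<odot>\<^bsub>A\<^esub> \<one>\<^bsub>A\<^esub>) m)"
      using M.lact_smult_left[OF r M.A.one_closed m] M.lact_one[OF m] by simp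
    also have "\<dots> = (r \<odot>\<^bsub>A\<^esub> \<one>\<^bsub>A\<^esub>) \<otimes>\<^bsub>A\<^esub> f m" using e m M.A.smult_closed[OF r M.A.one_closed] by simp
    also have "\<dots> = r \<odot>\<^bsub>A\<^esub> f m" using M.A.smult_mult_left[OF r M.A.one_closed fm] fm by simp
    finally show ?thesis .
  qed
  then have "carrier (dual \<Gamma> A M) \<subseteq> {f \<in> extensional (carrier M). equivariant R A M f}"
    unfolding dual_def Let_def equivariant_def lin_def by (auto simp: PiE_def)
  moreover have "{f \<in> extensional (carrier M). equivariant R A M f} \<subseteq> carrier (dual \<Gamma> A M)"
    unfolding dual_def Let_def equivariant_def lin_def by (auto simp: PiE_def)
  ultimately show ?thesis by (rule subset_antisym)
qed

lemma equivariant_restrict: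
  assumes b: "algebra_bimodule R A A' M" and f: "equivariant R A M f"
  shows "equivariant R A M (restrict f (carrier M))"
proof -
  interpret M: algebra_bimodule R A A' M by fact
  show ?thesis unfolding equivariant_def
  proof (intro conjI ballI)
    show "lin R M A (restrict f (carrier M))"
      by (rule lin_cong[OF equivariant_lin[OF f] M.module_axioms]) simp
    show "restrict f (carrier M) (lact M a m) = a \<otimes>\<^bsub>A\<^esub> restrict f (carrier M) m" if "a \<in> carrier A" "m \<in> carrier M" for a m
      using M.lact_closed[OF that] equivariant_lact[OF f that] that by simp
  qed
qed

locale bimodule_dual = graded_bimodule_over R \<Gamma> D A A' M
  for R :: "('r, 'k) ring_scheme" (structure) and \<Gamma> :: "('g, 'l) monoid_scheme"
    and D :: "('r, 'c, 'g, 'z1) acted_algebra_scheme"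
    and A :: "('r, 'a, 'g, 'c, 'z2) algebra_over_scheme"
    and A' :: "('r, 'b, 'g, 'c, 'z3) algebra_over_scheme"
    and M :: "('r, 'm, 'g, 'a, 'b) bimodule"
begin

abbreviation "E \<equiv> dual \<Gamma> A M"

lemma aA: "assoc_algebra R A" and aA': "assoc_algebra R A'"
  using algebra_bimodule_axioms by (rule algebra_bimodule.axioms)+

lemma mA: "module R A" and mA': "module R A'" and mM: "module R M"
  by (rule assoc_algebra.axioms(1)[OF aA], rule assoc_algebra.axioms(1)[OF aA'], rule module_axioms)

lemmas amult = assoc_algebra.mult_bilin[OF aA] and amult' = assoc_algebra.mult_bilin[OF aA']

lemma E_equivariant: "f \<in> carrier E \<Longrightarrow> equivariant R A M f"
  unfolding dual_carrier[OF algebra_bimodule_axioms] by simp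

lemma E_closed: "f \<in> carrier E \<Longrightarrow> m \<in> carrier M \<Longrightarrow> f m \<in> carrier A"
  by (rule equivariant_closed[OF E_equivariant])

lemma E_I: "equivariant R A M f \<Longrightarrow> restrict f (carrier M) \<in> carrier E"
  unfolding dual_carrier[OF algebra_bimodule_axioms] using equivariant_restrict[OF algebra_bimodule_axioms] by simp

lemma E_eqI:
  assumes "f \<in> carrier E" "f' \<in> carrier E" "\<And>m. m \<in> carrier M \<Longrightarrow> f m = f' m"
  shows "f = f'"
  using assms(1,2) unfolding dual_carrier[OF algebra_bimodule_axioms]
  by (intro extensionalityI[OF _ _ assms(3)]) simp_all

lemma E_module: "module R E"
proof (rule pointwise_module[OF mA _ dual_simps(1-3)])
  show "carrier E \<subseteq> carrier M \<rightarrow>\<^sub>E carrier A"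
    unfolding dual_carrier[OF algebra_bimodule_axioms] PiE_def using equivariant_closed[of R A M] by blast
  show "\<zero>\<^bsub>E\<^esub> \<in> carrier E" unfolding dual_simps
    by (rule E_I) (simp add: equivariant_def lin_const_zero[OF mA] lin_zero[OF bilin_right[OF amult] mA mA])
  show "f \<oplus>\<^bsub>E\<^esub> f' \<in> carrier E" if f: "f \<in> carrier E" and f': "f' \<in> carrier E" for f f' unfolding dual_simps
  proof (rule E_I)
    show "equivariant R A M (\<lambda>m. f m \<oplus>\<^bsub>A\<^esub> f' m)" unfolding equivariant_def
    proof (intro conjI ballI)
      show "lin R M A (\<lambda>m. f m \<oplus>\<^bsub>A\<^esub> f' m)"
        by (rule lin_plus[OF equivariant_lin[OF E_equivariant[OF f]] equivariant_lin[OF E_equivariant[OF f']] mA])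
      show "f (lact M a m) \<oplus>\<^bsub>A\<^esub> f' (lact M a m) = a \<otimes>\<^bsub>A\<^esub> (f m \<oplus>\<^bsub>A\<^esub> f' m)" if "a \<in> carrier A" "m \<in> carrier M" for a m
        using lin_add[OF bilin_right[OF amult that(1)] E_closed[OF f that(2)] E_closed[OF f' that(2)]]
          equivariant_lact[OF E_equivariant[OF f] that] equivariant_lact[OF E_equivariant[OF f'] that] by simp
    qed
  qed
  show "r \<odot>\<^bsub>E\<^esub> f \<in> carrier E" if r: "r \<in> carrier R" and f: "f \<in> carrier E" for r f unfolding dual_simps
  proof (rule E_I)
    show "equivariant R A M (\<lambda>m. r \<odot>\<^bsub>A\<^esub> f m)" unfolding equivariant_def
    proof (intro conjI ballI)
      show "lin R M A (\<lambda>m. r \<odot>\<^bsub>A\<^esub> f m)" by (rule lin_scale[OF equivariant_lin[OF E_equivariant[OF f]] r mA])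
      show "r \<odot>\<^bsub>A\<^esub> f (lact M a m) = a \<otimes>\<^bsub>A\<^esub> (r \<odot>\<^bsub>A\<^esub> f m)" if "a \<in> carrier A" "m \<in> carrier M" for a m
        using lin_smult[OF bilin_right[OF amult that(1)] r E_closed[OF f that(2)]]
          equivariant_lact[OF E_equivariant[OF f] that] by simp
    qed
  qed
qed

lemma E_eval: "m \<in> carrier M \<Longrightarrow> lin R E A (\<lambda>f. f m)"
  by (rule linI) (simp_all add: E_closed dual_simps(1-3))

lemma E_lact_apply: "m \<in> carrier M \<Longrightarrow> lact E b f m = f (ract M m b)"
  and E_ract_apply: "m \<in> carrier M \<Longrightarrow> ract E f a m = f m \<otimes>\<^bsub>A\<^esub> a"
  by (simp_all add: dual_simps(5,6))

section \<open>The two actions on the dual\<close>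

lemma E_lact_closed:
  assumes b: "b \<in> carrier A'" and f: "f \<in> carrier E"
  shows "lact E b f \<in> carrier E"
  unfolding dual_simps
proof (rule E_I)
  note e = E_equivariant[OF f]
  show "equivariant R A M (\<lambda>m. f (ract M m b))" unfolding equivariant_def
  proof (intro conjI ballI)
    show "lin R M A (\<lambda>m. f (ract M m b))" by (rule lin_comp[OF bilin_left[OF ract_bilin b] equivariant_lin[OF e]])
    show "f (ract M (lact M a m) b) = a \<otimes>\<^bsub>A\<^esub> f (ract M m b)" if "a \<in> carrier A" "m \<in> carrier M" for a m
      using lact_ract[OF that b] equivariant_lact[OF e that(1) ract_closed[OF that(2) b]] by simp
  qed
qed

lemma E_ract_closed:
  assumes f: "f \<in> carrier E" and c: "c \<in> carrier A"
  shows "ract E f c \<in> carrier E"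
  unfolding dual_simps
proof (rule E_I)
  note e = E_equivariant[OF f]
  show "equivariant R A M (\<lambda>m. f m \<otimes>\<^bsub>A\<^esub> c)" unfolding equivariant_def
  proof (intro conjI ballI)
    show "lin R M A (\<lambda>m. f m \<otimes>\<^bsub>A\<^esub> c)" by (rule lin_comp[OF equivariant_lin[OF e] bilin_left[OF amult c]])
    show "f (lact M a m) \<otimes>\<^bsub>A\<^esub> c = a \<otimes>\<^bsub>A\<^esub> (f m \<otimes>\<^bsub>A\<^esub> c)" if "a \<in> carrier A" "m \<in> carrier M" for a m
      using m_assoc[OF that(1) E_closed[OF f that(2)] c] equivariant_lact[OF e that] by simp
  qed
qed

lemma E_lact_bilin: "bilin R A' E E (lact E)"
proof (rule bilinI; rule linI)
  fix b f assume b: "b \<in> carrier A'" and f: "f \<in> carrier E"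
  note fl = equivariant_lin[OF E_equivariant[OF f]]
  show "lact E b f \<in> carrier E" "lact E b f \<in> carrier E" by (rule E_lact_closed[OF b f])+
  show "lact E b (f \<oplus>\<^bsub>E\<^esub> f') = lact E b f \<oplus>\<^bsub>E\<^esub> lact E b f'" if f': "f' \<in> carrier E" for f'
    by (rule E_eqI) (simp_all add: b f f' E_lact_closed mod_add_closed[OF E_module] E_lact_apply ract_closed
      lin_add[OF E_eval])
  show "lact E b (r \<odot>\<^bsub>E\<^esub> f) = r \<odot>\<^bsub>E\<^esub> lact E b f" if r: "r \<in> carrier R" for r
    by (rule E_eqI) (simp_all add: b f r E_lact_closed mod_smult_closed[OF E_module] E_lact_apply ract_closed
      lin_smult[OF E_eval])
  show "lact E (b \<oplus>\<^bsub>A'\<^esub> b') f = lact E b f \<oplus>\<^bsub>E\<^esub> lact E b' f" if b': "b' \<in> carrier A'" for b'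
    by (rule E_eqI) (simp_all add: b f b' E_lact_closed mod_add_closed[OF E_module] mod_add_closed[OF mA'] E_lact_apply ract_closed
      lin_add[OF E_eval] ract_add_right lin_add[OF fl])
  show "lact E (r \<odot>\<^bsub>A'\<^esub> b) f = r \<odot>\<^bsub>E\<^esub> lact E b f" if r: "r \<in> carrier R" for r
    by (rule E_eqI) (simp_all add: b f r E_lact_closed mod_smult_closed[OF E_module] mod_smult_closed[OF mA'] E_lact_apply ract_closed
      lin_smult[OF E_eval] ract_smult_right lin_smult[OF fl])
qed

lemma E_ract_bilin: "bilin R E A E (ract E)"
proof (rule bilinI; rule linI)
  fix f c assume c: "c \<in> carrier A" and f: "f \<in> carrier E"
  note al = bilin_left[OF amult] and ar = bilin_right[OF amult]
  show "ract E f c \<in> carrier E" "ract E f c \<in> carrier E" by (rule E_ract_closed[OF f c])+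
  show "ract E (f \<oplus>\<^bsub>E\<^esub> f') c = ract E f c \<oplus>\<^bsub>E\<^esub> ract E f' c" if f': "f' \<in> carrier E" for f'
    by (rule E_eqI) (simp_all add: c f f' E_ract_closed mod_add_closed[OF E_module] E_ract_apply E_closed
      lin_add[OF E_eval] lin_add[OF al])
  show "ract E (r \<odot>\<^bsub>E\<^esub> f) c = r \<odot>\<^bsub>E\<^esub> ract E f c" if r: "r \<in> carrier R" for r
    by (rule E_eqI) (simp_all add: c f r E_ract_closed mod_smult_closed[OF E_module] E_ract_apply E_closed
      lin_smult[OF E_eval] lin_smult[OF al])
  show "ract E f (c \<oplus>\<^bsub>A\<^esub> c') = ract E f c \<oplus>\<^bsub>E\<^esub> ract E f c'" if c': "c' \<in> carrier A" for c'
    by (rule E_eqI) (simp_all add: c f c' E_ract_closed mod_add_closed[OF E_module] mod_add_closed[OF mA] E_ract_apply E_closed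
      lin_add[OF E_eval] lin_add[OF ar])
  show "ract E f (r \<odot>\<^bsub>A\<^esub> c) = r \<odot>\<^bsub>E\<^esub> ract E f c" if r: "r \<in> carrier R" for r
    by (rule E_eqI) (simp_all add: c f r E_ract_closed mod_smult_closed[OF E_module] mod_smult_closed[OF mA] E_ract_apply E_closed
      lin_smult[OF E_eval] lin_smult[OF ar])
qed

lemma E_lact_ract: "b \<in> carrier A' \<Longrightarrow> f \<in> carrier E \<Longrightarrow> a \<in> carrier A \<Longrightarrow> ract E (lact E b f) a = lact E b (ract E f a)"
  by (rule E_eqI) (simp_all add: E_lact_closed E_ract_closed E_lact_apply E_ract_apply ract_closed)

lemma E_gcomp_closed: "f \<in> gcomp E g \<Longrightarrow> f \<in> carrier E"
  and E_gcompD: "f \<in> gcomp E g \<Longrightarrow> x \<in> carrier \<Gamma> \<Longrightarrow> m \<in> gcomp M x \<Longrightarrow> f m \<in> gcomp A (x \<otimes>\<^bsub>\<Gamma>\<^esub> g)"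
  unfolding dual_simps(4) by blast+


text \<open>The homogeneous part \<open>P h\<close> of \<open>f\<close> sends \<open>m\<close> of
  degree \<open>x\<close> to the component of \<open>f m\<close> in degree \<open>x h\<close>. It is
  linear over \<open>A\<close> because left multiplication by a homogeneous element shifts
  components, and the parts add up to \<open>f\<close> because left translation by \<open>x\<close>
  permutes the finite group.\<close>

lemma E_span: "carrier E \<subseteq> mspan R E (\<Union>g\<in>carrier \<Gamma>. gcomp E g)"
proof
  fix f assume f: "f \<in> carrier E"
  note e = E_equivariant[OF f]
  note fl = equivariant_lin[OF e] and fin = finite_\<Gamma> and hA = hcomp_lin[OF grading mA finite_\<Gamma>]
    and hM = hcomp_lin[OF bimodule_grading mM finite_\<Gamma>]
  define P where "P = (\<lambda>h m. \<Oplus>\<^bsub>A\<^esub>x\<in>carrier \<Gamma>. hcomp \<Gamma> A (f (hcomp \<Gamma> M m x)) (x \<otimes>\<^bsub>\<Gamma>\<^esub> h))"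
  have Pl: "lin R M A (P h)" if h: "h \<in> carrier \<Gamma>" for h
    unfolding P_def by (rule lin_sum[OF _ mA mM]) (rule lin_comp[OF lin_comp[OF hM fl] hA[OF \<Gamma>.m_closed[OF _ h]]])
  have Ph: "P h m = hcomp \<Gamma> A (f m) (x \<otimes>\<^bsub>\<Gamma>\<^esub> h)" if h: "h \<in> carrier \<Gamma>" and x: "x \<in> carrier \<Gamma>" and m: "m \<in> gcomp M x" for h x m
    unfolding P_def
  proof (rule finsum_delta[OF mA fin x])
    have mc: "m \<in> carrier M" by (rule M_gcomp_closed[OF x m])
    show "hcomp \<Gamma> A (f m) (x \<otimes>\<^bsub>\<Gamma>\<^esub> h) \<in> carrier A"
      by (rule hcomp_closed[OF grading E_closed[OF f mc] \<Gamma>.m_closed[OF x h]])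
    fix j assume j: "j \<in> carrier \<Gamma>"
    have "hcomp \<Gamma> M m j = (if j = x then m else \<zero>\<^bsub>M\<^esub>)" by (rule hcomp_homogeneous[OF bimodule_grading mM fin j x m])
    moreover have "f \<zero>\<^bsub>M\<^esub> = \<zero>\<^bsub>A\<^esub>" by (rule lin_zero[OF fl mM mA])
    moreover have "hcomp \<Gamma> A \<zero>\<^bsub>A\<^esub> (j \<otimes>\<^bsub>\<Gamma>\<^esub> h) = \<zero>\<^bsub>A\<^esub>" by (rule lin_zero[OF hA[OF \<Gamma>.m_closed[OF j h]] mA mA])
    ultimately show "hcomp \<Gamma> A (f (hcomp \<Gamma> M m j)) (j \<otimes>\<^bsub>\<Gamma>\<^esub> h) =
      (if j = x then hcomp \<Gamma> A (f m) (x \<otimes>\<^bsub>\<Gamma>\<^esub> h) else \<zero>\<^bsub>A\<^esub>)" by simp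
  qed
  have sA: "(\<Union>g\<in>carrier \<Gamma>. gcomp A g) \<subseteq> carrier A" using gcomp_closed by blast
  have sM: "(\<Union>g\<in>carrier \<Gamma>. gcomp M g) \<subseteq> carrier M" using M_gcomp_closed by blast
  have gA: "a \<in> mspan R A (\<Union>g\<in>carrier \<Gamma>. gcomp A g)" if "a \<in> carrier A" for a using that grading_span[OF grading mA] by simp
  have gM: "m \<in> mspan R M (\<Union>g\<in>carrier \<Gamma>. gcomp M g)" if "m \<in> carrier M" for m
    using that grading_span[OF bimodule_grading mM] by simp
  have Pe: "equivariant R A M (P h)" if h: "h \<in> carrier \<Gamma>" for h
    unfolding equivariant_def
  proof (intro conjI ballI Pl[OF h])
    fix a m assume a: "a \<in> carrier A" and m: "m \<in> carrier M"
    show "P h (lact M a m) = a \<otimes>\<^bsub>A\<^esub> P h m"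
    proof (rule bilin_eqI[where f="\<lambda>a m. P h (lact M a m)" and g="\<lambda>a m. a \<otimes>\<^bsub>A\<^esub> P h m",
          OF _ _ mA mM mA sA sM _ gA[OF a] gM[OF m]])
      show "bilin R A M A (\<lambda>a m. P h (lact M a m))"
        by (rule bilinI) (rule lin_comp[OF bilin_right[OF lact_bilin] Pl[OF h]], assumption,
          rule lin_comp[OF bilin_left[OF lact_bilin] Pl[OF h]])
      show "bilin R A M A (\<lambda>a m. a \<otimes>\<^bsub>A\<^esub> P h m)"
        by (rule bilinI) (rule lin_comp[OF Pl[OF h] bilin_right[OF amult]], assumption,
          rule bilin_left[OF amult lin_closed[OF Pl[OF h]]])
      fix a m assume "a \<in> (\<Union>g\<in>carrier \<Gamma>. gcomp A g)" "m \<in> (\<Union>g\<in>carrier \<Gamma>. gcomp M g)"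
      then obtain g x where g: "g \<in> carrier \<Gamma>" "a \<in> gcomp A g" and x: "x \<in> carrier \<Gamma>" "m \<in> gcomp M x" by blast
      have ac: "a \<in> carrier A" by (rule gcomp_closed[OF g])
      have mc: "m \<in> carrier M" by (rule M_gcomp_closed[OF x])
      have "P h (lact M a m) = hcomp \<Gamma> A (a \<otimes>\<^bsub>A\<^esub> f m) (g \<otimes>\<^bsub>\<Gamma>\<^esub> (x \<otimes>\<^bsub>\<Gamma>\<^esub> h))"
        using Ph[OF h \<Gamma>.m_closed[OF g(1) x(1)] lact_gcomp[OF g(1) x(1) g(2) x(2)]] \<Gamma>.m_assoc[OF g(1) x(1) h]
          equivariant_lact[OF e ac mc] by simp
      also have "\<dots> = a \<otimes>\<^bsub>A\<^esub> P h m"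
        using hcomp_mult_left[OF g(1) \<Gamma>.m_closed[OF x(1) h] g(2) E_closed[OF f mc]] Ph[OF h x] by simp
      finally show "P h (lact M a m) = a \<otimes>\<^bsub>A\<^esub> P h m" .
    qed
  qed
  have Pg: "restrict (P h) (carrier M) \<in> gcomp E h" if h: "h \<in> carrier \<Gamma>" for h
    unfolding dual_simps(4)
  proof (intro CollectI conjI ballI E_I[OF Pe[OF h]] image_subsetI)
    fix x m assume x: "x \<in> carrier \<Gamma>" and m: "m \<in> gcomp M x"
    have mc: "m \<in> carrier M" by (rule M_gcomp_closed[OF x m])
    show "restrict (P h) (carrier M) m \<in> gcomp A (x \<otimes>\<^bsub>\<Gamma>\<^esub> h)"
      using hcomp_mem[OF grading E_closed[OF f mc] \<Gamma>.m_closed[OF x h]] Ph[OF h x m] mc by simp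
  qed
  have Pc: "restrict (P h) (carrier M) \<in> carrier E" if "h \<in> carrier \<Gamma>" for h by (rule E_I[OF Pe[OF that]])
  have fs: "(\<Oplus>\<^bsub>A\<^esub>h\<in>carrier \<Gamma>. P h m) = f m" if m: "m \<in> carrier M" for m
  proof (rule lin_eqI[where f="\<lambda>m. \<Oplus>\<^bsub>A\<^esub>h\<in>carrier \<Gamma>. P h m", OF lin_sum[OF Pl mA mM] fl mM mA sM _ gM[OF m]])
    fix m assume "m \<in> (\<Union>g\<in>carrier \<Gamma>. gcomp M g)"
    then obtain x where x: "x \<in> carrier \<Gamma>" "m \<in> gcomp M x" by blast
    have c: "hcomp \<Gamma> A (f m) k \<in> carrier A" if "k \<in> carrier \<Gamma>" for k
      by (rule hcomp_closed[OF grading E_closed[OF f M_gcomp_closed[OF x]] that])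
    \<comment> \<open>For \<open>m\<close> of degree \<open>x\<close>, summing over \<open>h\<close>
      the components in the degrees \<open>x h\<close> means summing over all degrees.\<close>
    have im: "(\<lambda>h. x \<otimes>\<^bsub>\<Gamma>\<^esub> h) ` carrier \<Gamma> = carrier \<Gamma>" by (rule \<Gamma>.surj_const_mult[OF x(1)])
    have inj: "inj_on (\<lambda>h. x \<otimes>\<^bsub>\<Gamma>\<^esub> h) (carrier \<Gamma>)" by (rule \<Gamma>.inj_on_cmult[OF x(1)])
    have am: "abelian_monoid A" by (rule abelian_group.axioms(1)[OF module.axioms(2)[OF mA]])
    have "(\<Oplus>\<^bsub>A\<^esub>h\<in>carrier \<Gamma>. P h m) = (\<Oplus>\<^bsub>A\<^esub>h\<in>carrier \<Gamma>. hcomp \<Gamma> A (f m) (x \<otimes>\<^bsub>\<Gamma>\<^esub> h))"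
      by (rule abelian_monoid.finsum_cong'[OF am refl]) (use c x in \<open>auto simp: Ph\<close>)
    also have "\<dots> = finsum A (hcomp \<Gamma> A (f m)) ((\<lambda>h. x \<otimes>\<^bsub>\<Gamma>\<^esub> h) ` carrier \<Gamma>)"
      by (rule abelian_monoid.finsum_reindex[OF am _ inj, symmetric]) (use c im in auto)
    also have "\<dots> = f m" unfolding im by (rule hcomp_sum[OF grading E_closed[OF f M_gcomp_closed[OF x]]])
    finally show "(\<Oplus>\<^bsub>A\<^esub>h\<in>carrier \<Gamma>. P h m) = f m" .
  qed
  have sc: "(\<Oplus>\<^bsub>E\<^esub>h\<in>carrier \<Gamma>. restrict (P h) (carrier M)) \<in> carrier E"
    by (rule submodule_finsum[OF module.carrier_is_submodule[OF E_module] E_module Pc])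
  have "f = (\<Oplus>\<^bsub>E\<^esub>h\<in>carrier \<Gamma>. restrict (P h) (carrier M))"
  proof (rule E_eqI[OF f sc])
    fix m assume m: "m \<in> carrier M"
    have "(\<Oplus>\<^bsub>E\<^esub>h\<in>carrier \<Gamma>. restrict (P h) (carrier M)) m = (\<Oplus>\<^bsub>A\<^esub>h\<in>carrier \<Gamma>. restrict (P h) (carrier M) m)"
      by (rule lin_finsum[OF E_eval[OF m] E_module mA Pc])
    then show "f m = (\<Oplus>\<^bsub>E\<^esub>h\<in>carrier \<Gamma>. restrict (P h) (carrier M)) m" using fs[OF m] m by simp
  qed
  moreover have "(\<Oplus>\<^bsub>E\<^esub>h\<in>carrier \<Gamma>. restrict (P h) (carrier M)) \<in> mspan R E (\<Union>g\<in>carrier \<Gamma>. gcomp E g)"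
  proof (rule submodule_finsum[OF mspan_submodule[OF E_module] E_module])
    show "(\<Union>g\<in>carrier \<Gamma>. gcomp E g) \<subseteq> carrier E" using E_gcomp_closed by blast
    show "restrict (P h) (carrier M) \<in> mspan R E (\<Union>g\<in>carrier \<Gamma>. gcomp E g)" if "h \<in> carrier \<Gamma>" for h
      using Pg[OF that] that by (intro mspan_base) blast
  qed
  ultimately show "f \<in> mspan R E (\<Union>g\<in>carrier \<Gamma>. gcomp E g)" by simp
qed

section \<open>The tensor products of a bimodule with its dual, in both orders\<close>

sublocale X: tens_data R "carrier A'" "ract M" "lact E" M E
  by (rule tens_data.intro[OF mM E_module ract_closed E_lact_closed])

sublocale Y: tens_data R "carrier A" "ract E" "lact M" E M
  by (rule tens_data.intro[OF E_module mM E_ract_closed lact_closed])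

abbreviation "BX \<equiv> bimodule_tensor R \<Gamma> A' M E"
abbreviation "BY \<equiv> bimodule_tensor R \<Gamma> A E M"

lemma BX_same: "same_mod BX X.T" and BY_same: "same_mod BY Y.T"
  unfolding bimodule_tensor_def Let_def by (rule mk_bimodule_same)+

lemma X_lact: "bilin R A X.T X.T (lact BX)"
    "a \<in> carrier A \<Longrightarrow> m \<in> carrier M \<Longrightarrow> f \<in> carrier E \<Longrightarrow> lact BX a (X.t m f) = X.t (lact M a m) f"
  and X_ract: "bilin R X.T A X.T (ract BX)"
    "m \<in> carrier M \<Longrightarrow> f \<in> carrier E \<Longrightarrow> a \<in> carrier A \<Longrightarrow> ract BX (X.t m f) a = X.t m (ract E f a)"
proof -
  note l = X.act_left[OF mA lact_bilin lact_ract[symmetric]] and r = X.act_right[OF mA E_ract_bilin E_lact_ract]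
  note s = bimodule_tensor_def Let_def mk_bimodule_simps
  show "bilin R A X.T X.T (lact BX)" unfolding s by (rule l(1))
  show "bilin R X.T A X.T (ract BX)" unfolding s by (rule r(1))
  show "lact BX a (X.t m f) = X.t (lact M a m) f" if "a \<in> carrier A" "m \<in> carrier M" "f \<in> carrier E"
    unfolding s by (rule l(2)[OF _ _ _ that])
  show "ract BX (X.t m f) a = X.t m (ract E f a)" if "m \<in> carrier M" "f \<in> carrier E" "a \<in> carrier A"
    unfolding s by (rule r(2)[OF _ _ _ that(3,1,2)])
qed

lemma Y_lact: "bilin R A' Y.T Y.T (lact BY)"
    "b \<in> carrier A' \<Longrightarrow> f \<in> carrier E \<Longrightarrow> m \<in> carrier M \<Longrightarrow> lact BY b (Y.t f m) = Y.t (lact E b f) m"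
  and Y_ract: "bilin R Y.T A' Y.T (ract BY)"
    "f \<in> carrier E \<Longrightarrow> m \<in> carrier M \<Longrightarrow> b \<in> carrier A' \<Longrightarrow> ract BY (Y.t f m) b = Y.t f (ract M m b)"
proof -
  note l = Y.act_left[OF mA' E_lact_bilin E_lact_ract[symmetric]] and r = Y.act_right[OF mA' ract_bilin lact_ract]
  note s = bimodule_tensor_def Let_def mk_bimodule_simps
  show "bilin R A' Y.T Y.T (lact BY)" unfolding s by (rule l(1))
  show "bilin R Y.T A' Y.T (ract BY)" unfolding s by (rule r(1))
  show "lact BY b (Y.t f m) = Y.t (lact E b f) m" if "b \<in> carrier A'" "f \<in> carrier E" "m \<in> carrier M"
    unfolding s by (rule l(2)[OF _ _ _ that])
  show "ract BY (Y.t f m) b = Y.t f (ract M m b)" if "f \<in> carrier E" "m \<in> carrier M" "b \<in> carrier A'"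
    unfolding s by (rule r(2)[OF _ _ _ that(3,1,2)])
qed

end

section \<open>Graded Morita equivalences\<close>

context bimodule_dual
begin

text \<open>The isomorphisms \<phi> and \<psi> turn pure tensors into pairings \<open>pr\<close> and
  \<open>br\<close> with values in \<open>A\<close> and \<open>A'\<close>. In a Morita context
  \<open>x br(f, m)\<close> would be \<open>pr(x, f) m\<close>; arbitrary isomorphisms yield this
  only up to a twist \<alpha> of \<open>m\<close>. The twist is linear over \<open>A\<close> and
  onto, which suffices: it can be absorbed into the second argument of rank one
  endomorphisms.\<close>

lemma Morita_progenerator:
  assumes "induces_graded_Morita_over R \<Gamma> D A A' M"
  shows "progenerator R A A' M"
proof -
  note s = regular_bimodule_def mk_bimodule_simps
  have sA: "same_mod (regular_bimodule A) A" and sA': "same_mod (regular_bimodule A') A'"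
    unfolding regular_bimodule_def by (rule mk_bimodule_same)+
  obtain \<phi> where \<phi>: "\<phi> \<in> graded_bimodule_hom R \<Gamma> A A BX (regular_bimodule A)"
    and \<phi>b: "bij_betw \<phi> (carrier BX) (carrier (regular_bimodule A))"
    using assms unfolding induces_graded_Morita_over_def graded_bimodule_iso_def by blast
  obtain \<psi> where \<psi>: "\<psi> \<in> graded_bimodule_hom R \<Gamma> A' A' BY (regular_bimodule A')"
    and \<psi>b: "bij_betw \<psi> (carrier BY) (carrier (regular_bimodule A'))"
    using assms unfolding induces_graded_Morita_over_def graded_bimodule_iso_def by blast
  have cX: "carrier BX = carrier X.T" and cY: "carrier BY = carrier Y.T"
    using BX_same BY_same by (simp_all add: same_mod_def)
  have \<phi>l: "lin R X.T A \<phi>"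
    using graded_bimodule_homD(1)[OF \<phi>] unfolding same_mod_lin[OF BX_same] same_mod_lin'[OF sA] .
  have \<psi>l: "lin R Y.T A' \<psi>"
    using graded_bimodule_homD(1)[OF \<psi>] unfolding same_mod_lin[OF BY_same] same_mod_lin'[OF sA'] .
  have \<phi>L: "\<phi> (lact BX a \<tau>) = a \<otimes>\<^bsub>A\<^esub> \<phi> \<tau>" and \<phi>R: "\<phi> (ract BX \<tau> a) = \<phi> \<tau> \<otimes>\<^bsub>A\<^esub> a"
    if "a \<in> carrier A" "\<tau> \<in> carrier X.T" for a \<tau>
    using graded_bimodule_homD(2,3)[OF \<phi>] that cX by (simp_all add: s)
  have \<psi>L: "\<psi> (lact BY b \<tau>) = b \<otimes>\<^bsub>A'\<^esub> \<psi> \<tau>" and \<psi>R: "\<psi> (ract BY \<tau> b) = \<psi> \<tau> \<otimes>\<^bsub>A'\<^esub> b"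
    if "b \<in> carrier A'" "\<tau> \<in> carrier Y.T" for b \<tau>
    using graded_bimodule_homD(2,3)[OF \<psi>] that cY by (simp_all add: s)
  have \<phi>i: "inj_on \<phi> (carrier X.T)" and \<phi>s: "\<phi> ` carrier X.T = carrier A"
    using \<phi>b unfolding bij_betw_def cX by (simp_all add: s)
  have \<psi>s: "\<psi> ` carrier Y.T = carrier A'" using \<psi>b unfolding bij_betw_def cY by (simp add: s)
  define pr where "pr = (\<lambda>m f. \<phi> (X.t m f))"
  define br where "br = (\<lambda>f m. \<psi> (Y.t f m))"
  have prb: "bilin R M E A pr" unfolding pr_def
    by (rule bilinI) (rule lin_comp[OF bilin_right[OF X.t_bilin] \<phi>l], assumption, rule lin_comp[OF bilin_left[OF X.t_bilin] \<phi>l])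
  have brb: "bilin R E M A' br" unfolding br_def
    by (rule bilinI) (rule lin_comp[OF bilin_right[OF Y.t_bilin] \<psi>l], assumption, rule lin_comp[OF bilin_left[OF Y.t_bilin] \<psi>l])
  note prc = bilin_closed[OF prb] and brc = bilin_closed[OF brb]
  have pr_l: "pr (lact M a m) f = a \<otimes>\<^bsub>A\<^esub> pr m f" if "a \<in> carrier A" "m \<in> carrier M" "f \<in> carrier E" for a m f
    unfolding pr_def using \<phi>L[OF that(1) X.t_closed[OF that(2,3)]] X_lact(2)[OF that] by simp
  have br_l: "br (lact E b f) m = b \<otimes>\<^bsub>A'\<^esub> br f m" if "b \<in> carrier A'" "f \<in> carrier E" "m \<in> carrier M" for b m f
    unfolding br_def using \<psi>L[OF that(1) Y.t_closed[OF that(2,3)]] Y_lact(2)[OF that] by simp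
  have br_r: "br f (ract M m b) = br f m \<otimes>\<^bsub>A'\<^esub> b" if "f \<in> carrier E" "m \<in> carrier M" "b \<in> carrier A'" for b m f
    unfolding br_def using \<psi>R[OF that(3) Y.t_closed[OF that(1,2)]] Y_ract(2)[OF that] by simp
  have br_b: "br (ract E f a) m = br f (lact M a m)" if "f \<in> carrier E" "m \<in> carrier M" "a \<in> carrier A" for a m f
    unfolding br_def by (rule arg_cong[OF Y.t_balanced[OF that(1,3,2)]])
  \<comment> \<open>Surjectivity of \<psi> says that the values of \<open>br\<close> span
    \<open>A'\<close>, so membership in a submodule of \<open>A'\<close> may be tested on
    them.\<close>
  have full: "c \<in> K" if K: "submodule K R A'" and h: "\<And>f m. f \<in> carrier E \<Longrightarrow> m \<in> carrier M \<Longrightarrow> br f m \<in> K"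
    and c: "c \<in> carrier A'" for K c
  proof -
    obtain \<tau> where \<tau>: "\<tau> \<in> carrier Y.T" "c = \<psi> \<tau>" using c \<psi>s by blast
    have "\<tau> \<in> {\<tau> \<in> carrier Y.T. \<psi> \<tau> \<in> K}"
      by (rule Y.induct[OF lin_vimage_submodule[OF \<psi>l Y.T_module mA' K] _ \<tau>(1)])
        (use h Y.t_closed in \<open>simp add: br_def\<close>)
    then show ?thesis unfolding \<tau>(2) by simp
  qed
  \<comment> \<open>The preimage of the unit under \<phi>, a generator of the tensor product as a
    left \<open>A\<close>-module.\<close>
  have "\<one>\<^bsub>A\<^esub> \<in> \<phi> ` carrier X.T" unfolding \<phi>s by (rule one_closed)
  then obtain \<tau>1 where "\<one>\<^bsub>A\<^esub> = \<phi> \<tau>1" and "\<tau>1 \<in> carrier X.T" by (rule imageE)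
  then have \<tau>1: "\<tau>1 \<in> carrier X.T" "\<phi> \<tau>1 = \<one>\<^bsub>A\<^esub>" by simp_all
  \<comment> \<open>For fixed \<open>m\<close>, the left side of the relation sought, as a linear
    map on the tensor product. Its value at the preimage of the unit will be \<alpha>.\<close>
  define \<kappa> where "\<kappa> = (\<lambda>m. lin_ext R M (\<lambda>(x, f). ract M x (br f m)))"
  have kb: "bilin R M E M (\<lambda>x f. ract M x (br f m))" if m: "m \<in> carrier M" for m
    by (rule bilinI) (rule lin_comp[OF bilin_left[OF brb m] bilin_right[OF ract_bilin]], assumption,
      rule bilin_left[OF ract_bilin brc[OF _ m]])
  have kbal: "ract M (ract M x b) (br f m) = ract M x (br (lact E b f) m)"
    if "m \<in> carrier M" "x \<in> carrier M" "b \<in> carrier A'" "f \<in> carrier E" for m x b f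
    using br_l[OF that(3,4,1)] ract_mult[OF that(2,3) brc[OF that(4,1)]] by simp
  have \<kappa>l: "lin R X.T M (\<kappa> m)" if m: "m \<in> carrier M" for m
    unfolding \<kappa>_def by (rule X.lift(1)[OF mM kb[OF m] kbal[OF m]])
  have \<kappa>t: "\<kappa> m (X.t x f) = ract M x (br f m)" if m: "m \<in> carrier M" and "x \<in> carrier M" "f \<in> carrier E" for m x f
    unfolding \<kappa>_def by (rule X.lift(2)[OF mM kb[OF m] kbal[OF m] that(2,3)])
  have \<kappa>a: "\<kappa> m (lact BX a \<tau>) = lact M a (\<kappa> m \<tau>)" if m: "m \<in> carrier M" and a: "a \<in> carrier A" and \<tau>: "\<tau> \<in> carrier X.T" for m a \<tau>
  proof (rule X.eqI[where f="\<lambda>\<tau>. \<kappa> m (lact BX a \<tau>)" and g="\<lambda>\<tau>. lact M a (\<kappa> m \<tau>)",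
        OF mM lin_comp[OF bilin_right[OF X_lact(1) a] \<kappa>l[OF m]] lin_comp[OF \<kappa>l[OF m] bilin_right[OF lact_bilin a]] _ \<tau>])
    fix x f assume x: "x \<in> carrier M" and f: "f \<in> carrier E"
    show "\<kappa> m (lact BX a (X.t x f)) = lact M a (\<kappa> m (X.t x f))"
      using X_lact(2)[OF a x f] \<kappa>t[OF m x f] \<kappa>t[OF m lact_closed[OF a x] f] lact_ract[OF a x brc[OF f m]] by simp
  qed
  have \<kappa>r: "\<kappa> m (ract BX \<tau> a) = \<kappa> (lact M a m) \<tau>" if m: "m \<in> carrier M" and a: "a \<in> carrier A" and \<tau>: "\<tau> \<in> carrier X.T" for m a \<tau>
  proof (rule X.eqI[where f="\<lambda>\<tau>. \<kappa> m (ract BX \<tau> a)" and g="\<kappa> (lact M a m)",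
        OF mM lin_comp[OF bilin_left[OF X_ract(1) a] \<kappa>l[OF m]] \<kappa>l[OF lact_closed[OF a m]] _ \<tau>])
    fix x f assume x: "x \<in> carrier M" and f: "f \<in> carrier E"
    show "\<kappa> m (ract BX (X.t x f) a) = \<kappa> (lact M a m) (X.t x f)"
      using X_ract(2)[OF x f a] \<kappa>t[OF m x E_ract_closed[OF f a]] \<kappa>t[OF lact_closed[OF a m] x f] br_b[OF f m a] by simp
  qed
  define \<alpha> where "\<alpha> = (\<lambda>m. \<kappa> m \<tau>1)"
  have \<alpha>c: "\<alpha> m \<in> carrier M" if "m \<in> carrier M" for m unfolding \<alpha>_def by (rule lin_closed[OF \<kappa>l[OF that] \<tau>1(1)])
  have \<alpha>a: "\<alpha> (lact M a m) = lact M a (\<alpha> m)" if a: "a \<in> carrier A" and m: "m \<in> carrier M" for a m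
  proof -
    \<comment> \<open>Both sides are sent to \<open>a\<close> by \<phi>, which is injective. So the
      preimage of the unit commutes with \<open>A\<close>, and this makes \<alpha> linear over
      \<open>A\<close>.\<close>
    have "lact BX a \<tau>1 = ract BX \<tau>1 a"
      by (rule inj_onD[OF \<phi>i]) (simp_all add: \<phi>L \<phi>R a \<tau>1 bilin_closed[OF X_lact(1) a \<tau>1(1)] bilin_closed[OF X_ract(1) \<tau>1(1) a])
    then show ?thesis unfolding \<alpha>_def using \<kappa>a[OF m a \<tau>1(1)] \<kappa>r[OF m a \<tau>1(1)] by simp
  qed
  \<comment> \<open>Every \<tau> is \<open>\<phi> \<tau>\<close> times the preimage of the unit,
    again by injectivity of \<phi>. Applying \<kappa> and reading the result at a pure tensor gives
    the twisted relation \<open>rb\<close>.\<close>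
  have \<kappa>\<alpha>: "\<kappa> m \<tau> = lact M (\<phi> \<tau>) (\<alpha> m)" if m: "m \<in> carrier M" and \<tau>: "\<tau> \<in> carrier X.T" for m \<tau>
  proof -
    have c: "\<phi> \<tau> \<in> carrier A" by (rule lin_closed[OF \<phi>l \<tau>])
    have "lact BX (\<phi> \<tau>) \<tau>1 = \<tau>"
      by (rule inj_onD[OF \<phi>i]) (simp_all add: \<phi>L c \<tau>1 \<tau> bilin_closed[OF X_lact(1) c \<tau>1(1)])
    then show ?thesis using \<kappa>a[OF m c \<tau>1(1)] unfolding \<alpha>_def by simp
  qed
  have rb: "ract M x (br f m) = lact M (pr x f) (\<alpha> m)" if "x \<in> carrier M" "f \<in> carrier E" "m \<in> carrier M" for x f m
    using \<kappa>t[OF that(3,1,2)] \<kappa>\<alpha>[OF that(3) X.t_closed[OF that(1,2)]] unfolding pr_def by simp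
  have \<alpha>l: "lin R M M \<alpha>"
  proof (rule linI)
    fix m assume m: "m \<in> carrier M"
    show "\<alpha> m \<in> carrier M" by (rule \<alpha>c[OF m])
    show "\<alpha> (m \<oplus>\<^bsub>M\<^esub> m') = \<alpha> m \<oplus>\<^bsub>M\<^esub> \<alpha> m'" if m': "m' \<in> carrier M" for m'
      unfolding \<alpha>_def
    proof (rule X.eqI[OF mM \<kappa>l[OF mod_add_closed[OF mM m m']] lin_plus[OF \<kappa>l[OF m] \<kappa>l[OF m'] mM] _ \<tau>1(1)])
      fix x f assume x: "x \<in> carrier M" and f: "f \<in> carrier E"
      show "\<kappa> (m \<oplus>\<^bsub>M\<^esub> m') (X.t x f) = \<kappa> m (X.t x f) \<oplus>\<^bsub>M\<^esub> \<kappa> m' (X.t x f)"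
        using lin_add[OF bilin_right[OF brb f] m m'] lin_add[OF bilin_right[OF ract_bilin x] brc[OF f m] brc[OF f m']]
        by (simp add: \<kappa>t m m' x f mod_add_closed[OF mM])
    qed
    show "\<alpha> (r \<odot>\<^bsub>M\<^esub> m) = r \<odot>\<^bsub>M\<^esub> \<alpha> m" if r: "r \<in> carrier R" for r
      unfolding \<alpha>_def
    proof (rule X.eqI[OF mM \<kappa>l[OF mod_smult_closed[OF mM r m]] lin_scale[OF \<kappa>l[OF m] r mM] _ \<tau>1(1)])
      fix x f assume x: "x \<in> carrier M" and f: "f \<in> carrier E"
      show "\<kappa> (r \<odot>\<^bsub>M\<^esub> m) (X.t x f) = r \<odot>\<^bsub>M\<^esub> \<kappa> m (X.t x f)"
        using lin_smult[OF bilin_right[OF brb f] r m] lin_smult[OF bilin_right[OF ract_bilin x] r brc[OF f m]]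
        by (simp add: \<kappa>t m r x f mod_smult_closed[OF mM])
    qed
  qed
  \<comment> \<open>Write \<open>m\<close> as \<open>m\<close> times the unit of \<open>A'\<close>
    and the unit as a combination of values of \<open>br\<close>. By \<open>rb\<close> each
    \<open>m br(f, y)\<close> is the image under \<alpha> of \<open>pr(m, f) y\<close>.\<close>
  have \<alpha>s: "m \<in> \<alpha> ` carrier M" if m: "m \<in> carrier M" for m
  proof -
    have K: "submodule {b \<in> carrier A'. ract M m b \<in> \<alpha> ` carrier M} R A'"
      by (rule lin_vimage_submodule[OF bilin_right[OF ract_bilin m] mA' mM
        lin_image_submodule[OF \<alpha>l mM mM module.carrier_is_submodule[OF mM]]])
    have "\<one>\<^bsub>A'\<^esub> \<in> {b \<in> carrier A'. ract M m b \<in> \<alpha> ` carrier M}"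
    proof (rule full[OF K])
      fix f y assume f: "f \<in> carrier E" and y: "y \<in> carrier M"
      have "ract M m (br f y) = \<alpha> (lact M (pr m f) y)" using rb[OF m f y] \<alpha>a[OF prc[OF m f] y] by simp
      then show "br f y \<in> {b \<in> carrier A'. ract M m b \<in> \<alpha> ` carrier M}"
        using brc[OF f y] lact_closed[OF prc[OF m f] y] by blast
    qed (rule A'.one_closed)
    then show ?thesis using ract_one[OF m] by simp
  qed
  have pre: "equivariant R A M (\<lambda>m. pr m f)" if f: "f \<in> carrier E" for f
    unfolding equivariant_def using bilin_left[OF prb f] pr_l[OF _ _ f] by blast
  show ?thesis
  proof (rule progenerator.intro[OF algebra_bimodule_axioms], rule progenerator_axioms.intro)
    fix b assume b: "b \<in> carrier A'" and z: "\<And>m. m \<in> carrier M \<Longrightarrow> ract M m b = \<zero>\<^bsub>M\<^esub>"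
    have K: "submodule {s \<in> carrier A'. s \<otimes>\<^bsub>A'\<^esub> b \<in> {\<zero>\<^bsub>A'\<^esub>}} R A'"
      by (rule lin_vimage_submodule[OF bilin_left[OF amult' b] mA' mA' zero_submodule[OF mA']])
    have "\<one>\<^bsub>A'\<^esub> \<in> {s \<in> carrier A'. s \<otimes>\<^bsub>A'\<^esub> b \<in> {\<zero>\<^bsub>A'\<^esub>}}"
    proof (rule full[OF K])
      fix f y assume f: "f \<in> carrier E" and y: "y \<in> carrier M"
      \<comment> \<open>Right linearity of \<open>br\<close> moves \<open>b\<close> onto
        \<open>y\<close>, where it acts as zero.\<close>
      have "br f y \<otimes>\<^bsub>A'\<^esub> b = br f \<zero>\<^bsub>M\<^esub>" using br_r[OF f y b] z[OF y] by simp
      then show "br f y \<in> {s \<in> carrier A'. s \<otimes>\<^bsub>A'\<^esub> b \<in> {\<zero>\<^bsub>A'\<^esub>}}"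
        using brc[OF f y] lin_zero[OF bilin_right[OF brb f] mM mA'] by simp
    qed (rule A'.one_closed)
    then show "b = \<zero>\<^bsub>A'\<^esub>" using b by simp
  next
    fix f y assume f: "equivariant R A M f" and y: "y \<in> carrier M"
    have "\<one>\<^bsub>A'\<^esub> \<in> {s \<in> carrier A'. \<exists>b\<in>carrier A'. \<forall>m\<in>carrier M. ract M m b = lact M (f (ract M m s)) y}"
    proof (rule full[OF rank_one_submodule[OF algebra_bimodule_axioms f y]])
      fix g x assume g: "g \<in> carrier E" and x: "x \<in> carrier M"
      have fc: "f (\<alpha> x) \<in> carrier A" by (rule equivariant_closed[OF f \<alpha>c[OF x]])
      \<comment> \<open>Surjectivity of \<alpha> provides \<open>z\<close>, and
        \<open>br g z\<close> is the element required for \<open>br g x\<close>: both actions become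
        \<open>pr(m, g) f(\<alpha> x) y\<close>.\<close>
      obtain z where z: "z \<in> carrier M" "lact M (f (\<alpha> x)) y = \<alpha> z" using \<alpha>s[OF lact_closed[OF fc y]] by blast
      have "ract M m (br g z) = lact M (f (ract M m (br g x))) y" if m: "m \<in> carrier M" for m
        using rb[OF m g z(1)] rb[OF m g x] equivariant_lact[OF f prc[OF m g] \<alpha>c[OF x]] lact_mult[OF prc[OF m g] fc y] z(2)
        by simp
      then show "br g x \<in> {s \<in> carrier A'. \<exists>b\<in>carrier A'. \<forall>m\<in>carrier M. ract M m b = lact M (f (ract M m s)) y}"
        using brc[OF g x] brc[OF g z(1)] by blast
    qed (rule A'.one_closed)
    then show "\<exists>b\<in>carrier A'. \<forall>m\<in>carrier M. ract M m b = lact M (f m) y" using ract_one by auto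
  next
    let ?S = "{f x | f x. equivariant R A M f \<and> x \<in> carrier M}"
    have S: "?S \<subseteq> carrier A" using equivariant_closed[of R A M] by blast
    have "\<tau>1 \<in> {\<tau> \<in> carrier X.T. \<phi> \<tau> \<in> mspan R A ?S}"
    proof (rule X.induct[OF lin_vimage_submodule[OF \<phi>l X.T_module mA mspan_submodule[OF mA S]] _ \<tau>1(1)])
      fix m f assume m: "m \<in> carrier M" and f: "f \<in> carrier E"
      show "X.t m f \<in> {\<tau> \<in> carrier X.T. \<phi> \<tau> \<in> mspan R A ?S}"
        using equivariant_mspan[OF pre[OF f] m] X.t_closed[OF m f] by (simp add: pr_def)
    qed
    then show "\<one>\<^bsub>A\<^esub> \<in> mspan R A ?S" using \<tau>1(2) by simp
  next
    let ?S = "{b \<in> carrier A'. \<exists>g y. equivariant R A M g \<and> y \<in> carrier M \<and> (\<forall>m\<in>carrier M. ract M m b = lact M (g m) y)}"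
    have S: "?S \<subseteq> carrier A'" by blast
    show "\<one>\<^bsub>A'\<^esub> \<in> mspan R A' ?S"
    proof (rule full[OF mspan_submodule[OF mA' S]])
      fix f y assume f: "f \<in> carrier E" and y: "y \<in> carrier M"
      have "\<forall>m\<in>carrier M. ract M m (br f y) = lact M (pr m f) (\<alpha> y)" using rb[OF _ f y] by blast
      then have "\<exists>g z. equivariant R A M g \<and> z \<in> carrier M \<and> (\<forall>m\<in>carrier M. ract M m (br f y) = lact M (g m) z)"
        by (intro exI[of _ "\<lambda>m. pr m f"] exI[of _ "\<alpha> y"] conjI pre[OF f] \<alpha>c[OF y])
      with brc[OF f y] have "br f y \<in> ?S" by (intro CollectI conjI)
      then show "br f y \<in> mspan R A' ?S" by (rule mspan_base)
    qed (rule A'.one_closed)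
  qed
qed


text \<open>Evaluation and the bracket are the two isomorphisms. Their images are one-sided ideals
  that contain the unit, by \<open>generator\<close> and \<open>projective\<close>. For injectivity,
  an element of the kernel is shown to be annihilated by all values that span the unit, hence by the
  unit itself.\<close>

lemma progenerator_Morita:
  assumes "progenerator R A A' M"
  shows "induces_graded_Morita_over R \<Gamma> D A A' M"
proof -
  interpret P: progenerator R A A' M by fact
  note eq = E_equivariant and bc = P.bracket(1)[OF E_equivariant] and be = P.bracket(2)[OF E_equivariant]
  note fin = finite_\<Gamma>
  have brb: "bilin R E M A' P.bracket"
  proof (rule bilinI)
    show "lin R M A' (P.bracket f)" if "f \<in> carrier E" for f by (rule P.bracket_lin[OF eq[OF that]])
    show "lin R E A' (\<lambda>f. P.bracket f m)" if m: "m \<in> carrier M" for m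
    proof (rule linI)
      fix f assume f: "f \<in> carrier E"
      show "P.bracket f m \<in> carrier A'" by (rule bc[OF f m])
      show "P.bracket (f \<oplus>\<^bsub>E\<^esub> f') m = P.bracket f m \<oplus>\<^bsub>A'\<^esub> P.bracket f' m" if f': "f' \<in> carrier E" for f'
      proof (rule P.bracket_eqI[OF eq[OF mod_add_closed[OF E_module f f']] m mod_add_closed[OF mA' bc[OF f m] bc[OF f' m]]])
        fix x assume x: "x \<in> carrier M"
        show "ract M x (P.bracket f m \<oplus>\<^bsub>A'\<^esub> P.bracket f' m) = lact M ((f \<oplus>\<^bsub>E\<^esub> f') x) m"
          using ract_add_right[OF x bc[OF f m] bc[OF f' m]] be[OF f m x] be[OF f' m x]
            lact_add_left[OF E_closed[OF f x] E_closed[OF f' x] m] lin_add[OF E_eval[OF x] f f'] by simp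
      qed
      show "P.bracket (r \<odot>\<^bsub>E\<^esub> f) m = r \<odot>\<^bsub>A'\<^esub> P.bracket f m" if r: "r \<in> carrier R" for r
      proof (rule P.bracket_eqI[OF eq[OF mod_smult_closed[OF E_module r f]] m mod_smult_closed[OF mA' r bc[OF f m]]])
        fix x assume x: "x \<in> carrier M"
        show "ract M x (r \<odot>\<^bsub>A'\<^esub> P.bracket f m) = lact M ((r \<odot>\<^bsub>E\<^esub> f) x) m"
          using ract_smult_right[OF r x bc[OF f m]] be[OF f m x]
            lact_smult_left[OF r E_closed[OF f x] m] lin_smult[OF E_eval[OF x] r f] by simp
      qed
    qed
  qed
  have br_l: "P.bracket (lact E b f) m = b \<otimes>\<^bsub>A'\<^esub> P.bracket f m"
    if b: "b \<in> carrier A'" and f: "f \<in> carrier E" and m: "m \<in> carrier M" for b f m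
  proof (rule P.bracket_eqI[OF eq[OF E_lact_closed[OF b f]] m bilin_closed[OF amult' b bc[OF f m]]])
    fix x assume x: "x \<in> carrier M"
    show "ract M x (b \<otimes>\<^bsub>A'\<^esub> P.bracket f m) = lact M (lact E b f x) m"
      using ract_mult[OF x b bc[OF f m]] be[OF f m ract_closed[OF x b]] E_lact_apply[OF x] by simp
  qed
  have br_b: "P.bracket (ract E f a) m = P.bracket f (lact M a m)"
    if f: "f \<in> carrier E" and a: "a \<in> carrier A" and m: "m \<in> carrier M" for a f m
  proof (rule P.bracket_eqI[OF eq[OF E_ract_closed[OF f a]] m bc[OF f lact_closed[OF a m]]])
    fix x assume x: "x \<in> carrier M"
    show "ract M x (P.bracket f (lact M a m)) = lact M (ract E f a x) m"
      using be[OF f lact_closed[OF a m] x] lact_mult[OF E_closed[OF f x] a m] E_ract_apply[OF x] by simp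
  qed
  \<comment> \<open>The second associativity relation of the Morita context,
    \<open>[g, y] f = g f(y)\<close>, as an identity in the dual. The first is the defining property
    of the bracket.\<close>
  have key: "lact E (P.bracket g y) f = ract E g (f y)" if g: "g \<in> carrier E" and y: "y \<in> carrier M" and f: "f \<in> carrier E" for g y f
  proof (rule E_eqI[OF E_lact_closed[OF bc[OF g y] f] E_ract_closed[OF g E_closed[OF f y]]])
    fix x assume x: "x \<in> carrier M"
    show "lact E (P.bracket g y) f x = ract E g (f y) x"
      using be[OF g y x] equivariant_lact[OF eq[OF f] E_closed[OF g x] y] by (simp add: E_lact_apply[OF x] E_ract_apply[OF x])
  qed
  define \<phi> where "\<phi> = lin_ext R A (\<lambda>(m :: 'm, f). f m)"
  have evb: "bilin R M E A (\<lambda>m f. f m)" by (rule bilinI) (rule E_eval, assumption, rule equivariant_lin[OF eq])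
  have evbal: "f (ract M m b) = lact E b f m" if "m \<in> carrier M" "b \<in> carrier A'" "f \<in> carrier E" for f m b
    by (simp only: E_lact_apply[OF that(1)])
  have \<phi>l: "lin R X.T A \<phi>" unfolding \<phi>_def by (rule X.lift(1)[OF mA evb evbal])
  have \<phi>t: "\<phi> (X.t m f) = f m" if "m \<in> carrier M" "f \<in> carrier E" for m f
    unfolding \<phi>_def by (rule X.lift(2)[OF mA evb evbal that])
  define \<psi> where "\<psi> = lin_ext R A' (\<lambda>(f, m). P.bracket f m)"
  have \<psi>l: "lin R Y.T A' \<psi>" unfolding \<psi>_def by (rule Y.lift(1)[OF mA' brb br_b])
  have \<psi>t: "\<psi> (Y.t f m) = P.bracket f m" if "f \<in> carrier E" "m \<in> carrier M" for m f
    unfolding \<psi>_def by (rule Y.lift(2)[OF mA' brb br_b that])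
  have \<phi>L: "\<phi> (lact BX a \<tau>) = a \<otimes>\<^bsub>A\<^esub> \<phi> \<tau>" if a: "a \<in> carrier A" and \<tau>: "\<tau> \<in> carrier X.T" for a \<tau>
  proof (rule X.eqI[where f="\<lambda>\<tau>. \<phi> (lact BX a \<tau>)" and g="\<lambda>\<tau>. a \<otimes>\<^bsub>A\<^esub> \<phi> \<tau>",
        OF mA lin_comp[OF bilin_right[OF X_lact(1) a] \<phi>l] lin_comp[OF \<phi>l bilin_right[OF amult a]] _ \<tau>])
    fix m f assume m: "m \<in> carrier M" and f: "f \<in> carrier E"
    show "\<phi> (lact BX a (X.t m f)) = a \<otimes>\<^bsub>A\<^esub> \<phi> (X.t m f)"
      using X_lact(2)[OF a m f] \<phi>t[OF m f] \<phi>t[OF lact_closed[OF a m] f] equivariant_lact[OF eq[OF f] a m] by simp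
  qed
  have \<phi>R: "\<phi> (ract BX \<tau> a) = \<phi> \<tau> \<otimes>\<^bsub>A\<^esub> a" if a: "a \<in> carrier A" and \<tau>: "\<tau> \<in> carrier X.T" for a \<tau>
  proof (rule X.eqI[where f="\<lambda>\<tau>. \<phi> (ract BX \<tau> a)" and g="\<lambda>\<tau>. \<phi> \<tau> \<otimes>\<^bsub>A\<^esub> a",
        OF mA lin_comp[OF bilin_left[OF X_ract(1) a] \<phi>l] lin_comp[OF \<phi>l bilin_left[OF amult a]] _ \<tau>])
    fix m f assume m: "m \<in> carrier M" and f: "f \<in> carrier E"
    show "\<phi> (ract BX (X.t m f) a) = \<phi> (X.t m f) \<otimes>\<^bsub>A\<^esub> a"
      using X_ract(2)[OF m f a] \<phi>t[OF m f] \<phi>t[OF m E_ract_closed[OF f a]] E_ract_apply[OF m] by simp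
  qed
  have \<psi>L: "\<psi> (lact BY b \<tau>) = b \<otimes>\<^bsub>A'\<^esub> \<psi> \<tau>" if b: "b \<in> carrier A'" and \<tau>: "\<tau> \<in> carrier Y.T" for b \<tau>
  proof (rule Y.eqI[where f="\<lambda>\<tau>. \<psi> (lact BY b \<tau>)" and g="\<lambda>\<tau>. b \<otimes>\<^bsub>A'\<^esub> \<psi> \<tau>",
        OF mA' lin_comp[OF bilin_right[OF Y_lact(1) b] \<psi>l] lin_comp[OF \<psi>l bilin_right[OF amult' b]] _ \<tau>])
    fix f m assume f: "f \<in> carrier E" and m: "m \<in> carrier M"
    show "\<psi> (lact BY b (Y.t f m)) = b \<otimes>\<^bsub>A'\<^esub> \<psi> (Y.t f m)"
      using Y_lact(2)[OF b f m] \<psi>t[OF f m] \<psi>t[OF E_lact_closed[OF b f] m] br_l[OF b f m] by simp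
  qed
  have \<psi>R: "\<psi> (ract BY \<tau> b) = \<psi> \<tau> \<otimes>\<^bsub>A'\<^esub> b" if b: "b \<in> carrier A'" and \<tau>: "\<tau> \<in> carrier Y.T" for b \<tau>
  proof (rule Y.eqI[where f="\<lambda>\<tau>. \<psi> (ract BY \<tau> b)" and g="\<lambda>\<tau>. \<psi> \<tau> \<otimes>\<^bsub>A'\<^esub> b",
        OF mA' lin_comp[OF bilin_left[OF Y_ract(1) b] \<psi>l] lin_comp[OF \<psi>l bilin_left[OF amult' b]] _ \<tau>])
    fix f m assume f: "f \<in> carrier E" and m: "m \<in> carrier M"
    show "\<psi> (ract BY (Y.t f m) b) = \<psi> (Y.t f m) \<otimes>\<^bsub>A'\<^esub> b"
      using Y_ract(2)[OF f m b] \<psi>t[OF f m] \<psi>t[OF f ract_closed[OF m b]] P.bracket_ract[OF eq[OF f] m b] by simp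
  qed
  \<comment> \<open>Members of the dual are extensional while the maps in \<open>generator\<close>
    are arbitrary off the carrier; restriction leaves the relevant values unchanged.\<close>
  have oX: "\<one>\<^bsub>A\<^esub> \<in> K" if K: "submodule K R A" and h: "\<And>m f. m \<in> carrier M \<Longrightarrow> f \<in> carrier E \<Longrightarrow> f m \<in> K" for K
  proof (rule subsetD[OF mspan_least[OF K] P.generator], rule subsetI, elim CollectE exE conjE)
    fix a f x assume a: "a = f x" and f: "equivariant R A M f" and x: "x \<in> carrier M"
    show "a \<in> K" using h[OF x E_I[OF f]] a x by simp
  qed
  have oY: "\<one>\<^bsub>A'\<^esub> \<in> K" if K: "submodule K R A'" and h: "\<And>f m. f \<in> carrier E \<Longrightarrow> m \<in> carrier M \<Longrightarrow> P.bracket f m \<in> K" for K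
  proof (rule subsetD[OF mspan_least[OF K] P.projective'], rule subsetI, elim CollectE exE conjE)
    fix b f x assume b: "b = P.bracket f x" and f: "equivariant R A M f" and x: "x \<in> carrier M"
    have "P.bracket (restrict f (carrier M)) x = P.bracket f x"
      by (rule P.bracket_eqI[OF eq[OF E_I[OF f]] x P.bracket(1)[OF f x]]) (simp add: P.bracket(2)[OF f x])
    then show "b \<in> K" using h[OF E_I[OF f] x] b by simp
  qed
  have \<phi>i: "inj_on \<phi> (carrier X.T)"
  proof (rule lin_injI[OF \<phi>l X.T_module mA])
    fix \<tau> assume \<tau>: "\<tau> \<in> carrier X.T" and z: "\<phi> \<tau> = \<zero>\<^bsub>A\<^esub>"
    have "\<one>\<^bsub>A\<^esub> \<in> {a \<in> carrier A. ract BX \<tau> a \<in> {\<zero>\<^bsub>X.T\<^esub>}}"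
    proof (rule oX[OF lin_vimage_submodule[OF bilin_right[OF X_ract(1) \<tau>] mA X.T_module zero_submodule[OF X.T_module]]])
      fix x f assume x: "x \<in> carrier M" and f: "f \<in> carrier E"
      have fx: "f x \<in> carrier A" by (rule E_closed[OF f x])
      \<comment> \<open>For \<tau> the tensor of \<open>m\<close> and \<open>h\<close>, rewrite
        \<open>h f(x)\<close> as \<open>[h, x] f\<close>, move the bracket across the tensor sign
        and evaluate \<open>m [h, x] = h(m) x\<close>. The right side depends on \<tau> through
        \<open>\<phi> \<tau>\<close> only, so it vanishes on the kernel.\<close>
      have "ract BX \<tau> (f x) = X.t (lact M (\<phi> \<tau>) x) f"
      proof (rule X.eqI[where f="\<lambda>\<tau>. ract BX \<tau> (f x)" and g="\<lambda>\<tau>. X.t (lact M (\<phi> \<tau>) x) f",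
            OF X.T_module bilin_left[OF X_ract(1) fx] lin_comp[OF lin_comp[OF \<phi>l bilin_left[OF lact_bilin x]] bilin_left[OF X.t_bilin f]] _ \<tau>])
        fix m h assume m: "m \<in> carrier M" and h: "h \<in> carrier E"
        have "ract BX (X.t m h) (f x) = X.t m (lact E (P.bracket h x) f)"
          using X_ract(2)[OF m h fx] key[OF h x f] by simp
        also have "\<dots> = X.t (lact M (h m) x) f"
          using X.t_balanced[OF m bc[OF h x] f] be[OF h x m] by simp
        finally show "ract BX (X.t m h) (f x) = X.t (lact M (\<phi> (X.t m h)) x) f" by (simp only: \<phi>t[OF m h])
      qed
      also have "\<dots> = \<zero>\<^bsub>X.T\<^esub>"
        using lin_zero[OF bilin_left[OF lact_bilin x] mA mM] lin_zero[OF bilin_left[OF X.t_bilin f] mM X.T_module] z by simp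
      finally show "f x \<in> {a \<in> carrier A. ract BX \<tau> a \<in> {\<zero>\<^bsub>X.T\<^esub>}}" using fx by simp
    qed
    moreover have "ract BX \<tau> \<one>\<^bsub>A\<^esub> = \<tau>"
    proof (rule X.eqI[where f="\<lambda>\<tau>. ract BX \<tau> \<one>\<^bsub>A\<^esub>", OF X.T_module bilin_left[OF X_ract(1) one_closed] lin_ident _ \<tau>])
      fix m f assume m: "m \<in> carrier M" and f: "f \<in> carrier E"
      have "ract E f \<one>\<^bsub>A\<^esub> = f"
        by (rule E_eqI[OF E_ract_closed[OF f one_closed] f]) (simp add: E_ract_apply E_closed[OF f])
      then show "ract BX (X.t m f) \<one>\<^bsub>A\<^esub> = X.t m f" using X_ract(2)[OF m f one_closed] by simp
    qed
    ultimately show "\<tau> = \<zero>\<^bsub>X.T\<^esub>" by simp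
  qed
  have \<phi>s: "\<phi> ` carrier X.T = carrier A"
  proof
    show "\<phi> ` carrier X.T \<subseteq> carrier A" using lin_closed[OF \<phi>l] by (rule image_subsetI)
    have "\<one>\<^bsub>A\<^esub> \<in> \<phi> ` carrier X.T"
    proof (rule oX[OF lin_image_submodule[OF \<phi>l X.T_module mA module.carrier_is_submodule[OF X.T_module]]])
      show "f m \<in> \<phi> ` carrier X.T" if "m \<in> carrier M" "f \<in> carrier E" for m f
        by (rule image_eqI[where f=\<phi>, OF \<phi>t[OF that, symmetric] X.t_closed[OF that]])
    qed
    then obtain \<tau> where e: "\<one>\<^bsub>A\<^esub> = \<phi> \<tau>" and \<tau>: "\<tau> \<in> carrier X.T" by (rule imageE)
    show "carrier A \<subseteq> \<phi> ` carrier X.T"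
    proof
      fix a assume a: "a \<in> carrier A"
      have "a = \<phi> (lact BX a \<tau>)" using \<phi>L[OF a \<tau>] a unfolding e[symmetric] by simp
      then show "a \<in> \<phi> ` carrier X.T" by (rule image_eqI) (rule bilin_closed[OF X_lact(1) a \<tau>])
    qed
  qed
  have \<psi>i: "inj_on \<psi> (carrier Y.T)"
  proof (rule lin_injI[OF \<psi>l Y.T_module mA'])
    fix \<tau> assume \<tau>: "\<tau> \<in> carrier Y.T" and z: "\<psi> \<tau> = \<zero>\<^bsub>A'\<^esub>"
    have "\<one>\<^bsub>A'\<^esub> \<in> {b \<in> carrier A'. lact BY b \<tau> \<in> {\<zero>\<^bsub>Y.T\<^esub>}}"
    proof (rule oY[OF lin_vimage_submodule[OF bilin_left[OF Y_lact(1) \<tau>] mA' Y.T_module zero_submodule[OF Y.T_module]]])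
      fix g y assume g: "g \<in> carrier E" and y: "y \<in> carrier M"
      note b = bc[OF g y]
      \<comment> \<open>The same argument in the other order: for \<tau> the tensor of
        \<open>f\<close> and \<open>m\<close>, \<open>[g, y] f = g f(y)\<close>, the element
        \<open>f(y)\<close> of \<open>A\<close> crosses the tensor sign, and
        \<open>f(y) m = y [f, m]\<close>.\<close>
      have "lact BY (P.bracket g y) \<tau> = Y.t g (ract M y (\<psi> \<tau>))"
      proof (rule Y.eqI[where f="\<lambda>\<tau>. lact BY (P.bracket g y) \<tau>" and g="\<lambda>\<tau>. Y.t g (ract M y (\<psi> \<tau>))",
            OF Y.T_module bilin_right[OF Y_lact(1) b] lin_comp[OF lin_comp[OF \<psi>l bilin_right[OF ract_bilin y]] bilin_right[OF Y.t_bilin g]] _ \<tau>])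
        fix f m assume f: "f \<in> carrier E" and m: "m \<in> carrier M"
        have "lact BY (P.bracket g y) (Y.t f m) = Y.t (ract E g (f y)) m"
          using Y_lact(2)[OF b f m] key[OF g y f] by simp
        also have "\<dots> = Y.t g (ract M y (P.bracket f m))"
          using Y.t_balanced[OF g E_closed[OF f y] m] be[OF f m y] by simp
        finally show "lact BY (P.bracket g y) (Y.t f m) = Y.t g (ract M y (\<psi> (Y.t f m)))" by (simp only: \<psi>t[OF f m])
      qed
      also have "\<dots> = \<zero>\<^bsub>Y.T\<^esub>"
        using lin_zero[OF bilin_right[OF ract_bilin y] mA' mM] lin_zero[OF bilin_right[OF Y.t_bilin g] mM Y.T_module] z by simp
      finally show "P.bracket g y \<in> {b \<in> carrier A'. lact BY b \<tau> \<in> {\<zero>\<^bsub>Y.T\<^esub>}}" using b by simp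
    qed
    moreover have "lact BY \<one>\<^bsub>A'\<^esub> \<tau> = \<tau>"
    proof (rule Y.eqI[where f="\<lambda>\<tau>. lact BY \<one>\<^bsub>A'\<^esub> \<tau>", OF Y.T_module bilin_right[OF Y_lact(1) A'.one_closed] lin_ident _ \<tau>])
      fix f m assume f: "f \<in> carrier E" and m: "m \<in> carrier M"
      have "lact E \<one>\<^bsub>A'\<^esub> f = f"
        by (rule E_eqI[OF E_lact_closed[OF A'.one_closed f] f]) (simp add: E_lact_apply ract_one)
      then show "lact BY \<one>\<^bsub>A'\<^esub> (Y.t f m) = Y.t f m" using Y_lact(2)[OF A'.one_closed f m] by simp
    qed
    ultimately show "\<tau> = \<zero>\<^bsub>Y.T\<^esub>" by simp
  qed
  have \<psi>s: "\<psi> ` carrier Y.T = carrier A'"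
  proof
    show "\<psi> ` carrier Y.T \<subseteq> carrier A'" using lin_closed[OF \<psi>l] by (rule image_subsetI)
    have "\<one>\<^bsub>A'\<^esub> \<in> \<psi> ` carrier Y.T"
    proof (rule oY[OF lin_image_submodule[OF \<psi>l Y.T_module mA' module.carrier_is_submodule[OF Y.T_module]]])
      show "P.bracket f m \<in> \<psi> ` carrier Y.T" if "f \<in> carrier E" "m \<in> carrier M" for m f
        by (rule image_eqI[where f=\<psi>, OF \<psi>t[OF that, symmetric] Y.t_closed[OF that]])
    qed
    then obtain \<tau> where e: "\<one>\<^bsub>A'\<^esub> = \<psi> \<tau>" and \<tau>: "\<tau> \<in> carrier Y.T" by (rule imageE)
    show "carrier A' \<subseteq> \<psi> ` carrier Y.T"
    proof
      fix b assume b: "b \<in> carrier A'"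
      have "b = \<psi> (lact BY b \<tau>)" using \<psi>L[OF b \<tau>] b unfolding e[symmetric] by simp
      then show "b \<in> \<psi> ` carrier Y.T" by (rule image_eqI) (rule bilin_closed[OF Y_lact(1) b \<tau>])
    qed
  qed
  have brg: "P.bracket f m \<in> gcomp A' (h \<otimes>\<^bsub>\<Gamma>\<^esub> k)"
    if h: "h \<in> carrier \<Gamma>" and k: "k \<in> carrier \<Gamma>" and f: "f \<in> gcomp E h" and m: "m \<in> gcomp M k" for f m h k
  proof -
    have fc: "f \<in> carrier E" by (rule E_gcomp_closed[OF f])
    have mc: "m \<in> carrier M" by (rule M_gcomp_closed[OF k m])
    note b = bc[OF fc mc] and hk = \<Gamma>.m_closed[OF h k]
    \<comment> \<open>The components of the bracket in all other degrees act as zero: on homogeneous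
      \<open>y\<close> of degree \<open>w\<close> the whole bracket acts by \<open>f(y) m\<close>,
      which is homogeneous of degree \<open>w h k\<close>, so the component in degree
      \<open>g\<close> could contribute only if \<open>g\<close> equals \<open>h k\<close>.
      Faithfulness then makes these components zero.\<close>
    have z: "hcomp \<Gamma> A' (P.bracket f m) g = \<zero>\<^bsub>A'\<^esub>" if g: "g \<in> carrier \<Gamma>" and ne: "g \<noteq> h \<otimes>\<^bsub>\<Gamma>\<^esub> k" for g
    proof (rule P.faithful[OF hcomp_closed[OF A'.grading b g]])
      fix x assume x: "x \<in> carrier M"
      have hc: "hcomp \<Gamma> A' (P.bracket f m) g \<in> carrier A'" by (rule hcomp_closed[OF A'.grading b g])
      have sM: "(\<Union>g\<in>carrier \<Gamma>. gcomp M g) \<subseteq> carrier M" using M_gcomp_closed by blast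
      show "ract M x (hcomp \<Gamma> A' (P.bracket f m) g) = \<zero>\<^bsub>M\<^esub>"
      proof (rule lin_eqI[where f="\<lambda>x. ract M x (hcomp \<Gamma> A' (P.bracket f m) g)" and g="\<lambda>x. \<zero>\<^bsub>M\<^esub>",
            OF bilin_left[OF ract_bilin hc] lin_const_zero[OF mM] mM mM sM])
        show "x \<in> mspan R M (\<Union>g\<in>carrier \<Gamma>. gcomp M g)" using x grading_span[OF bimodule_grading mM] by simp
        fix y assume "y \<in> (\<Union>g\<in>carrier \<Gamma>. gcomp M g)"
        then obtain w where w: "w \<in> carrier \<Gamma>" "y \<in> gcomp M w" by blast
        have yc: "y \<in> carrier M" by (rule M_gcomp_closed[OF w])
        have "hcomp \<Gamma> M (ract M y (P.bracket f m)) (w \<otimes>\<^bsub>\<Gamma>\<^esub> g) = ract M y (hcomp \<Gamma> A' (P.bracket f m) g)"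
          by (rule hcomp_shift[where \<pi>="\<lambda>k. w \<otimes>\<^bsub>\<Gamma>\<^esub> k" and f="ract M y", OF mA' A'.grading mM bimodule_grading fin
              bilin_right[OF ract_bilin yc] \<Gamma>.m_closed[OF w(1)] \<Gamma>.inj_on_cmult[OF w(1)] ract_gcomp[OF w(1) _ w(2)] g b])
        moreover have "ract M y (P.bracket f m) \<in> gcomp M (w \<otimes>\<^bsub>\<Gamma>\<^esub> h \<otimes>\<^bsub>\<Gamma>\<^esub> k)"
          using lact_gcomp[OF \<Gamma>.m_closed[OF w(1) h] k E_gcompD[OF f w] m] be[OF fc mc yc] by simp
        moreover have "w \<otimes>\<^bsub>\<Gamma>\<^esub> g \<noteq> w \<otimes>\<^bsub>\<Gamma>\<^esub> h \<otimes>\<^bsub>\<Gamma>\<^esub> k"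
          using ne \<Gamma>.m_assoc[OF w(1) h k] w(1) g hk by simp
        ultimately show "ract M y (hcomp \<Gamma> A' (P.bracket f m) g) = \<zero>\<^bsub>M\<^esub>"
          using hcomp_homogeneous[OF bimodule_grading mM fin \<Gamma>.m_closed[OF w(1) g] \<Gamma>.m_closed[OF \<Gamma>.m_closed[OF w(1) h] k]]
          by simp
      qed
    qed
    have "(\<Oplus>\<^bsub>A'\<^esub>g\<in>carrier \<Gamma>. hcomp \<Gamma> A' (P.bracket f m) g) = hcomp \<Gamma> A' (P.bracket f m) (h \<otimes>\<^bsub>\<Gamma>\<^esub> k)"
      by (rule finsum_delta[OF mA' fin hk hcomp_closed[OF A'.grading b hk]]) (simp add: z)
    then show ?thesis using hcomp_mem[OF A'.grading b hk] hcomp_sum[OF A'.grading b] by simp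
  qed
  note spE = E_span and spM = equalityD1[OF grading_span[OF bimodule_grading mM]]
  have cl: "\<forall>h\<in>carrier \<Gamma>. \<forall>k\<in>carrier \<Gamma>. h \<otimes>\<^bsub>\<Gamma>\<^esub> k \<in> carrier \<Gamma>" by simp
  have sM: "(\<Union>g\<in>carrier \<Gamma>. gcomp M g) \<subseteq> carrier M" using M_gcomp_closed by blast
  have sE: "(\<Union>g\<in>carrier \<Gamma>. gcomp E g) \<subseteq> carrier E" using E_gcomp_closed by blast
  note gX = X.graded_span[OF cl sM sE spM spE] and gY = Y.graded_span[OF cl sE sM spE spM]
  note s = regular_bimodule_def mk_bimodule_simps
  have cX: "carrier BX = carrier X.T" and cY: "carrier BY = carrier Y.T"
    using BX_same BY_same by (simp_all add: same_mod_def)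
  have gcX: "gcomp BX g = mspan R X.T {X.t m x | m x h k. h \<in> carrier \<Gamma> \<and> k \<in> carrier \<Gamma> \<and> h \<otimes>\<^bsub>\<Gamma>\<^esub> k = g \<and> m \<in> gcomp M h \<and> x \<in> gcomp E k}"
    and gcY: "gcomp BY g = mspan R Y.T {Y.t m x | m x h k. h \<in> carrier \<Gamma> \<and> k \<in> carrier \<Gamma> \<and> h \<otimes>\<^bsub>\<Gamma>\<^esub> k = g \<and> m \<in> gcomp E h \<and> x \<in> gcomp M k}" for g
    by (simp_all add: bimodule_tensor_def Let_def mk_bimodule_simps)
  have sA: "same_mod (regular_bimodule A) A" and sA': "same_mod (regular_bimodule A') A'"
    unfolding regular_bimodule_def by (rule mk_bimodule_same)+
  have isoX: "graded_bimodule_iso R \<Gamma> D A A BX (regular_bimodule A)"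
  proof (rule graded_bimodule_transport[where \<phi>=\<phi>, OF regular_bimodule_over[OF crossed_product_over_axioms]
        same_mod_module[OF BX_same X.T_module]], unfold cX same_mod_lin[OF BX_same] same_mod_lin'[OF sA]
        same_mod_mspan[OF BX_same X.T_module] same_mod_submodule[OF BX_same X.T_module])
    show "lin R X.T A \<phi>" by (rule \<phi>l)
    show "bij_betw \<phi> (carrier X.T) (carrier (regular_bimodule A))" unfolding bij_betw_def using \<phi>i \<phi>s by (simp add: s)
    show "lact BX a \<tau> \<in> carrier X.T" if "a \<in> carrier A" "\<tau> \<in> carrier X.T" for a \<tau> by (rule bilin_closed[OF X_lact(1) that])
    show "ract BX \<tau> a \<in> carrier X.T" if "\<tau> \<in> carrier X.T" "a \<in> carrier A" for a \<tau> by (rule bilin_closed[OF X_ract(1) that])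
    show "\<phi> (lact BX a \<tau>) = lact (regular_bimodule A) a (\<phi> \<tau>)" if "a \<in> carrier A" "\<tau> \<in> carrier X.T" for a \<tau>
      using \<phi>L[OF that] by (simp add: s)
    show "\<phi> (ract BX \<tau> a) = ract (regular_bimodule A) (\<phi> \<tau>) a" if "\<tau> \<in> carrier X.T" "a \<in> carrier A" for a \<tau>
      using \<phi>R[OF that(2,1)] by (simp add: s)
    show "submodule (gcomp BX g) R X.T" if "g \<in> carrier \<Gamma>" for g unfolding gcX by (rule gX(1))
    show "carrier X.T \<subseteq> mspan R X.T (\<Union>g\<in>carrier \<Gamma>. gcomp BX g)" unfolding gcX by (rule gX(2))
    show "\<phi> \<tau> \<in> gcomp (regular_bimodule A) g" if g: "g \<in> carrier \<Gamma>" and \<tau>: "\<tau> \<in> gcomp BX g" for g \<tau>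
      unfolding s
    proof (rule gX(3)[OF \<phi>l mA is_grading_submodule[OF grading g] _ \<tau>[unfolded gcX]])
      fix m f h k assume h: "h \<in> carrier \<Gamma>" and k: "k \<in> carrier \<Gamma>" and e: "h \<otimes>\<^bsub>\<Gamma>\<^esub> k = g" and m: "m \<in> gcomp M h" and f: "f \<in> gcomp E k"
      show "\<phi> (X.t m f) \<in> gcomp A g"
        using E_gcompD[OF f h m] \<phi>t[OF M_gcomp_closed[OF h m] E_gcomp_closed[OF f]] e by simp
    qed
  qed
  have isoY: "graded_bimodule_iso R \<Gamma> D A' A' BY (regular_bimodule A')"
  proof (rule graded_bimodule_transport[where \<phi>=\<psi>, OF regular_bimodule_over[OF A'.crossed_product_over_axioms]
        same_mod_module[OF BY_same Y.T_module]], unfold cY same_mod_lin[OF BY_same] same_mod_lin'[OF sA']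
        same_mod_mspan[OF BY_same Y.T_module] same_mod_submodule[OF BY_same Y.T_module])
    show "lin R Y.T A' \<psi>" by (rule \<psi>l)
    show "bij_betw \<psi> (carrier Y.T) (carrier (regular_bimodule A'))" unfolding bij_betw_def using \<psi>i \<psi>s by (simp add: s)
    show "lact BY b \<tau> \<in> carrier Y.T" if "b \<in> carrier A'" "\<tau> \<in> carrier Y.T" for b \<tau> by (rule bilin_closed[OF Y_lact(1) that])
    show "ract BY \<tau> b \<in> carrier Y.T" if "\<tau> \<in> carrier Y.T" "b \<in> carrier A'" for b \<tau> by (rule bilin_closed[OF Y_ract(1) that])
    show "\<psi> (lact BY b \<tau>) = lact (regular_bimodule A') b (\<psi> \<tau>)" if "b \<in> carrier A'" "\<tau> \<in> carrier Y.T" for b \<tau>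
      using \<psi>L[OF that] by (simp add: s)
    show "\<psi> (ract BY \<tau> b) = ract (regular_bimodule A') (\<psi> \<tau>) b" if "\<tau> \<in> carrier Y.T" "b \<in> carrier A'" for b \<tau>
      using \<psi>R[OF that(2,1)] by (simp add: s)
    show "submodule (gcomp BY g) R Y.T" if "g \<in> carrier \<Gamma>" for g unfolding gcY by (rule gY(1))
    show "carrier Y.T \<subseteq> mspan R Y.T (\<Union>g\<in>carrier \<Gamma>. gcomp BY g)" unfolding gcY by (rule gY(2))
    show "\<psi> \<tau> \<in> gcomp (regular_bimodule A') g" if g: "g \<in> carrier \<Gamma>" and \<tau>: "\<tau> \<in> gcomp BY g" for g \<tau>
      unfolding s
    proof (rule gY(3)[OF \<psi>l mA' is_grading_submodule[OF A'.grading g] _ \<tau>[unfolded gcY]])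
      fix f m h k assume h: "h \<in> carrier \<Gamma>" and k: "k \<in> carrier \<Gamma>" and e: "h \<otimes>\<^bsub>\<Gamma>\<^esub> k = g" and f: "f \<in> gcomp E h" and m: "m \<in> gcomp M k"
      show "\<psi> (Y.t f m) \<in> gcomp A' g"
        using brg[OF h k f m] \<psi>t[OF E_gcomp_closed[OF f] M_gcomp_closed[OF k m]] e by simp
    qed
  qed
  show ?thesis unfolding induces_graded_Morita_over_def using graded_bimodule_over_axioms isoX isoY by (intro conjI)
qed

end

theorem theorem5p3:
  fixes R :: "'r ring" and G :: "'h monoid" and N :: "'h set" and n :: nat
    and C :: "('r, 'c, 'h set) acted_algebra"
    and A :: "('r, 'a, 'h set, 'c) algebra_over"
    and A' :: "('r, 'b, 'h set, 'c) algebra_over"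
    and M :: "('r, 'm, 'h set, 'a, 'b) bimodule"
  assumes "cring R" and "\<one>\<^bsub>R\<^esub> \<noteq> \<zero>\<^bsub>R\<^esub>"
    and "group G" and "finite (carrier G)" and "N \<lhd> G" and "n \<ge> 1"
    and "graded_acted_algebra R (G Mod N) C"
    and "crossed_product_over R (G Mod N) C A"
    and "crossed_product_over R (G Mod N) C A'"
    and "graded_bimodule_over R (G Mod N) C A A' M"
  shows "let \<Gamma> = wreath_group (G Mod N) n; Cn = tpow_acted R C n;
             Aw = wr_algebra R A n; Aw' = wr_algebra R A' n; Mw = wr_bimodule R A' M n
         in graded_bimodule_over R \<Gamma> Cn Aw Aw' Mw \<and>
            graded_bimodule_iso R \<Gamma> Cn Aw Aw'
              (left_induced R \<Gamma> Aw Aw' Mw) (right_induced R \<Gamma> Aw Aw' Mw) \<and>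
            graded_bimodule_iso R \<Gamma> Cn Aw Aw' (right_induced R \<Gamma> Aw Aw' Mw) Mw \<and>
            (induces_graded_Morita_over R (G Mod N) C A A' M \<longrightarrow>
             induces_graded_Morita_over R \<Gamma> Cn Aw Aw' Mw)"
proof -
  have over: "graded_bimodule_over R (G Mod N) C A A' M" by fact
  note w = wr_bimodule_over[OF over, of n]
  note l = left_induced_iso[OF w] and r = right_induced_iso[OF w]
  have m: "induces_graded_Morita_over R (G Mod N) C A A' M \<longrightarrow>
    induces_graded_Morita_over R (wreath_group (G Mod N) n) (tpow_acted R C n) (wr_algebra R A n) (wr_algebra R A' n)
      (wr_bimodule R A' M n)"
  proof
    assume "induces_graded_Morita_over R (G Mod N) C A A' M"
    then have "progenerator R A A' M"
      by (rule bimodule_dual.Morita_progenerator[OF bimodule_dual.intro[OF over]])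
    from wr_progenerator[OF this, of n]
    show "induces_graded_Morita_over R (wreath_group (G Mod N) n) (tpow_acted R C n) (wr_algebra R A n) (wr_algebra R A' n)
      (wr_bimodule R A' M n)"
      by (rule bimodule_dual.progenerator_Morita[OF bimodule_dual.intro[OF w]])
  qed
  show ?thesis
    \<comment> \<open>The two induced bimodules are compared through their common target, the wreath
      product bimodule.\<close>
    unfolding Let_def by (intro conjI w graded_bimodule_iso_joint[OF l r] r m)
qed

end
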